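(* Let $n\ge2$ and let $\Omega\subset\mathbb{R}^n$ be a bounded Lipschitz domain with boundary $\Gamma$. Let $0<p<\infty$ and $0<q\le\infty$. (i) Then $\operatorname{Tr}\mathbf{B}^{\frac1p}_{p,q}(\Omega)=L_p(\Gamma)$ if $0<q\le\min(1,p)$. (ii) Furthermore, $\operatorname{Tr}\mathfrak{F}^{\frac1p}_{p,q}(\Omega)=L_p(\Gamma)$ if $0<p\le1$.
   Context: Notation: $\mathbb{N}_0=\{0,1,2,\dots\}$. For $j\in\mathbb{N}_0$, $m\in\mathbb{Z}^n$, $Q_{j,m}$ is the cube in $\mathbb{R}^n$ with sides parallel to the axes, centre $2^{-j}m$, side length $2^{-j+1}$, and $\chi_{j,m}$ its characteristic function; $dQ_{j,m}$ is the concentric cube with side length $d$ times as large. $[s]$ is the integer part of $s$. Besov and Triebel--Lizorkin spaces on domains. Let $\Omega\subset\mathbb{R}^n$ be a domain ($\Omega=\mathbb{R}^n$ allowed), $s>0$, $0<p,q\le\infty$ ($p<\infty$ for the F-case). For complex $\lambda=\{\lambda_{j,m}\}$ put $$\|\lambda|b^s_{p,q}(\Omega)\|=\Big(\sum_{j=0}^\infty2^{j(s-n/p)q}\Big(\sum_{m:\,Q_{j,m}\cap\Omega\ne\emptyset}|\lambda_{j,m}|^p\Big)^{q/p}\Big)^{1/q},\quad \|\lambda|f^s_{p,q}(\Omega)\|=\Big\|\Big(\sum_{j=0}^\infty\sum_{m:\,Q_{j,m}\cap\Omega\ne\emptyset}2^{jsq}|\lambda_{j,m}\chi_{j,m}(\cdot)|^q\Big)^{1/q}\Big|L_p(\mathbb{R}^n)\Big\|$$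 (usual modification for $\infty$). Fix $d>1$ and $K\in\mathbb{N}_0$, $K\ge1+[s]$. A $K$-atom located at $Q_{j,m}$ is a $C^K$ function $a:\mathbb{R}^n\to\mathbb{C}$ with $\operatorname{supp}a\subset dQ_{j,m}$ and $|D^\alpha a|\le2^{|\alpha|j}$ for $|\alpha|\le K$. $\mathbf{B}^s_{p,q}(\Omega)$ (resp. $\mathfrak{F}^s_{p,q}(\Omega)$) is the set of $f\in L_p(\Omega)$ with $f=\sum_{j}\sum_{m:\,Q_{j,m}\cap\Omega\neq\emptyset}\lambda_{j,m}a_{j,m}$ (convergence in $L_p(\Omega)$), $a_{j,m}$ $K$-atoms located at $Q_{j,m}$, and $\|\lambda|b^s_{p,q}(\Omega)\|<\infty$ (resp. $\|\lambda|f^s_{p,q}(\Omega)\|<\infty$); the quasi-norm is the infimum of the sequence quasi-norm over all such representations. These are the spaces of restrictions to $\Omega$ of the corresponding spaces on $\mathbb{R}^n$. Lipschitz domains. A Lipschitz diffeomorphism is a one-to-one map $\Phi$ of $\mathbb{R}^n$ onto itself with Lipschitz components and $|\Phi(x)-\Phi(y)|\sim|x-y|$ for $|x-y|\le1$. A bounded domain $\Omega\subset\mathbb{R}^n$ is a Lipschitz domain if its boundary $\Gamma=\partial\Omega$ is covered by finitely many open balls $K_1,\dots,K_N$, $K_j\cap\Gamma\ne\emptyset$, and there are Lipschitz diffeomorphisms $\psi^{(j)}$ with $\psi^{(j)}(K_j\cap\Omega)\subset\mathbb{R}^n_+=\{x_n>0\}$ and $\psi^{(j)}(K_j\cap\Gamma)\subset\mathbb{R}^{n-1}$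 (identified with $\mathbb{R}^{n-1}\times\{0\}$). $\Gamma$ carries the surface measure $d\sigma$, used to define $L_p(\Gamma)$. Trace. For restrictions $\varphi\in\mathcal{S}(\Omega)$ to $\Omega$ of Schwartz functions, $\operatorname{Tr}\varphi=\varphi|_\Gamma$. For $p,q<\infty$, $\mathcal{S}(\Omega)$ is dense and $\operatorname{Tr}$ into $L_p(\Gamma)$ is defined by completion from the estimate $\|\operatorname{Tr}\varphi|L_p(\Gamma)\|\le c\|\varphi\|$, $\varphi\in\mathcal{S}(\Omega)$. For $q=\infty$ in (ii), $\operatorname{Tr}f=\sum_{j,m}\lambda_{j,m}a_{j,m}|_\Gamma$ (sum over $Q_{j,m}\cap\Gamma\neq\emptyset$, convergence in $L_p(\Gamma)$) for a representation $f=\sum_{j}\sum_{m:\,Q_{j,m}\cap\Omega\neq\emptyset}\lambda_{j,m}a_{j,m}$ (convergence in $L_p(\Omega)$) with $K$-atoms $a_{j,m}$ located at $Q_{j,m}$ and $\|\lambda|f^{1/p}_{p,\infty}(\Omega)\|<\infty$. $\operatorname{Tr}X=Y$ means that $Y$ is the image of $X$ under $\operatorname{Tr}$.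
   Formalization: For q=∞ in (ii), Tr f is taken over representations whose atoms at cubes Q_{j,m} not meeting Γ vanish on Γ; without this the stated sum over cubes meeting Γ depends on the representation (even f=0 gets nonzero traces). Every f has such a representation. *)

theory Defs
  imports "HOL-Analysis.Analysis"
begin

text \<open>
  Points of \<open>n\<close>-dimensional Euclidean space are vectors of type \<^typ>\<open>real ^ 'n\<close>; the index type is
  linearly ordered so that there is a last coordinate \<open>x\<^sub>n\<close>. Elements of function spaces over
  a set \<open>\<Omega>\<close> or over its frontier are represented by total functions whose values
  elsewhere are irrelevant, and all the spaces below are closed under changes on null sets.
\<close>

section \<open>Lebesgue spaces\<close>

definition epowr :: "ennreal \<Rightarrow> real \<Rightarrow> ennreal" (infixr "epowr" 80) where
  "x epowr a = (if x = \<infinity> then \<infinity> else ennreal (enn2real x powr a))"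
  \<comment> \<open>only used for \<open>a > 0\<close>\<close>

definition Lp_norm :: "real \<Rightarrow> 'a measure \<Rightarrow> ('a \<Rightarrow> complex) \<Rightarrow> ennreal" where
  "Lp_norm p M f = (\<integral>\<^sup>+x. ennreal (cmod (f x) powr p) \<partial>M) epowr (1 / p)"

definition Lp :: "real \<Rightarrow> 'a measure \<Rightarrow> ('a \<Rightarrow> complex) set" where
  "Lp p M = {f \<in> borel_measurable M. Lp_norm p M f < \<infinity>}"

section \<open>Smooth functions\<close>

definition partial_deriv :: "'n \<Rightarrow> (real ^ 'n \<Rightarrow> complex) \<Rightarrow> real ^ 'n::finite \<Rightarrow> complex" where
  "partial_deriv i f x = vector_derivative (\<lambda>t. f (x + t *\<^sub>R axis i 1)) (at 0)"

primrec Ck :: "nat \<Rightarrow> (real ^ 'n::finite \<Rightarrow> complex) \<Rightarrow> bool" where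
  "Ck 0 f \<longleftrightarrow> continuous_on UNIV f"
| "Ck (Suc k) f \<longleftrightarrow> (\<forall>x. f differentiable (at x)) \<and> (\<forall>i. Ck k (partial_deriv i f))"

text \<open>
  \<open>D\<^sup>\<alpha>\<close> for a multi-index \<open>\<alpha>\<close>; it is only applied to functions of class
  \<open>C\<^sup>k\<close> with \<open>|\<alpha>| \<le> k\<close>, for which the order of differentiation is irrelevant.
\<close>

definition multi_deriv ::
    "nat ^ 'n::{finite,linorder} \<Rightarrow> (real ^ 'n::{finite,linorder} \<Rightarrow> complex) \<Rightarrow> real ^ 'n::{finite,linorder} \<Rightarrow> complex" where
  "multi_deriv \<alpha> f = foldr (\<lambda>i g. (partial_deriv i ^^ (\<alpha> $ i)) g) (sorted_list_of_set UNIV) f"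

definition multi_order :: "nat ^ 'n::finite \<Rightarrow> nat" where
  "multi_order \<alpha> = (\<Sum>i\<in>UNIV. \<alpha> $ i)"

definition schwartz :: "(real ^ 'n::{finite,linorder} \<Rightarrow> complex) \<Rightarrow> bool" where
  "schwartz \<phi> \<longleftrightarrow> (\<forall>k. Ck k \<phi>) \<and>
     (\<forall>N \<alpha>. \<exists>C. \<forall>x. (1 + norm x) ^ N * cmod (multi_deriv \<alpha> \<phi> x) \<le> C)"

section \<open>Cubes, sequence spaces and atoms\<close>

definition dcube :: "real \<Rightarrow> nat \<Rightarrow> int ^ 'n \<Rightarrow> (real ^ 'n::finite) set" where
  "dcube d j m = {x. \<forall>i. \<bar>x $ i - of_int (m $ i) / 2 ^ j\<bar> \<le> d / 2 ^ j}"

text \<open>The closed cube \<open>Q\<^bsub>j,m\<^esub>\<close> has side length \<open>2 / 2 ^ j\<close>, and \<^term>\<open>dcube d j m\<close> is \<open>d Q\<^bsub>j,m\<^esub>\<close>.\<close>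

abbreviation cube :: "nat \<Rightarrow> int ^ 'n \<Rightarrow> (real ^ 'n::finite) set" where
  "cube \<equiv> dcube 1"

definition cubes_meeting :: "(real ^ 'n::finite) set \<Rightarrow> nat \<Rightarrow> (int ^ 'n) set" where
  "cubes_meeting S j = {m. cube j m \<inter> S \<noteq> {}}"

definition lq_norm :: "ennreal \<Rightarrow> 'i set \<Rightarrow> ('i \<Rightarrow> ennreal) \<Rightarrow> ennreal" where
  "lq_norm q I u = (if q = \<infinity> then (SUP i\<in>I. u i)
     else (\<Sum>\<^sub>\<infinity>i\<in>I. u i epowr enn2real q) epowr (1 / enn2real q))"

type_synonym 'n coeffs = "nat \<Rightarrow> int ^ 'n \<Rightarrow> complex"
type_synonym 'n atoms = "nat \<Rightarrow> int ^ 'n \<Rightarrow> real ^ 'n \<Rightarrow> complex"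

definition b_norm :: "real \<Rightarrow> real \<Rightarrow> ennreal \<Rightarrow> (real ^ 'n::finite) set \<Rightarrow> 'n coeffs \<Rightarrow> ennreal" where
  "b_norm s p q \<Omega> c = lq_norm q UNIV
     (\<lambda>j. ennreal (2 powr (real j * (s - CARD('n) / p))) *
          lq_norm (ennreal p) (cubes_meeting \<Omega> j) (\<lambda>m. ennreal (cmod (c j m))))"

definition f_norm :: "real \<Rightarrow> real \<Rightarrow> ennreal \<Rightarrow> (real ^ 'n::finite) set \<Rightarrow> 'n coeffs \<Rightarrow> ennreal" where
  "f_norm s p q \<Omega> c =
     (\<integral>\<^sup>+x. lq_norm q (SIGMA j:UNIV. cubes_meeting \<Omega> j)
        (\<lambda>(j, m). ennreal (2 powr (real j * s) * cmod (c j m) * indicator (cube j m) x)) epowr p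
      \<partial>lebesgue) epowr (1 / p)"

definition is_atom ::
    "real \<Rightarrow> nat \<Rightarrow> nat \<Rightarrow> int ^ 'n::{finite,linorder} \<Rightarrow> (real ^ 'n::{finite,linorder} \<Rightarrow> complex) \<Rightarrow> bool" where
  "is_atom d K j m a \<longleftrightarrow> Ck K a \<and> closure {x. a x \<noteq> 0} \<subseteq> dcube d j m \<and>
     (\<forall>\<alpha> x. multi_order \<alpha> \<le> K \<longrightarrow> cmod (multi_deriv \<alpha> a x) \<le> 2 ^ (multi_order \<alpha> * j))"

section \<open>Besov and Triebel--Lizorkin spaces on domains\<close>

text \<open>
  For functions \<open>a j m\<close> supported in \<^term>\<open>dcube d j m\<close> the inner sum has only finitely many
  nonzero terms at each point, whether or not \<^term>\<open>I j\<close> is finite.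
\<close>

definition atomic_sum :: "(nat \<Rightarrow> (int ^ 'n) set) \<Rightarrow> 'n coeffs \<Rightarrow> 'n atoms
    \<Rightarrow> nat \<Rightarrow> real ^ 'n \<Rightarrow> complex" where
  "atomic_sum I c a J x = (\<Sum>j<J. \<Sum>\<^sub>\<infinity>m\<in>I j. c j m * a j m x)"

definition atomic_rep :: "real \<Rightarrow> nat \<Rightarrow> real \<Rightarrow> (real ^ 'n::{finite,linorder}) set
    \<Rightarrow> (real ^ 'n::{finite,linorder} \<Rightarrow> complex) \<Rightarrow> 'n coeffs \<Rightarrow> 'n atoms \<Rightarrow> bool" where
  "atomic_rep d K p \<Omega> f c a \<longleftrightarrow>
     (\<forall>j. \<forall>m\<in>cubes_meeting \<Omega> j. is_atom d K j m (a j m)) \<and>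
     (\<lambda>J. Lp_norm p (lebesgue_on \<Omega>) (\<lambda>x. f x - atomic_sum (cubes_meeting \<Omega>) c a J x))
       \<longlonglongrightarrow> 0"

text \<open>The argument \<open>\<nu>\<close> is one of the sequence quasi-norms.\<close>

definition atomic_space :: "real \<Rightarrow> nat \<Rightarrow> real \<Rightarrow> (real ^ 'n::{finite,linorder}) set
    \<Rightarrow> ('n coeffs \<Rightarrow> ennreal) \<Rightarrow> (real ^ 'n::{finite,linorder} \<Rightarrow> complex) set" where
  "atomic_space d K p \<Omega> \<nu> =
     {f \<in> Lp p (lebesgue_on \<Omega>). \<exists>c a. atomic_rep d K p \<Omega> f c a \<and> \<nu> c < \<infinity>}"

definition atomic_norm :: "real \<Rightarrow> nat \<Rightarrow> real \<Rightarrow> (real ^ 'n::{finite,linorder}) set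
    \<Rightarrow> ('n coeffs \<Rightarrow> ennreal) \<Rightarrow> (real ^ 'n::{finite,linorder} \<Rightarrow> complex) \<Rightarrow> ennreal" where
  "atomic_norm d K p \<Omega> \<nu> f = Inf {\<nu> c | c. \<exists>a. atomic_rep d K p \<Omega> f c a}"

definition B_space where
  "B_space d K s p q \<Omega> = atomic_space d K p \<Omega> (b_norm s p q \<Omega>)"

definition F_space where
  "F_space d K s p q \<Omega> = atomic_space d K p \<Omega> (f_norm s p q \<Omega>)"

section \<open>Bounded Lipschitz domains and surface measure\<close>

definition lipschitz_diffeo :: "(real ^ 'n::finite \<Rightarrow> real ^ 'n) \<Rightarrow> bool" where
  "lipschitz_diffeo \<Phi> \<longleftrightarrow> bij \<Phi> \<and> (\<forall>i. \<exists>L. L-lipschitz_on UNIV (\<lambda>x. \<Phi> x $ i)) \<and>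
     (\<exists>A>0. \<exists>B>0. \<forall>x y. norm (x - y) \<le> 1 \<longrightarrow>
        A * norm (x - y) \<le> norm (\<Phi> x - \<Phi> y) \<and> norm (\<Phi> x - \<Phi> y) \<le> B * norm (x - y))"

definition bounded_lipschitz_domain :: "(real ^ 'n::{finite,linorder}) set \<Rightarrow> bool" where
  "bounded_lipschitz_domain \<Omega> \<longleftrightarrow> open \<Omega> \<and> connected \<Omega> \<and> \<Omega> \<noteq> {} \<and> bounded \<Omega> \<and>
     (\<exists>N::nat. \<exists>z r \<psi>. frontier \<Omega> \<subseteq> (\<Union>j<N. ball (z j) (r j)) \<and>
        (\<forall>j<N. ball (z j) (r j) \<inter> frontier \<Omega> \<noteq> {} \<and> lipschitz_diffeo (\<psi> j) \<and>
           \<psi> j ` (ball (z j) (r j) \<inter> \<Omega>) \<subseteq> {x. x $ Max UNIV > 0} \<and>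
           \<psi> j ` (ball (z j) (r j) \<inter> frontier \<Omega>) \<subseteq> {x. x $ Max UNIV = 0}))"

text \<open>
  \<open>k\<close>-dimensional Hausdorff measure for \<open>k \<ge> 1\<close> (so that empty sets in a cover contribute 0),
  normalised so that it is Lebesgue measure on \<open>k\<close>-dimensional planes. The surface measure of
  the boundary of a Lipschitz domain is the \<open>(n - 1)\<close>-dimensional one.
\<close>

definition hausdorff_outer :: "nat \<Rightarrow> 'a::metric_space set \<Rightarrow> ennreal" where
  "hausdorff_outer k A = (SUP \<delta>\<in>{0<..}.
     Inf {(\<Sum>i. ennreal (unit_ball_vol (real k) * (diameter (U i) / 2) ^ k)) | U :: nat \<Rightarrow> 'a set.
       A \<subseteq> (\<Union>i. U i) \<and> (\<forall>i. bounded (U i) \<and> diameter (U i) \<le> \<delta>)})"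

definition hausdorff_measure :: "nat \<Rightarrow> 'a::metric_space measure" where
  "hausdorff_measure k = measure_of UNIV (sets borel) (hausdorff_outer k)"

definition surface_measure :: "(real ^ 'n::finite) set \<Rightarrow> (real ^ 'n) measure" where
  "surface_measure \<Gamma> = completion (restrict_space (hausdorff_measure (CARD('n) - 1)) \<Gamma>)"

section \<open>Traces\<close>

text \<open>
  Extension of the restriction map by completion: \<open>g\<close> is the trace of \<open>f\<close> if some sequence of Schwartz
  functions approximates \<open>f\<close> in the quasi-norm of the space, and along every such sequence
  the restrictions to the boundary converge to \<open>g\<close>. A Schwartz function is determined on
  \<^term>\<open>frontier \<Omega>\<close> by its values on \<open>\<Omega>\<close>.
\<close>

definition completion_trace :: "real \<Rightarrow> (real ^ 'n::{finite,linorder}) set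
    \<Rightarrow> ((real ^ 'n::{finite,linorder} \<Rightarrow> complex) \<Rightarrow> ennreal)
    \<Rightarrow> (real ^ 'n::{finite,linorder} \<Rightarrow> complex) \<Rightarrow> (real ^ 'n::{finite,linorder} \<Rightarrow> complex) \<Rightarrow> bool" where
  "completion_trace p \<Omega> N f g \<longleftrightarrow>
     (let \<sigma> = surface_measure (frontier \<Omega>);
          approx = (\<lambda>\<phi>. (\<forall>k. schwartz (\<phi> k)) \<and> (\<lambda>k::nat. N (\<lambda>x. f x - \<phi> k x)) \<longlonglongrightarrow> 0)
      in g \<in> Lp p \<sigma> \<and> (\<exists>\<phi>. approx \<phi>) \<and>
         (\<forall>\<phi>. approx \<phi> \<longrightarrow> (\<lambda>k. Lp_norm p \<sigma> (\<lambda>x. g x - \<phi> k x)) \<longlonglongrightarrow> 0))"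

text \<open>
  Trace by termwise restriction of an atomic representation. Since atoms live on the dilated cubes,
  an atom located at a cube that misses the boundary can still be nonzero there; in the
  representations used here this does not happen, so that the sum over the cubes meeting the
  boundary is the restriction of the whole sum. Without this condition the sum would depend on the
  representation of \<open>f\<close>.
\<close>

definition series_trace :: "real \<Rightarrow> nat \<Rightarrow> real \<Rightarrow> (real ^ 'n::{finite,linorder}) set
    \<Rightarrow> ('n coeffs \<Rightarrow> ennreal)
    \<Rightarrow> (real ^ 'n::{finite,linorder} \<Rightarrow> complex) \<Rightarrow> (real ^ 'n::{finite,linorder} \<Rightarrow> complex) \<Rightarrow> bool" where
  "series_trace d K p \<Omega> \<nu> f g \<longleftrightarrow>
     (let \<Gamma> = frontier \<Omega>; \<sigma> = surface_measure \<Gamma>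
      in g \<in> Lp p \<sigma> \<and>
         (\<exists>c a. atomic_rep d K p \<Omega> f c a \<and> \<nu> c < \<infinity> \<and>
            (\<forall>j. \<forall>m\<in>cubes_meeting \<Omega> j - cubes_meeting \<Gamma> j. \<forall>x\<in>\<Gamma>. a j m x = 0) \<and>
            (\<lambda>J. Lp_norm p \<sigma> (\<lambda>x. g x -
               atomic_sum (\<lambda>j. cubes_meeting \<Omega> j \<inter> cubes_meeting \<Gamma> j) c a J x)) \<longlonglongrightarrow> 0))"

definition B_trace where
  "B_trace d K s p q \<Omega> = completion_trace p \<Omega> (atomic_norm d K p \<Omega> (b_norm s p q \<Omega>))"
  \<comment> \<open>for \<open>q < \<infinity>\<close>\<close>

definition F_trace where
  "F_trace d K s p q \<Omega> =
     (if q = \<infinity> then series_trace d K p \<Omega> (f_norm s p q \<Omega>)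
      else completion_trace p \<Omega> (atomic_norm d K p \<Omega> (f_norm s p q \<Omega>)))"

text \<open>
  The relation \<open>T\<close> is the graph of a map on the space \<open>X\<close>, single-valued up to null sets of
  \<open>\<sigma>\<close>, and the image of \<open>X\<close> under this map is \<open>Y\<close>.
\<close>

definition image_under_trace :: "'a measure \<Rightarrow> ('f \<Rightarrow> ('a \<Rightarrow> complex) \<Rightarrow> bool)
    \<Rightarrow> 'f set \<Rightarrow> ('a \<Rightarrow> complex) set \<Rightarrow> bool" where
  "image_under_trace \<sigma> T X Y \<longleftrightarrow>
     (\<forall>f\<in>X. \<exists>g. T f g) \<and>
     (\<forall>f\<in>X. \<forall>g h. T f g \<longrightarrow> T f h \<longrightarrow> (AE x in \<sigma>. g x = h x)) \<and>
     {g. \<exists>f\<in>X. T f g} = Y"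

end

theory Submission
  imports Defs
begin

text \<open>
  The whole proof rests on one functional that replaces the trace. For a function \<open>h\<close> on
  \<open>\<Omega>\<close>, the integral of \<open>|h| ^ p\<close> over the part of \<open>\<Omega>\<close> at distance less than
  \<open>\<delta>\<close> from the boundary \<open>\<Gamma>\<close>, divided by \<open>\<delta>\<close>, is considered as \<open>\<delta>\<close> tends to 0
  (\<open>avg\<close>, \<open>collar_bound\<close>). It makes sense for every \<open>p > 0\<close> and every measurable \<open>h\<close>, and for
  continuous \<open>h\<close> it bounds the integral of \<open>|h| ^ p\<close> over \<open>\<Gamma>\<close> (\<open>pint_surface_le_collar\<close>). So a
  function has a trace in \<open>L\<^sub>p(\<Gamma>)\<close> as soon as continuous functions approximate it in the sense of
  these averages, and the trace does not depend on the approximation (\<open>trace_exists\<close>,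
  \<open>trace_independent\<close>).

  An atom of level \<open>j\<close> meets such a neighbourhood of \<open>\<Gamma>\<close> in a set of volume at most a multiple
  of \<open>\<delta> / 2 ^ (j (n - 1))\<close>. This matches the weight of the coefficients in the sequence norms
  with smoothness \<open>1 / p\<close>. For the Besov norms the levels are added by Minkowski's inequality,
  or by subadditivity of the power if \<open>p < 1\<close>; this is where \<open>q \<le> min 1 p\<close> enters
  (\<open>collar_bound_B\<close>). For the Triebel--Lizorkin norms and \<open>p \<le> 1\<close>, a cube near \<open>\<Gamma>\<close> has a fixed
  part whose distance from \<open>\<Gamma>\<close> is comparable to the side length; such parts of different levels
  overlap boundedly often, so the sum over the cubes near \<open>\<Gamma>\<close> is controlled by the integral of the
  supremum over all cubes, whatever \<open>q\<close> is (\<open>sum_near_le_gmax\<close>, \<open>collar_bound_F\<close>).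

  Conversely, a boundary function is approximated by continuous functions, hence by sums
  of members of a partition of unity on a single fine level whose coefficients are values of the function.
  Iterating on the residuals with increasing levels gives geometrically decaying coefficients,
  for which all the sequence norms are finite (\<open>discretize\<close>, \<open>sparse_extension\<close>, \<open>b_norm_sparse\<close>,
  \<open>f_norm_sparse\<close>).

  For \<open>q < \<infinity>\<close> the remaining point is density: if the atoms of the first levels are smoothed, the
  error has a representation with small coefficients on these levels and the old ones on the others,
  and its quasi-norm tends to 0 (\<open>schwartz_approximation\<close>). For \<open>q = \<infinity>\<close> it is the choice of a
  representation whose atoms at cubes off \<open>\<Gamma>\<close> vanish on \<open>\<Gamma>\<close>, which a partition of unity
  provides (\<open>relocation\<close>).

  Of Lipschitz domains, three facts are used: the interior corkscrew condition, the volume of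
  neighbourhoods of \<open>\<Gamma>\<close>, and two-sided bounds for the surface measure of boundary balls. All come from
  charts that distort distances by bounded factors, together with invariance of domain.
\<close>

notation LIMSEQ ("((_)/ ----> (_))" [60, 60] 60)


section \<open>Iterated partial derivatives\<close>

definition pderivs :: "'n list => (real ^ 'n::finite => complex) => real ^ 'n => complex" where
 "pderivs is f = foldr partial_deriv is f"

lemma pderivs_simps [simp]:
 "pderivs [] f = f" "pderivs (i # is) f = partial_deriv i (pderivs is f)"
 by (auto simp: pderivs_def)

lemma partial_deriv_eq:
 assumes "(f has_derivative f') (at x)"
 shows "partial_deriv i f x = f' (axis i 1)"
proof -
 have lin: "linear f'" using assms has_derivative_linear by blast
 have g: "((%t::real. x + t *\<^sub>R axis i 1) has_derivative (%t. t *\<^sub>R axis i 1)) (at 0)"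
  by (auto intro!: derivative_eq_intros)
 have "((%t. f (x + t *\<^sub>R axis i 1)) has_derivative (%t. f' (t *\<^sub>R axis i 1))) (at 0)"
  by (rule has_derivative_compose[OF g, of f f', simplified]) (use assms in simp)
 then have "((%t. f (x + t *\<^sub>R axis i 1)) has_vector_derivative f' (axis i 1)) (at 0)"
  unfolding has_vector_derivative_def using lin by (simp add: linear_cmul)
 then show ?thesis
  unfolding partial_deriv_def by (rule vector_derivative_at)
qed

lemma has_derivative_partials:
 fixes f :: "real ^ 'n::finite => complex"
 assumes "f differentiable (at x)"
 shows "(f has_derivative (%v. \<Sum>i\<in>UNIV. v $ i *\<^sub>R partial_deriv i f x)) (at x)"
proof -
 obtain f' where f': "(f has_derivative f') (at x)" using assms differentiable_def by blast
 then have lin: "linear f'" using has_derivative_linear by blast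
 have "f' v = (\<Sum>i\<in>UNIV. v $ i *\<^sub>R partial_deriv i f x)" for v
 proof -
  have "f' v = f' (\<Sum>i\<in>UNIV. v $ i *\<^sub>R axis i 1)"
   by (simp add: basis_expansion[of v, unfolded scalar_mult_eq_scaleR])
  also have "... = (\<Sum>i\<in>UNIV. v $ i *\<^sub>R f' (axis i 1))"
   by (simp add: linear_sum[OF lin] linear_cmul[OF lin])
  finally show ?thesis by (simp add: partial_deriv_eq[OF f'])
 qed
 then have "f' = (%v. \<Sum>i\<in>UNIV. v $ i *\<^sub>R partial_deriv i f x)" by blast
 with f' show ?thesis by simp
qed

lemma Ck_Suc_imp_Ck: "Ck (Suc k) f ==> Ck k f"
proof (induction k arbitrary: f)
 case 0
 then show ?case
  by (auto simp: continuous_on_eq_continuous_within differentiable_imp_continuous_within)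
qed auto

lemma Ck_le: "Ck k f ==> l <= k ==> Ck l f"
 by (induction "k - l" arbitrary: l) (auto, metis Ck_Suc_imp_Ck Suc_diff_Suc Suc_leI diff_Suc_1 le_neq_implies_less zero_less_Suc zero_less_diff)

lemma Ck_pderivs: "Ck k f ==> length is <= k ==> Ck (k - length is) (pderivs is f)"
proof (induction "is")
 case (Cons i "is")
 then have "Ck (k - length is) (pderivs is f)" by simp
 moreover have "k - length is = Suc (k - length (i # is))" using Cons.prems by simp
 ultimately show ?case by simp
qed simp

lemma Ck_continuous: "Ck k f ==> continuous_on UNIV f"
 using Ck_le[of k f 0] by simp

lemma continuous_pderivs: "Ck k f ==> length is <= k ==> continuous_on UNIV (pderivs is f)"
 using Ck_pderivs Ck_continuous by blast

lemma differentiable_pderivs: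
 "Ck k f ==> length is < k ==> pderivs is f differentiable (at x)"
 using Ck_pderivs[of k f "is"] by (cases "k - length is") auto

lemma partial_deriv_add:
 assumes "f differentiable (at x)" "g differentiable (at x)"
 shows "partial_deriv i (%x. f x + g x) x = partial_deriv i f x + partial_deriv i g x"
proof -
 obtain f' g' where d: "(f has_derivative f') (at x)" "(g has_derivative g') (at x)"
  using assms differentiable_def by metis
 show ?thesis
  using partial_deriv_eq[OF has_derivative_add[OF d]] by (simp add: partial_deriv_eq[OF d(1)] partial_deriv_eq[OF d(2)])
qed

lemma partial_deriv_mult:
 assumes "f differentiable (at x)" "g differentiable (at x)"
 shows "partial_deriv i (%x. f x * g x) x = partial_deriv i f x * g x + f x * partial_deriv i g x"
proof -
 obtain f' g' where d: "(f has_derivative f') (at x)" "(g has_derivative g') (at x)"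
  using assms differentiable_def by metis
 show ?thesis
  using partial_deriv_eq[OF has_derivative_mult[OF d]] by (simp add: partial_deriv_eq[OF d(1)] partial_deriv_eq[OF d(2)])
qed

lemma partial_deriv_const [simp]: "partial_deriv i (%x. c) = (%x. 0)"
 using partial_deriv_eq[OF has_derivative_const] by (auto simp: fun_eq_iff)

lemma partial_deriv_cmult:
 assumes "f differentiable (at x)"
 shows "partial_deriv i (%x. c * f x) x = c * partial_deriv i f x"
 using partial_deriv_mult[of "%_. c" x f i] assms by simp

lemma partial_deriv_affine:
 fixes f :: "real ^ 'n::finite => complex"
 assumes "f differentiable (at (s *\<^sub>R x + b))"
 shows "(%x. f (s *\<^sub>R x + b)) differentiable (at x)"
  and "partial_deriv i (%x. f (s *\<^sub>R x + b)) x = of_real s * partial_deriv i f (s *\<^sub>R x + b)"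
proof -
 obtain f' where f': "(f has_derivative f') (at (s *\<^sub>R x + b))" using assms differentiable_def by blast
 then have lin: "linear f'" using has_derivative_linear by blast
 have g: "((%x. s *\<^sub>R x + b) has_derivative (%v. s *\<^sub>R v)) (at x)"
  by (auto intro!: derivative_eq_intros)
 have h: "((%x. f (s *\<^sub>R x + b)) has_derivative (%v. f' (s *\<^sub>R v))) (at x)"
  by (rule has_derivative_compose[OF g f'])
 show "(%x. f (s *\<^sub>R x + b)) differentiable (at x)" using h differentiable_def by blast
 show "partial_deriv i (%x. f (s *\<^sub>R x + b)) x = of_real s * partial_deriv i f (s *\<^sub>R x + b)"
  using partial_deriv_eq[OF h, of i] partial_deriv_eq[OF f', of i]
  by (simp add: linear_cmul[OF lin] scaleR_conv_of_real[of _ "_ :: complex"])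
qed

lemma Ck_const [simp]: "Ck k (%x. c)"
 by (induction k arbitrary: c) auto

lemma Ck_add: "Ck k f ==> Ck k g ==> Ck k (%x. f x + g x)"
proof (induction k arbitrary: f g)
 case (Suc k)
 then have "partial_deriv i (%x. f x + g x) = (%x. partial_deriv i f x + partial_deriv i g x)" for i
  by (auto simp: partial_deriv_add fun_eq_iff)
 with Suc show ?case by auto
qed (auto intro: continuous_intros)

lemma Ck_mult: "Ck k f ==> Ck k g ==> Ck k (%x. f x * g x)"
proof (induction k arbitrary: f g)
 case (Suc k)
 then have "partial_deriv i (%x. f x * g x) = (%x. partial_deriv i f x * g x + f x * partial_deriv i g x)" for i
  by (auto simp: partial_deriv_mult fun_eq_iff)
 moreover have "Ck k f" "Ck k g" using Suc.prems Ck_Suc_imp_Ck by blast+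
 ultimately show ?case using Suc by (auto intro!: Ck_add)
qed (auto intro: continuous_intros)

lemma Ck_cmult: "Ck k f ==> Ck k (%x. c * f x)"
 by (rule Ck_mult) auto

lemma Ck_diff: "Ck k f ==> Ck k g ==> Ck k (%x. f x - g x)"
 using Ck_add[of k f "%x. (-1) * g x"] Ck_cmult[of k g "-1"] by simp

lemma Ck_sum: "(!!m. m \<in> M ==> Ck k (f m)) ==> Ck k (%x. \<Sum>m\<in>M. f m x)"
 by (induction M rule: infinite_finite_induct) (auto intro!: Ck_add)

lemma Ck_prod: "(!!m. m \<in> M ==> Ck k (f m)) ==> Ck k (%x. \<Prod>m\<in>M. f m x)"
 by (induction M rule: infinite_finite_induct) (auto intro!: Ck_mult)

lemma Ck_affine: "Ck k f ==> Ck k (%x. f (s *\<^sub>R x + b))"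
proof (induction k arbitrary: f)
 case 0
 then have "continuous_on UNIV f" by simp
 then show ?case
  by simp (rule continuous_on_compose2, auto intro!: continuous_intros)
next
 case (Suc k)
 then have "partial_deriv i (%x. f (s *\<^sub>R x + b)) = (%x. of_real s * partial_deriv i f (s *\<^sub>R x + b))" for i
  by (auto simp: partial_deriv_affine(2) fun_eq_iff)
 with Suc show ?case by (auto intro!: Ck_cmult partial_deriv_affine(1))
qed

lemma pderivs_add:
 "Ck k f ==> Ck k g ==> length is <= k ==>
  pderivs is (%x. f x + g x) = (%x. pderivs is f x + pderivs is g x)"
 by (induction "is") (auto intro!: ext partial_deriv_add differentiable_pderivs)

lemma pderivs_cmult:
 "Ck k f ==> length is <= k ==> pderivs is (%x. c * f x) = (%x. c * pderivs is f x)"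
 by (induction "is") (auto intro!: ext partial_deriv_cmult differentiable_pderivs)

lemma pderivs_diff:
 assumes "Ck k f" "Ck k g" "length is <= k"
 shows "pderivs is (%x. f x - g x) = (%x. pderivs is f x - pderivs is g x)"
 using pderivs_add[OF assms(1) Ck_cmult[OF assms(2), of "-1"] assms(3)] pderivs_cmult[OF assms(2,3), of "-1"]
 by simp

lemma pderivs_affine:
 "Ck k f ==> length is <= k ==>
  pderivs is (%x. f (s *\<^sub>R x + b)) = (%x. of_real s ^ length is * pderivs is f (s *\<^sub>R x + b))"
proof (induction "is")
 case (Cons i "is")
 then have d: "pderivs is f differentiable (at y)" for y by (auto intro: differentiable_pderivs)
 have "partial_deriv i (pderivs is (%x. f (s *\<^sub>R x + b))) x =
   partial_deriv i (%x. of_real s ^ length is * pderivs is f (s *\<^sub>R x + b)) x" for x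
  using Cons by simp
 also have "... x = of_real s ^ length is * (of_real s * partial_deriv i (pderivs is f) (s *\<^sub>R x + b))" for x
  by (subst partial_deriv_cmult) (auto simp: partial_deriv_affine d)
 finally show ?case by (simp add: fun_eq_iff)
qed simp

lemma pderivs_eq_0_on_open:
 "open U ==> (!!x. x \<in> U ==> f x = 0) ==> x \<in> U ==> pderivs is f x = 0"
proof (induction "is" arbitrary: x)
 case (Cons i "is")
 have "(pderivs is f has_derivative (%v. 0)) (at x)"
  by (rule has_derivative_transform_within_open[of "%x. 0" _ _ _ U]) (use Cons in auto)
 then show ?case using partial_deriv_eq by fastforce
qed auto

text \<open>
  Leibniz rule for iterated derivatives, as a sum over all ways to distribute the list of
  differentiations over the two factors. Sublists of sorted lists are sorted, which keeps the rule
  inside the derivatives that the definition of an atom controls and avoids the symmetry of mixed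
  derivatives.
\<close>

fun splits :: "'a list => ('a list \<times> 'a list) list" where
 "splits [] = [([], [])]"
| "splits (i # is) = map (%(u, v). (i # u, v)) (splits is) @ map (%(u, v). (u, i # v)) (splits is)"

lemma length_splits [simp]: "length (splits is) = 2 ^ length is"
 by (induction "is") auto

lemma splits_length: "(u, v) \<in> set (splits is) ==> length u + length v = length is"
 by (induction "is" arbitrary: u v) auto

lemma splits_subset: "(u, v) \<in> set (splits is) ==> set u \<subseteq> set is & set v \<subseteq> set is"
 by (induction "is" arbitrary: u v) fastforce+

lemma splits_sorted: "(u, v) \<in> set (splits is) ==> sorted is ==> sorted u & sorted v"
proof (induction "is" arbitrary: u v)
 case (Cons i "is")
 then show ?case using splits_subset[of _ _ "is"] by fastforce
qed simp

lemma partial_deriv_sum_list: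
 "(!!p. p \<in> set ps ==> F p differentiable (at x)) ==>
   (%x. \<Sum>p\<leftarrow>ps. F p x) differentiable (at x) \<and>
   partial_deriv i (%x. \<Sum>p\<leftarrow>ps. F p x) x = (\<Sum>p\<leftarrow>ps. partial_deriv i (F p) x)"
 by (induction ps) (auto simp: partial_deriv_add)

lemma pderivs_mult:
 "Ck k f ==> Ck k g ==> length is <= k ==>
  pderivs is (%x. f x * g x) = (%x. \<Sum>(u, v)\<leftarrow>splits is. pderivs u f x * pderivs v g x)"
proof (induction "is")
 case (Cons i "is")
 let ?F = "%p x. pderivs (fst p) f x * pderivs (snd p) g x"
 have d: "pderivs (fst p) f differentiable (at x)" "pderivs (snd p) g differentiable (at x)"
  if "p \<in> set (splits is)" for p x
  using that Cons.prems splits_length[of "fst p" "snd p" "is"]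
  by (auto intro!: differentiable_pderivs[of k])
 have "pderivs (i # is) (%x. f x * g x) x = partial_deriv i (%x. \<Sum>p\<leftarrow>splits is. ?F p x) x" for x
  using Cons by (simp add: case_prod_beta')
 also have "... x = (\<Sum>p\<leftarrow>splits is. partial_deriv i (?F p) x)" for x
  by (intro conjunct2[OF partial_deriv_sum_list] differentiable_mult d)
 also have "... x = (\<Sum>p\<leftarrow>splits is. pderivs (i # fst p) f x * pderivs (snd p) g x
   + pderivs (fst p) f x * pderivs (i # snd p) g x)" for x
  by (intro arg_cong[of _ _ sum_list] map_cong refl) (simp add: partial_deriv_mult d)
 also have "... x = (\<Sum>(u, v)\<leftarrow>splits (i # is). pderivs u f x * pderivs v g x)" for x
  by (simp add: sum_list_addf case_prod_beta' comp_def)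
 finally show ?case by (simp add: fun_eq_iff)
qed simp


section \<open>Atoms\<close>

text \<open>
  Sorted lists of coordinate directions encode multi-indices; induction on lists then replaces induction on
  multi-indices.
\<close>

definition index_list :: "nat ^ 'n::{finite,linorder} => 'n list" where
 "index_list \<alpha> = concat (map (%i. replicate (\<alpha> $ i) i) (sorted_list_of_set UNIV))"

lemma foldr_replicate: "foldr f (replicate k i) g = (f i ^^ k) g"
 by (induction k) auto

lemma multi_deriv_eq_pderivs: "multi_deriv \<alpha> f = pderivs (index_list \<alpha>) f"
proof -
 have "foldr (%i g. (partial_deriv i ^^ (\<alpha> $ i)) g) is f
   = foldr partial_deriv (concat (map (%i. replicate (\<alpha> $ i) i) is)) f" for "is"
  by (induction "is") (auto simp: foldr_replicate)
 then show ?thesis by (simp add: multi_deriv_def pderivs_def index_list_def)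
qed

lemma length_index_list: "length (index_list \<alpha>) = multi_order \<alpha>"
proof -
 have "length (index_list \<alpha>) = (\<Sum>i\<leftarrow>sorted_list_of_set UNIV. \<alpha> $ i)"
  by (simp add: index_list_def length_concat comp_def)
 also have "... = multi_order \<alpha>"
  by (simp add: multi_order_def sum_list_distinct_conv_sum_set)
 finally show ?thesis .
qed

lemma sorted_concat_replicate:
 "sorted is ==> sorted (concat (map (%i. replicate (k i) i) is))"
 by (induction "is") (auto simp: sorted_append)

lemma sorted_index_list: "sorted (index_list \<alpha>)"
 unfolding index_list_def by (rule sorted_concat_replicate) simp

lemma sorted_is_index_list:
 fixes "is" :: "'n::{finite,linorder} list"
 assumes "sorted is"
 shows "is = index_list (\<chi> i. count_list is i)"
proof (rule properties_for_sort[OF _ assms, symmetric, THEN trans[OF _ sorted_sort_id[OF sorted_index_list]], symmetric, symmetric])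
 have 1: "count (mset (concat (map (%i. replicate (k i) i) js))) x = (if x \<in> set js then k x else 0)"
  if "distinct js" for k :: "'n => nat" and js x
  using that by (induction js) auto
 show "mset is = mset (index_list (\<chi> i. count_list is i))"
  by (rule multiset_eqI) (simp add: index_list_def 1 count_mset[of "is"] del: mset_concat)
qed

text \<open>
  With \<open>R = 2 ^ j\<close> and \<open>M = 1\<close> these are the derivative bounds of an atom at
  level \<open>j\<close>. Keeping \<open>M\<close> separate makes the condition additive and, up to a
  factor \<open>2 ^ K\<close>, multiplicative.
\<close>

definition Ck_bounded :: "nat => real => real => (real ^ 'n::{finite,linorder} => complex) => bool" where
 "Ck_bounded K R M f \<longleftrightarrow> Ck K f \<and>
   (ALL is x. sorted is --> length is <= K --> cmod (pderivs is f x) <= M * R ^ length is)"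

lemma is_atom_iff:
 fixes a :: "real ^ 'n::{finite,linorder} => complex"
 shows "is_atom d K j m a \<longleftrightarrow> Ck_bounded K (2 ^ j) 1 a & closure {x. a x ~= 0} \<subseteq> dcube d j m"
proof -
 have "(\<forall>\<alpha> x. multi_order \<alpha> <= K --> cmod (multi_deriv \<alpha> a x) <= 2 ^ (multi_order \<alpha> * j)) \<longleftrightarrow>
  (ALL is x. sorted is --> length is <= K --> cmod (pderivs is a x) <= 1 * (2 ^ j) ^ length is)"
 proof safe
  fix "is" :: "'n list" and x
  assume H: "\<forall>\<alpha> x. multi_order \<alpha> <= K --> cmod (multi_deriv \<alpha> a x) <= 2 ^ (multi_order \<alpha> * j)"
   and s: "sorted is" "length is <= K"
  let ?\<alpha> = "\<chi> i. count_list is i"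
  have "is = index_list ?\<alpha>" using sorted_is_index_list[OF s(1)] .
  then have "multi_order ?\<alpha> = length is" "multi_deriv ?\<alpha> a = pderivs is a"
   by (metis length_index_list, metis multi_deriv_eq_pderivs)
  then show "cmod (pderivs is a x) <= 1 * (2 ^ j) ^ length is"
   using H s(2) by (metis mult.commute mult_1 power_mult)
 next
  fix \<alpha> :: "(nat, 'n) vec" and x
  assume "ALL is x. sorted is --> length is <= K --> cmod (pderivs is a x) <= 1 * (2 ^ j) ^ length is"
   and "multi_order \<alpha> <= K"
  then show "cmod (multi_deriv \<alpha> a x) <= 2 ^ (multi_order \<alpha> * j)"
   using sorted_index_list[of \<alpha>] length_index_list[of \<alpha>]
   by (metis multi_deriv_eq_pderivs mult.commute mult_1 power_mult)
 qed
 then show ?thesis unfolding is_atom_def Ck_bounded_def by blast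
qed

lemma Ck_bounded_mono: "Ck_bounded K R M f ==> M <= N ==> 0 <= R ==> Ck_bounded K R N f"
 unfolding Ck_bounded_def by (blast intro: order_trans mult_right_mono zero_le_power)

lemma pderivs_zero: "pderivs is (%x. 0) = (%x. 0)"
 by (induction "is") auto

lemma Ck_bounded_zero: "0 <= M ==> 0 <= R ==> Ck_bounded K R M (%x. 0)"
 by (simp add: Ck_bounded_def pderivs_zero)

lemma Ck_bounded_cmult: "Ck_bounded K R M f ==> Ck_bounded K R (cmod c * M) (%x. c * f x)"
 by (auto simp: Ck_bounded_def Ck_cmult pderivs_cmult[of K f _ c] norm_mult mult.assoc intro: mult_left_mono)

lemma Ck_bounded_add:
 "Ck_bounded K R M f ==> Ck_bounded K R N g ==> Ck_bounded K R (M + N) (%x. f x + g x)"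
 by (auto simp: Ck_bounded_def Ck_add pderivs_add[of K f g] distrib_right intro: order_trans[OF norm_triangle_ineq add_mono])

lemma Ck_bounded_sum:
 "finite S ==> 0 <= R ==> (!!m. m \<in> S ==> Ck_bounded K R (M m) (f m)) ==>
   Ck_bounded K R (\<Sum>m\<in>S. M m) (%x. \<Sum>m\<in>S. f m x)"
 by (induction S rule: finite_induct) (auto intro!: Ck_bounded_zero Ck_bounded_add)

lemma norm_sum_list_le: "norm (sum_list (map f xs)) <= (\<Sum>x\<leftarrow>xs. norm (f x :: 'a::real_normed_vector))"
 by (induction xs) (auto intro: order_trans[OF norm_triangle_ineq])

lemma Ck_bounded_mult:
 fixes f g :: "real ^ 'n::{finite,linorder} => complex"
 assumes f: "Ck_bounded K R M f" and g: "Ck_bounded K R N g" and nonneg: "0 <= R" "0 <= M" "0 <= N"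
 shows "Ck_bounded K R (2 ^ K * M * N) (%x. f x * g x)"
 unfolding Ck_bounded_def
proof (intro conjI allI impI)
 show "Ck K (%x. f x * g x)" using f g by (auto simp: Ck_bounded_def intro: Ck_mult)
 fix "is" :: "'n list" and x
 assume s: "sorted is" "length is <= K"
 have *: "cmod (pderivs u f x * pderivs v g x) <= M * N * R ^ length is"
  if uv: "(u, v) \<in> set (splits is)" for u v
 proof -
  have len: "length u + length v = length is" and "sorted u" "sorted v"
   using splits_length[OF uv] splits_sorted[OF uv s(1)] by auto
  then have "cmod (pderivs u f x) <= M * R ^ length u" "cmod (pderivs v g x) <= N * R ^ length v"
   using f g s(2) by (auto simp: Ck_bounded_def)
  then have "cmod (pderivs u f x) * cmod (pderivs v g x) <= (M * R ^ length u) * (N * R ^ length v)"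
   using nonneg by (intro mult_mono) auto
  then show ?thesis by (simp add: norm_mult len[symmetric] power_add mult_ac)
 qed
 have "cmod (pderivs is (%x. f x * g x) x) <= (\<Sum>(u, v)\<leftarrow>splits is. cmod (pderivs u f x * pderivs v g x))"
  unfolding pderivs_mult[OF conjunct1[OF f[unfolded Ck_bounded_def]] conjunct1[OF g[unfolded Ck_bounded_def]] s(2)] case_prod_beta'
  by (rule norm_sum_list_le)
 also have "... <= (\<Sum>(u, v)\<leftarrow>splits is. M * N * R ^ length is)"
  by (intro sum_list_mono) (use * in auto)
 also have "... = 2 ^ length is * (M * N * R ^ length is)"
  by (simp add: case_prod_beta' sum_list_triv)
 also have "... <= 2 ^ K * (M * N * R ^ length is)"
  using s(2) nonneg by (intro mult_right_mono) (auto intro: power_increasing)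
 finally show "cmod (pderivs is (%x. f x * g x) x) <= 2 ^ K * M * N * R ^ length is"
  by (simp add: mult_ac)
qed

lemma dcube_eq_cbox:
 "dcube d j m = cbox (\<chi> i. of_int (m $ i) / 2 ^ j - d / 2 ^ j) (\<chi> i. of_int (m $ i) / 2 ^ j + d / 2 ^ j)"
proof -
 have "\<bar>a - b\<bar> <= c \<longleftrightarrow> b - c <= a & a <= b + c" for a b c :: real by linarith
 then show ?thesis by (simp add: dcube_def set_eq_iff mem_box_cart)
qed

lemma closed_dcube [simp]: "closed (dcube d j m)" and compact_dcube [simp]: "compact (dcube d j m)"
 unfolding dcube_eq_cbox by (rule closed_cbox compact_cbox)+

lemma support_subset_dcube_iff:
 "closure {x. a x ~= 0} \<subseteq> dcube d j m \<longleftrightarrow> (ALL x. x ~: dcube d j m --> a x = 0)"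
proof -
 have "closure {x. a x ~= 0} \<subseteq> dcube d j m \<longleftrightarrow> {x. a x ~= 0} \<subseteq> dcube d j m"
  using closure_minimal[OF _ closed_dcube, of "{x. a x ~= 0}" d j m] closure_subset[of "{x. a x ~= 0}"]
  by (meson order_trans)
 then show ?thesis by auto
qed

lemma atom_eq_0: "is_atom d K j m a ==> x ~: dcube d j m ==> a x = 0"
 by (auto simp: is_atom_iff support_subset_dcube_iff)

lemma Ck_bounded_norm: "Ck_bounded K R M f ==> cmod (f x) <= M"
 unfolding Ck_bounded_def by (auto dest!: spec[of _ "[]"])

lemma atom_bounded: "is_atom d K j m a ==> cmod (a x) <= 1"
 unfolding is_atom_iff using Ck_bounded_norm by blast

lemma atom_continuous: "is_atom d K j m a ==> continuous_on UNIV a"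
 unfolding is_atom_iff Ck_bounded_def using Ck_continuous by blast

lemma Ck_compact_support_bounded:
 fixes f :: "real ^ 'n::{finite,linorder} => complex"
 assumes f: "Ck K f" and S: "compact S" "!!x. x ~: S ==> f x = 0" and R: "0 < R"
 obtains M where "0 < M" "Ck_bounded K R M f"
proof -
 have z: "pderivs is f x = 0" if "x ~: S" for "is" x
  by (rule pderivs_eq_0_on_open[of "- S"]) (use that S compact_imp_closed in auto)
 have "EX M. ALL x. cmod (pderivs is f x) <= M" if "length is <= K" for "is"
 proof -
  have "compact (pderivs is f ` S)"
   by (intro compact_continuous_image continuous_on_subset[OF continuous_pderivs[OF f that]] S) auto
  then obtain B where B: "!!x. x \<in> S ==> cmod (pderivs is f x) <= B"
   using compact_imp_bounded bounded_iff by (metis imageI)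
  then have "cmod (pderivs is f x) <= max B 0" for x by (cases "x \<in> S") (auto simp: z le_max_iff_disj)
  then show ?thesis by blast
 qed
 then obtain B where B: "length is <= K ==> cmod (pderivs is f x) <= B is" for "is" x by metis
 have fin: "finite {is :: 'n list. set is \<subseteq> UNIV & length is <= K}"
  by (rule finite_lists_length_le) simp
 let ?L = "{is :: 'n list. length is <= K}"
 have fin: "finite ?L" using fin by simp
 define M where "M = 1 + (\<Sum>is\<in>?L. \<bar>B is\<bar> / R ^ length is)"
 have "Ck_bounded K R M f"
  unfolding Ck_bounded_def
 proof (intro conjI allI impI f)
  fix "is" :: "'n list" and x assume "length is <= K"
  then have "\<bar>B is\<bar> / R ^ length is <= (\<Sum>is\<in>?L. \<bar>B is\<bar> / R ^ length is)"
   using R by (intro member_le_sum fin) auto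
  then have "\<bar>B is\<bar> / R ^ length is <= M" by (simp add: M_def)
  then have "\<bar>B is\<bar> <= M * R ^ length is" using R by (simp add: pos_divide_le_eq)
  then show "cmod (pderivs is f x) <= M * R ^ length is"
   using B[OF \<open>length is <= K\<close>, of x] by linarith
 qed
 moreover have "0 < M" unfolding M_def using R by (intro add_pos_nonneg sum_nonneg) auto
 ultimately show ?thesis using that by blast
qed

lemma schwartz_compact_support:
 fixes f :: "real ^ 'n::{finite,linorder} => complex"
 assumes f: "!!k. Ck k f" and S: "compact S" "!!x. x ~: S ==> f x = 0"
 shows "schwartz f"
 unfolding schwartz_def
proof (intro conjI allI f)
 fix N :: nat and \<alpha> :: "(nat, 'n) vec"
 obtain M where M: "0 < M" "Ck_bounded (multi_order \<alpha>) 1 M f"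
  using Ck_compact_support_bounded[OF f S, of 1] by auto
 have b: "cmod (multi_deriv \<alpha> f x) <= M" for x
  using M(2) sorted_index_list[of \<alpha>] length_index_list[of \<alpha>]
  by (auto simp: Ck_bounded_def multi_deriv_eq_pderivs)
 have z: "multi_deriv \<alpha> f x = 0" if "x ~: S" for x
  unfolding multi_deriv_eq_pderivs
  by (rule pderivs_eq_0_on_open[of "- S"]) (use that S compact_imp_closed in auto)
 obtain B where B: "!!x. x \<in> S ==> norm x <= B" using compact_imp_bounded[OF S(1)] bounded_iff by metis
 have "(1 + norm x) ^ N * cmod (multi_deriv \<alpha> f x) <= (1 + \<bar>B\<bar>) ^ N * M" for x
 proof (cases "x \<in> S")
  case True
  then show ?thesis using B[OF True] b[of x] by (intro mult_mono power_mono) auto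
 qed (use M z in auto)
 then show "EX C. ALL x. (1 + norm x) ^ N * cmod (multi_deriv \<alpha> f x) <= C" by blast
qed


section \<open>A smooth partition of unity\<close>

primrec Cr :: "nat => (real => real) => bool" where
 "Cr 0 f \<longleftrightarrow> continuous_on UNIV f"
| "Cr (Suc k) f \<longleftrightarrow> (EX f'. (ALL x. (f has_real_derivative f' x) (at x)) & Cr k f')"

lemma Cr_SucI: "(!!x. (f has_real_derivative f' x) (at x)) ==> Cr k f' ==> Cr (Suc k) f"
 by auto

lemma Cr_Suc_imp_Cr: "Cr (Suc k) f ==> Cr k f"
proof (induction k arbitrary: f)
 case 0
 then show ?case by (auto simp: continuous_on_eq_continuous_within intro: DERIV_isCont)
next
 case (Suc k)
 from Suc.prems obtain f' where f': "ALL x. (f has_real_derivative f' x) (at x)" "Cr (Suc k) f'"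
  unfolding Cr.simps(2)[of "Suc k"] by blast
 show ?case unfolding Cr.simps(2)[of k] using f'(1) Suc.IH[OF f'(2)] by blast
qed

lemma Cr_continuous: "Cr k f ==> continuous_on UNIV f"
proof (induction k)
 case (Suc k)
 show ?case by (rule Suc.IH[OF Cr_Suc_imp_Cr[OF Suc.prems]])
qed simp

lemma Cr_const: "Cr k (%x. c)"
 by (induction k arbitrary: c) (auto intro!: exI[of _ "%x. 0"])

lemma Cr_add: "Cr k f ==> Cr k g ==> Cr k (%x. f x + g x)"
proof (induction k arbitrary: f g)
 case (Suc k)
 then obtain f' g' where d: "!!x. (f has_real_derivative f' x) (at x)" "Cr k f'"
  "!!x. (g has_real_derivative g' x) (at x)" "Cr k g'" by auto
 have "((%x. f x + g x) has_real_derivative f' x + g' x) (at x)" for x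
  by (rule DERIV_add[OF d(1) d(3)])
 then show ?case by (rule Cr_SucI) (rule Suc.IH[OF d(2,4)])
qed (auto intro: continuous_intros)

lemma Cr_mult: "Cr k f ==> Cr k g ==> Cr k (%x. f x * g x)"
proof (induction k arbitrary: f g)
 case (Suc k)
 then obtain f' g' where d: "!!x. (f has_real_derivative f' x) (at x)" "Cr k f'"
  "!!x. (g has_real_derivative g' x) (at x)" "Cr k g'" by auto
 have "Cr k (%x. f' x * g x + f x * g' x)"
  using Cr_add[OF Suc.IH[OF d(2) Cr_Suc_imp_Cr[OF Suc.prems(2)]] Suc.IH[OF Cr_Suc_imp_Cr[OF Suc.prems(1)] d(4)]] .
 moreover have "((%x. f x * g x) has_real_derivative f' x * g x + f x * g' x) (at x)" for x
  using DERIV_mult[OF d(1)[of x] d(3)[of x]] by (simp add: mult.commute add.commute)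
 ultimately show ?case by (intro Cr_SucI[of "%x. f x * g x" "%x. f' x * g x + f x * g' x"])
qed (auto intro: continuous_intros)

lemma Cr_cmult: "Cr k f ==> Cr k (%x. c * f x)"
 by (intro Cr_mult Cr_const)

lemma Cr_affine: "Cr k f ==> Cr k (%x. f (s * x + b))"
proof (induction k arbitrary: f)
 case 0
 then have "continuous_on UNIV f" by simp
 then show ?case
  using continuous_on_compose2[of UNIV f UNIV "%x. s * x + b"] by (simp add: continuous_intros)
next
 case (Suc k)
 then obtain f' where d: "!!x. (f has_real_derivative f' x) (at x)" "Cr k f'" by auto
 have "((%x. f (s * x + b)) has_real_derivative s * f' (s * x + b)) (at x)" for x
  by (rule DERIV_cong[OF DERIV_chain2[OF d(1), of "%x. s * x + b" s]]) (auto intro!: derivative_eq_intros)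
 then show ?case by (rule Cr_SucI) (rule Cr_cmult[OF Suc.IH[OF d(2)]])
qed

lemma Ck_coordinate: "Cr k f ==> Ck k (%x :: real ^ 'n::finite. of_real (f (x $ i)))"
proof (induction k arbitrary: f)
 case 0
 then have "continuous_on UNIV f" by simp
 then have "continuous_on UNIV (%x :: real ^ 'n. f (x $ i))"
  by (rule continuous_on_compose2) (auto intro: continuous_on_component)
 then show ?case by (simp add: continuous_on_of_real)
next
 case (Suc k)
 then obtain f' where d: "!!x. (f has_real_derivative f' x) (at x)" "Cr k f'" by auto
 have h: "((%x :: real ^ 'n. of_real (f (x $ i)) :: complex) has_derivative (%v. of_real (f' (x $ i) * v $ i))) (at x)" for x
  by (intro has_derivative_of_real has_derivative_compose[of "%x. x $ i" "%v. v $ i" x UNIV f "%h. f' (x $ i) * h"])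
    (use d(1)[of "x $ i"] in "auto simp: has_field_derivative_def intro: bounded_linear_imp_has_derivative bounded_linear_vec_nth")
 have "partial_deriv j (%x :: real ^ 'n. of_real (f (x $ i))) = (%x. (if i = j then 1 else 0) * of_real (f' (x $ i)))" for j
  using partial_deriv_eq[OF h] by (auto simp: fun_eq_iff axis_def)
 then show ?case using Suc.IH[OF d(2)] h
  by (auto simp: differentiable_def intro!: Ck_cmult)
qed

text \<open>The functions \<open>P (1 / t) exp (- 1 / t)\<close>, extended by 0, are closed under differentiation.\<close>

definition flat_exp :: "real poly => real => real" where
 "flat_exp P t = (if 0 < t then poly P (1 / t) * exp (- (1 / t)) else 0)"

lemma poly_exp_tendsto_0: "((%u. poly P u * exp (- u)) \<longlongrightarrow> (0::real)) at_top"
proof -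
 have "((%u. \<Sum>i\<le>degree P. coeff P i * (u ^ i / exp u)) \<longlongrightarrow> (\<Sum>i\<le>degree P. coeff P i * 0)) at_top"
  by (intro tendsto_intros tendsto_power_div_exp_0)
 then show ?thesis by (simp add: poly_altdef sum_distrib_right exp_minus divide_inverse mult.assoc)
qed

lemma flat_exp_tendsto_0: "(flat_exp P \<longlongrightarrow> 0) (at 0)"
proof -
 have "((%t. poly P (1 / t) * exp (- (1 / t))) \<longlongrightarrow> 0) (at_right 0)"
  using filterlim_compose[OF poly_exp_tendsto_0 filterlim_inverse_at_top_right, of P]
  by (simp add: inverse_eq_divide)
 then have r: "(flat_exp P \<longlongrightarrow> 0) (at_right 0)"
  by (rule Lim_transform_eventually) (auto simp: eventually_at_filter flat_exp_def)
 have l: "(flat_exp P \<longlongrightarrow> 0) (at_left 0)"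
  by (rule Lim_transform_eventually[of "%x. 0"]) (auto simp: eventually_at_filter flat_exp_def)
 show ?thesis using l r by (simp add: filterlim_split_at)
qed

lemma flat_exp_has_derivative:
 "(flat_exp P has_real_derivative flat_exp ([:0, 0, 1:] * (P - pderiv P)) t) (at t)"
proof -
 consider "t > 0" | "t < 0" | "t = 0" by linarith
 then show ?thesis
 proof cases
  case 1
  have "((%t. poly P (1 / t) * exp (- (1 / t))) has_real_derivative
    flat_exp ([:0, 0, 1:] * (P - pderiv P)) t) (at t)"
   using 1 by (auto intro!: derivative_eq_intros simp: flat_exp_def field_simps power2_eq_square)
  then show ?thesis
   by (rule has_field_derivative_transform_within[OF _ 1]) (use 1 in "auto simp: flat_exp_def dist_real_def")
 next
  case 2
  have "((%t. 0) has_real_derivative flat_exp ([:0, 0, 1:] * (P - pderiv P)) t) (at t)"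
   using 2 by (auto simp: flat_exp_def)
  then show ?thesis
   by (rule has_field_derivative_transform_within[where d = "-t"]) (use 2 in "auto simp: flat_exp_def dist_real_def")
 next
  case 3
  have "((%h. flat_exp (pCons 0 P) h) \<longlongrightarrow> 0) (at 0)" by (rule flat_exp_tendsto_0)
  moreover have "flat_exp (pCons 0 P) h = (flat_exp P (0 + h) - flat_exp P 0) / h" for h
   by (auto simp: flat_exp_def field_simps)
  ultimately show ?thesis unfolding DERIV_def 3 by (simp add: flat_exp_def)
 qed
qed

lemma Cr_flat_exp: "Cr k (flat_exp P)"
proof (induction k arbitrary: P)
 case 0
 show ?case using flat_exp_has_derivative[of P]
  by (auto simp: continuous_on_eq_continuous_within intro: DERIV_isCont)
next
 case (Suc k)
 then show ?case using flat_exp_has_derivative[of P] by auto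
qed

definition bump :: "real => real" where
 "bump t = flat_exp 1 (1 / 4 + t) * flat_exp 1 (1 / 4 - t)"

lemma Cr_bump: "Cr k bump"
 using Cr_mult[OF Cr_affine[OF Cr_flat_exp[of k 1], of 1 "1 / 4"] Cr_affine[OF Cr_flat_exp[of k 1], of "-1" "1 / 4"]]
 unfolding bump_def by (simp add: add.commute)

lemma bump_nonneg: "0 <= bump t" and bump_pos: "\<bar>t\<bar> < 1 / 4 ==> 0 < bump t"
 and bump_eq_0: "1 / 4 <= \<bar>t\<bar> ==> bump t = 0"
 by (auto simp: bump_def flat_exp_def)

lemma bump_integrable: "bump integrable_on {a..b}"
 by (intro integrable_continuous_real continuous_on_subset[OF Cr_continuous[OF Cr_bump[of 0]]]) auto

definition bump_mass :: real where "bump_mass = integral {-1..1} bump"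

lemma bump_mass_pos: "0 < bump_mass"
proof -
 have "bump_mass ~= 0"
 proof
  assume "bump_mass = 0"
  then have "(bump has_integral 0) (cbox (-1) 1)"
   using bump_integrable[of "-1" 1] by (simp add: bump_mass_def has_integral_integrable_integral)
  moreover have "continuous_on (cbox (-1) 1) bump"
   by (rule continuous_on_subset[OF Cr_continuous[OF Cr_bump[of 0]]]) auto
  ultimately have "bump 0 = 0"
   using has_integral_0_cbox_imp_0[of "-1" "1::real" bump 0] bump_nonneg by auto
  then show False using bump_pos[of 0] by simp
 qed
 moreover have "0 <= bump_mass" unfolding bump_mass_def
  by (intro integral_nonneg bump_integrable bump_nonneg)
 ultimately show ?thesis by simp
qed

definition smooth_step :: "real => real" where
 "smooth_step t = integral {-1..t} bump / bump_mass"

lemma smooth_step_low: "t <= - (1 / 4) ==> smooth_step t = 0"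
proof -
 assume t: "t <= - (1 / 4)"
 have "integral {-1..t} bump = integral {-1..t} (%x. 0)"
  by (intro integral_cong bump_eq_0) (use t in auto)
 then show ?thesis by (simp add: smooth_step_def)
qed

lemma smooth_step_high: "1 / 4 <= t ==> smooth_step t = 1"
proof -
 have *: "integral {-1..s} bump = integral {-1..1/4} bump" if "1 / 4 <= s" for s :: real
 proof -
  have "integral {-1..1/4} bump + integral {1/4..s} bump = integral {-1..s} bump"
   by (rule Henstock_Kurzweil_Integration.integral_combine) (use that bump_integrable in auto)
  moreover have "integral {1/4..s} bump = integral {1/4..s} (%x. 0)"
   by (intro integral_cong bump_eq_0) auto
  ultimately show ?thesis by simp
 qed
 assume "1 / 4 <= t"
 then show ?thesis using *[of t] *[of 1] bump_mass_pos by (simp add: smooth_step_def bump_mass_def)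
qed

lemma smooth_step_deriv: "(smooth_step has_real_derivative bump t / bump_mass) (at t)"
proof (cases "t < - (1 / 4)")
 case True
 have "((%t. 0) has_real_derivative bump t / bump_mass) (at t)" using True bump_eq_0[of t] by auto
 then show ?thesis
  by (rule has_field_derivative_transform_within[where d = "-(1/4) - t"]) (use True in "auto simp: smooth_step_low dist_real_def")
next
 case False
 have "((%x. integral {-1..x} bump) has_real_derivative bump t) (at t within {-1..t+1})"
  by (intro integral_has_real_derivative continuous_on_subset[OF Cr_continuous[OF Cr_bump[of 0]]]) (use False in auto)
 then have "((%x. integral {-1..x} bump) has_real_derivative bump t) (at t)"
  using at_within_interior[of t "{-1..t+1}"] False by (auto simp: interior_atLeastAtMost_real)
 then show ?thesis unfolding smooth_step_def by (rule DERIV_cdivide)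
qed

lemma Cr_smooth_step: "Cr k smooth_step"
proof -
 have "Cr (Suc k) smooth_step"
  using smooth_step_deriv Cr_cmult[OF Cr_bump[of k], of "1 / bump_mass"] by (auto intro!: exI[of _ "%t. bump t / bump_mass"])
 then show ?thesis by (rule Cr_Suc_imp_Cr)
qed

text \<open>
  Differences of a smooth step from 0 to 1 telescope, so their integer translates add up to 1; this
  avoids a division.
\<close>

definition theta1 :: "real => real" where
 "theta1 t = smooth_step (t + 1 / 2) - smooth_step (t - 1 / 2)"

lemma Cr_theta1: "Cr k theta1"
 using Cr_add[OF Cr_affine[OF Cr_smooth_step[of k], of 1 "1 / 2"]
   Cr_cmult[OF Cr_affine[OF Cr_smooth_step[of k], of 1 "- (1 / 2)"], of "-1"]]
 by (simp add: theta1_def[abs_def])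

lemma theta1_eq_0: "3 / 4 <= \<bar>t\<bar> ==> theta1 t = 0"
 unfolding theta1_def by (cases "t >= 0") (auto simp: smooth_step_low smooth_step_high abs_if)

lemma sum_theta1: 
 assumes "of_int a <= t - 1" "t + 1 <= of_int b"
 shows "(\<Sum>k\<in>{a..b}. theta1 (t - of_int k)) = 1"
proof -
 have tel: "(\<Sum>k\<in>{a..b}. theta1 (t - of_int k)) = smooth_step (t - of_int a + 1 / 2) - smooth_step (t - of_int b - 1 / 2)"
  if "a <= b" using that
 proof (induction b rule: int_ge_induct)
  case (step b)
  have "{a..b + 1} = insert (b + 1) {a..b}" using step.hyps by auto
  with step show ?case by (simp add: theta1_def algebra_simps)
 qed (simp add: theta1_def)
 have "a <= b" using assms by linarith
 from tel[OF this] show ?thesis using assms by (simp add: smooth_step_low smooth_step_high)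
qed

definition theta :: "nat => int ^ 'n => real ^ 'n::finite => complex" where
 "theta j m x = (\<Prod>i\<in>UNIV. of_real (theta1 (2 ^ j * x $ i - of_int (m $ i))))"

lemma theta_scale:
 "theta j m = (%x. theta 0 0 ((2 ^ j) *\<^sub>R x + (\<chi> i. - of_int (m $ i))))"
 by (simp add: theta_def fun_eq_iff)

lemma Ck_theta0: "Ck k (theta 0 0 :: real ^ 'n::finite => complex)"
proof -
 have "Ck k (%x :: real ^ 'n. \<Prod>i\<in>UNIV. of_real (theta1 (x $ i)) :: complex)"
  by (intro Ck_prod Ck_coordinate Cr_theta1)
 then show ?thesis by (simp add: theta_def[abs_def])
qed

lemma Ck_theta: "Ck k (theta j m)"
 by (subst theta_scale) (intro Ck_affine Ck_theta0)

lemma theta_eq_0: "3 / 4 <= \<bar>2 ^ j * x $ i - of_int (m $ i)\<bar> ==> theta j m x = 0"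
 using theta1_eq_0 unfolding theta_def by (intro prod_zero) auto

lemma mem_dcube_iff: "x \<in> dcube d j m \<longleftrightarrow> (ALL i. \<bar>2 ^ j * x $ i - of_int (m $ i)\<bar> <= d)"
proof -
 have "\<bar>x $ i - of_int (m $ i) / 2 ^ j\<bar> <= d / 2 ^ j \<longleftrightarrow> \<bar>2 ^ j * x $ i - of_int (m $ i)\<bar> <= d" for i
 proof -
  have "2 ^ j * (x $ i - of_int (m $ i) / 2 ^ j) = 2 ^ j * x $ i - of_int (m $ i)"
   by (simp add: right_diff_distrib)
  then have "\<bar>2 ^ j * x $ i - of_int (m $ i)\<bar> = 2 ^ j * \<bar>x $ i - of_int (m $ i) / 2 ^ j\<bar>"
   by (metis abs_mult abs_of_pos zero_less_numeral zero_less_power)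
  then show ?thesis by (simp add: pos_le_divide_eq mult.commute)
 qed
 then show ?thesis by (simp add: dcube_def)
qed

lemma theta_outside_cube: "x ~: dcube (3 / 4) j m ==> theta j m x = 0"
 unfolding mem_dcube_iff by (meson theta_eq_0 less_imp_le not_le)

lemma dcube_mono: "d <= e ==> dcube d j m \<subseteq> dcube e j m"
 unfolding mem_dcube_iff subset_iff by (meson order_trans)

lemma sum_theta:
 fixes x :: "real ^ 'n::finite"
 assumes fin: "finite M" and M: "!!m. theta j m x ~= 0 ==> m \<in> M"
 shows "(\<Sum>m\<in>M. theta j m x) = 1"
proof -
 define I where "I i = {\<lfloor>2 ^ j * x $ i\<rfloor> - 1 .. \<lceil>2 ^ j * x $ i\<rceil> + 1}" for i
 have one: "(\<Sum>k\<in>I i. theta1 (2 ^ j * x $ i - of_int k)) = 1" for i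
  unfolding I_def by (rule sum_theta1) linarith+
 have z: "theta1 (2 ^ j * x $ i - of_int k) = 0" if "k ~: I i" for i k
 proof (rule theta1_eq_0)
  from that have "k < \<lfloor>2 ^ j * x $ i\<rfloor> - 1 \<or> \<lceil>2 ^ j * x $ i\<rceil> + 1 < k" by (auto simp: I_def)
  then show "3 / 4 <= \<bar>2 ^ j * x $ i - of_int k\<bar>" by linarith
 qed
 let ?B = "PiE UNIV I"
 have bij: "bij_betw vec_lambda ?B (vec_lambda ` ?B)"
  by (intro bij_betw_imageI inj_onI) (auto simp: vec_lambda_inject)
 have finB: "finite ?B" by (auto intro!: finite_PiE simp: I_def)
 have out: "theta j m x = 0" if "m ~: vec_lambda ` ?B" for m
 proof -
  have "vec_nth m ~: ?B" using that by (metis image_eqI vec_nth_inverse)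
  then obtain i where "m $ i ~: I i" by auto
  then show ?thesis using z unfolding theta_def by (intro prod_zero) auto
 qed
 have "(\<Sum>m\<in>M. theta j m x) = (\<Sum>m\<in>vec_lambda ` ?B. theta j m x)"
  by (rule sum.mono_neutral_cong) (use fin finB M out in auto)
 also have "... = (\<Sum>g\<in>?B. theta j (vec_lambda g) x)"
  by (rule sum.reindex_bij_betw[OF bij, symmetric])
 also have "... = (\<Sum>g\<in>?B. \<Prod>i\<in>UNIV. complex_of_real (theta1 (2 ^ j * x $ i - of_int (g i))))"
  by (simp add: theta_def)
 also have "... = (\<Prod>i\<in>UNIV. \<Sum>k\<in>I i. complex_of_real (theta1 (2 ^ j * x $ i - of_int k)))"
  by (rule prod_sum_PiE[symmetric]) (auto simp: I_def)
 also have "... = (\<Prod>i\<in>UNIV. complex_of_real (\<Sum>k\<in>I i. theta1 (2 ^ j * x $ i - of_int k)))"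
  by simp
 also have "... = 1" by (simp only: one) simp
 finally show ?thesis .
qed

lemma theta_Ck_bounded:
 obtains M where "0 < M" "!!j m. Ck_bounded K (2 ^ j) M (theta j m :: real ^ 'n::{finite,linorder} => complex)"
proof -
 obtain M where M: "0 < M" "Ck_bounded K 1 M (theta 0 0 :: (real, 'n) vec => complex)"
  by (rule Ck_compact_support_bounded[OF Ck_theta, of "dcube (3 / 4) 0 (0 :: (int, 'n) vec)" 0 0 1 K])
   (auto simp: theta_outside_cube)
 have "Ck_bounded K (2 ^ j) M (theta j m :: (real, 'n) vec => complex)" for j m
  unfolding Ck_bounded_def
 proof (intro conjI allI impI Ck_theta)
  fix "is" :: "'n list" and x assume s: "sorted is" "length is <= K"
  have "cmod (pderivs is (theta j m) x) = (2 ^ j) ^ length is * cmod (pderivs is (theta 0 0) (2 ^ j *\<^sub>R x + (\<chi> i. - of_int (m $ i))))"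
   by (subst theta_scale, subst pderivs_affine[OF Ck_theta0 s(2)]) (simp add: norm_mult norm_power)
  also have "... <= (2 ^ j) ^ length is * (M * 1 ^ length is)"
   using M(2) s by (intro mult_left_mono) (auto simp: Ck_bounded_def)
  finally show "cmod (pderivs is (theta j m) x) <= M * (2 ^ j) ^ length is" by (simp add: mult.commute)
 qed
 with M(1) that show ?thesis by blast
qed


section \<open>Smooth approximation of atoms\<close>

text \<open>Differentiation under the integral sign for a function with continuous partial derivatives.\<close>

lemma has_derivative_parameter_integral:
 fixes F :: "real ^ 'n::finite => real ^ 'n => complex"
 assumes d: "!!x t. ((%x. F x t) has_derivative (%v. \<Sum>i\<in>UNIV. v $ i *\<^sub>R G i x t)) (at x)"
  and cF: "!!x. continuous_on UNIV (F x)"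
  and cG: "!!i. continuous_on UNIV (%(x, t). G i x t)"
 shows "((%x. integral (cbox a b) (F x)) has_derivative
   (%v. \<Sum>i\<in>UNIV. v $ i *\<^sub>R integral (cbox a b) (G i x))) (at x)"
proof -
 define P where "P i = Blinfun (%v :: real ^ 'n. v $ i)" for i
 have P: "blinfun_apply (P i) = (%v. v $ i)" for i
  unfolding P_def by (rule bounded_linear_Blinfun_apply) (rule bounded_linear_vec_nth)
 define fx where "fx x t = (\<Sum>i\<in>UNIV. blinfun_scaleR_left (G i x t) o\<^sub>L P i)" for x t
 have fx: "blinfun_apply (fx x t) = (%v. \<Sum>i\<in>UNIV. v $ i *\<^sub>R G i x t)" for x t
  by (rule ext) (simp add: fx_def blinfun.sum_left P)
 have cont: "continuous_on (UNIV \<times> cbox a b) (%(x, t). fx x t)"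
  unfolding fx_def case_prod_beta'
  using cG[unfolded case_prod_beta']
  by (intro continuous_intros) (auto intro: continuous_on_subset)
 have D: "((%x. integral (cbox a b) (F x)) has_derivative blinfun_apply (integral (cbox a b) (fx x))) (at x within UNIV)"
  by (rule leibniz_rule) (use d cont fx in "auto intro!: integrable_continuous intro: continuous_on_subset[OF cF]")
 have int_fx: "fx x integrable_on cbox a b"
 proof (rule integrable_continuous)
  have "continuous_on (cbox a b) (%t. case (x, t) of (x, t) => fx x t)"
   by (rule continuous_on_compose2[OF cont]) (auto intro: continuous_on_Pair continuous_on_const continuous_on_id)
  then show "continuous_on (cbox a b) (fx x)" by simp
 qed
 have int_G: "G i x integrable_on cbox a b" for i
 proof (rule integrable_continuous)
  have "continuous_on (cbox a b) (%t. case (x, t) of (x, t) => G i x t)"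
   by (rule continuous_on_compose2[OF cG]) (auto intro: continuous_on_Pair continuous_on_const continuous_on_id)
  then show "continuous_on (cbox a b) (G i x)" by simp
 qed
 have "blinfun_apply (integral (cbox a b) (fx x)) v = (\<Sum>i\<in>UNIV. v $ i *\<^sub>R integral (cbox a b) (G i x))" for v
 proof -
  have "blinfun_apply (integral (cbox a b) (fx x)) v = integral (cbox a b) (%t. blinfun_apply (fx x t) v)"
   by (rule blinfun_apply_integral[OF int_fx])
  also have "... = (\<Sum>i\<in>UNIV. integral (cbox a b) (%t. v $ i *\<^sub>R G i x t))"
   unfolding fx by (intro integral_sum integrable_cmul int_G) auto
  finally show ?thesis by simp
 qed
 then have "blinfun_apply (integral (cbox a b) (fx x)) = (%v. \<Sum>i\<in>UNIV. v $ i *\<^sub>R integral (cbox a b) (G i x))"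
  by (rule ext)
 then show ?thesis using D by simp
qed

definition mollify :: "real => (real ^ 'n::finite => complex) => real ^ 'n => complex" where
 "mollify e f w = integral (cbox (\<chi> i. -e) (\<chi> i. e))
   (%y. (\<Prod>i\<in>UNIV. of_real (bump (y $ i / e))) * f (w + y))"

definition kernel :: "real => real ^ 'n::finite => complex" where
 "kernel e y = (\<Prod>i\<in>UNIV. of_real (bump (y $ i / e)))"

lemma Ck_kernel: "Ck k (kernel e)"
 unfolding kernel_def[abs_def]
proof (rule Ck_prod)
 fix i
 have "Cr k (%t. bump (t / e))" using Cr_affine[OF Cr_bump, of k "1 / e" 0] by simp
 then show "Ck k (%y. complex_of_real (bump (y $ i / e)))" by (rule Ck_coordinate)
qed

lemma kernel_eq_0: "0 < e ==> e <= 4 * \<bar>y $ i\<bar> ==> kernel e y = 0"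
proof -
 assume e: "0 < e" "e <= 4 * \<bar>y $ i\<bar>"
 then have "1 / 4 <= \<bar>y $ i / e\<bar>" by (simp add: pos_le_divide_eq)
 then have "bump (y $ i / e) = 0" by (rule bump_eq_0)
 then show ?thesis unfolding kernel_def by (intro prod_zero) auto
qed

lemma kernel_real: "kernel e y = of_real (\<Prod>i\<in>UNIV. bump (y $ i / e))"
 by (simp add: kernel_def)

text \<open>
  The substitution moves the variable into the kernel, so that smoothness no longer depends on the function
  mollified.
\<close>

lemma mollify_eq_convolution:
 fixes f :: "real ^ 'n::finite => complex"
 assumes e: "0 < e" and f: "continuous_on UNIV f" "!!x. x ~: cbox a b ==> f x = 0"
 shows "mollify e f w = integral (cbox a b) (%z. kernel e (z - w) * f z)"
proof -
 let ?u = "\<chi> i. e :: real ^ 'n"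
 let ?g = "%z. kernel e (z - w) * f z"
 have neg: "(\<chi> i. -e) = - ?u" by (simp add: vec_eq_iff)
 have "mollify e f w = integral (cbox (- ?u) ?u) (%y. ?g (y + w))"
  by (simp add: mollify_def kernel_def neg add.commute)
 also have "... = integral (cbox (w - ?u) (w + ?u)) ?g"
  using integral_shift_cbox[of "w - ?u" w "w + ?u" ?g] by simp
 also have "... = integral UNIV (%x. if x \<in> cbox (w - ?u) (w + ?u) then ?g x else 0)"
  by (simp add: integral_restrict_UNIV)
 also have "(%x. if x \<in> cbox (w - ?u) (w + ?u) then ?g x else 0) = (%x. if x \<in> cbox a b then ?g x else 0)"
 proof -
  have "kernel e (x - w) = 0" if x: "x ~: cbox (w - ?u) (w + ?u)" for x
  proof -
   obtain i where "\<not> (w $ i - e <= x $ i & x $ i <= w $ i + e)" using x by (auto simp: mem_box_cart)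
   then have "e <= 4 * \<bar>(x - w) $ i\<bar>" using e by (auto simp: abs_if)
   then show ?thesis using kernel_eq_0[OF e] by blast
  qed
  then show ?thesis using f(2) by fastforce
 qed
 also have "integral UNIV ... = integral (cbox a b) ?g"
  by (simp add: integral_restrict_UNIV)
 finally show ?thesis .
qed

lemma Ck_convolution:
 fixes f :: "real ^ 'n::finite => complex"
 assumes f: "continuous_on UNIV f" and k: "!!k. Ck k \<kappa>"
 shows "Ck k (%w. integral (cbox a b) (%z. \<kappa> (z - w) * f z))"
 using k
proof (induction k arbitrary: \<kappa>)
 have D: "((%w. integral (cbox a b) (%z. \<kappa> (z - w) * f z)) has_derivative
   (%v. \<Sum>i\<in>UNIV. v $ i *\<^sub>R integral (cbox a b) (%z. - partial_deriv i \<kappa> (z - w) * f z))) (at w)"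
  if \<kappa>: "!!k. Ck k \<kappa>" for \<kappa> w
 proof (rule has_derivative_parameter_integral)
  have dk: "\<kappa> differentiable (at y)" for y using \<kappa>[of 1] by simp
  have cpk: "continuous_on UNIV (partial_deriv i \<kappa>)" for i using \<kappa>[of 1] by simp
  fix w z
  have "((%w. \<kappa> (z - w)) has_derivative (%v. \<Sum>i\<in>UNIV. (0 - v) $ i *\<^sub>R partial_deriv i \<kappa> (z - w))) (at w)"
   by (rule has_derivative_compose[of "%w. z - w", OF _ has_derivative_partials[OF dk]])
     (auto intro!: derivative_eq_intros)
  then have "((%w. \<kappa> (z - w) * f z) has_derivative (%v. (\<Sum>i\<in>UNIV. (0 - v) $ i *\<^sub>R partial_deriv i \<kappa> (z - w)) * f z)) (at w)"
   by (rule has_derivative_mult_left)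
  then show "((%w. \<kappa> (z - w) * f z) has_derivative (%v. \<Sum>i\<in>UNIV. v $ i *\<^sub>R (- partial_deriv i \<kappa> (z - w) * f z))) (at w)"
   by (simp add: sum_distrib_right)
  have "continuous_on UNIV (%z. \<kappa> (z - w))" for w
   by (rule continuous_on_compose2[OF Ck_continuous[OF \<kappa>[of 0]]]) (auto intro!: continuous_intros)
  then show "continuous_on UNIV (%z. \<kappa> (z - w) * f z)" for w
   by (intro continuous_intros f)
  have "continuous_on UNIV (%x. partial_deriv i \<kappa> (snd x - fst x))" for i
   by (rule continuous_on_compose2[OF cpk]) (auto intro!: continuous_intros)
  moreover have "continuous_on UNIV (%x. f (snd x))"
   by (rule continuous_on_compose2[OF f]) (auto intro!: continuous_intros)
  ultimately show "continuous_on UNIV (%(x, t). - partial_deriv i \<kappa> (t - x) * f t)" for i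
   unfolding case_prod_beta' by (intro continuous_intros)
 qed
 have P: "partial_deriv i (%w. integral (cbox a b) (%z. \<kappa> (z - w) * f z)) =
    (%w. (-1) * integral (cbox a b) (%z. partial_deriv i \<kappa> (z - w) * f z))"
  if \<kappa>: "!!k. Ck k \<kappa>" for \<kappa> i
 proof
  fix w
  show "partial_deriv i (%w. integral (cbox a b) (%z. \<kappa> (z - w) * f z)) w =
    (-1) * integral (cbox a b) (%z. partial_deriv i \<kappa> (z - w) * f z)"
   using partial_deriv_eq[OF D[OF \<kappa>, of w], of i] 
   by (simp add: axis_def sum_negf if_distrib[of "%c. c *\<^sub>R _"] cong: if_cong)
 qed
 {
  case 0
  then show ?case using D[of \<kappa>]
   by (auto simp: continuous_on_eq_continuous_within intro: has_derivative_continuous)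
 next
  case (Suc k)
  have "Ck k (partial_deriv i \<kappa>)" for k i using Suc.prems[of "Suc k"] by simp
  then have "Ck k (%w. (-1) * integral (cbox a b) (%z. partial_deriv i \<kappa> (z - w) * f z))" for i
   by (intro Ck_cmult Suc.IH)
  moreover have "(%w. integral (cbox a b) (%z. \<kappa> (z - w) * f z)) differentiable (at w)" for w
   using D[of \<kappa>] Suc.prems differentiable_def by blast
  ultimately show ?case unfolding Ck.simps P[OF Suc.prems] by blast
 }
qed

lemma Ck_mollify:
 fixes f :: "real ^ 'n::finite => complex"
 assumes "0 < e" "continuous_on UNIV f" "!!x. x ~: cbox a b ==> f x = 0"
 shows "Ck k (mollify e f)"
proof -
 have "mollify e f = (%w. integral (cbox a b) (%z. kernel e (z - w) * f z))"
  using mollify_eq_convolution[OF assms] by blast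
 then show ?thesis using Ck_convolution[OF assms(2) Ck_kernel] by simp
qed

lemma partial_deriv_mollify:
 fixes f :: "real ^ 'n::finite => complex"
 assumes f: "Ck 1 f"
 shows "partial_deriv i (mollify e f) = mollify e (partial_deriv i f)"
proof
 fix w
 have df: "f differentiable (at y)" for y using f by simp
 have cpf: "continuous_on UNIV (partial_deriv i f)" for i using f by simp
 have cf: "continuous_on UNIV f" using Ck_continuous f by blast
 have ck: "continuous_on UNIV (kernel e)" using Ck_continuous[OF Ck_kernel] .
 have D: "((%w. integral (cbox (\<chi> i. -e) (\<chi> i. e)) (%y. kernel e y * f (w + y))) has_derivative
   (%v. \<Sum>i\<in>UNIV. v $ i *\<^sub>R integral (cbox (\<chi> i. -e) (\<chi> i. e)) (%y. kernel e y * partial_deriv i f (w + y)))) (at w)"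
 proof (rule has_derivative_parameter_integral)
  fix w y
  have "((%w. f (w + y)) has_derivative (%v. \<Sum>i\<in>UNIV. v $ i *\<^sub>R partial_deriv i f (w + y))) (at w)"
   by (rule has_derivative_compose[of "%w. w + y", OF _ has_derivative_partials[OF df]])
     (auto intro!: derivative_eq_intros)
  then have "((%w. kernel e y * f (w + y)) has_derivative (%v. kernel e y * (\<Sum>i\<in>UNIV. v $ i *\<^sub>R partial_deriv i f (w + y)))) (at w)"
   by (rule has_derivative_mult_right)
  then show "((%w. kernel e y * f (w + y)) has_derivative (%v. \<Sum>i\<in>UNIV. v $ i *\<^sub>R (kernel e y * partial_deriv i f (w + y)))) (at w)"
   by (simp add: sum_distrib_left)
  have "continuous_on UNIV (%y. f (w + y))" for w
   by (rule continuous_on_compose2[OF cf]) (auto intro!: continuous_intros)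
  then show "continuous_on UNIV (%y. kernel e y * f (w + y))" for w
   by (intro continuous_intros ck)
  have "continuous_on UNIV (%x. partial_deriv i f (fst x + snd x))" for i
   by (rule continuous_on_compose2[OF cpf]) (auto intro!: continuous_intros)
  moreover have "continuous_on UNIV (%x. kernel e (snd x))"
   by (rule continuous_on_compose2[OF ck]) (auto intro!: continuous_intros)
  ultimately show "continuous_on UNIV (%(x, t). kernel e t * partial_deriv i f (x + t))" for i
   unfolding case_prod_beta' by (intro continuous_intros)
 qed
 then show "partial_deriv i (mollify e f) w = mollify e (partial_deriv i f) w"
  using partial_deriv_eq[OF D, of i] unfolding mollify_def[abs_def] kernel_def[symmetric]
  by (simp add: axis_def if_distrib[of "%c. c *\<^sub>R _"] cong: if_cong)
qed

lemma pderivs_mollify: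
 "Ck k f ==> length is <= k ==> pderivs is (mollify e f) = mollify e (pderivs is f)"
proof (induction "is")
 case (Cons i "is")
 then have "Ck (k - length is) (pderivs is f)" by (intro Ck_pderivs) auto
 then have "Ck 1 (pderivs is f)" by (rule Ck_le) (use Cons.prems in auto)
 with Cons show ?case by (simp add: partial_deriv_mollify del: One_nat_def)
qed simp

lemma uniformly_continuous_compact_support:
 fixes f :: "real ^ 'n::finite => complex"
 assumes f: "continuous_on UNIV f" and S: "bounded S" "!!x. x ~: S ==> f x = 0" and e: "0 < e"
 shows "\<exists>dlt>0. ALL x y. norm (x - y) < dlt --> cmod (f x - f y) < e"
proof -
 obtain B where B: "!!x. x \<in> S ==> norm x <= B" using S(1) bounded_iff by metis
 have "uniformly_continuous_on (cball 0 (B + 1)) f"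
  by (intro compact_uniformly_continuous continuous_on_subset[OF f]) auto
 then obtain dlt where dlt: "0 < dlt"
  "!!x y. x \<in> cball 0 (B + 1) ==> y \<in> cball 0 (B + 1) ==> dist y x < dlt ==> dist (f y) (f x) < e"
  using e unfolding uniformly_continuous_on_def by meson
 have "cmod (f x - f y) < e" if d: "norm (x - y) < min dlt 1" for x y
 proof (cases "x \<in> S \<or> y \<in> S")
  case True
  then have "norm x <= B + 1" "norm y <= B + 1"
   using B[of x] B[of y] d norm_triangle_ineq2[of x y] norm_triangle_ineq2[of y x]
   by (auto simp: norm_minus_commute)
  then show ?thesis using dlt(2)[of y x] d by (simp add: dist_norm)
 next
  case False
  then show ?thesis using S(2) e by simp
 qed
 then show ?thesis using dlt(1) by (intro exI[of _ "min dlt 1"]) simp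
qed

definition kernel_mass :: "'n::finite itself => real => real" where
 "kernel_mass _ e = integral (cbox (\<chi> i. -e) (\<chi> i. e)) (%y :: real ^ 'n. \<Prod>i\<in>UNIV. bump (y $ i / e))"

lemma continuous_real_kernel: "continuous_on UNIV (%y :: real ^ 'n::finite. \<Prod>i\<in>UNIV. bump (y $ i / e))"
proof -
 have "continuous_on UNIV (%y :: real ^ 'n. Re (kernel e y))"
  by (intro continuous_intros Ck_continuous[OF Ck_kernel])
 then show ?thesis by (simp only: kernel_real Re_complex_of_real)
qed

lemma kernel_mass_pos:
 assumes e: "0 < e"
 shows "0 < kernel_mass TYPE('n::finite) e"
proof -
 let ?B = "cbox (\<chi> i. -e) (\<chi> i. e) :: (real ^ 'n) set"
 let ?k = "%y :: real ^ 'n. \<Prod>i\<in>UNIV. bump (y $ i / e)"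
 have c: "continuous_on ?B ?k" by (rule continuous_on_subset[OF continuous_real_kernel]) simp
 have i: "?k integrable_on ?B" by (rule integrable_continuous[OF c])
 have nn: "0 <= ?k y" for y by (intro prod_nonneg) (auto simp: bump_nonneg)
 have "integral ?B ?k ~= 0"
 proof
  assume "integral ?B ?k = 0"
  then have hi: "(?k has_integral 0) ?B" using i by (simp add: has_integral_integrable_integral)
  have "box (\<chi> i. -e) (\<chi> i. e) ~= ({} :: (real ^ 'n) set)"
   using e by (auto simp: box_ne_empty Basis_vec_def inner_axis)
  moreover have "(0 :: real ^ 'n) \<in> ?B" using e by (simp add: mem_box_cart)
  ultimately have "?k 0 = 0"
   using has_integral_0_cbox_imp_0[OF c _ hi, of 0] nn by auto
  then show False using bump_pos[of 0] by simp
 qed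
 moreover have "0 <= integral ?B ?k" by (rule integral_nonneg[OF i]) (use nn in auto)
 ultimately show ?thesis by (simp add: kernel_mass_def)
qed

lemma mollify_close:
 fixes f :: "real ^ 'n::finite => complex"
 assumes e: "0 < e" and f: "continuous_on UNIV f"
  and close: "!!y. (!!i. \<bar>y $ i\<bar> <= e) ==> cmod (f w - f (w + y)) <= eps"
 shows "cmod (f w - of_real (1 / kernel_mass TYPE('n) e) * mollify e f w) <= eps"
proof -
 let ?B = "cbox (\<chi> i. -e) (\<chi> i. e) :: (real ^ 'n) set"
 let ?k = "%y :: real ^ 'n. \<Prod>i\<in>UNIV. bump (y $ i / e)"
 let ?m = "kernel_mass TYPE('n) e"
 have m: "0 < ?m" using kernel_mass_pos[OF e] .
 have nn: "0 <= ?k y" for y by (intro prod_nonneg) (auto simp: bump_nonneg)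
 have ck: "continuous_on ?B ?k" by (rule continuous_on_subset[OF continuous_real_kernel]) simp
 have i: "?k integrable_on ?B" by (rule integrable_continuous[OF ck])
 have cf: "continuous_on ?B (%y. f (w + y))"
  by (rule continuous_on_compose2[OF f]) (auto intro!: continuous_intros)
 have i2: "(%y. of_real (?k y) * f (w + y)) integrable_on ?B"
  by (intro integrable_continuous continuous_intros cf continuous_on_of_real ck)
 have i1: "(%y. of_real (?k y) * f w) integrable_on ?B"
  by (intro integrable_continuous continuous_intros continuous_on_of_real ck)
 have "integral ?B (%y. of_real (?k y) * f w) = of_real (integral ?B ?k) * f w"
 proof -
  have "((%y. of_real (?k y) * f w) has_integral of_real (integral ?B ?k) * f w) ?B"
   by (intro has_integral_mult_left has_integral_of_real integrable_integral i)
  then show ?thesis by (rule integral_unique)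
 qed
 then have "integral ?B (%y. of_real (?k y) * f w) = of_real ?m * f w"
  by (simp only: kernel_mass_def)
 note 1 = this[symmetric]
 have 2: "mollify e f w = integral ?B (%y. of_real (?k y) * f (w + y))"
  by (simp add: mollify_def)
 have "of_real ?m * f w - mollify e f w = integral ?B (%y. of_real (?k y) * f w - of_real (?k y) * f (w + y))"
  unfolding 1 2 by (rule integral_diff[symmetric]) (fact i1 i2)+
 also have "cmod ... <= integral ?B (%y. ?k y * eps)"
 proof (rule integral_norm_bound_integral)
  show "(%y. of_real (?k y) * f w - of_real (?k y) * f (w + y)) integrable_on ?B"
   by (intro integrable_diff i1 i2)
  show "(%y. ?k y * eps) integrable_on ?B" using i by (rule integrable_on_mult_left)
  fix y assume "y \<in> ?B"
  then have "cmod (f w - f (w + y)) <= eps" by (intro close) (auto simp: mem_box_cart abs_le_iff minus_le_iff)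
  then have "?k y * cmod (f w - f (w + y)) <= ?k y * eps" by (intro mult_left_mono nn)
  moreover have "cmod (of_real (?k y) * f w - of_real (?k y) * f (w + y)) = ?k y * cmod (f w - f (w + y))"
   using nn[of y] by (simp only: right_diff_distrib[symmetric] norm_mult norm_of_real abs_of_nonneg)
  ultimately show "cmod (of_real (?k y) * f w - of_real (?k y) * f (w + y)) <= ?k y * eps" by simp
 qed
 also have "... = ?m * eps" by (simp add: kernel_mass_def)
 finally have "cmod (of_real ?m * f w - mollify e f w) <= ?m * eps" .
 moreover have "of_real ?m * f w - mollify e f w = of_real ?m * (f w - of_real (1 / ?m) * mollify e f w)"
  using m by (simp add: right_diff_distrib)
 ultimately have "?m * cmod (f w - of_real (1 / ?m) * mollify e f w) <= ?m * eps"
  using m by (simp only: norm_mult norm_of_real abs_of_pos)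
 then show ?thesis using m by simp
qed

lemma finite_lists_le: "finite {is :: 'n::finite list. length is <= K}"
 using finite_lists_length_le[of "UNIV :: 'n set" K] by simp

lemma smooth_approximation:
 fixes f :: "real ^ 'n::finite => complex"
 assumes f: "Ck K f" and supp: "!!x. x ~: cbox a b ==> f x = 0" and eps: "0 < eps" and rho: "0 < rho"
 shows "\<exists>phi. (ALL k. Ck k phi) & (ALL x. x ~: cbox (\<chi> i. a $ i - rho) (\<chi> i. b $ i + rho) --> phi x = 0) \<and>
  (ALL is x. length is <= K --> cmod (pderivs is (%x. f x - phi x) x) <= eps)"
proof -
 have z: "pderivs is f x = 0" if "x ~: cbox a b" for "is" x
  by (rule pderivs_eq_0_on_open[of "- cbox a b"]) (use that supp closed_cbox in auto)
 have "\<exists>dlt>0. ALL x y. norm (x - y) < dlt --> cmod (pderivs is f x - pderivs is f y) < eps"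
  if l: "length is <= K" for "is"
  by (rule uniformly_continuous_compact_support[OF continuous_pderivs[OF f l] bounded_cbox z eps])
 then obtain \<Delta> where \<Delta>: "!!is. length is <= K ==> 0 < \<Delta> is"
  "!!is x y. length is <= K ==> norm (x - y) < \<Delta> is ==> cmod (pderivs is f x - pderivs is f y) < eps"
  by metis
 let ?L = "{is :: 'n list. length is <= K}"
 define dlt where "dlt = Min (\<Delta> ` ?L)"
 have ne: "?L ~= {}" by (auto intro: exI[of _ "[]"])
 have dlt: "0 < dlt" "!!is. is \<in> ?L ==> dlt <= \<Delta> is"
  unfolding dlt_def using finite_lists_le[of K, where 'n='n] ne \<Delta>(1) by (auto simp: Min_gr_iff)
 define e where "e = min rho (dlt / (2 * real CARD('n)))"
 have e: "0 < e" "e <= rho" using rho dlt(1) by (auto simp: e_def)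
 have small: "norm y < dlt" if "!!i. \<bar>y $ i\<bar> <= e" for y :: "real ^ 'n"
 proof -
  have "norm y <= (\<Sum>i\<in>UNIV. \<bar>y $ i\<bar>)" by (rule norm_le_l1_cart)
  also have "... <= (\<Sum>i\<in>(UNIV :: 'n set). e)" by (intro sum_mono that)
  also have "... = real CARD('n) * e" by simp
  also have "... <= real CARD('n) * (dlt / (2 * real CARD('n)))" by (intro mult_left_mono) (auto simp: e_def)
  also have "... = dlt / 2" by simp
  finally show ?thesis using dlt(1) by simp
 qed
 define c :: complex where "c = of_real (1 / kernel_mass TYPE('n) e)"
 define phi where "phi = (%x. c * mollify e f x)"
 have cf: "continuous_on UNIV f" using Ck_continuous f by blast
 have ckm: "Ck k (mollify e f)" for k using Ck_mollify[OF e(1) cf supp] by blast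
 show ?thesis
 proof (intro exI[of _ phi] conjI allI impI)
  show "Ck k phi" for k unfolding phi_def by (intro Ck_cmult ckm)
  show "phi x = 0" if x: "x ~: cbox (\<chi> i. a $ i - rho) (\<chi> i. b $ i + rho)" for x
  proof -
   have "f (x + y) = 0" if y: "y \<in> cbox (\<chi> i. -e) (\<chi> i. e)" for y
   proof (rule supp)
    obtain i where i: "\<not> (a $ i - rho <= x $ i & x $ i <= b $ i + rho)" using x by (auto simp: mem_box_cart)
    have "- e <= y $ i" "y $ i <= e" using y by (auto simp: mem_box_cart)
    then have "\<not> (a $ i <= (x + y) $ i & (x + y) $ i <= b $ i)" using i e(2) by auto
    then show "x + y ~: cbox a b" unfolding mem_box_cart by blast
   qed
   then have "mollify e f x = integral (cbox (\<chi> i. -e) (\<chi> i. e)) (%y :: real ^ 'n. 0)"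
    unfolding mollify_def by (intro integral_cong) simp
   then show ?thesis by (simp add: phi_def)
  qed
  fix "is" :: "'n list" and x assume l: "length is <= K"
  have "pderivs is (%x. f x - phi x) x = pderivs is f x - c * mollify e (pderivs is f) x"
   unfolding phi_def pderivs_diff[OF f Ck_cmult[OF ckm] l] pderivs_cmult[OF ckm l] pderivs_mollify[OF f l] ..
  also have "cmod ... <= eps"
   unfolding c_def
  proof (rule mollify_close[OF e(1) continuous_pderivs[OF f l]])
   fix y :: "real ^ 'n" assume "!!i. \<bar>y $ i\<bar> <= e"
   then have "norm y < dlt" by (rule small)
   then have "norm (x - (x + y)) < \<Delta> is" using dlt(2)[of "is"] l by simp
   then show "cmod (pderivs is f x - pderivs is f (x + y)) <= eps" using \<Delta>(2)[OF l] by fastforce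
  qed
  finally show "cmod (pderivs is (%x. f x - phi x) x) <= eps" .
 qed
qed

text \<open>
  An atom may fill the whole cube that it is allowed to live on. It is therefore first contracted
  slightly towards the centre of the cube, which makes room for the mollifier.
\<close>

lemma atom_smooth_approximation:
 fixes a :: "real ^ 'n::{finite,linorder} => complex"
 assumes a: "is_atom d K j m a" and d: "0 < d" and eps: "0 < eps"
 obtains phi where "!!k. Ck k phi" "!!x. x ~: dcube d j m ==> phi x = 0"
  "Ck_bounded K (2 ^ j) eps (%x. a x - phi x)"
proof -
 have ck: "Ck K a" using a by (simp add: is_atom_iff Ck_bounded_def)
 have supp: "a x = 0" if "x ~: dcube d j m" for x using atom_eq_0[OF a that] .
 have z: "pderivs is a x = 0" if "x ~: dcube d j m" for "is" x
  by (rule pderivs_eq_0_on_open[of "- dcube d j m"]) (use that supp in auto)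
 define c :: "(real, 'n) vec" where "c = (\<chi> i. of_int (m $ i) / 2 ^ j)"
 have cube_t: "t *\<^sub>R x + (1 - t) *\<^sub>R c \<in> dcube d j m \<longleftrightarrow> (ALL i. \<bar>t * (2 ^ j * x $ i - of_int (m $ i))\<bar> <= d)" for t x
  by (simp add: mem_dcube_iff c_def algebra_simps)
 have mid: "t *\<^sub>R x + (1 - t) *\<^sub>R c ~: dcube d j m" if t: "1 <= t" and x: "x ~: dcube d j m" for t x
 proof -
  obtain i where i: "d < \<bar>2 ^ j * x $ i - of_int (m $ i)\<bar>" using x by (auto simp: mem_dcube_iff not_le)
  also have "... <= \<bar>t * (2 ^ j * x $ i - of_int (m $ i))\<bar>"
   using t by (simp add: abs_mult mult_le_cancel_right1)
  finally show ?thesis unfolding cube_t by (auto simp: not_le intro!: exI[of _ i])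
 qed
 obtain B where B: "!!x. x \<in> dcube d j m ==> norm (x - c) <= B" and Bpos: "0 < B"
 proof -
  have "bounded ((%x. x - c) ` dcube d j m)"
   by (intro compact_imp_bounded compact_continuous_image continuous_intros compact_dcube)
  then show ?thesis using that unfolding bounded_pos by fast
 qed
 have ev: "\<forall>\<^sub>F t in at_right 1. ALL x. cmod (pderivs is a x - of_real t ^ length is * pderivs is a (t *\<^sub>R x + (1 - t) *\<^sub>R c)) <= eps / 2"
  if l: "length is <= K" for "is"
 proof -
  have cp: "continuous_on UNIV (pderivs is a)" using continuous_pderivs[OF ck l] .
  have "compact (pderivs is a ` dcube d j m)"
   by (intro compact_continuous_image continuous_on_subset[OF cp]) auto
  then obtain M where M: "0 < M" "!!x. x \<in> dcube d j m ==> cmod (pderivs is a x) <= M"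
   using compact_imp_bounded bounded_pos by (metis imageI)
  have M': "cmod (pderivs is a x) <= M" for x
   using M z[of x] by (cases "x \<in> dcube d j m") (auto simp: less_imp_le)
  obtain dlt where dlt: "0 < dlt" "!!x y. norm (x - y) < dlt ==> cmod (pderivs is a x - pderivs is a y) < eps / 4"
   using uniformly_continuous_compact_support[OF cp compact_imp_bounded[OF compact_dcube[of d j m]] z, of "eps / 4"] eps
   by auto
  have "((%t::real. \<bar>t ^ length is - 1\<bar> * M) \<longlongrightarrow> \<bar>1 ^ length is - 1\<bar> * M) (at_right 1)"
   by (intro tendsto_intros)
  then have "\<forall>\<^sub>F t in at_right 1. \<bar>t ^ length is - 1\<bar> * M < eps / 4"
   by (rule order_tendstoD(2)) (use eps in simp)
  moreover have "((%t::real. (t - 1) * B) \<longlongrightarrow> (1 - 1) * B) (at_right 1)" by (intro tendsto_intros)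
  then have "\<forall>\<^sub>F t in at_right 1. (t - 1) * B < dlt"
   by (rule order_tendstoD(2)) (use dlt in simp)
  moreover have "\<forall>\<^sub>F t in at_right (1::real). 1 < t" by (simp add: eventually_at_filter)
  ultimately show ?thesis
  proof eventually_elim
   case (elim t)
   show ?case
   proof
    fix x
    let ?y = "t *\<^sub>R x + (1 - t) *\<^sub>R c"
    show "cmod (pderivs is a x - of_real t ^ length is * pderivs is a ?y) <= eps / 2"
    proof (cases "x \<in> dcube d j m")
     case True
     have "x - ?y = (1 - t) *\<^sub>R (x - c)" by (simp add: algebra_simps)
     then have "norm (x - ?y) = (t - 1) * norm (x - c)" using elim by simp
     also have "... <= (t - 1) * B" using elim B[OF True] by (intro mult_left_mono) auto
     finally have 1: "cmod (pderivs is a x - pderivs is a ?y) < eps / 4" using elim by (intro dlt) simp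
     have "pderivs is a ?y - of_real t ^ length is * pderivs is a ?y = of_real (1 - t ^ length is) * pderivs is a ?y"
      by (simp add: algebra_simps)
     then have "cmod (pderivs is a ?y - of_real t ^ length is * pderivs is a ?y) = \<bar>t ^ length is - 1\<bar> * cmod (pderivs is a ?y)"
      by (simp only: norm_mult norm_of_real abs_minus_commute)
     also have "... <= \<bar>t ^ length is - 1\<bar> * M" by (intro mult_left_mono M') auto
     finally have 2: "cmod (pderivs is a ?y - of_real t ^ length is * pderivs is a ?y) < eps / 4" using elim by simp
     show ?thesis
      using norm_triangle_ineq[of "pderivs is a x - pderivs is a ?y" "pderivs is a ?y - of_real t ^ length is * pderivs is a ?y"] 1 2
      by simp
    next
     case False
     then show ?thesis using z[OF False] z[OF mid[of t x]] elim eps by simp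
    qed
   qed
  qed
 qed
 have "\<forall>\<^sub>F t in at_right 1. \<forall>is\<in>{is :: 'n list. length is <= K}. ALL x. cmod (pderivs is a x - of_real t ^ length is * pderivs is a (t *\<^sub>R x + (1 - t) *\<^sub>R c)) <= eps / 2"
  using ev by (intro eventually_ball_finite finite_lists_le) auto
 moreover have "\<forall>\<^sub>F t in at_right (1::real). 1 < t" by (simp add: eventually_at_filter)
 ultimately obtain t where t: "1 < t"
  "!!is x. length is <= K ==> cmod (pderivs is a x - of_real t ^ length is * pderivs is a (t *\<^sub>R x + (1 - t) *\<^sub>R c)) <= eps / 2"
  using eventually_happens'[OF trivial_limit_at_right_real, OF eventually_conj] by (metis (no_types, lifting) mem_Collect_eq)
 define b where "b = (%x. a (t *\<^sub>R x + (1 - t) *\<^sub>R c))"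
 have ckb: "Ck K b" unfolding b_def by (rule Ck_affine[OF ck])
 have suppb: "b x = 0" if x: "x ~: dcube (d / t) j m" for x
 proof -
  obtain i where "d / t < \<bar>2 ^ j * x $ i - of_int (m $ i)\<bar>" using x by (auto simp: mem_dcube_iff not_le)
  then have "d < t * \<bar>2 ^ j * x $ i - of_int (m $ i)\<bar>" using t(1) by (simp add: pos_divide_less_eq mult.commute)
  also have "... = \<bar>t * (2 ^ j * x $ i - of_int (m $ i))\<bar>" using t(1) by (simp add: abs_mult)
  finally have "d < \<bar>t * (2 ^ j * x $ i - of_int (m $ i))\<bar>" .
  then have "t *\<^sub>R x + (1 - t) *\<^sub>R c ~: dcube d j m" unfolding cube_t by (auto simp: not_le intro!: exI[of _ i])
  then show ?thesis unfolding b_def by (rule supp)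
 qed
 define rho where "rho = (d - d / t) / 2 ^ j"
 have rho: "0 < rho" using d t(1) by (auto simp: rho_def field_simps)
 obtain phi where phi: "!!k. Ck k phi"
  "!!x. x ~: cbox (\<chi> i. (\<chi> i. of_int (m $ i) / 2 ^ j - (d / t) / 2 ^ j) $ i - rho) (\<chi> i. (\<chi> i. of_int (m $ i) / 2 ^ j + (d / t) / 2 ^ j) $ i + rho) ==> phi x = 0"
  "!!is x. length is <= K ==> cmod (pderivs is (%x. b x - phi x) x) <= eps / 2"
  using smooth_approximation[OF ckb suppb[unfolded dcube_eq_cbox] half_gt_zero[OF eps] rho] by blast
 have "cbox (\<chi> i. (\<chi> i. of_int (m $ i) / 2 ^ j - (d / t) / 2 ^ j) $ i - rho) (\<chi> i. (\<chi> i. of_int (m $ i) / 2 ^ j + (d / t) / 2 ^ j) $ i + rho) = dcube d j m"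
  by (simp add: dcube_eq_cbox rho_def diff_divide_distrib)
 with phi(2) have suppphi: "phi x = 0" if "x ~: dcube d j m" for x using that by simp
 show ?thesis
 proof (rule that[OF phi(1) suppphi])
  show "Ck_bounded K (2 ^ j) eps (%x. a x - phi x)"
   unfolding Ck_bounded_def
  proof (intro conjI allI impI)
   show "Ck K (%x. a x - phi x)" by (intro Ck_diff ck phi(1))
   fix "is" :: "'n list" and x assume l: "length is <= K"
   have "pderivs is (%x. a x - phi x) x = (pderivs is a x - pderivs is b x) + pderivs is (%x. b x - phi x) x"
    unfolding pderivs_diff[OF ck phi(1) l] pderivs_diff[OF ckb phi(1) l] by simp
   also have "pderivs is b x = of_real t ^ length is * pderivs is a (t *\<^sub>R x + (1 - t) *\<^sub>R c)"
    unfolding b_def pderivs_affine[OF ck l] ..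
   finally have "cmod (pderivs is (%x. a x - phi x) x) <= eps / 2 + eps / 2"
    by (simp only: norm_triangle_mono[OF t(2)[OF l] phi(3)[OF l]])
   also have "... <= eps * (2 ^ j) ^ length is" using eps by simp
   finally show "cmod (pderivs is (%x. a x - phi x) x) <= eps * (2 ^ j) ^ length is" .
  qed
 qed
qed


section \<open>Hausdorff measure\<close>

definition hausdorff_pre :: "nat => real => 'a::metric_space set => ennreal" where
 "hausdorff_pre k dlt A = Inf {(\<Sum>i. ennreal (unit_ball_vol (real k) * (diameter (U i) / 2) ^ k)) | U :: nat => 'a set.
    A \<subseteq> (\<Union>i. U i) & (ALL i. bounded (U i) & diameter (U i) <= dlt)}"

lemma hausdorff_outer_eq: "hausdorff_outer k A = (SUP dlt\<in>{0<..}. hausdorff_pre k dlt A)"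
 by (simp add: hausdorff_outer_def hausdorff_pre_def)

lemma hausdorff_pre_le:
 assumes "A \<subseteq> (\<Union>i. U i)" "!!i. bounded (U i)" "!!i. diameter (U i) <= dlt"
 shows "hausdorff_pre k dlt A <= (\<Sum>i. ennreal (unit_ball_vol (real k) * (diameter (U i) / 2) ^ k))"
 unfolding hausdorff_pre_def by (rule Inf_lower) (use assms in blast)

lemma hausdorff_pre_less:
 assumes "hausdorff_pre k dlt A < y"
 shows "EX U. A \<subseteq> (\<Union>i. U i) & (ALL i. bounded (U i) & diameter (U i) <= dlt) \<and>
  (\<Sum>i. ennreal (unit_ball_vol (real k) * (diameter (U i) / 2) ^ k)) < y"
 using assms unfolding hausdorff_pre_def Inf_less_iff by blast

lemma hausdorff_pre_antimono: "dlt <= eps ==> hausdorff_pre k eps A <= hausdorff_pre k dlt A"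
 unfolding hausdorff_pre_def by (rule Inf_superset_mono) (blast intro: order_trans)

lemma hausdorff_pre_le_outer: "0 < dlt ==> hausdorff_pre k dlt A <= hausdorff_outer k A"
 unfolding hausdorff_outer_eq by (intro SUP_upper) simp

lemma hausdorff_outer_mono: "A \<subseteq> B ==> hausdorff_outer k A <= hausdorff_outer k B"
 unfolding hausdorff_outer_eq hausdorff_pre_def
 by (intro SUP_mono' Inf_superset_mono) blast

lemma hausdorff_outer_empty:
 assumes "k ~= 0" shows "hausdorff_outer k {} = 0"
proof -
 have "hausdorff_pre k dlt {} <= 0" if "0 < dlt" for dlt
  using hausdorff_pre_le[of "{}" "%i. {}" dlt k] that assms by (simp add: power_0_left)
 then show ?thesis unfolding hausdorff_outer_eq by (intro antisym SUP_least) auto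
qed

lemma hausdorff_pre_countable_subadditive:
 "hausdorff_pre k dlt (\<Union>i. A i) <= (\<Sum>i. hausdorff_pre k dlt (A i :: 'a::metric_space set))"
proof (rule ennreal_le_epsilon)
 fix e :: real
 assume fin: "(\<Sum>i. hausdorff_pre k dlt (A i)) < top" and e: "0 < e"
 let ?w = "%U. ennreal (unit_ball_vol (real k) * (diameter (U :: 'a set) / 2) ^ k)"
 have fin_i: "hausdorff_pre k dlt (A i) < top" for i
  using fin ennreal_suminf_lessD by blast
 have "EX U. A i \<subseteq> (\<Union>j. U j) & (ALL j. bounded (U j) & diameter (U j) <= dlt) \<and>
   (\<Sum>j. ?w (U j)) <= hausdorff_pre k dlt (A i) + ennreal (e * (1/2) ^ Suc i)" for i
 proof -
  have "hausdorff_pre k dlt (A i) < hausdorff_pre k dlt (A i) + ennreal (e * (1/2) ^ Suc i)"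
  proof -
   have "0 < e * (1/2) ^ Suc i" using e by simp
   then show ?thesis using fin_i[of i]
    by (cases "hausdorff_pre k dlt (A i)") (auto simp: ennreal_plus[symmetric] ennreal_less_iff simp del: ennreal_plus power_Suc)
  qed
  from hausdorff_pre_less[OF this] obtain U where "A i \<subseteq> (\<Union>j. U j)" "ALL j. bounded (U j) & diameter (U j) <= dlt"
   "(\<Sum>j. ?w (U j)) < hausdorff_pre k dlt (A i) + ennreal (e * (1/2) ^ Suc i)" by (elim exE conjE)
  then show ?thesis by (intro exI[of _ U]) (simp add: less_imp_le)
 qed
 then obtain U where U: "!!i. A i \<subseteq> (\<Union>j. U i j)" "!!i j. bounded (U i j)" "!!i j. diameter (U i j) <= dlt"
   "!!i. (\<Sum>j. ?w (U i j)) <= hausdorff_pre k dlt (A i) + ennreal (e * (1/2) ^ Suc i)" by metis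
 let ?V = "%n. case prod_decode n of (i, j) => U i j"
 have "hausdorff_pre k dlt (\<Union>i. A i) <= (\<Sum>n. ?w (?V n))"
 proof (rule hausdorff_pre_le)
  show "(\<Union>i. A i) \<subseteq> (\<Union>n. ?V n)"
  proof
   fix x assume "x \<in> (\<Union>i. A i)"
   then obtain i j where "x \<in> U i j" using U(1) by blast
   then have "x \<in> ?V (prod_encode (i, j))" by simp
   then show "x \<in> (\<Union>n. ?V n)" by (rule UN_I[OF UNIV_I])
  qed
 qed (simp_all add: U(2,3) split: prod.split)
 also have "(\<Sum>n. ?w (?V n)) = (\<Sum>i. \<Sum>j. ?w (U i j))"
  using suminf_ennreal_2dimen[of "%i. \<Sum>j. ?w (U i j)" "%p. ?w (case p of (i, j) => U i j)"] by simp
 also have "... <= (\<Sum>i. hausdorff_pre k dlt (A i) + ennreal (e * (1/2) ^ Suc i))"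
  by (intro suminf_le U summableI)
 also have "... = (\<Sum>i. hausdorff_pre k dlt (A i)) + (\<Sum>i. ennreal (e * (1/2) ^ Suc i))"
  by (rule suminf_add[symmetric]) auto
 also have "(\<Sum>i. ennreal (e * (1/2) ^ Suc i)) = ennreal e"
  using sums_mult[OF power_half_series, of e] e by (intro suminf_ennreal_eq) auto
 finally show "hausdorff_pre k dlt (\<Union>i. A i) <= (\<Sum>i. hausdorff_pre k dlt (A i)) + ennreal e" .
qed

lemma hausdorff_outer_countable_subadditive:
 "hausdorff_outer k (\<Union>i. A i) <= (\<Sum>i. hausdorff_outer k (A i :: 'a::metric_space set))"
 unfolding hausdorff_outer_eq[of k "\<Union>i. A i"]
proof (rule SUP_least)
 fix dlt :: real assume "dlt \<in> {0<..}"
 then have "(\<Sum>i. hausdorff_pre k dlt (A i)) <= (\<Sum>i. hausdorff_outer k (A i))"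
  by (intro suminf_le summableI hausdorff_pre_le_outer) auto
 then show "hausdorff_pre k dlt (\<Union>i. A i) <= (\<Sum>i. hausdorff_outer k (A i))"
  using hausdorff_pre_countable_subadditive order_trans by blast
qed

lemma hausdorff_outer_subadditive:
 assumes "k ~= 0"
 shows "hausdorff_outer k (A Un B) <= hausdorff_outer k A + hausdorff_outer k (B :: 'a::metric_space set)"
proof -
 let ?C = "%i::nat. if i = 0 then A else if i = 1 then B else {}"
 have "(\<Union>i. ?C i) = A Un B" by (auto split: if_splits)
 moreover have "(\<Sum>i. hausdorff_outer k (?C i)) = (\<Sum>i\<in>{0,1}. hausdorff_outer k (?C i))"
  by (rule suminf_finite) (auto simp: hausdorff_outer_empty assms)
 ultimately show ?thesis using hausdorff_outer_countable_subadditive[of k ?C] by simp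
qed

text \<open>
  A cover by sets of diameter less than the distance of two sets splits into a cover of the one and a
  cover of the other.
\<close>

lemma hausdorff_outer_separated:
 fixes A B :: "'a::metric_space set"
 assumes k: "k ~= 0" and r: "0 < r" and sep: "!!x y. x \<in> A ==> y \<in> B ==> r <= dist x y"
 shows "hausdorff_outer k A + hausdorff_outer k B <= hausdorff_outer k (A Un B)"
proof -
 let ?w = "%U. ennreal (unit_ball_vol (real k) * (diameter (U :: 'a set) / 2) ^ k)"
 have *: "hausdorff_pre k dlt A + hausdorff_pre k dlt B <= hausdorff_outer k (A Un B)" if dlt: "0 < dlt" "dlt < r" for dlt
 proof -
  have "hausdorff_pre k dlt A + hausdorff_pre k dlt B <= hausdorff_pre k dlt (A Un B)"
  proof (rule dense_ge)
   fix y assume "hausdorff_pre k dlt (A Un B) < y"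
   then obtain U where U: "A Un B \<subseteq> (\<Union>i. U i)" "!!i. bounded (U i)" "!!i. diameter (U i) <= dlt"
    "(\<Sum>i. ?w (U i)) < y" by (elim hausdorff_pre_less[THEN exE] conjE) blast
   let ?UA = "%i. if U i Int A ~= {} then U i else {}" and ?UB = "%i. if U i Int A = {} then U i else {}"
   have "hausdorff_pre k dlt A <= (\<Sum>i. ?w (?UA i))"
    by (rule hausdorff_pre_le) (use U dlt in \<open>auto simp: subset_iff\<close>, blast)
   moreover have "hausdorff_pre k dlt B <= (\<Sum>i. ?w (?UB i))"
   proof (rule hausdorff_pre_le)
    show "B \<subseteq> (\<Union>i. ?UB i)"
    proof
     fix y assume y: "y \<in> B"
     then obtain i where i: "y \<in> U i" using U(1) by blast
     have "U i Int A = {}"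
     proof (rule ccontr)
      assume "U i Int A ~= {}"
      then obtain x where x: "x \<in> U i" "x \<in> A" by blast
      then have "dist x y <= dlt" using diameter_bounded_bound[OF U(2) x(1) i] U(3)[of i] by simp
      then show False using sep[OF x(2) y] dlt by simp
     qed
     then have "y \<in> ?UB i" using i by simp
     then show "y \<in> (\<Union>i. ?UB i)" by (rule UN_I[OF UNIV_I])
    qed
   qed (use U dlt in auto)
   ultimately have "hausdorff_pre k dlt A + hausdorff_pre k dlt B <= (\<Sum>i. ?w (?UA i)) + (\<Sum>i. ?w (?UB i))"
    by (rule add_mono)
   also have "... = (\<Sum>i. ?w (?UA i) + ?w (?UB i))" by (rule suminf_add) auto
   also have "... = (\<Sum>i. ?w (U i))"
    by (intro arg_cong[of _ _ suminf] ext) (use k in "auto simp: power_0_left")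
   finally show "hausdorff_pre k dlt A + hausdorff_pre k dlt B <= y" using U(4) by simp
  qed
  then show ?thesis using hausdorff_pre_le_outer[OF dlt(1)] order_trans by blast
 qed
 have S: "hausdorff_outer k C = (SUP dlt\<in>{0<..<r}. hausdorff_pre k dlt C)" for C :: "'a set"
  unfolding hausdorff_outer_eq
 proof (rule antisym)
  show "(SUP dlt\<in>{0<..}. hausdorff_pre k dlt C) <= (SUP dlt\<in>{0<..<r}. hausdorff_pre k dlt C)"
  proof (rule SUP_mono)
   fix dlt :: real assume "dlt \<in> {0<..}"
   then show "\<exists>eps\<in>{0<..<r}. hausdorff_pre k dlt C <= hausdorff_pre k eps C"
    using r by (intro bexI[of _ "min dlt (r / 2)"] hausdorff_pre_antimono) auto
  qed
 qed (auto intro: SUP_subset_mono)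
 have "hausdorff_outer k A + hausdorff_outer k B = (SUP dlt\<in>{0<..<r}. hausdorff_pre k dlt A + hausdorff_pre k dlt B)"
  unfolding S
 proof (rule SUP_add_directed_ennreal[symmetric])
  fix i j :: real assume "i \<in> {0<..<r}" "j \<in> {0<..<r}"
  then show "\<exists>l\<in>{0<..<r}. hausdorff_pre k i A + hausdorff_pre k j B <= hausdorff_pre k l A + hausdorff_pre k l B"
   by (intro bexI[of _ "min i j"] add_mono hausdorff_pre_antimono) auto
 qed
 also have "... <= hausdorff_outer k (A Un B)" by (rule SUP_least) (use * in auto)
 finally show ?thesis .
qed

text \<open>
  Caratheodory's criterion: additivity on separated sets makes closed sets measurable. The part of a
  test set \<open>A\<close> outside a closed set \<open>C\<close> is exhausted by the parts at distance at least
  \<open>1 / n\<close>; the shells between consecutive ones contribute a convergent series, since every other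
  shell is separated from the previous ones.
\<close>

lemma hausdorff_outer_shells:
 fixes A C :: "'a::metric_space set"
 assumes k: "k ~= 0" and C: "closed C" "C ~= {}" and fin: "hausdorff_outer k A < top"
 shows "hausdorff_outer k (A Int C) + hausdorff_outer k (A - C) <= hausdorff_outer k A"
proof -
 let ?h = "hausdorff_outer k"
 define D where "D n = {x \<in> A. 1 / real (Suc n) <= infdist x C}" for n
 define R where "R n = D (Suc n) - D n" for n
 have Dmono: "m <= n ==> D m \<subseteq> D n" for m n
  unfolding D_def by (auto intro: order_trans[rotated] simp: frac_le)
 have sepD: "1 / real (Suc n) - 1 / real (Suc (Suc n)) <= dist x y"
  if "x \<in> D n" "y \<in> A - D (Suc n)" for n x y
 proof -
  have "1 / real (Suc n) <= infdist x C" "infdist y C < 1 / real (Suc (Suc n))"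
   using that by (auto simp: D_def)
  then show ?thesis using infdist_triangle[of x C y] by simp
 qed
 have gap: "0 < 1 / real (Suc n) - 1 / real (Suc (Suc n))" for n
  using frac_less2[of 1 1 "real (Suc n)" "real (Suc (Suc n))"] by simp
 have sum_R: "(\<Sum>i<n. ?h (R (2 * i + c))) <= ?h A" if c: "c \<in> {0, 1}" for n c
 proof -
  have "(\<Sum>i<n. ?h (R (2 * i + c))) <= ?h (D (2 * n + c) Int (\<Union>i<n. R (2 * i + c)))"
  proof (induction n)
   case (Suc n)
   let ?U = "D (2 * n + c) Int (\<Union>i<n. R (2 * i + c))"
   have "(\<Sum>i<Suc n. ?h (R (2 * i + c))) <= ?h ?U + ?h (R (2 * n + c))"
    using Suc.IH by (simp add: add_right_mono)
   also have "... <= ?h ((\<Union>i<n. R (2 * i + c)) Int D (2 * n + c - 1) Un R (2 * n + c))"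
   proof (cases "2 * n + c = 0")
    case True
    then show ?thesis using k by (simp add: hausdorff_outer_empty)
   next
    case False
    then have Suc_eq: "Suc (2 * n + c - 1) = 2 * n + c" by simp
    have sub: "(\<Union>i<n. R (2 * i + c)) \<subseteq> D (2 * n + c - 1)"
    proof
     fix x assume "x \<in> (\<Union>i<n. R (2 * i + c))"
     then obtain i where i: "i < n" "x \<in> D (Suc (2 * i + c))" by (auto simp: R_def)
     then have "Suc (2 * i + c) <= 2 * n + c - 1" by linarith
     then show "x \<in> D (2 * n + c - 1)" using Dmono i(2) by blast
    qed
    have "?h ((\<Union>i<n. R (2 * i + c)) Int D (2 * n + c - 1)) + ?h (R (2 * n + c)) \<le>
      ?h ((\<Union>i<n. R (2 * i + c)) Int D (2 * n + c - 1) Un R (2 * n + c))"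
    proof (rule hausdorff_outer_separated[OF k gap[of "2 * n + c - 1"]])
     fix x y assume "x \<in> (\<Union>i<n. R (2 * i + c)) Int D (2 * n + c - 1)" "y \<in> R (2 * n + c)"
     then show "1 / real (Suc (2 * n + c - 1)) - 1 / real (Suc (Suc (2 * n + c - 1))) <= dist x y"
      using sepD[of x "2 * n + c - 1" y] by (auto simp: R_def Suc_eq D_def)
    qed
    moreover have "?U = (\<Union>i<n. R (2 * i + c)) Int D (2 * n + c - 1)"
     using sub Dmono[of "2 * n + c - 1" "2 * n + c"] by auto
    ultimately show ?thesis by simp
   qed
   also have "... <= ?h (D (2 * Suc n + c) Int (\<Union>i<Suc n. R (2 * i + c)))"
   proof (rule hausdorff_outer_mono)
    have "D (2 * n + c - 1) \<subseteq> D (2 * Suc n + c)" "D (Suc (2 * n + c)) \<subseteq> D (2 * Suc n + c)"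
     by (simp_all add: Dmono)
    then show "(\<Union>i<n. R (2 * i + c)) Int D (2 * n + c - 1) Un R (2 * n + c) \<subseteq>
      D (2 * Suc n + c) Int (\<Union>i<Suc n. R (2 * i + c))"
     by (auto simp: R_def less_Suc_eq)
   qed
   finally show ?case .
  qed (use k in "simp add: hausdorff_outer_empty")
  also have "... <= ?h A" by (rule hausdorff_outer_mono) (auto simp: D_def)
  finally show ?thesis .
 qed
 have sumR: "(\<Sum>i<n. ?h (R i)) <= 2 * ?h A" for n
 proof -
  have "(\<Sum>i<n. ?h (R i)) <= (\<Sum>i<2 * n. ?h (R i))" by (rule sum_mono2) auto
  also have "... = (\<Sum>i<n. ?h (R (2 * i + 0))) + (\<Sum>i<n. ?h (R (2 * i + 1)))"
   by (induction n) (auto simp: algebra_simps)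
  also have "... <= ?h A + ?h A" by (intro add_mono sum_R) auto
  finally show ?thesis by (simp add: mult_2)
 qed
 have "suminf (%i. ?h (R i)) <= 2 * ?h A"
  by (rule suminf_le_const) (auto intro: sumR summableI)
 moreover have "2 * ?h A < top" using fin by (simp add: ennreal_mult_less_top)
 ultimately have finR: "suminf (%i. ?h (R i)) < top" by (rule le_less_trans)
 have tail: "(%n. \<Sum>i. ?h (R (i + n))) ----> 0"
 proof -
  have r: "!!i. ?h (R i) = ennreal (enn2real (?h (R i)))"
   using finR by (metis ennreal_enn2real ennreal_suminf_lessD less_top)
  have s: "summable (%i. enn2real (?h (R i)))"
   using finR by (intro summable_suminf_not_top) (auto simp: r[symmetric])
  have "(\<Sum>i. ?h (R (i + n))) = ennreal (\<Sum>i. enn2real (?h (R (i + n))))" for n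
   using summable_ignore_initial_segment[OF s, of n]
   by (subst suminf_ennreal2[symmetric]) (auto simp: r[symmetric])
  moreover have "(%n. \<Sum>i. enn2real (?h (R (i + n)))) ----> 0" by (rule suminf_exist_split2[OF s])
  ultimately show ?thesis by (simp add: tendsto_ennrealI[of _ 0, simplified])
 qed
 have main: "?h (A Int C) + ?h (A - C) <= ?h A + (\<Sum>i. ?h (R (i + n)))" for n
 proof -
  have "A - C \<subseteq> D n Un (\<Union>i. R (i + n))"
  proof
   fix x assume x: "x \<in> A - C"
   then have "0 < infdist x C" using in_closed_iff_infdist_zero[OF C] infdist_nonneg[of x C] by (auto simp: less_le)
   then obtain m where "1 / real (Suc m) < infdist x C" using nat_approx_posE by metis
   then have ex: "EX m. x \<in> D m" using x by (auto simp: D_def intro!: exI[of _ m])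
   define m where "m = (LEAST m. x \<in> D m)"
   have m: "x \<in> D m" "!!l. l < m ==> x ~: D l"
    using LeastI_ex[OF ex] not_less_Least unfolding m_def by auto
   show "x \<in> D n Un (\<Union>i. R (i + n))"
   proof (cases "m <= n")
    case True
    then show ?thesis using m(1) Dmono by auto
   next
    case False
    then have "x \<in> R ((m - 1 - n) + n)" using m by (auto simp: R_def)
    then show ?thesis by blast
   qed
  qed
  then have "?h (A - C) <= ?h (D n Un (\<Union>i. R (i + n)))" by (rule hausdorff_outer_mono)
  also have "... <= ?h (D n) + ?h (\<Union>i. R (i + n))" by (rule hausdorff_outer_subadditive[OF k])
  also have "... <= ?h (D n) + (\<Sum>i. ?h (R (i + n)))"
   by (intro add_left_mono hausdorff_outer_countable_subadditive)
  finally have "?h (A Int C) + ?h (A - C) <= (?h (A Int C) + ?h (D n)) + (\<Sum>i. ?h (R (i + n)))"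
   by (simp add: add.assoc add_left_mono)
  also have "?h (A Int C) + ?h (D n) <= ?h (A Int C Un D n)"
  proof (rule hausdorff_outer_separated[OF k, of "1 / real (Suc n)"])
   fix x y assume "x \<in> A Int C" "y \<in> D n"
   then show "1 / real (Suc n) <= dist x y"
    using infdist_le[of x C y] by (auto simp: D_def dist_commute)
  qed simp
  also have "... <= ?h A" by (rule hausdorff_outer_mono) (auto simp: D_def)
  finally show ?thesis by (simp add: add_right_mono)
 qed
 have "(%n. ?h A + (\<Sum>i. ?h (R (i + n)))) ----> ?h A + 0" by (intro tendsto_intros tail)
 then show ?thesis using main by (auto intro: LIMSEQ_le_const)
qed

lemma closed_lambda_system:
 fixes C :: "'a::metric_space set"
 assumes k: "k ~= 0" and C: "closed C"
 shows "C \<in> lambda_system UNIV UNIV (hausdorff_outer k)"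
proof -
 have "hausdorff_outer k (C Int A) + hausdorff_outer k (A - C) = hausdorff_outer k A" for A
 proof (rule antisym)
  show "hausdorff_outer k (C Int A) + hausdorff_outer k (A - C) <= hausdorff_outer k A"
  proof (cases "C = {} \<or> hausdorff_outer k A = top")
   case False
   then show ?thesis using hausdorff_outer_shells[OF k C, of A] by (auto simp: Int_commute less_top)
  qed (use k in "auto simp: hausdorff_outer_empty")
  have "A = C Int A Un (A - C)" by blast
  then show "hausdorff_outer k A <= hausdorff_outer k (C Int A) + hausdorff_outer k (A - C)"
   using hausdorff_outer_subadditive[OF k] by metis
 qed
 then show ?thesis by (auto simp: lambda_system_def Diff_eq Int_commute)
qed

lemma
 assumes k: "k ~= 0"
 shows sets_hausdorff_measure [simp]: "sets (hausdorff_measure k :: 'a::metric_space measure) = sets borel"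
  and space_hausdorff_measure [simp]: "space (hausdorff_measure k :: 'a measure) = UNIV"
  and emeasure_hausdorff_measure: "A \<in> sets borel ==> emeasure (hausdorff_measure k :: 'a measure) A = hausdorff_outer k A"
proof -
 let ?h = "hausdorff_outer k :: 'a set => ennreal"
 interpret sigma_algebra UNIV "Pow UNIV :: 'a set set" by (rule sigma_algebra_Pow)
 have "outer_measure_space (Pow UNIV) ?h"
  using k by (auto simp: outer_measure_space_def positive_def increasing_def countably_subadditive_def
    hausdorff_outer_empty hausdorff_outer_countable_subadditive intro: hausdorff_outer_mono)
 then have ms: "measure_space UNIV (lambda_system UNIV (Pow UNIV) ?h) ?h" by (rule caratheodory_lemma)
 then have sa: "sigma_algebra UNIV (lambda_system UNIV (Pow UNIV) ?h)" by (simp add: measure_space_def)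
 have "sets borel \<subseteq> lambda_system UNIV (Pow UNIV) ?h"
  unfolding borel_eq_closed
  by (subst sets_measure_of) (use sigma_algebra.sigma_sets_subset[OF sa, of "Collect closed"] closed_lambda_system[OF k] in auto)
 then have ms': "measure_space UNIV (sets borel) ?h"
  using measure_down[OF ms] sets.sigma_algebra_axioms[of borel] by (simp add: space_borel)
 show s: "sets (hausdorff_measure k :: 'a measure) = sets borel"
  unfolding hausdorff_measure_def using sets.sets_measure_of_eq[of borel] by (simp add: space_borel)
 show "space (hausdorff_measure k :: 'a measure) = UNIV" unfolding hausdorff_measure_def by (simp add: space_measure_of_conv)
 show "A \<in> sets borel ==> emeasure (hausdorff_measure k :: 'a measure) A = ?h A"
  unfolding hausdorff_measure_def
  by (rule emeasure_measure_of_sigma) (use ms' in "auto simp: measure_space_def")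
qed


section \<open>Counting and boxes\<close>

lemma card_int_interval_le:
 fixes t s :: real
 assumes "0 <= s"
 shows "finite {k. \<bar>of_int k - t\<bar> <= s}" "real (card {k. \<bar>of_int k - t\<bar> <= s}) <= 2 * s + 1"
proof -
 have e: "{k. \<bar>of_int k - t\<bar> <= s} = {\<lceil>t - s\<rceil>..\<lfloor>t + s\<rfloor>}"
  by (auto simp: ceiling_le_iff le_floor_iff abs_le_iff)
 show "finite {k. \<bar>of_int k - t\<bar> <= s}" unfolding e by simp
 have "real (card {k. \<bar>of_int k - t\<bar> <= s}) = real (nat (\<lfloor>t + s\<rfloor> - \<lceil>t - s\<rceil> + 1))"
  unfolding e by simp
 also have "... <= max 0 (of_int (\<lfloor>t + s\<rfloor> - \<lceil>t - s\<rceil> + 1))" by simp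
 also have "... <= 2 * s + 1" using assms by simp linarith
 finally show "real (card {k. \<bar>of_int k - t\<bar> <= s}) <= 2 * s + 1" .
qed

lemma card_int_vectors_le:
 fixes t s :: "'n::finite => real"
 assumes "!!k. 0 <= s k"
 shows "finite {v :: int ^ 'n. ALL k. \<bar>of_int (v $ k) - t k\<bar> <= s k}"
  "real (card {v :: int ^ 'n. ALL k. \<bar>of_int (v $ k) - t k\<bar> <= s k}) <= (\<Prod>k\<in>UNIV. 2 * s k + 1)"
proof -
 let ?S = "%k. {i. \<bar>of_int i - t k\<bar> <= s k}"
 have e: "{v :: int ^ 'n. ALL k. \<bar>of_int (v $ k) - t k\<bar> <= s k} = vec_lambda ` PiE UNIV ?S"
 proof (intro set_eqI iffI)
  fix v :: "int ^ 'n" assume "v \<in> {v. ALL k. \<bar>of_int (v $ k) - t k\<bar> <= s k}"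
  then have "vec_nth v \<in> PiE UNIV ?S" by auto
  then show "v \<in> vec_lambda ` PiE UNIV ?S" by (rule image_eqI[rotated]) (simp add: vec_nth_inverse)
 next
  fix v :: "int ^ 'n" assume "v \<in> vec_lambda ` PiE UNIV ?S"
  then obtain g where "v = vec_lambda g" "!!k. g k \<in> ?S k" by (auto simp: PiE_def Pi_def)
  then show "v \<in> {v. ALL k. \<bar>of_int (v $ k) - t k\<bar> <= s k}" by simp
 qed
 have fin: "finite (PiE UNIV ?S)" by (rule finite_PiE) (simp_all add: card_int_interval_le assms)
 show "finite {v :: int ^ 'n. ALL k. \<bar>of_int (v $ k) - t k\<bar> <= s k}" unfolding e using fin by simp
 have "real (card {v :: int ^ 'n. ALL k. \<bar>of_int (v $ k) - t k\<bar> <= s k}) <= real (card (PiE UNIV ?S))"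
  unfolding e using card_image_le[OF fin] by simp
 also have "... = (\<Prod>k\<in>UNIV. real (card (?S k)))" by (simp add: card_PiE)
 also have "... <= (\<Prod>k\<in>UNIV. 2 * s k + 1)"
  by (intro prod_mono conjI card_int_interval_le assms) auto
 finally show "real (card {v :: int ^ 'n. ALL k. \<bar>of_int (v $ k) - t k\<bar> <= s k}) <= (\<Prod>k\<in>UNIV. 2 * s k + 1)" .
qed

lemma card_cubes_at_point:
 fixes x :: "real ^ 'n::finite"
 assumes "0 <= d"
 shows "finite {m. x \<in> dcube d j m}" "real (card {m. x \<in> dcube d j m}) <= (2 * d + 1) ^ CARD('n)"
proof -
 have e: "{m. x \<in> dcube d j m} = {v. ALL k. \<bar>of_int (v $ k) - 2 ^ j * x $ k\<bar> <= d}"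
  by (auto simp: mem_dcube_iff abs_minus_commute)
 show "finite {m. x \<in> dcube d j m}" "real (card {m. x \<in> dcube d j m}) <= (2 * d + 1) ^ CARD('n)"
  unfolding e using card_int_vectors_le[of "%_ :: 'n. d" "%k. 2 ^ j * x $ k"] assms by auto
qed

lemma emeasure_lborel_box_prod:
 fixes a b :: "real ^ 'n::finite"
 assumes "!!i. a $ i <= b $ i"
 shows "emeasure lborel (cbox a b) = ennreal (\<Prod>i\<in>UNIV. b $ i - a $ i)"
proof -
 have "cbox a b ~= {}" using assms by (simp add: interval_ne_empty_cart)
 moreover have "emeasure lborel (cbox a b) = ennreal (measure lborel (cbox a b))"
  by (rule emeasure_eq_ennreal_measure) (use emeasure_lborel_cbox_finite[of a b] in auto)
 ultimately show ?thesis using content_cbox_cart[of a b] by simp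
qed

lemma emeasure_dcube:
 assumes "0 <= d"
 shows "emeasure lborel (dcube d j (m :: int ^ 'n::finite)) = ennreal ((2 * d / 2 ^ j) ^ CARD('n))"
 unfolding dcube_eq_cbox using assms by (subst emeasure_lborel_box_prod) auto

lemma prod_if_eq_power:
 fixes c :: "'a::comm_semiring_1"
 shows "(\<Prod>i\<in>(UNIV :: 'n::finite set). if i = k then 1 else c) = c ^ (CARD('n) - 1)"
proof -
 have "(\<Prod>i\<in>(UNIV :: 'n set). if i = k then 1 else c) = (\<Prod>i\<in>UNIV - {k}. if i = k then 1 else c)"
  by (subst prod.remove[of UNIV k]) auto
 also have "... = (\<Prod>i\<in>UNIV - {k}. c)" by (rule prod.cong) auto
 finally show ?thesis by (simp add: card_Diff_singleton)
qed

lemma norm_axis_real: "norm (axis i c :: real ^ 'n::finite) = \<bar>c\<bar>"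
proof -
 have "(axis i c :: real ^ 'n) = c *\<^sub>R axis i 1" by (simp add: vec_eq_iff axis_def)
 then show ?thesis by (simp add: axis_in_Basis_iff norm_Basis)
qed

section \<open>The geometry of Lipschitz domains\<close>

locale lipschitz_domain =
 fixes \<Omega> :: "(real ^ 'n::{finite,linorder}) set"
 assumes domain: "bounded_lipschitz_domain \<Omega>" and dim: "2 <= CARD('n)"
begin

abbreviation "\<Gamma> \<equiv> frontier \<Omega>"
abbreviation height :: "(real, 'n) vec => real" where "height x \<equiv> x $ Max UNIV"

lemma dimb_pos: "CARD('n) - 1 ~= 0" and Suc_dimb: "CARD('n) = Suc (CARD('n) - 1)"
 using dim by auto

lemma open_domain: "open \<Omega>" and domain_nonempty: "\<Omega> ~= {}" and bounded_domain: "bounded \<Omega>"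
 using domain by (auto simp: bounded_lipschitz_domain_def)

lemma compact_boundary: "compact \<Gamma>"
 using compact_frontier_bounded[OF bounded_domain] .

lemma boundary_nonempty: "\<Gamma> ~= {}"
proof (rule frontier_not_empty)
 show "\<Omega> ~= UNIV" using bounded_domain by (metis not_bounded_UNIV)
qed (rule domain_nonempty)

text \<open>
  The constants \<open>A\<close>, \<open>B\<close>, \<open>R\<close> are parameters because finitely many
  charts give the same ones for all boundary points. The two-sided bound is only available at distances up
  to 1.
\<close>

definition chart :: "real => real => real => (real, 'n) vec => ((real, 'n) vec => (real, 'n) vec) => bool" where
 "chart A B R x psi \<longleftrightarrow> inj psi & continuous_on UNIV psi \<and>
   (ALL u v. norm (u - v) <= 1 --> A * norm (u - v) <= norm (psi u - psi v) & norm (psi u - psi v) <= B * norm (u - v)) \<and>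
   (\<forall>y\<in>ball x R Int \<Omega>. 0 < height (psi y)) & (\<forall>y\<in>ball x R Int \<Gamma>. height (psi y) = 0)"

lemma ex_chart:
 obtains A B R where "0 < A" "0 < B" "0 < R" "R <= 1 / 2" "!!x. x \<in> \<Gamma> ==> \<exists>psi. chart A B R x psi"
proof -
 obtain N :: nat and z r psi where cover: "\<Gamma> \<subseteq> (\<Union>j<N. ball (z j) (r j))"
  and all: "\<forall>j<N. ball (z j) (r j) Int \<Gamma> ~= {} & lipschitz_diffeo (psi j) \<and>
      psi j ` (ball (z j) (r j) Int \<Omega>) \<subseteq> {x. 0 < height x} \<and>
      psi j ` (ball (z j) (r j) Int \<Gamma>) \<subseteq> {x. height x = 0}"
  using domain unfolding bounded_lipschitz_domain_def by (elim conjE exE) (rule that)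
 have ch: "lipschitz_diffeo (psi j)" "psi j ` (ball (z j) (r j) Int \<Omega>) \<subseteq> {x. 0 < height x}"
  "psi j ` (ball (z j) (r j) Int \<Gamma>) \<subseteq> {x. height x = 0}" if "j < N" for j
  using all that by simp_all
 have "EX A B. 0 < A & 0 < B & (ALL u v. norm (u - v) <= 1 -->
    A * norm (u - v) <= norm (psi j u - psi j v) & norm (psi j u - psi j v) <= B * norm (u - v))" if "j < N" for j
  using ch(1)[OF that] unfolding lipschitz_diffeo_def by blast
 then obtain A B where AB: "!!j. j < N ==> 0 < A j" "!!j. j < N ==> 0 < B j"
  "!!j u v. j < N ==> norm (u - v) <= 1 ==>
    A j * norm (u - v) <= norm (psi j u - psi j v) & norm (psi j u - psi j v) <= B j * norm (u - v)"
  by metis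
 have N: "N ~= 0" using cover boundary_nonempty by auto
 define A0 where "A0 = Min (A ` {..<N})"
 define B0 where "B0 = Max (B ` {..<N})"
 have "A0 \<in> A ` {..<N}" unfolding A0_def by (rule Min_in) (use N in auto)
 then have A0: "0 < A0" "!!j. j < N ==> A0 <= A j" using AB(1) by (auto simp: A0_def)
 have "B0 \<in> B ` {..<N}" unfolding B0_def by (rule Max_in) (use N in auto)
 then have B0: "0 < B0" "!!j. j < N ==> B j <= B0" using AB(2) by (auto simp: B0_def)
 obtain e where e: "0 < e" "!!x. x \<in> \<Gamma> ==> \<exists>G\<in>(%j. ball (z j) (r j)) ` {..<N}. ball x e \<subseteq> G"
  using Heine_Borel_lemma[OF compact_boundary, of "(%j. ball (z j) (r j)) ` {..<N}"] cover by blast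
 define R where "R = min e (1 / 2)"
 have "\<exists>psi. chart A0 B0 R x psi" if x: "x \<in> \<Gamma>" for x
 proof -
  obtain j where j: "j < N" "ball x e \<subseteq> ball (z j) (r j)" using e(2)[OF x] by blast
  have sub: "ball x R \<subseteq> ball (z j) (r j)" using j(2) by (auto simp: R_def)
  have lip: "A0 * norm (u - v) <= norm (psi j u - psi j v)" "norm (psi j u - psi j v) <= B0 * norm (u - v)"
   if "norm (u - v) <= 1" for u v
   using AB(3)[OF j(1) that] A0(2)[OF j(1)] B0(2)[OF j(1)]
   by (auto intro: order_trans[OF mult_right_mono] order_trans[OF _ mult_right_mono])
  have "continuous_on UNIV (psi j)"
   unfolding continuous_on_iff
  proof safe
   fix u :: "(real, 'n) vec" and eps :: real assume "0 < eps"
   show "\<exists>d>0. \<forall>v\<in>UNIV. dist v u < d --> dist (psi j v) (psi j u) < eps"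
   proof (intro exI[of _ "min 1 (eps / B0)"] conjI ballI impI)
    show "0 < min 1 (eps / B0)" using \<open>0 < eps\<close> B0(1) by simp
    fix v assume "dist v u < min 1 (eps / B0)"
    then have "norm (v - u) <= 1" "B0 * norm (v - u) < eps"
     using B0(1) by (auto simp: dist_norm pos_less_divide_eq mult.commute)
    then show "dist (psi j v) (psi j u) < eps" using lip(2)[of v u] by (simp add: dist_norm)
   qed
  qed
  then have "chart A0 B0 R x (psi j)"
   unfolding chart_def using lip ch[OF j(1)] sub
   by (auto simp: lipschitz_diffeo_def bij_is_inj image_subset_iff)
  then show ?thesis by blast
 qed
 then show ?thesis using that[of A0 B0 R] A0(1) B0(1) e(1) by (auto simp: R_def)
qed

text \<open>
  By invariance of domain, the image of a small ball under a chart contains a ball: its intersection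
  with the ball below is relatively open and relatively closed there.
\<close>

lemma chart_ball:
 assumes ch: "chart A B R x psi" and A: "0 < A" and dlt: "0 < dlt" "dlt <= 1"
 shows "ball (psi x) (A * dlt) \<subseteq> psi ` ball x dlt"
proof -
 let ?V = "ball (psi x) (A * dlt)"
 have cont: "continuous_on UNIV psi" and inj: "inj psi" using ch by (auto simp: chart_def)
 have op: "open (psi ` ball x dlt)"
  by (rule invariance_of_domain) (auto intro: continuous_on_subset[OF cont] inj_on_subset[OF inj])
 have "compact (psi ` cball x dlt)"
  by (intro compact_continuous_image continuous_on_subset[OF cont]) auto
 then have cl: "open (- psi ` cball x dlt)" by (simp add: compact_imp_closed open_Compl)
 have boundary: "psi u \<in> psi ` ball x dlt" if "u \<in> cball x dlt" "psi u \<in> ?V" for u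
 proof (rule imageI, rule ccontr)
  assume "u ~: ball x dlt"
  then have u: "norm (u - x) = dlt" using that(1) by (auto simp: dist_norm norm_minus_commute)
  then have "A * dlt <= norm (psi u - psi x)" using ch dlt unfolding chart_def by metis
  then show False using that(2) by (simp add: dist_norm norm_minus_commute)
 qed
 have "psi ` ball x dlt Int ?V = {} \<or> - psi ` cball x dlt Int ?V = {}"
 proof (rule connectedD[OF _ op cl])
  show "connected ?V" by simp
  show "psi ` ball x dlt Int - psi ` cball x dlt Int ?V = {}" using ball_subset_cball by blast
  show "?V \<subseteq> psi ` ball x dlt Un - psi ` cball x dlt" using boundary by blast
 qed
 moreover have "psi x \<in> psi ` ball x dlt Int ?V" using A dlt by simp
 ultimately have "- psi ` cball x dlt Int ?V = {}" by blast
 then show ?thesis using boundary by blast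
qed

text \<open>
  A chart sees the domain exactly as the upper half of a ball: the upper half ball is connected and
  avoids the image of the boundary, and it meets the image of the domain.
\<close>

lemma chart_upper_half:
 assumes ch: "chart A B R x psi" and A: "0 < A" and B: "0 < B" and x: "x \<in> \<Gamma>"
  and dlt: "0 < dlt" "dlt <= R" "dlt <= 1"
 shows "ball (psi x) (A * dlt) Int {y. 0 < height y} \<subseteq> psi ` (ball x dlt Int \<Omega>)"
proof -
 let ?V = "ball (psi x) (A * dlt) Int {y. 0 < height y}"
 have cont: "continuous_on UNIV psi" and inj: "inj psi" using ch by (auto simp: chart_def)
 have h: "0 < height (psi y)" if "y \<in> ball x dlt Int \<Omega>" for y
  using ch that dlt unfolding chart_def by auto
 have h0: "height (psi y) = 0" if "y \<in> ball x dlt Int \<Gamma>" for y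
  using ch that dlt unfolding chart_def by auto
 let ?ext = "ball x dlt - closure \<Omega>"
 have op1: "open (psi ` (ball x dlt Int \<Omega>))"
  by (rule invariance_of_domain) (auto intro: continuous_on_subset[OF cont] inj_on_subset[OF inj] open_domain)
 have op2: "open (psi ` ?ext)"
  by (rule invariance_of_domain) (auto intro: continuous_on_subset[OF cont] inj_on_subset[OF inj])
 have "psi ` (ball x dlt Int \<Omega>) Int ?V = {} \<or> psi ` ?ext Int ?V = {}"
 proof (rule connectedD[OF _ op1 op2])
  have "convex {y :: (real, 'n) vec. 0 < height y}"
   using convex_halfspace_gt[of 0 "axis (Max UNIV) 1 :: (real, 'n) vec"] by (simp add: inner_axis')
  then show "connected ?V" by (intro convex_connected convex_Int) auto
  show "psi ` (ball x dlt Int \<Omega>) Int psi ` ?ext Int ?V = {}"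
   using inj closure_subset[of \<Omega>] by (auto simp: inj_eq)
  show "?V \<subseteq> psi ` (ball x dlt Int \<Omega>) Un psi ` ?ext"
  proof
   fix w assume w: "w \<in> ?V"
   then obtain y where y: "y \<in> ball x dlt" "w = psi y" using chart_ball[OF ch A] dlt by blast
   have "y ~: \<Gamma>" using h0[of y] y w by auto
   then show "w \<in> psi ` (ball x dlt Int \<Omega>) Un psi ` ?ext"
    using y open_domain by (auto simp: frontier_def interior_open)
  qed
 qed
 moreover have "psi ` (ball x dlt Int \<Omega>) Int ?V ~= {}"
 proof -
  have "x \<in> closure \<Omega>" using x by (simp add: frontier_def)
  moreover have "0 < min dlt (A * dlt / B)" using A B dlt by simp
  ultimately obtain y where y: "y \<in> \<Omega>" "dist y x < min dlt (A * dlt / B)"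
   unfolding closure_approachable by blast
  then have "norm (y - x) <= 1" using dlt by (simp add: dist_norm)
  then have "norm (psi y - psi x) <= B * norm (y - x)" using ch unfolding chart_def by blast
  also have "... < A * dlt" using y(2) B by (simp add: dist_norm pos_less_divide_eq mult.commute)
  finally have "psi y \<in> ball (psi x) (A * dlt)" by (simp add: dist_norm norm_minus_commute)
  moreover have "y \<in> ball x dlt Int \<Omega>" using y by (simp add: dist_commute)
  ultimately show ?thesis using h by blast
 qed
 ultimately have "psi ` ?ext Int ?V = {}" by blast
 then show ?thesis
 proof (intro subsetI)
  fix w assume e: "psi ` ?ext Int ?V = {}" and w: "w \<in> ?V"
  then obtain y where y: "y \<in> ball x dlt" "w = psi y" using chart_ball[OF ch A] dlt by blast
  then have "y \<in> closure \<Omega>" using e w by blast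
  moreover have "y ~: \<Gamma>" using h0[of y] y w by auto
  ultimately show "w \<in> psi ` (ball x dlt Int \<Omega>)"
   using y open_domain by (auto simp: frontier_def interior_open)
 qed
qed

lemma chart_plane:
 assumes ch: "chart A B R x psi" and A: "0 < A" and B: "0 < B" and x: "x \<in> \<Gamma>"
  and dlt: "0 < dlt" "dlt <= R" "dlt <= 1"
 shows "ball (psi x) (A * dlt) Int {y. height y = 0} \<subseteq> psi ` (ball x dlt Int \<Gamma>)"
proof
 fix w assume w: "w \<in> ball (psi x) (A * dlt) Int {y. height y = 0}"
 then obtain y where y: "y \<in> ball x dlt" "w = psi y" using chart_ball[OF ch A] dlt by blast
 have cont: "continuous_on UNIV psi" and inj: "inj psi" using ch by (auto simp: chart_def)
 have "y ~: \<Omega>" using ch w y dlt unfolding chart_def by force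
 moreover have "y \<in> closure \<Omega>"
  unfolding closure_iff_nhds_not_empty
 proof (intro allI impI)
  fix S V assume "V \<subseteq> S" "open V" "y \<in> V"
  have "open (psi ` (V Int ball x dlt))"
   using \<open>open V\<close>
   by (intro invariance_of_domain) (auto intro: continuous_on_subset[OF cont] inj_on_subset[OF inj])
  then have "open (psi ` (V Int ball x dlt) Int ball (psi x) (A * dlt))" by (intro open_Int) auto
  moreover have "w \<in> psi ` (V Int ball x dlt) Int ball (psi x) (A * dlt)" using y w \<open>y \<in> V\<close> by auto
  ultimately obtain e where e: "0 < e" "ball w e \<subseteq> psi ` (V Int ball x dlt) Int ball (psi x) (A * dlt)"
   unfolding open_contains_ball by blast
  let ?w = "w + axis (Max UNIV) (e / 2)"
  have w': "?w \<in> ball w e" using e(1) by (simp add: dist_norm norm_axis_real)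
  have "height ?w = e / 2" using w by simp
  then have "?w \<in> ball (psi x) (A * dlt) Int {y. 0 < height y}" using w' e by auto
  then obtain u where u: "u \<in> \<Omega>" "?w = psi u" using chart_upper_half[OF ch A B x dlt] by blast
  moreover obtain v where v: "v \<in> V" "?w = psi v" using w' e(2) by blast
  ultimately have "u = v" using inj by (metis inj_eq)
  then show "\<Omega> Int S ~= {}" using u(1) v(1) \<open>V \<subseteq> S\<close> by blast
 qed
 ultimately have "y \<in> \<Gamma>" using open_domain by (simp add: frontier_def interior_open)
 then show "w \<in> psi ` (ball x dlt Int \<Gamma>)" using y by blast
qed

text \<open>The interior corkscrew condition.\<close>

lemma ex_corkscrew:
 obtains c R where "0 < c" "0 < R"
  "!!x r. x \<in> \<Gamma> ==> 0 < r ==> r <= R ==> EX x'. ball x' (c * r) \<subseteq> \<Omega> Int ball x r"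
proof -
 obtain A B R where AB: "0 < A" "0 < B" "0 < R" "R <= 1 / 2" "!!x. x \<in> \<Gamma> ==> \<exists>psi. chart A B R x psi"
  using ex_chart by blast
 define c where "c = min 1 (A / (4 * B))"
 have c: "0 < c" "c <= 1" "B * c <= A / 4" using AB by (auto simp: c_def min_def field_simps)
 have "EX x'. ball x' (c * r) \<subseteq> \<Omega> Int ball x r" if x: "x \<in> \<Gamma>" and r: "0 < r" "r <= R" for x r
 proof -
  obtain psi where ch: "chart A B R x psi" using AB(5)[OF x] by blast
  have inj: "inj psi" using ch by (simp add: chart_def)
  have r1: "r <= 1" using r AB(4) by simp
  have hx: "height (psi x) = 0" using ch x AB(3) by (simp add: chart_def)
  let ?y = "psi x + axis (Max UNIV) (A * r / 2)"
  have upper: "psi z \<in> psi ` (ball x r Int \<Omega>)" if "norm (psi z - ?y) < A * r / 2" for z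
  proof -
   have "norm (psi z - psi x) <= norm (psi z - ?y) + norm (?y - psi x)"
    using norm_triangle_ineq[of "psi z - ?y" "?y - psi x"] by simp
   also have "norm (?y - psi x) = A * r / 2" using AB(1) r by (simp add: norm_axis_real)
   finally have "norm (psi z - psi x) < A * r" using that by simp
   moreover have "\<bar>(psi z - ?y) $ Max UNIV\<bar> < A * r / 2"
    using component_le_norm_cart[of "psi z - ?y" "Max UNIV"] that by (rule le_less_trans)
   then have "\<bar>height (psi z) - A * r / 2\<bar> < A * r / 2" using hx by simp
   then have "0 < height (psi z)" unfolding abs_less_iff by simp
   ultimately show ?thesis using chart_upper_half[OF ch AB(1,2) x r r1]
    by (auto simp: dist_norm norm_minus_commute)
  qed
  have "?y \<in> ball (psi x) (A * r) Int {y. 0 < height y}"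
   using AB(1) r hx by (simp add: dist_norm norm_axis_real)
  then obtain x' where x': "x' \<in> ball x r Int \<Omega>" "psi x' = ?y" using chart_upper_half[OF ch AB(1,2) x r r1] by force
  have "ball x' (c * r) \<subseteq> \<Omega> Int ball x r"
  proof
   fix z assume z: "z \<in> ball x' (c * r)"
   then have zn: "norm (z - x') < c * r" by (simp add: dist_norm norm_minus_commute)
   also have "c * r <= 1" using c r r1 by (simp add: mult_le_one)
   finally have "norm (psi z - psi x') <= B * norm (z - x')" using ch unfolding chart_def by simp
   also have "... < B * (c * r)" using zn AB(2) by simp
   also have "... <= A / 4 * r" using c(3) r(1) by (simp add: mult.assoc[symmetric])
   also have "... <= A * r / 2" using AB(1) r(1) by simp
   finally have "psi z \<in> psi ` (ball x r Int \<Omega>)" using upper[of z] x'(2) by simp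
   then show "z \<in> \<Omega> Int ball x r" using inj by (auto simp: inj_eq)
  qed
  then show ?thesis by blast
 qed
 then show ?thesis using that[of c R] c(1) AB(3) by blast
qed

end


context lipschitz_domain
begin

text \<open>Counting separated points of the boundary, by rounding their images in a chart to a grid.\<close>

lemma card_separated_in_plane:
 fixes Y :: "(real, 'n) vec set"
 assumes Y: "finite Y" "!!y. y \<in> Y ==> height y = 0" "!!y. y \<in> Y ==> norm (y - yc) <= D"
  and sep: "!!y y'. y \<in> Y ==> y' \<in> Y ==> y ~= y' ==> rho <= norm (y - y')" and rho: "0 < rho" and D: "0 <= D"
 shows "real (card Y) <= (2 * real CARD('n) * D / rho + 3) ^ (CARD('n) - 1)"
proof -
 define h where "h = rho / real CARD('n)"
 have h: "0 < h" using rho by (simp add: h_def)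
 let ?f = "%y :: (real, 'n) vec. \<chi> k. \<lfloor>y $ k / h\<rfloor>"
 have inj: "inj_on ?f Y"
 proof (rule inj_onI, rule ccontr)
  fix y y' assume y: "y \<in> Y" "y' \<in> Y" and eq: "?f y = ?f y'" and ne: "y ~= y'"
  have "\<bar>(y - y') $ k\<bar> < h" for k
  proof -
   have "\<lfloor>y $ k / h\<rfloor> = \<lfloor>y' $ k / h\<rfloor>" using eq by (simp add: vec_eq_iff)
   then have "\<bar>y $ k / h - y' $ k / h\<bar> < 1" by linarith
   then have "\<bar>(y $ k - y' $ k) / h\<bar> < 1" by (simp add: diff_divide_distrib)
   then show ?thesis using h by (simp add: abs_div_pos[symmetric] pos_divide_less_eq)
  qed
  then have "(\<Sum>k\<in>UNIV. \<bar>(y - y') $ k\<bar>) < (\<Sum>k\<in>(UNIV :: 'n set). h)" by (intro sum_strict_mono) auto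
  also have "... = rho" by (simp add: h_def)
  finally have "norm (y - y') < rho" using norm_le_l1_cart[of "y - y'"] by simp
  then show False using sep[OF y ne] by simp
 qed
 define s where "s k = (if k = Max UNIV then 0 else D / h + 1)" for k :: 'n
 define t where "t k = (if k = Max UNIV then 0 else yc $ k / h)" for k :: 'n
 have s0: "0 <= s k" for k using D h by (simp add: s_def)
 have "?f ` Y \<subseteq> {v. ALL k. \<bar>of_int (v $ k) - t k\<bar> <= s k}"
 proof safe
  fix y k assume y: "y \<in> Y"
  show "\<bar>of_int (?f y $ k) - t k\<bar> <= s k"
  proof (cases "k = Max UNIV")
   case True
   then show ?thesis using Y(2)[OF y] by (simp add: t_def s_def)
  next
   case False
   have "\<bar>(y - yc) $ k\<bar> <= D" using component_le_norm_cart[of "y - yc" k] Y(3)[OF y] by linarith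
   then have "\<bar>(y $ k - yc $ k) / h\<bar> <= D / h" using h by (simp add: divide_right_mono)
   then have "\<bar>y $ k / h - yc $ k / h\<bar> <= D / h" by (simp add: diff_divide_distrib)
   then have "\<bar>of_int \<lfloor>y $ k / h\<rfloor> - yc $ k / h\<bar> <= D / h + 1" by linarith
   then show ?thesis using False by (simp add: t_def s_def)
  qed
 qed
 then have "card (?f ` Y) <= card {v. ALL k. \<bar>of_int (v $ k) - t k\<bar> <= s k}"
  by (intro card_mono card_int_vectors_le s0)
 then have "real (card Y) <= real (card {v. ALL k. \<bar>of_int (v $ k) - t k\<bar> <= s k})"
  by (simp add: card_image[OF inj])
 also have "... <= (\<Prod>k\<in>UNIV. 2 * s k + 1)" by (intro card_int_vectors_le s0)
 also have "... = (\<Prod>k\<in>(UNIV :: 'n set). if k = Max UNIV then 1 else 2 * real CARD('n) * D / rho + 3)"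
  by (rule prod.cong) (auto simp: s_def h_def)
 also have "... = (2 * real CARD('n) * D / rho + 3) ^ (CARD('n) - 1)" by (rule prod_if_eq_power)
 finally show ?thesis .
qed

definition separated :: "real => (real, 'n) vec set => bool" where
 "separated r X \<longleftrightarrow> (\<forall>x\<in>X. \<forall>y\<in>X. x ~= y --> r <= dist x y)"

lemma card_separated_boundary:
 "\<exists>C>0. ALL X z r R. finite X --> X \<subseteq> \<Gamma> Int cball z R --> separated r X --> 0 < r --> r <= R -->
  real (card X) <= C * (R / r) ^ (CARD('n) - 1)"
proof -
 obtain A B R0 where AB: "0 < A" "0 < B" "0 < R0" "R0 <= 1 / 2" "!!x. x \<in> \<Gamma> ==> \<exists>psi. chart A B R0 x psi"
  using ex_chart by blast
 have "\<Gamma> \<subseteq> (\<Union>x\<in>\<Gamma>. ball x R0)" using AB(3) by force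
 from compactE_image[OF compact_boundary open_ball this] obtain P where P: "P \<subseteq> \<Gamma>" "finite P" "\<Gamma> \<subseteq> (\<Union>x\<in>P. ball x R0)" by blast
 define c where "c = (4 * real CARD('n) * B / A + 3) ^ (CARD('n) - 1)"
 have c: "0 < c" unfolding c_def using AB by (intro zero_less_power add_nonneg_pos) auto
 have part: "real (card (X Int ball p R0)) <= c * (R / r) ^ (CARD('n) - 1)"
  if X: "finite X" "X \<subseteq> \<Gamma> Int cball z R" "separated r X" and r: "0 < r" "r <= R" and p: "p \<in> P" for X z r R p
 proof (cases "X Int ball p R0 = {}")
  case True
  then show ?thesis using c r by simp
 next
  case False
  then obtain x0 where x0: "x0 \<in> X" "x0 \<in> ball p R0" by blast
  obtain psi where ch: "chart A B R0 p psi" using AB(5) p P(1) by blast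
  have inj: "inj psi" using ch by (simp add: chart_def)
  have close: "norm (u - v) <= 1" if "u \<in> ball p R0" "v \<in> ball p R0" for u v
   using norm_triangle_ineq4[of "u - p" "v - p"] that AB(4) by (simp add: dist_norm norm_minus_commute)
  have lip: "A * norm (u - v) <= norm (psi u - psi v)" "norm (psi u - psi v) <= B * norm (u - v)"
   if "u \<in> ball p R0" "v \<in> ball p R0" for u v
   using ch close[OF that] unfolding chart_def by blast+
  have "real (card (psi ` (X Int ball p R0))) <= (2 * real CARD('n) * (B * (2 * R)) / (A * r) + 3) ^ (CARD('n) - 1)"
  proof (rule card_separated_in_plane[where yc = "psi x0"])
   show "finite (psi ` (X Int ball p R0))" using X(1) by simp
   show "height y = 0" if "y \<in> psi ` (X Int ball p R0)" for y
    using that ch X(2) unfolding chart_def by auto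
   show "norm (y - psi x0) <= B * (2 * R)" if y: "y \<in> psi ` (X Int ball p R0)" for y
   proof -
    obtain u where u: "u \<in> X" "u \<in> ball p R0" "y = psi u" using y by blast
    have "dist u z <= R" "dist x0 z <= R" using u(1) x0(1) X(2) by (auto simp: dist_commute)
    then have "norm (u - x0) <= 2 * R" using dist_triangle2[of u x0 z] by (simp add: dist_norm)
    then have "B * norm (u - x0) <= B * (2 * R)" using AB(2) by simp
    then show ?thesis using lip(2)[OF u(2) x0(2)] u(3) by simp
   qed
   show "A * r <= norm (y - y')" if y: "y \<in> psi ` (X Int ball p R0)" "y' \<in> psi ` (X Int ball p R0)" "y ~= y'" for y y'
   proof -
    obtain u v where u: "u \<in> X" "u \<in> ball p R0" "y = psi u" "v \<in> X" "v \<in> ball p R0" "y' = psi v" using y by blast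
    then have "r <= norm (u - v)" using X(3) y(3) by (auto simp: separated_def dist_norm)
    then have "A * r <= A * norm (u - v)" using AB(1) by simp
    then show ?thesis using lip(1)[OF u(2,5)] u by simp
   qed
  qed (use AB r in auto)
  also have "card (psi ` (X Int ball p R0)) = card (X Int ball p R0)"
   by (rule card_image[OF inj_on_subset[OF inj]]) simp
  also have "(2 * real CARD('n) * (B * (2 * R)) / (A * r) + 3) ^ (CARD('n) - 1) \<le>
   ((4 * real CARD('n) * B / A + 3) * (R / r)) ^ (CARD('n) - 1)"
  proof (rule power_mono)
   have "1 <= R / r" using r by simp
   then have "3 <= 3 * (R / r)" by linarith
   moreover have "2 * real CARD('n) * (B * (2 * R)) / (A * r) = 4 * real CARD('n) * B / A * (R / r)" by simp
   ultimately show "2 * real CARD('n) * (B * (2 * R)) / (A * r) + 3 <= (4 * real CARD('n) * B / A + 3) * (R / r)"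
    unfolding distrib_right by linarith
  qed (use AB r in auto)
  also have "... = c * (R / r) ^ (CARD('n) - 1)" by (simp only: power_mult_distrib c_def)
  finally show ?thesis .
 qed
 have "real (card X) <= (real (card P) * c + 1) * (R / r) ^ (CARD('n) - 1)"
  if X: "finite X" "X \<subseteq> \<Gamma> Int cball z R" "separated r X" and r: "0 < r" "r <= R" for X z r R
 proof -
  have "X = (\<Union>p\<in>P. X Int ball p R0)" using P(3) X(2) by blast
  then have "card X <= (\<Sum>p\<in>P. card (X Int ball p R0))" using card_UN_le[OF P(2), of "%p. X Int ball p R0"] by simp
  then have "real (card X) <= (\<Sum>p\<in>P. real (card (X Int ball p R0)))" by (metis of_nat_le_iff of_nat_sum)
  also have "... <= (\<Sum>p\<in>P. c * (R / r) ^ (CARD('n) - 1))" by (intro sum_mono part[OF X r])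
  also have "... = real (card P) * c * (R / r) ^ (CARD('n) - 1)" by simp
  also have "... <= (real (card P) * c + 1) * (R / r) ^ (CARD('n) - 1)" using r by (intro mult_right_mono) auto
  finally show ?thesis .
 qed
 moreover have "0 < real (card P) * c + 1" using c by (intro add_nonneg_pos) auto
 ultimately show ?thesis by (intro exI[of _ "real (card P) * c + 1"] conjI allI impI)
qed

text \<open>A separated set of maximal cardinality is a net.\<close>

lemma ex_net:
 "\<exists>C>0. ALL z r R. 0 < r --> r <= R -->
  (EX X. finite X & X \<subseteq> \<Gamma> Int cball z R & separated r X & (\<forall>x\<in>\<Gamma> Int cball z R. \<exists>y\<in>X. dist x y < r) \<and>
   real (card X) <= C * (R / r) ^ (CARD('n) - 1))"
proof -
 from card_separated_boundary obtain C where C1: "0 < C" and C2: "ALL X z r R. finite X --> X \<subseteq> \<Gamma> Int cball z R --> separated r X --> 0 < r --> r <= R -->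
  real (card X) <= C * (R / r) ^ (CARD('n) - 1)" by (elim exE conjE)
 note C = C1 C2[rule_format]
 have "EX X. finite X & X \<subseteq> \<Gamma> Int cball z R & separated r X & (\<forall>x\<in>\<Gamma> Int cball z R. \<exists>y\<in>X. dist x y < r) \<and>
   real (card X) <= C * (R / r) ^ (CARD('n) - 1)" if r: "0 < r" "r <= R" for z r R
 proof -
  define good where "good X \<longleftrightarrow> finite X & X \<subseteq> \<Gamma> Int cball z R & separated r X" for X
  have "good {}" by (simp add: good_def separated_def)
  moreover have "card X <= nat \<lceil>C * (R / r) ^ (CARD('n) - 1)\<rceil>" if "good X" for X
   using C(2)[of X z R r] that r unfolding good_def by linarith
  ultimately obtain X where X: "good X" "!!Y. good Y ==> card Y <= card X"
   using ex_has_greatest_nat[of good "{}" card "nat \<lceil>C * (R / r) ^ (CARD('n) - 1)\<rceil> + 1"] by (metis less_Suc_eq_le Suc_eq_plus1)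
  have "\<exists>y\<in>X. dist x y < r" if x: "x \<in> \<Gamma> Int cball z R" for x
  proof (rule ccontr)
   assume far: "\<not> (\<exists>y\<in>X. dist x y < r)"
   then have "x ~: X" using r by force
   moreover have "good (insert x X)"
    using X(1) x far unfolding good_def separated_def by (auto simp: dist_commute not_less)
   ultimately show False using X(2)[of "insert x X"] X(1) by (simp add: good_def)
  qed
  then show ?thesis using X(1) C(2)[of X z R r] r unfolding good_def by (intro exI[of _ X]) simp
 qed
 then show ?thesis using C(1) by (intro exI[of _ C] conjI allI impI)
qed

definition collar :: "real => (real, 'n) vec set" where
 "collar eps = {x. infdist x \<Gamma> < eps}"

lemma open_collar: "open (collar eps)"
 unfolding collar_def by (intro open_Collect_less continuous_intros)

lemma cball_subset_dcube: "cball y s \<subseteq> cbox (\<chi> i. y $ i - s) (\<chi> i. y $ i + s)" for y :: "(real, 'n) vec"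
proof
 fix x assume "x \<in> cball y s"
 then have "\<bar>(x - y) $ i\<bar> <= s" for i
  using component_le_norm_cart[of "x - y" i] by (simp add: dist_norm norm_minus_commute)
 then show "x \<in> cbox (\<chi> i. y $ i - s) (\<chi> i. y $ i + s)" by (auto simp: mem_box_cart abs_le_iff algebra_simps)
qed

lemma emeasure_cball_le: "0 <= s ==> emeasure lborel (cball y s) <= ennreal ((2 * s) ^ CARD('n))" for y :: "(real, 'n) vec"
proof -
 assume s: "0 <= s"
 have "emeasure lborel (cball y s) <= emeasure lborel (cbox (\<chi> i. y $ i - s) (\<chi> i. y $ i + s))"
  by (intro emeasure_mono cball_subset_dcube) auto
 also have "... = ennreal ((2 * s) ^ CARD('n))" using s by (subst emeasure_lborel_box_prod) auto
 finally show ?thesis .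
qed

text \<open>
  A point of the collar is close to a boundary point and hence to a point of a net whose mesh is the width
  of the collar; balls of twice that radius around the net points cover.
\<close>

lemma emeasure_collar:
 "\<exists>C>0. ALL z eps R. 0 < eps --> eps <= R -->
   emeasure lborel (collar eps Int cball z R) <= ennreal (C * eps * R ^ (CARD('n) - 1))"
proof -
 from ex_net obtain C where C1: "0 < C" and C2: "ALL z r R. 0 < r --> r <= R -->
  (EX X. finite X & X \<subseteq> \<Gamma> Int cball z R & separated r X & (\<forall>x\<in>\<Gamma> Int cball z R. \<exists>y\<in>X. dist x y < r) \<and>
   real (card X) <= C * (R / r) ^ (CARD('n) - 1))" by (elim exE conjE)
 note C = C1 C2[rule_format]
 define C' where "C' = C * 2 ^ (CARD('n) - 1) * 4 ^ CARD('n)"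
 have "emeasure lborel (collar eps Int cball z R) <= ennreal (C' * eps * R ^ (CARD('n) - 1))"
  if eps: "0 < eps" "eps <= R" for z eps R
 proof -
  have "eps <= 2 * R" using eps by simp
  then obtain X where X: "finite X" "\<forall>x\<in>\<Gamma> Int cball z (2 * R). \<exists>y\<in>X. dist x y < eps"
   "real (card X) <= C * (2 * R / eps) ^ (CARD('n) - 1)" using C(2)[OF eps(1), of "2 * R" z] by blast
  have "collar eps Int cball z R \<subseteq> (\<Union>y\<in>X. cball y (2 * eps))"
  proof
   fix x assume x: "x \<in> collar eps Int cball z R"
   obtain g where g: "g \<in> \<Gamma>" "infdist x \<Gamma> = dist x g"
    by (rule infdist_attains_inf[OF compact_imp_closed[OF compact_boundary] boundary_nonempty])
   then have xg: "dist x g < eps" using x by (simp add: collar_def)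
   then have "dist z g <= 2 * R" using x eps dist_triangle[of z g x] by simp
   then have "g \<in> \<Gamma> Int cball z (2 * R)" using g(1) by simp
   then obtain y where y: "y \<in> X" "dist g y < eps" using X(2) by blast
   then have "dist y x <= 2 * eps" using xg dist_triangle[of y x g] by (simp add: dist_commute)
   then show "x \<in> (\<Union>y\<in>X. cball y (2 * eps))" using y(1) by auto
  qed
  then have "emeasure lborel (collar eps Int cball z R) <= emeasure lborel (\<Union>y\<in>X. cball y (2 * eps))"
   by (intro emeasure_mono) (auto intro!: borel_closed closed_UN X(1))
  also have "... <= (\<Sum>y\<in>X. emeasure lborel (cball y (2 * eps)))"
   by (rule emeasure_subadditive_finite) (auto simp: X(1))
  also have "... <= (\<Sum>y\<in>X. ennreal ((2 * (2 * eps)) ^ CARD('n)))"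
   using eps by (intro sum_mono emeasure_cball_le) simp
  also have "... = ennreal (real (card X) * (4 * eps) ^ CARD('n))"
   using eps by (simp add: ennreal_mult ennreal_of_nat_eq_real_of_nat)
  also have "... <= ennreal ((C * (2 * R / eps) ^ (CARD('n) - 1)) * (4 * eps) ^ CARD('n))"
   using eps X(3) by (intro ennreal_leI mult_right_mono) auto
  also have "(C * (2 * R / eps) ^ (CARD('n) - 1)) * (4 * eps) ^ CARD('n) = C' * eps * R ^ (CARD('n) - 1)"
  proof -
   have "eps ^ CARD('n) = eps * eps ^ (CARD('n) - 1)" by (metis Suc_dimb power_Suc)
   then show ?thesis using eps by (simp add: C'_def power_mult_distrib power_divide)
  qed
  finally show ?thesis .
 qed
 moreover have "0 < C'" using C(1) by (simp add: C'_def)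
 ultimately show ?thesis by (intro exI[of _ C'] conjI allI impI)
qed

text \<open>
  The balls around the points of ever finer nets are admissible covers, of bounded total content.
\<close>

lemma hausdorff_boundary_upper:
 "\<exists>C>0. ALL z R. 0 < R --> hausdorff_outer (CARD('n) - 1) (\<Gamma> Int cball z R) <= ennreal (C * R ^ (CARD('n) - 1))"
proof -
 let ?k = "CARD('n) - 1"
 from ex_net obtain C where C1: "0 < C" and C2: "ALL z r R. 0 < r --> r <= R -->
  (EX X. finite X & X \<subseteq> \<Gamma> Int cball z R & separated r X & (\<forall>x\<in>\<Gamma> Int cball z R. \<exists>y\<in>X. dist x y < r) \<and>
   real (card X) <= C * (R / r) ^ ?k)" by (elim exE conjE)
 note C = C1 C2[rule_format]
 let ?v = "unit_ball_vol (real ?k)"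
 have v: "0 < ?v" by simp
 have "hausdorff_outer ?k (\<Gamma> Int cball z R) <= ennreal (C * ?v * R ^ ?k)" if R: "0 < R" for z R
  unfolding hausdorff_outer_eq
 proof (rule SUP_least)
  fix dlt :: real assume "dlt \<in> {0<..}"
  then have dlt: "0 < dlt" by simp
  define rho where "rho = min R (dlt / 2)"
  have rho: "0 < rho" "rho <= R" "2 * rho <= dlt" using R dlt by (auto simp: rho_def)
  obtain X where X: "finite X" "\<forall>x\<in>\<Gamma> Int cball z R. \<exists>y\<in>X. dist x y < rho"
   "real (card X) <= C * (R / rho) ^ ?k" using C(2)[OF rho(1,2), of z] by blast
  obtain f where f: "bij_betw f {0..<card X} X" using ex_bij_betw_nat_finite[OF X(1)] by blast
  define U where "U i = (if i < card X then cball (f i) rho else {})" for i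
  have "hausdorff_pre ?k dlt (\<Gamma> Int cball z R) <= (\<Sum>i. ennreal (?v * (diameter (U i) / 2) ^ ?k))"
  proof (rule hausdorff_pre_le)
   show "\<Gamma> Int cball z R \<subseteq> (\<Union>i. U i)"
   proof
    fix x assume "x \<in> \<Gamma> Int cball z R"
    then obtain y where y: "y \<in> X" "dist x y < rho" using X(2) by blast
    then have "y \<in> f ` {0..<card X}" using f by (simp add: bij_betw_def)
    then obtain i where "i < card X" "f i = y" by auto
    then have "x \<in> U i" using y(2) by (simp add: U_def dist_commute)
    then show "x \<in> (\<Union>i. U i)" by blast
   qed
   show "bounded (U i)" for i by (simp add: U_def)
   show "diameter (U i) <= dlt" for i using rho dlt by (auto simp: U_def)
  qed
  also have "... = (\<Sum>i<card X. ennreal (?v * (diameter (U i) / 2) ^ ?k))"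
   by (rule suminf_finite) (use dim in "auto simp: U_def power_0_left")
  also have "... = (\<Sum>i<card X. ennreal (?v * rho ^ ?k))"
   by (rule sum.cong) (use rho in "auto simp: U_def")
  also have "... = ennreal (real (card X) * (?v * rho ^ ?k))"
   using rho by (simp add: ennreal_mult ennreal_of_nat_eq_real_of_nat)
  also have "... <= ennreal (C * (R / rho) ^ ?k * (?v * rho ^ ?k))"
   using rho v X(3) by (intro ennreal_leI mult_right_mono) auto
  also have "C * (R / rho) ^ ?k * (?v * rho ^ ?k) = C * ?v * R ^ ?k"
   using rho(1) by (simp add: power_divide)
  finally show "hausdorff_pre ?k dlt (\<Gamma> Int cball z R) <= ennreal (C * ?v * R ^ ?k)" .
 qed
 moreover have "0 < C * ?v" using C(1) v by simp
 ultimately show ?thesis by (intro exI[of _ "C * ?v"] conjI allI impI)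
qed

text \<open>
  The lower bound compares a cover of a piece of the boundary with a cover of a flat box of height 1
  by cylinders over the images under a chart.
\<close>

lemma hausdorff_boundary_lower:
 "\<exists>c>0. \<exists>R0>0. \<forall>x\<in>\<Gamma>. \<forall>r>0. r <= R0 --> ennreal (c * r ^ (CARD('n) - 1)) <= hausdorff_outer (CARD('n) - 1) (\<Gamma> Int ball x r)"
proof -
 let ?k = "CARD('n) - 1"
 obtain A B R0 where AB: "0 < A" "0 < B" "0 < R0" "R0 <= 1 / 2" "!!x. x \<in> \<Gamma> ==> \<exists>psi. chart A B R0 x psi"
  using ex_chart by blast
 define V where "V = unit_ball_vol (real ?k)"
 have v: "0 < V" by (simp add: V_def)
 define q where "q = (4 * B) ^ ?k / V"
 have q: "0 < q" using v AB by (simp add: q_def)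
 define c where "c = (A / real CARD('n)) ^ ?k / q"
 have c: "0 < c" using q AB by (simp add: c_def)
 have "ennreal (c * r ^ ?k) <= hausdorff_outer ?k (\<Gamma> Int ball x r)" if x: "x \<in> \<Gamma>" and r: "0 < r" "r <= R0" for x r
 proof -
  obtain psi where ch: "chart A B R0 x psi" using AB(5)[OF x] by blast
  have r1: "r <= 1" using r AB(4) by simp
  define s where "s = A * r / (2 * real CARD('n))"
  have s: "0 < s" using AB r by (simp add: s_def)
  let ?W = "cbox (\<chi> k. if k = Max UNIV then 0 else psi x $ k - s) (\<chi> k. if k = Max UNIV then 1 else psi x $ k + s)"
  have eW: "emeasure lborel ?W = ennreal ((2 * s) ^ ?k)"
  proof (subst emeasure_lborel_box_prod)
   have "(\<Prod>i\<in>UNIV. (\<chi> k. if k = Max UNIV then 1 else psi x $ k + s) $ i - (\<chi> k. if k = Max UNIV then 0 else psi x $ k - s) $ i)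
    = (\<Prod>i\<in>(UNIV :: 'n set). if i = Max UNIV then 1 else 2 * s)" by (rule prod.cong) auto
   then show "ennreal (\<Prod>i\<in>UNIV. (\<chi> k. if k = Max UNIV then 1 else psi x $ k + s) $ i - (\<chi> k. if k = Max UNIV then 0 else psi x $ k - s) $ i)
    = ennreal ((2 * s) ^ ?k)" by (simp only: prod_if_eq_power)
  qed (use s in auto)
  have key: "ennreal (c * r ^ ?k) <= y" if "hausdorff_pre ?k 1 (\<Gamma> Int ball x r) < y" for y
  proof -
   from hausdorff_pre_less[OF that] obtain U where U: "\<Gamma> Int ball x r \<subseteq> (\<Union>i. U i)"
    "ALL i. bounded (U i) & diameter (U i) <= 1"
    "(\<Sum>i. ennreal (V * (diameter (U i) / 2) ^ ?k)) < y" unfolding V_def by (elim exE conjE)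
   define D where "D i = B * diameter (U i)" for i
   have D: "0 <= D i" for i using AB(2) U(2) by (simp add: D_def diameter_ge_0)
   define u where "u i = (SOME u. u \<in> U i Int (\<Gamma> Int ball x r))" for i
   let ?P = "%i. cbox (\<chi> k. if k = Max UNIV then 0 else psi (u i) $ k - D i) (\<chi> k. if k = Max UNIV then 1 else psi (u i) $ k + D i)"
   have eP: "emeasure lborel (?P i) = ennreal ((2 * D i) ^ ?k)" for i
   proof (subst emeasure_lborel_box_prod)
    have "(\<Prod>j\<in>UNIV. (\<chi> k. if k = Max UNIV then 1 else psi (u i) $ k + D i) $ j - (\<chi> k. if k = Max UNIV then 0 else psi (u i) $ k - D i) $ j)
     = (\<Prod>j\<in>(UNIV :: 'n set). if j = Max UNIV then 1 else 2 * D i)" by (rule prod.cong) auto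
    then show "ennreal (\<Prod>j\<in>UNIV. (\<chi> k. if k = Max UNIV then 1 else psi (u i) $ k + D i) $ j - (\<chi> k. if k = Max UNIV then 0 else psi (u i) $ k - D i) $ j)
     = ennreal ((2 * D i) ^ ?k)" by (simp only: prod_if_eq_power)
   qed (use D in auto)
   have "?W \<subseteq> (\<Union>i. ?P i)"
   proof
    fix w assume w: "w \<in> ?W"
    define w' where "w' = (\<chi> k. if k = Max UNIV then 0 else w $ k)"
    have hx: "height (psi x) = 0" using ch x AB(3) by (simp add: chart_def)
    have "\<bar>(w' - psi x) $ k\<bar> <= s" for k
     using w s hx by (auto simp: w'_def mem_box_cart abs_le_iff algebra_simps dest: spec[of _ k])
    then have "(\<Sum>k\<in>UNIV. \<bar>(w' - psi x) $ k\<bar>) <= (\<Sum>k\<in>(UNIV :: 'n set). s)" by (intro sum_mono)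
    then have "norm (w' - psi x) <= real CARD('n) * s" using norm_le_l1_cart[of "w' - psi x"] by simp
    also have "... = A * r / 2" by (simp add: s_def)
    also have "... < A * r" using AB r by simp
    finally have "w' \<in> ball (psi x) (A * r) Int {y. height y = 0}"
     by (simp add: dist_norm norm_minus_commute w'_def)
    then obtain g where g: "g \<in> ball x r Int \<Gamma>" "w' = psi g" using chart_plane[OF ch AB(1,2) x r r1] by blast
    then obtain i where i: "g \<in> U i" using U(1) by blast
    have "u i \<in> U i Int (\<Gamma> Int ball x r)" unfolding u_def by (rule someI[of _ g]) (use g i in auto)
    then have ui: "u i \<in> U i" "u i \<in> ball x r" by auto
    have "norm (g - u i) <= norm (g - x) + norm (u i - x)" using norm_triangle_ineq4[of "g - x" "u i - x"] by simp
    also have "... <= 1" using g(1) ui(2) r AB(4) by (simp add: dist_norm norm_minus_commute)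
    finally have "norm (psi g - psi (u i)) <= B * norm (g - u i)" using ch unfolding chart_def by simp
    also have "... <= D i" unfolding D_def using diameter_bounded_bound[OF _ i ui(1)] U(2) AB(2) by (simp add: dist_norm)
    finally have comp: "\<bar>(w' - psi (u i)) $ k\<bar> <= D i" for k
     using component_le_norm_cart[of "w' - psi (u i)" k] g(2) by simp
    have "w \<in> ?P i"
     unfolding mem_box_cart
    proof (intro allI)
     fix k
     show "(\<chi> k. if k = Max UNIV then 0 else psi (u i) $ k - D i) $ k <= w $ k & w $ k <= (\<chi> k. if k = Max UNIV then 1 else psi (u i) $ k + D i) $ k"
      using comp[of k] w by (auto simp: w'_def mem_box_cart abs_le_iff split: if_splits dest: spec[of _ k])
    qed
    then show "w \<in> (\<Union>i. ?P i)" by (rule UN_I[OF UNIV_I])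
   qed
   then have "emeasure lborel ?W <= emeasure lborel (\<Union>i. ?P i)" by (intro emeasure_mono) auto
   also have "... <= (\<Sum>i. emeasure lborel (?P i))" by (rule emeasure_subadditive_countably) auto
   also have "... = (\<Sum>i. ennreal q * ennreal (V * (diameter (U i) / 2) ^ ?k))"
   proof (rule suminf_cong)
    fix i
    have "(2 * D i) ^ ?k = q * (V * (diameter (U i) / 2) ^ ?k)"
    proof -
     have "2 * D i = 4 * B * (diameter (U i) / 2)" by (simp add: D_def)
     then show ?thesis using v by (simp only: q_def power_mult_distrib) simp
    qed
    then show "emeasure lborel (?P i) = ennreal q * ennreal (V * (diameter (U i) / 2) ^ ?k)"
     unfolding eP using q v U(2) by (simp only:) (intro ennreal_mult, auto simp: diameter_ge_0)
   qed
   also have "... = ennreal q * (\<Sum>i. ennreal (V * (diameter (U i) / 2) ^ ?k))" by simp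
   also have "... <= ennreal q * y" using U(3) by (intro mult_left_mono) auto
   finally have le: "ennreal ((2 * s) ^ ?k) <= ennreal q * y" unfolding eW .
   have "(2 * s) ^ ?k = q * (c * r ^ ?k)" using q by (simp add: c_def s_def power_mult_distrib power_divide)
   then have "ennreal q * ennreal (c * r ^ ?k) <= ennreal q * y" using le q c r by (simp add: ennreal_mult)
   then show ?thesis using q by (simp add: ennreal_mult_le_mult_iff)
  qed
  have "ennreal (c * r ^ ?k) <= hausdorff_pre ?k 1 (\<Gamma> Int ball x r)" by (rule dense_ge) (rule key)
  also have "... <= hausdorff_outer ?k (\<Gamma> Int ball x r)" by (rule hausdorff_pre_le_outer) simp
  finally show ?thesis .
 qed
 then show ?thesis using c AB(3) by (intro exI[of _ c] exI[of _ R0] conjI ballI allI impI)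
qed

end


section \<open>Lebesgue spaces for all positive exponents\<close>

definition pint :: "real => 'a measure => ('a => complex) => ennreal" where
 "pint p M f = (\<integral>\<^sup>+x. ennreal (cmod (f x) powr p) \<partial>M)"

lemma Lp_norm_pint: "Lp_norm p M f = pint p M f epowr (1 / p)"
 by (simp add: Lp_norm_def pint_def)

lemma epowr_less_iff:
 assumes "0 < a" "0 < e"
 shows "x epowr a < ennreal e \<longleftrightarrow> x < ennreal (e powr (1 / a))"
proof (cases x)
 case (real r)
 have "r powr a < e \<longleftrightarrow> r < e powr (1 / a)"
 proof
  assume "r powr a < e"
  then have "(r powr a) powr (1 / a) < e powr (1 / a)" using assms real by (intro powr_less_mono2) auto
  then show "r < e powr (1 / a)" using assms real by (simp add: powr_powr)
 next
  assume "r < e powr (1 / a)"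
  then have "r powr a < (e powr (1 / a)) powr a" using assms real by (intro powr_less_mono2) auto
  then show "r powr a < e" using assms by (simp add: powr_powr)
 qed
 then show ?thesis using real assms by (simp add: epowr_def ennreal_less_iff)
qed (simp add: epowr_def)

lemma epowr_less_top_iff: "x epowr a < \<infinity> \<longleftrightarrow> x < \<infinity>"
 by (auto simp: epowr_def less_top)

lemma epowr_mono: "x <= y ==> 0 <= a ==> x epowr a <= y epowr a"
proof (cases y)
 case (real r)
 assume xy: "x <= y" "0 <= a"
 then obtain s where "x = ennreal s" "0 <= s" "s <= r" using real by (cases x) (auto simp: top_unique)
 then show ?thesis using real xy by (auto simp: epowr_def intro!: ennreal_leI powr_mono2)
qed (auto simp: epowr_def)

lemma epowr_ennreal: "0 <= r ==> ennreal r epowr a = ennreal (r powr a)"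
 by (simp add: epowr_def)

lemma epowr_zero [simp]: "0 epowr a = 0"
 by (simp add: epowr_def)

lemma epowr_epowr: "0 < a ==> 0 < b ==> (x epowr a) epowr b = x epowr (a * b)"
 by (cases x) (auto simp: epowr_def powr_powr)

lemma epowr_inverse [simp]: "0 < a ==> (x epowr a) epowr (1 / a) = x" "0 < a ==> (x epowr (1 / a)) epowr a = x"
 by (cases x; simp add: epowr_def powr_powr)+

lemma tendsto_0_ennreal_iff:
 fixes u :: "'a => ennreal"
 shows "(u \<longlongrightarrow> 0) F \<longleftrightarrow> (\<forall>e>0. \<forall>\<^sub>F n in F. u n < ennreal e)"
proof
 assume "(u \<longlongrightarrow> 0) F"
 then show "\<forall>e>0. \<forall>\<^sub>F n in F. u n < ennreal e" by (auto intro: order_tendstoD)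
next
 assume H: "\<forall>e>0. \<forall>\<^sub>F n in F. u n < ennreal e"
 show "(u \<longlongrightarrow> 0) F"
 proof (rule order_tendstoI)
  fix a :: ennreal assume a: "0 < a"
  then obtain e where e: "0 < e" "ennreal e <= a"
   by (cases a) (auto simp: ennreal_zero_less_top intro: that[of 1])
  show "\<forall>\<^sub>F n in F. u n < a" using H e by (auto elim!: eventually_mono)
 qed simp
qed

lemma epowr_tendsto_0_iff:
 assumes "0 < a"
 shows "((%n. u n epowr a) \<longlongrightarrow> 0) F \<longleftrightarrow> (u \<longlongrightarrow> 0) F"
proof
 assume H: "((%n. u n epowr a) \<longlongrightarrow> 0) F"
 show "(u \<longlongrightarrow> 0) F"
  unfolding tendsto_0_ennreal_iff
 proof (intro allI impI)
  fix e :: real assume e: "0 < e"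
  then have "\<forall>\<^sub>F n in F. u n epowr a < ennreal (e powr a)"
   using H unfolding tendsto_0_ennreal_iff by auto
  then show "\<forall>\<^sub>F n in F. u n < ennreal e"
   by (rule eventually_mono) (use assms e in "simp add: epowr_less_iff powr_powr")
 qed
next
 assume H: "(u \<longlongrightarrow> 0) F"
 show "((%n. u n epowr a) \<longlongrightarrow> 0) F"
  unfolding tendsto_0_ennreal_iff
 proof (intro allI impI)
  fix e :: real assume e: "0 < e"
  then have "\<forall>\<^sub>F n in F. u n < ennreal (e powr (1 / a))"
   using H unfolding tendsto_0_ennreal_iff by auto
  then show "\<forall>\<^sub>F n in F. u n epowr a < ennreal e"
   by (rule eventually_mono) (use assms e in "simp add: epowr_less_iff")
 qed
qed

lemma Lp_norm_tendsto_0_iff: "0 < p ==> ((%n. Lp_norm p M (f n)) \<longlongrightarrow> 0) F \<longleftrightarrow> ((%n. pint p M (f n)) \<longlongrightarrow> 0) F"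
 by (simp add: Lp_norm_pint epowr_tendsto_0_iff)

lemma mem_Lp_iff: "f \<in> Lp p M \<longleftrightarrow> f \<in> borel_measurable M & pint p M f < \<infinity>"
 unfolding Lp_def Lp_norm_pint mem_Collect_eq epowr_less_top_iff ..

lemma powr_add_le:
 fixes a b p :: real
 assumes "0 <= a" "0 <= b" "0 < p"
 shows "(a + b) powr p <= 2 powr p * (a powr p + b powr p)"
proof -
 have "(a + b) powr p <= (2 * max a b) powr p" using assms by (intro powr_mono2) auto
 also have "... = 2 powr p * max a b powr p" using assms by (simp add: powr_mult)
 also have "... <= 2 powr p * (a powr p + b powr p)" by (intro mult_left_mono) (auto simp: max_def)
 finally show ?thesis .
qed

lemma pint_mono: "(!!x. x \<in> space M ==> cmod (f x) <= cmod (g x)) ==> 0 < p ==> pint p M f <= pint p M g"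
 unfolding pint_def by (intro nn_integral_mono ennreal_leI powr_mono2) auto

lemma pint_zero [simp]: "pint p M (%x. 0) = 0"
 by (simp add: pint_def)

lemma pint_triangle:
 assumes p: "0 < p" and f[measurable]: "f \<in> borel_measurable M" and g[measurable]: "g \<in> borel_measurable M"
  and h: "!!x. x \<in> space M ==> cmod (h x) <= cmod (f x) + cmod (g x)"
 shows "pint p M h <= ennreal (2 powr p) * (pint p M f + pint p M g)"
proof -
 have "pint p M h <= (\<integral>\<^sup>+x. ennreal (2 powr p) * (ennreal (cmod (f x) powr p) + ennreal (cmod (g x) powr p)) \<partial>M)"
  unfolding pint_def
 proof (rule nn_integral_mono)
  fix x assume "x \<in> space M"
  then have "cmod (h x) powr p <= (cmod (f x) + cmod (g x)) powr p" using h p by (intro powr_mono2) auto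
  also have "... <= 2 powr p * (cmod (f x) powr p + cmod (g x) powr p)" by (rule powr_add_le) (use p in auto)
  finally have "ennreal (cmod (h x) powr p) <= ennreal (2 powr p * (cmod (f x) powr p + cmod (g x) powr p))" by (rule ennreal_leI)
  also have "... = ennreal (2 powr p) * (ennreal (cmod (f x) powr p) + ennreal (cmod (g x) powr p))"
   by (simp add: ennreal_mult ennreal_plus[symmetric] del: ennreal_plus)
  finally show "ennreal (cmod (h x) powr p) <= ennreal (2 powr p) * (ennreal (cmod (f x) powr p) + ennreal (cmod (g x) powr p))" .
 qed
 also have "... = ennreal (2 powr p) * (pint p M f + pint p M g)"
  unfolding pint_def by (subst nn_integral_cmult, measurable, subst nn_integral_add) (auto)
 finally show ?thesis .
qed

lemma pint_AE_eq:
 assumes p: "0 < p" and f: "!!k. f k \<in> borel_measurable M" and g: "g \<in> borel_measurable M" and h: "h \<in> borel_measurable M"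
  and lim: "(%k::nat. pint p M (%x. g x - f k x)) ----> 0" "(%k. pint p M (%x. h x - f k x)) ----> 0"
 shows "AE x in M. g x = h x"
proof -
 have "(%k. ennreal (2 powr p) * (pint p M (%x. g x - f k x) + pint p M (%x. h x - f k x))) ----> ennreal (2 powr p) * (0 + 0)"
  by (intro tendsto_intros lim) auto
 moreover have "pint p M (%x. g x - h x) <= ennreal (2 powr p) * (pint p M (%x. g x - f k x) + pint p M (%x. h x - f k x))" for k
 proof (rule pint_triangle[OF p])
  show "cmod (g x - h x) <= cmod (g x - f k x) + cmod (h x - f k x)" for x
   using norm_triangle_ineq4[of "g x - f k x" "h x - f k x"] by simp
 qed (use f g h in auto)
 ultimately have "pint p M (%x. g x - h x) <= 0"
  by (intro LIMSEQ_le_const) auto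
 then have "(\<integral>\<^sup>+x. ennreal (cmod (g x - h x) powr p) \<partial>M) = 0" by (simp add: pint_def)
 then have "AE x in M. ennreal (cmod (g x - h x) powr p) = 0"
  by (subst (asm) nn_integral_0_iff_AE) (use g h in auto)
 then show ?thesis by eventually_elim (auto simp: powr_def split: if_splits)
qed

lemma convergent_geometric:
 fixes f :: "nat => complex"
 assumes "!!i. cmod (f (Suc i) - f i) <= c * q ^ i" "0 <= q" "q < 1"
 shows "convergent f"
proof -
 have "summable (%i. c * q ^ i)" using assms by (intro summable_mult summable_geometric) auto
 then have "summable (%i. f (Suc i) - f i)"
  by (rule summable_comparison_test'[of _ 0]) (use assms in auto)
 then have "convergent (%n. \<Sum>i<n. f (Suc i) - f i)" by (simp add: summable_iff_convergent)
 then have "convergent (%n. f n - f 0)" by (simp add: sum_lessThan_telescope)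
 then show ?thesis by (simp add: convergent_diff_const_right_iff)
qed

text \<open>
  Below exponent 1 there is no norm, but a subsequence can be chosen along which the series of the
  \<open>p\<close>-th powers of the differences, weighted by \<open>2 ^ i\<close>, has a finite integral.
  Where it converges, the differences decay geometrically.
\<close>

lemma Lp_complete:
 assumes p: "0 < p" and f[measurable]: "!!k. f k \<in> borel_measurable M" and fin: "!!k. pint p M (f k) < \<infinity>"
  and cauchy: "!!e. 0 < e ==> EX N. \<forall>k\<ge>N. \<forall>l\<ge>N. pint p M (%x. f k x - f l x) <= ennreal e"
 shows "\<exists>g\<in>Lp p M. (%k. pint p M (%x. g x - f k x)) ----> 0"
proof -
 have "EX N. ALL i. \<forall>k\<ge>N i. \<forall>l\<ge>N i. pint p M (%x. f k x - f l x) <= ennreal ((1 / 4) ^ i)"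
  by (intro choice allI cauchy) simp
 then obtain N where N: "!!i k l. N i <= k ==> N i <= l ==> pint p M (%x. f k x - f l x) <= ennreal ((1 / 4) ^ i)" by blast
 define r where "r i = (\<Sum>j\<le>i. N j) + i" for i
 have r: "N i <= r j" if "i <= j" for i j
 proof -
  have "N i <= (\<Sum>j\<le>j. N j)" by (rule member_le_sum) (use that in auto)
  then show ?thesis by (simp add: r_def)
 qed
 have r_ge: "i <= r i" for i by (simp add: r_def)
 define d where "d i x = f (r (Suc i)) x - f (r i) x" for i x
 have d[measurable]: "d i \<in> borel_measurable M" for i unfolding d_def by measurable
 have "(\<integral>\<^sup>+x. (\<Sum>i. ennreal (2 ^ i * cmod (d i x) powr p)) \<partial>M) = (\<Sum>i. ennreal (2 ^ i) * pint p M (d i))"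
 proof -
  have "(\<integral>\<^sup>+x. ennreal (2 ^ i * cmod (d i x) powr p) \<partial>M) = ennreal (2 ^ i) * pint p M (d i)" for i
   unfolding pint_def by (subst nn_integral_cmult[symmetric]) (measurable, simp add: ennreal_mult)
  moreover have "(\<integral>\<^sup>+x. (\<Sum>i. ennreal (2 ^ i * cmod (d i x) powr p)) \<partial>M) = (\<Sum>i. \<integral>\<^sup>+x. ennreal (2 ^ i * cmod (d i x) powr p) \<partial>M)"
   by (rule nn_integral_suminf) measurable
  ultimately show ?thesis by simp
 qed
 also have "... <= (\<Sum>i. ennreal ((1 / 2) ^ i))"
 proof (intro suminf_le summableI)
  fix i
  have "ennreal (2 ^ i) * pint p M (d i) <= ennreal (2 ^ i) * ennreal ((1 / 4) ^ i)"
   unfolding d_def by (intro mult_left_mono N r) auto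
  also have "... = ennreal ((1 / 2) ^ i)" by (simp add: ennreal_mult[symmetric] power_mult_distrib[symmetric])
  finally show "ennreal (2 ^ i) * pint p M (d i) <= ennreal ((1 / 2) ^ i)" .
 qed
 also have "... = ennreal 2"
  using geometric_sums[of "1 / 2 :: real"] by (intro suminf_ennreal_eq) auto
 finally have le2: "(\<integral>\<^sup>+x. (\<Sum>i. ennreal (2 ^ i * cmod (d i x) powr p)) \<partial>M) <= ennreal 2" .
 have "AE x in M. (\<Sum>i. ennreal (2 ^ i * cmod (d i x) powr p)) ~= \<infinity>"
 proof (rule nn_integral_PInf_AE)
  show "(%x. \<Sum>i. ennreal (2 ^ i * cmod (d i x) powr p)) \<in> borel_measurable M" by measurable
  show "(\<integral>\<^sup>+x. (\<Sum>i. ennreal (2 ^ i * cmod (d i x) powr p)) \<partial>M) ~= \<infinity>"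
   using le_less_trans[OF le2 ennreal_less_top] by simp
 qed
 then have conv: "AE x in M. convergent (%i. f (r i) x)"
 proof eventually_elim
  case (elim x)
  define S where "S = (\<Sum>i. ennreal (2 ^ i * cmod (d i x) powr p))"
  have "S ~= \<infinity>" unfolding S_def by (rule elim)
  then obtain B where B: "0 <= B" "S = ennreal B" by (cases S) auto
  have "cmod (d i x) <= B powr (1 / p) * (2 powr (- 1 / p)) ^ i" for i
  proof -
   have "(\<Sum>j\<in>{i}. ennreal (2 ^ j * cmod (d j x) powr p)) <= ennreal B"
    unfolding B(2)[symmetric] S_def by (rule sum_le_suminf) (auto intro: summableI)
   then have "2 ^ i * cmod (d i x) powr p <= B" using B(1) by simp
   then have "cmod (d i x) powr p <= B * 2 powr (- real i)"
    by (simp add: powr_minus powr_realpow field_simps)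
   then have "(cmod (d i x) powr p) powr (1 / p) <= (B * 2 powr (- real i)) powr (1 / p)"
    using p by (intro powr_mono2) auto
   then show ?thesis using p B(1)
    by (simp add: powr_powr powr_mult powr_realpow[symmetric] mult.commute)
  qed
  then show ?case
   unfolding d_def by (rule convergent_geometric) (use p in "auto simp: powr_less_one")
 qed
 define g where "g x = lim (%i. f (r i) x)" for x
 have g[measurable]: "g \<in> borel_measurable M" unfolding g_def by measurable
 have bound: "pint p M (%x. g x - f k x) <= ennreal ((1 / 4) ^ i)" if k: "N i <= k" for i k
 proof -
  have "pint p M (%x. g x - f k x) <= (\<integral>\<^sup>+x. liminf (%m. ennreal (cmod (f (r m) x - f k x) powr p)) \<partial>M)"
   unfolding pint_def
  proof (rule nn_integral_mono_AE, use conv in eventually_elim)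
   case (elim x)
   then have "(%m. f (r m) x) ----> g x" by (simp add: g_def convergent_LIMSEQ_iff)
   then have "(%m. cmod (f (r m) x - f k x) powr p) ----> cmod (g x - f k x) powr p"
    using p by (intro tendsto_powr2 tendsto_intros) auto
   then have "(%m. ennreal (cmod (f (r m) x - f k x) powr p)) ----> ennreal (cmod (g x - f k x) powr p)"
    by (rule tendsto_ennrealI)
   then have "liminf (%m. ennreal (cmod (f (r m) x - f k x) powr p)) = ennreal (cmod (g x - f k x) powr p)"
    by (intro lim_imp_Liminf) auto
   then show ?case by (simp only: order_refl)
  qed
  also have "... <= liminf (%m. pint p M (%x. f (r m) x - f k x))"
   unfolding pint_def by (rule nn_integral_liminf) measurable
  also have "... <= ennreal ((1 / 4) ^ i)"
  proof (rule Liminf_le)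
   show "\<forall>\<^sub>F m in sequentially. pint p M (%x. f (r m) x - f k x) <= ennreal ((1 / 4) ^ i)"
    using eventually_ge_at_top[of i] by eventually_elim (intro N r k)
  qed simp
  finally show ?thesis .
 qed
 have "(%k. pint p M (%x. g x - f k x)) ----> 0"
  unfolding tendsto_0_ennreal_iff
 proof (intro allI impI)
  fix e :: real assume "0 < e"
  then obtain i where i: "(1 / 4) ^ i < e" using real_arch_pow_inv[of e "1 / 4"] by auto
  show "\<forall>\<^sub>F k in sequentially. pint p M (%x. g x - f k x) < ennreal e"
   using eventually_ge_at_top[of "N i"]
  proof eventually_elim
   case (elim k)
   have "ennreal ((1 / 4) ^ i) < ennreal e" using i \<open>0 < e\<close> by (simp add: ennreal_less_iff)
   then show ?case using bound[OF elim] by (rule le_less_trans[rotated])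
  qed
 qed
 moreover have "pint p M g < \<infinity>"
 proof -
  have "pint p M g <= ennreal (2 powr p) * (pint p M (%x. g x - f (N 0) x) + pint p M (f (N 0)))"
  proof (rule pint_triangle[OF p])
   show "cmod (g x) <= cmod (g x - f (N 0) x) + cmod (f (N 0) x)" for x
    using norm_triangle_ineq[of "g x - f (N 0) x" "f (N 0) x"] by simp
  qed auto
  also have "... < \<infinity>"
   using fin[of "N 0"] bound[of 0 "N 0"] by (auto simp: ennreal_mult_less_top le_less_trans)
  finally show ?thesis .
 qed
 ultimately show ?thesis using g by (auto simp: mem_Lp_iff intro!: bexI[of _ g])
qed

section \<open>Surface measure and averages over collars\<close>

context lipschitz_domain
begin

abbreviation "\<sigma> \<equiv> surface_measure \<Gamma>"
abbreviation "LO \<equiv> lebesgue_on \<Omega>"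

lemma boundary_borel [measurable]: "\<Gamma> \<in> sets borel"
 using compact_boundary by (simp add: borel_closed compact_imp_closed)

lemma domain_borel: "\<Omega> \<in> sets borel"
 using open_domain by (rule borel_open)

lemma domain_lebesgue: "\<Omega> \<in> sets lebesgue"
 using domain_borel by simp

lemma space_surface [simp]: "space \<sigma> = \<Gamma>"
 unfolding surface_measure_def space_completion space_restrict_space space_hausdorff_measure[OF dimb_pos] by simp

lemma borel_measurable_surface:
 fixes f :: "(real, 'n) vec => 'b::topological_space"
 assumes "f \<in> borel_measurable borel" shows "f \<in> borel_measurable \<sigma>"
proof -
 have "f \<in> borel_measurable (hausdorff_measure (CARD('n) - 1))"
  using assms measurable_cong_sets[OF sets_hausdorff_measure[OF dimb_pos] refl] by blast
 then have "f \<in> borel_measurable (restrict_space (hausdorff_measure (CARD('n) - 1)) \<Gamma>)"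
  by (rule measurable_restrict_space1)
 then show ?thesis unfolding surface_measure_def by (rule measurable_completion)
qed

lemma continuous_measurable_surface: "continuous_on UNIV f ==> f \<in> borel_measurable \<sigma>"
 for f :: "(real, 'n) vec => 'b::topological_space"
 by (intro borel_measurable_surface borel_measurable_continuous_onI)

lemma continuous_measurable_domain: "continuous_on UNIV f ==> f \<in> borel_measurable LO"
 for f :: "(real, 'n) vec => complex"
 using borel_measurable_continuous_onI[of f] by (intro measurable_restrict_space1 measurable_completion) simp

lemma emeasure_surface:
 assumes "A \<in> sets borel" shows "emeasure \<sigma> (\<Gamma> Int A) = hausdorff_outer (CARD('n) - 1) (\<Gamma> Int A)"
proof -
 let ?H = "hausdorff_measure (CARD('n) - 1) :: (real, 'n) vec measure"
 have s: "\<Gamma> Int A \<in> sets (restrict_space ?H \<Gamma>)"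
  unfolding sets_restrict_space sets_hausdorff_measure[OF dimb_pos] using assms by blast
 then have "emeasure \<sigma> (\<Gamma> Int A) = emeasure (restrict_space ?H \<Gamma>) (\<Gamma> Int A)"
  unfolding surface_measure_def by simp
 also have "... = emeasure ?H (\<Gamma> Int A)"
  by (rule emeasure_restrict_space) (simp_all only: space_hausdorff_measure[OF dimb_pos] sets_hausdorff_measure[OF dimb_pos] Int_UNIV_right boundary_borel Int_lower1)
 also have "... = hausdorff_outer (CARD('n) - 1) (\<Gamma> Int A)"
  using assms by (intro emeasure_hausdorff_measure dimb_pos) auto
 finally show ?thesis .
qed

lemma finite_surface: "emeasure \<sigma> \<Gamma> < \<infinity>"
proof -
 from hausdorff_boundary_upper obtain C where C: "ALL z R. 0 < R --> hausdorff_outer (CARD('n) - 1) (\<Gamma> Int cball z R) <= ennreal (C * R ^ (CARD('n) - 1))"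
  by (elim exE conjE)
 obtain B where B: "0 < B" "\<Gamma> \<subseteq> cball 0 B"
  using compact_imp_bounded[OF compact_boundary] by (auto simp: bounded_pos subset_iff)
 then have "\<Gamma> Int cball 0 B = \<Gamma>" by blast
 then have "emeasure \<sigma> \<Gamma> <= ennreal (C * B ^ (CARD('n) - 1))"
  using emeasure_surface[of "cball 0 B"] C[rule_format, OF B(1), of 0] by simp
 then show ?thesis by (rule le_less_trans) simp
qed

lemma pint_surface_continuous_finite:
 fixes f :: "(real, 'n) vec => complex"
 assumes p: "0 < p" and f: "continuous_on UNIV f" shows "pint p \<sigma> f < \<infinity>"
proof -
 have "compact (f ` \<Gamma>)" by (intro compact_continuous_image continuous_on_subset[OF f] compact_boundary) auto
 then obtain B where B: "!!x. x \<in> \<Gamma> ==> cmod (f x) <= B" using compact_imp_bounded bounded_iff by (metis imageI)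
 have "pint p \<sigma> f <= (\<integral>\<^sup>+x. ennreal (B powr p) \<partial>\<sigma>)"
  unfolding pint_def by (intro nn_integral_mono ennreal_leI powr_mono2) (use p B in auto)
 also have "... < \<infinity>" using finite_surface by (simp add: ennreal_mult_less_top)
 finally show ?thesis .
qed

text \<open>
  A substitute for the integral over the boundary that is defined for functions on the domain.
\<close>

definition avg :: "real => real => ((real, 'n) vec => complex) => ennreal" where
 "avg p eps h = ennreal (1 / eps) * pint p LO (%x. h x * indicator (collar eps) x)"

text \<open>
  Stated for small widths rather than as an upper limit, so that it can be combined with inequalities at a
  fixed width.
\<close>

definition collar_bound :: "real => ((real, 'n) vec => complex) => ennreal => bool" where
 "collar_bound p h M \<longleftrightarrow> (\<forall>\<^sub>F eps in at_right 0. avg p eps h <= M)"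

lemma collar_measurable [measurable]: "collar eps \<in> sets borel"
 using open_collar by (rule borel_open)

lemma indicator_collar_measurable: "(%x. indicator (collar eps) x :: complex) \<in> borel_measurable LO"
proof -
 have "(%x. indicator (collar eps) x :: complex) \<in> borel_measurable borel" by measurable
 then show ?thesis by (intro measurable_restrict_space1 measurable_completion) simp
qed

lemma avg_triangle:
 assumes p: "0 < p" and f: "f \<in> borel_measurable LO" and g: "g \<in> borel_measurable LO"
  and h: "!!x. cmod (h x) <= cmod (f x) + cmod (g x)"
 shows "avg p eps h <= ennreal (2 powr p) * (avg p eps f + avg p eps g)"
proof -
 have "pint p LO (%x. h x * indicator (collar eps) x) <= ennreal (2 powr p) *
   (pint p LO (%x. f x * indicator (collar eps) x) + pint p LO (%x. g x * indicator (collar eps) x))"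
  by (intro pint_triangle p borel_measurable_times f g indicator_collar_measurable)
    (use h in "auto simp: norm_mult indicator_def")
 then have "avg p eps h <= ennreal (1 / eps) * (ennreal (2 powr p) *
   (pint p LO (%x. f x * indicator (collar eps) x) + pint p LO (%x. g x * indicator (collar eps) x)))"
  unfolding avg_def by (rule mult_left_mono) simp
 then show ?thesis unfolding avg_def by (simp add: distrib_left mult_ac)
qed

lemma collar_bound_triangle:
 assumes "0 < p" "f \<in> borel_measurable LO" "g \<in> borel_measurable LO"
  "!!x. cmod (h x) <= cmod (f x) + cmod (g x)" and f: "collar_bound p f M" and g: "collar_bound p g N"
 shows "collar_bound p h (ennreal (2 powr p) * (M + N))"
 using f g unfolding collar_bound_def
proof eventually_elim
 case (elim eps)
 show ?case
  by (rule order_trans[OF avg_triangle[OF assms(1-4)]]) (intro mult_left_mono add_mono elim, simp)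
qed

lemma collar_bound_mono: "collar_bound p h M ==> M <= N ==> collar_bound p h N"
 unfolding collar_bound_def by (auto elim!: eventually_mono intro: order_trans)

end


lemma powr_sum_le_weighted:
 fixes a b s t p :: real
 assumes ab: "0 <= a" "0 <= b" and st: "0 < s" "0 < t" and p: "1 <= p"
 shows "(a + b) powr p <= (s + t) powr (p - 1) * (s powr (1 - p) * a powr p + t powr (1 - p) * b powr p)"
proof -
 have one: "x powr p <= (s + t) powr (p - 1) * (u powr (1 - p) * x powr p)" if "0 < u" "u <= s + t" "0 <= x" for u x
 proof -
  have "1 = u powr (p - 1) * u powr (1 - p)" using that by (simp add: powr_add[symmetric])
  also have "... <= (s + t) powr (p - 1) * u powr (1 - p)" using that p by (intro mult_right_mono powr_mono2) auto
  finally have "1 * x powr p <= ((s + t) powr (p - 1) * u powr (1 - p)) * x powr p" by (intro mult_right_mono) auto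
  then show ?thesis by (simp add: mult.assoc)
 qed
 consider "a = 0" | "b = 0" | "0 < a" "0 < b" using ab by fastforce
 then show ?thesis
 proof cases
  case 1
  then show ?thesis using one[of t b] st ab by simp
 next
  case 2
  then show ?thesis using one[of s a] st ab by simp
 next
  case 3
  let ?w = "t / (s + t)"
  have w: "0 <= ?w" "?w <= 1" "1 - ?w = s / (s + t)" using st by (auto simp: field_simps)
  have "((1 - ?w) *\<^sub>R (a / s) + ?w *\<^sub>R (b / t)) powr p <= (1 - ?w) * (a / s) powr p + ?w * (b / t) powr p"
   using convex_onD[OF powr_convex[OF p], of ?w "a / s" "b / t"] w(1,2) 3 st by simp
  moreover have "(1 - ?w) *\<^sub>R (a / s) + ?w *\<^sub>R (b / t) = (a + b) / (s + t)"
   using st unfolding w(3) by (simp add: add_divide_distrib)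
  ultimately have "((a + b) / (s + t)) powr p <= s / (s + t) * (a / s) powr p + t / (s + t) * (b / t) powr p"
   unfolding w(3) by simp
  then have "(s + t) powr p * ((a + b) / (s + t)) powr p <= (s + t) powr p * (s / (s + t) * (a / s) powr p + t / (s + t) * (b / t) powr p)"
   by (intro mult_left_mono) auto
  also have "(s + t) powr p * ((a + b) / (s + t)) powr p = (a + b) powr p"
   using st 3 by (simp add: powr_mult[symmetric])
  also have "(s + t) powr p = (s + t) powr (p - 1) * (s + t)" using st by (simp add: powr_diff)
  also have "(s + t) powr (p - 1) * (s + t) * (s / (s + t) * (a / s) powr p + t / (s + t) * (b / t) powr p)
   = (s + t) powr (p - 1) * (s * (a / s) powr p + t * (b / t) powr p)"
  proof -
   have "P * T * (s / T * X + t / T * Y) = P * (s * X + t * Y)" if "T ~= 0" for P T X Y :: real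
    using that by (simp add: field_simps)
   moreover have "s + t ~= 0" using st by simp
   ultimately show ?thesis by blast
  qed
  also have "s * (a / s) powr p = s powr (1 - p) * a powr p"
   using st 3 by (simp add: powr_divide powr_diff)
  also have "t * (b / t) powr p = t powr (1 - p) * b powr p"
   using st 3 by (simp add: powr_divide powr_diff)
  finally show ?thesis .
 qed
qed

lemma pint_eq_0_imp_AE:
 assumes "f \<in> borel_measurable M" "pint p M f = 0"
 shows "AE x in M. f x = 0"
proof -
 have "AE x in M. ennreal (cmod (f x) powr p) = 0"
  using assms by (subst (asm) pint_def, subst (asm) nn_integral_0_iff_AE) auto
 then show ?thesis by eventually_elim (auto simp: powr_def split: if_splits)
qed

text \<open>Minkowski's inequality for two functions, from the convexity of the power.\<close>

lemma pint_add_Minkowski: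
 assumes p: "1 <= p" and f[measurable]: "f \<in> borel_measurable M" and g[measurable]: "g \<in> borel_measurable M"
  and fs: "pint p M f <= ennreal (s powr p)" and gt: "pint p M g <= ennreal (t powr p)" and st: "0 <= s" "0 <= t"
 shows "pint p M (%x. f x + g x) <= ennreal ((s + t) powr p)"
proof -
 consider "s = 0" | "t = 0" | "0 < s" "0 < t" using st by fastforce
 then show ?thesis
 proof cases
  case 1
  then have "AE x in M. f x = 0" using fs p by (intro pint_eq_0_imp_AE[of _ _ p]) auto
  then have "pint p M (%x. f x + g x) = pint p M g"
   unfolding pint_def by (intro nn_integral_cong_AE) (auto elim!: eventually_mono)
  then show ?thesis using gt 1 by simp
 next
  case 2
  then have "AE x in M. g x = 0" using gt p by (intro pint_eq_0_imp_AE[of _ _ p]) auto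
  then have "pint p M (%x. f x + g x) = pint p M f"
   unfolding pint_def by (intro nn_integral_cong_AE) (auto elim!: eventually_mono)
  then show ?thesis using fs 2 by simp
 next
  case 3
  let ?a = "(s + t) powr (p - 1) * s powr (1 - p)" and ?b = "(s + t) powr (p - 1) * t powr (1 - p)"
  have "pint p M (%x. f x + g x) <= (\<integral>\<^sup>+x. ennreal ?a * ennreal (cmod (f x) powr p) + ennreal ?b * ennreal (cmod (g x) powr p) \<partial>M)"
   unfolding pint_def
  proof (rule nn_integral_mono)
   fix x
   have "cmod (f x + g x) powr p <= (cmod (f x) + cmod (g x)) powr p"
    using p by (intro powr_mono2 norm_triangle_ineq) auto
   also have "... <= ?a * cmod (f x) powr p + ?b * cmod (g x) powr p"
    using powr_sum_le_weighted[of "cmod (f x)" "cmod (g x)" s t p] 3 p by (simp add: distrib_left mult.assoc)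
   finally have "ennreal (cmod (f x + g x) powr p) <= ennreal (?a * cmod (f x) powr p + ?b * cmod (g x) powr p)" by (rule ennreal_leI)
   also have "... = ennreal ?a * ennreal (cmod (f x) powr p) + ennreal ?b * ennreal (cmod (g x) powr p)"
    by (subst ennreal_plus) (auto simp: ennreal_mult)
   finally show "ennreal (cmod (f x + g x) powr p) <= ennreal ?a * ennreal (cmod (f x) powr p) + ennreal ?b * ennreal (cmod (g x) powr p)" .
  qed
  also have "... = ennreal ?a * pint p M f + ennreal ?b * pint p M g"
   unfolding pint_def by (subst nn_integral_add) (auto simp: nn_integral_cmult)
  also have "... <= ennreal ?a * ennreal (s powr p) + ennreal ?b * ennreal (t powr p)"
   by (intro add_mono mult_left_mono fs gt) auto
  also have "... = ennreal (?a * s powr p + ?b * t powr p)"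
   by (subst ennreal_plus) (auto simp: ennreal_mult)
  also have "?a * s powr p + ?b * t powr p = (s + t) powr p"
  proof -
   have "s powr (1 - p) * s powr p = s" "t powr (1 - p) * t powr p = t"
    using 3 by (simp_all add: powr_add[symmetric])
   then have "?a * s powr p + ?b * t powr p = (s + t) powr (p - 1) * (s + t)"
    by (simp add: mult.assoc distrib_left)
   also have "... = (s + t) powr p" using 3 by (simp add: powr_diff)
   finally show ?thesis .
  qed
  finally show ?thesis .
 qed
qed

lemma pint_sum_Minkowski:
 assumes p: "1 <= p" and fin: "finite I" and f: "!!i. i \<in> I ==> f i \<in> borel_measurable M"
  and le: "!!i. i \<in> I ==> pint p M (f i) <= ennreal (t i powr p)" and t: "!!i. i \<in> I ==> 0 <= t i"
 shows "pint p M (%x. \<Sum>i\<in>I. f i x) <= ennreal ((\<Sum>i\<in>I. t i) powr p)"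
 using fin f le t
proof (induction I rule: finite_induct)
 case (insert i I)
 then show ?case by (auto intro!: pint_add_Minkowski p borel_measurable_sum sum_nonneg)
qed simp

lemma powr_sum_le:
 fixes a :: "'i => real"
 assumes "finite I" "!!i. i \<in> I ==> 0 <= a i" "0 < p" "p <= 1"
 shows "(\<Sum>i\<in>I. a i) powr p <= (\<Sum>i\<in>I. a i powr p)"
proof -
 have two: "(x + y) powr p <= x powr p + y powr p" if xy: "0 <= x" "0 <= y" for x y :: real
 proof (cases "x + y = 0")
  case False
  then have s: "0 < x + y" using xy by linarith
  have le: "u / (x + y) <= (u / (x + y)) powr p" if "0 <= u" "u <= x + y" for u
  proof (cases "u = 0")
   case False
   then show ?thesis using powr_mono'[of p 1 "u / (x + y)"] that s assms by simp
  qed simp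
  have "1 = x / (x + y) + y / (x + y)" using s by (simp add: add_divide_distrib[symmetric])
  also have "... <= (x / (x + y)) powr p + (y / (x + y)) powr p" using le[of x] le[of y] xy by simp
  finally have "(x + y) powr p * 1 <= (x + y) powr p * ((x / (x + y)) powr p + (y / (x + y)) powr p)"
   by (intro mult_left_mono) auto
  then show ?thesis using s xy by (simp add: distrib_left powr_divide)
 qed (use xy in simp)
 show ?thesis using assms(1,2)
 proof (induction I rule: finite_induct)
  case (insert i I)
  have "(a i + (\<Sum>i\<in>I. a i)) powr p <= a i powr p + (\<Sum>i\<in>I. a i) powr p"
   using insert by (intro two sum_nonneg) auto
  with insert show ?case by auto
 qed (use assms in simp)
qed

lemma pint_sum_le:
 assumes p: "0 < p" "p <= 1" and fin: "finite I" and f: "!!i. i \<in> I ==> f i \<in> borel_measurable M"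
 shows "pint p M (%x. \<Sum>i\<in>I. f i x) <= (\<Sum>i\<in>I. pint p M (f i))"
proof -
 have "pint p M (%x. \<Sum>i\<in>I. f i x) <= (\<integral>\<^sup>+x. (\<Sum>i\<in>I. ennreal (cmod (f i x) powr p)) \<partial>M)"
  unfolding pint_def
 proof (rule nn_integral_mono)
  fix x
  have "cmod (\<Sum>i\<in>I. f i x) powr p <= (\<Sum>i\<in>I. cmod (f i x)) powr p"
   using p by (intro powr_mono2 norm_sum) auto
  also have "... <= (\<Sum>i\<in>I. cmod (f i x) powr p)" by (rule powr_sum_le) (use fin p in auto)
  finally show "ennreal (cmod (\<Sum>i\<in>I. f i x) powr p) <= (\<Sum>i\<in>I. ennreal (cmod (f i x) powr p))"
   by (simp add: ennreal_leI sum_ennreal)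
 qed
 also have "... = (\<Sum>i\<in>I. pint p M (f i))"
  unfolding pint_def by (rule nn_integral_sum) (use f in auto)
 finally show ?thesis .
qed

context lipschitz_domain
begin

section \<open>Boundary integrals of continuous functions\<close>

text \<open>
  Around the points of a separated net of the boundary, the corkscrew condition supplies disjoint
  balls inside the domain and the collar whose volume is comparable to the radius times the surface
  measure of a boundary ball; on both a continuous function is nearly constant.
\<close>

lemma pint_surface_le_collar:
 "\<exists>C>0. \<forall>p phi M. 0 < p --> continuous_on UNIV phi --> collar_bound p phi M --> pint p \<sigma> phi <= ennreal C * M"
proof -
 let ?k = "CARD('n) - 1"
 from hausdorff_boundary_upper obtain Cu where Cu: "0 < Cu" and Cu': "ALL z R. 0 < R --> hausdorff_outer ?k (\<Gamma> Int cball z R) <= ennreal (Cu * R ^ ?k)"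
  by (elim exE conjE)
 obtain c R0 where c: "0 < c" "0 < R0" and cork: "!!x r. x \<in> \<Gamma> ==> 0 < r ==> r <= R0 ==> EX x'. ball x' (c * r) \<subseteq> \<Omega> Int ball x r"
  using ex_corkscrew by blast
 from emeasure_collar obtain Cv where Cv: "0 < Cv" and Cv': "ALL z eps R. 0 < eps --> eps <= R -->
   emeasure lborel (collar eps Int cball z R) <= ennreal (Cv * eps * R ^ ?k)" by (elim exE conjE)
 from ex_net obtain Cn where Cn: "ALL z r R. 0 < r --> r <= R -->
  (EX X. finite X & X \<subseteq> \<Gamma> Int cball z R & separated r X & (\<forall>x\<in>\<Gamma> Int cball z R. \<exists>y\<in>X. dist x y < r) \<and>
   real (card X) <= Cn * (R / r) ^ ?k)" by (elim exE conjE)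
 obtain B where B: "0 < B" "\<Gamma> \<subseteq> cball 0 B"
  using compact_imp_bounded[OF compact_boundary] by (auto simp: bounded_pos subset_iff)
 define V where "V = unit_ball_vol (real CARD('n)) * (c / 2) ^ CARD('n)"
 have V: "0 < V" using c by (simp add: V_def)
 define K where "K = Cu / V"
 have K: "0 < K" using Cu V by (simp add: K_def)
 have main: "pint p \<sigma> phi <= ennreal K * M" if p: "0 < p" and phi: "continuous_on UNIV phi" and M: "collar_bound p phi M" for p phi M
 proof -
  define w where "w x = cmod (phi x) powr p" for x
  have w: "continuous_on UNIV w" unfolding w_def using p by (intro continuous_on_powr' continuous_intros phi) auto
  have w0: "0 <= w x" for x by (simp add: w_def)
  have wm[measurable]: "w \<in> borel_measurable borel" by (rule borel_measurable_continuous_onI[OF w])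
  define D where "D = Cv * (2 * B + 2) ^ ?k"
  have D: "0 <= D" using Cv B by (simp add: D_def)
  have approx: "pint p \<sigma> phi <= ennreal K * M + ennreal (K * (2 * eta * D))" if eta: "0 < eta" for eta
  proof -
   have "uniformly_continuous_on (cball 0 (B + 1)) w"
    by (intro compact_uniformly_continuous continuous_on_subset[OF w]) auto
   then obtain dlt where dlt: "0 < dlt" "!!x y. x \<in> cball 0 (B + 1) ==> y \<in> cball 0 (B + 1) ==> dist y x < dlt ==> dist (w y) (w x) < eta"
    using eta unfolding uniformly_continuous_on_def by meson
   have "\<forall>\<^sub>F eps in at_right 0. eps < min (min dlt 1) (min R0 B)"
    using dlt(1) c B by (intro eventually_at_rightI[of 0 "min (min dlt 1) (min R0 B)"]) auto
   moreover have "\<forall>\<^sub>F eps in at_right (0::real). 0 < eps" by (simp add: eventually_at_filter)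
   ultimately have "\<forall>\<^sub>F eps in at_right 0. avg p eps phi <= M & eps < min (min dlt 1) (min R0 B) & 0 < eps"
    using M unfolding collar_bound_def by eventually_elim auto
   then obtain eps where eps: "avg p eps phi <= M" "eps < dlt" "eps < 1" "eps < R0" "eps < B" "0 < eps"
    using eventually_happens'[OF trivial_limit_at_right_real] by fastforce
   have "eps <= B" using eps by simp
   from Cn[rule_format, OF eps(6) this, of 0] obtain X where X: "finite X" "X \<subseteq> \<Gamma>" "separated eps X"
    "\<forall>x\<in>\<Gamma> Int cball 0 B. \<exists>y\<in>X. dist x y < eps" by blast
   have net: "\<exists>y\<in>X. dist x y < eps" if "x \<in> \<Gamma>" for x using X(4) that B by blast
   have "EX x'. ball x' (c * (eps / 2)) \<subseteq> \<Omega> Int ball x (eps / 2)" if "x \<in> X" for x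
    using cork[of x "eps / 2"] that X(2) eps by auto
   then obtain q where q: "!!x. x \<in> X ==> ball (q x) (c * (eps / 2)) \<subseteq> \<Omega> Int ball x (eps / 2)" by metis
   define Bx where "Bx x = ball (q x) (c * (eps / 2))" for x
   have Bx: "Bx x \<subseteq> \<Omega> Int ball x (eps / 2)" if "x \<in> X" for x using q[OF that] by (simp add: Bx_def)
   have eBx: "emeasure lborel (Bx x) = ennreal (V * eps ^ CARD('n))" for x
    unfolding Bx_def using c eps by (subst emeasure_ball) (auto simp: V_def power_mult_distrib power_divide)
   have inG: "x \<in> cball 0 (B + 1)" if "x \<in> \<Gamma>" for x using B that by auto
   have near: "w y <= w x + eta" "w x <= w y + eta" if "x \<in> \<Gamma>" "dist y x <= eps" for x y
   proof -
    have "norm x <= B" using B(2) that(1) by auto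
    then have "y \<in> cball 0 (B + 1)" using that(2) eps norm_triangle_ineq2[of y x] by (simp add: dist_norm)
    then have "dist (w y) (w x) < eta" using dlt(2)[OF inG[OF that(1)], of y] that(2) eps by simp
    then show "w y <= w x + eta" "w x <= w y + eta" by (auto simp: dist_real_def abs_less_iff)
   qed
   have disj: "Bx x Int Bx y = {}" if xy: "x \<in> X" "y \<in> X" "x ~= y" for x y
   proof (rule ccontr)
    assume "Bx x Int Bx y ~= {}"
    then obtain u where "u \<in> Bx x" "u \<in> Bx y" by blast
    then have "dist x u < eps / 2" "dist y u < eps / 2" using Bx[OF xy(1)] Bx[OF xy(2)] by auto
    then have "dist x y < eps" using dist_triangle2[of x y u] by simp
    moreover have "eps <= dist x y" using X(3) xy unfolding separated_def by blast
    ultimately show False by simp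
   qed
   have "pint p \<sigma> phi = (\<integral>\<^sup>+y. ennreal (w y) \<partial>\<sigma>)" by (simp add: pint_def w_def)
   also have "... <= (\<integral>\<^sup>+y. (\<Sum>x\<in>X. ennreal (w x + eta) * indicator (\<Gamma> Int cball x eps) y) \<partial>\<sigma>)"
   proof (rule nn_integral_mono)
    fix y assume "y \<in> space \<sigma>"
    then have y: "y \<in> \<Gamma>" by simp
    then obtain x where x: "x \<in> X" "dist y x < eps" using net by blast
    have "ennreal (w y) <= ennreal (w x + eta) * indicator (\<Gamma> Int cball x eps) y"
     using near(1)[of x y] x X(2) y by (auto simp: dist_commute intro!: ennreal_leI)
    also have "... <= (\<Sum>x\<in>X. ennreal (w x + eta) * indicator (\<Gamma> Int cball x eps) y)"
     using x(1) X(1) by (intro member_le_sum) auto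
    finally show "ennreal (w y) <= (\<Sum>x\<in>X. ennreal (w x + eta) * indicator (\<Gamma> Int cball x eps) y)" .
   qed
   also have "... = (\<Sum>x\<in>X. ennreal (w x + eta) * emeasure \<sigma> (\<Gamma> Int cball x eps))"
   proof -
    have s: "\<Gamma> Int cball x eps \<in> sets \<sigma>" for x
    proof -
     have "(%x. x) \<in> measurable \<sigma> (borel :: (real, 'n) vec measure)" by (rule borel_measurable_surface) simp
     from measurable_sets[OF this, of "cball x eps"] show ?thesis by (simp add: Int_commute)
    qed
    then show ?thesis by (subst nn_integral_sum) (auto simp: nn_integral_cmult_indicator)
   qed
   also have "... <= (\<Sum>x\<in>X. ennreal (w x + eta) * ennreal (Cu * eps ^ ?k))"
    using Cu'[rule_format, OF eps(6)] by (intro sum_mono mult_left_mono) (simp_all add: emeasure_surface)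
   also have "... = (\<Sum>x\<in>X. ennreal (K / eps) * (ennreal (w x + eta) * emeasure lborel (Bx x)))"
   proof (rule sum.cong[OF refl])
    fix x
    have "Cu * eps ^ ?k = K / eps * (V * eps ^ CARD('n))"
    proof -
     have "eps ^ CARD('n) = eps * eps ^ ?k" by (metis Suc_dimb power_Suc)
     then show ?thesis using V eps by (simp add: K_def)
    qed
    moreover have "ennreal (K / eps * (V * eps ^ CARD('n))) = ennreal (K / eps) * ennreal (V * eps ^ CARD('n))"
     by (rule ennreal_mult) (use K V eps in auto)
    ultimately have "ennreal (Cu * eps ^ ?k) = ennreal (K / eps) * ennreal (V * eps ^ CARD('n))" by (simp only:)
    then show "ennreal (w x + eta) * ennreal (Cu * eps ^ ?k) = ennreal (K / eps) * (ennreal (w x + eta) * emeasure lborel (Bx x))"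
     unfolding eBx by (simp only: mult_ac)
   qed
   also have "... = ennreal (K / eps) * (\<Sum>x\<in>X. ennreal (w x + eta) * emeasure lborel (Bx x))"
    by (rule sum_distrib_left[symmetric])
   also have "... <= ennreal (K / eps) * (\<integral>\<^sup>+y. ennreal (w y + 2 * eta) * indicator (\<Omega> Int collar eps Int cball 0 (2 * B + 2)) y \<partial>lborel)"
   proof (rule mult_left_mono)
    have "(\<Sum>x\<in>X. ennreal (w x + eta) * emeasure lborel (Bx x)) = (\<integral>\<^sup>+y. (\<Sum>x\<in>X. ennreal (w x + eta) * indicator (Bx x) y) \<partial>lborel)"
    proof -
     have [measurable]: "Bx x \<in> sets borel" for x by (simp add: Bx_def)
     show ?thesis by (subst nn_integral_sum) (auto simp: nn_integral_cmult_indicator)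
    qed
    also have "... <= (\<integral>\<^sup>+y. ennreal (w y + 2 * eta) * indicator (\<Omega> Int collar eps Int cball 0 (2 * B + 2)) y \<partial>lborel)"
    proof (rule nn_integral_mono)
     fix y
     show "(\<Sum>x\<in>X. ennreal (w x + eta) * indicator (Bx x) y) <= ennreal (w y + 2 * eta) * indicator (\<Omega> Int collar eps Int cball 0 (2 * B + 2)) y"
     proof (cases "\<exists>x\<in>X. y \<in> Bx x")
      case True
      then obtain x where x: "x \<in> X" "y \<in> Bx x" by blast
      have "(\<Sum>z\<in>X. ennreal (w z + eta) * indicator (Bx z) y) = (\<Sum>z\<in>{x}. ennreal (w z + eta) * indicator (Bx z) y)"
       using x X(1) disj by (intro sum.mono_neutral_right) (auto simp: indicator_def)
      also have "... = ennreal (w x + eta)" using x by simp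
      also have "... <= ennreal (w y + 2 * eta)"
      proof (rule ennreal_leI)
       have "y \<in> ball x (eps / 2)" using Bx[OF x(1)] x(2) by blast
       then have "dist y x <= eps" using eps(6) by (simp add: dist_commute)
       moreover have "x \<in> \<Gamma>" using x(1) X(2) by blast
       ultimately show "w x + eta <= w y + 2 * eta" using near(2)[of x y] by simp
      qed
      also have "y \<in> \<Omega> Int collar eps Int cball 0 (2 * B + 2)"
      proof -
       have "y \<in> \<Omega> Int ball x (eps / 2)" using Bx[OF x(1)] x(2) by blast
       then have d: "dist x y < eps" "y \<in> \<Omega>" using eps(6) by auto
       then have "infdist y \<Gamma> < eps" using infdist_le[of x \<Gamma> y] x(1) X(2) by (auto simp: dist_commute)
       moreover have "norm x <= B" using x(1) X(2) B by auto
       then have "norm y <= 2 * B + 2" using d eps B norm_triangle_ineq2[of y x] by (simp add: dist_norm norm_minus_commute)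
       ultimately show ?thesis using d by (simp add: collar_def)
      qed
      then have "ennreal (w y + 2 * eta) = ennreal (w y + 2 * eta) * indicator (\<Omega> Int collar eps Int cball 0 (2 * B + 2)) y" by simp
      finally show ?thesis .
     next
      case False
      then have "(\<Sum>x\<in>X. ennreal (w x + eta) * indicator (Bx x) y) = 0" by (intro sum.neutral) auto
      then show ?thesis by simp
     qed
    qed
    finally show "(\<Sum>x\<in>X. ennreal (w x + eta) * emeasure lborel (Bx x)) <= (\<integral>\<^sup>+y. ennreal (w y + 2 * eta) * indicator (\<Omega> Int collar eps Int cball 0 (2 * B + 2)) y \<partial>lborel)" .
   qed simp
   also have "... <= ennreal (K / eps) * (ennreal eps * avg p eps phi + ennreal (2 * eta * (D * eps)))"
   proof (rule mult_left_mono)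
    have sets1[measurable]: "\<Omega> \<in> sets borel" by (rule domain_borel)
    have "(\<integral>\<^sup>+y. ennreal (w y + 2 * eta) * indicator (\<Omega> Int collar eps Int cball 0 (2 * B + 2)) y \<partial>lborel)
      <= (\<integral>\<^sup>+y. ennreal (w y) * indicator (collar eps) y * indicator \<Omega> y + ennreal (2 * eta) * indicator (collar eps Int cball 0 (2 * B + 2)) y \<partial>lborel)"
     by (rule nn_integral_mono) (use w0 eta in "auto simp: indicator_def")
    also have "... = (\<integral>\<^sup>+y. ennreal (w y) * indicator (collar eps) y * indicator \<Omega> y \<partial>lborel) + ennreal (2 * eta) * emeasure lborel (collar eps Int cball 0 (2 * B + 2))"
    proof -
     have cm[measurable]: "collar eps Int cball 0 (2 * B + 2) \<in> sets borel" by (intro sets.Int collar_measurable) simp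
     have 1: "(%y. ennreal (w y) * indicator (collar eps) y * indicator \<Omega> y) \<in> borel_measurable lborel"
      by (intro borel_measurable_times_ennreal borel_measurable_indicator measurable_compose[OF _ measurable_ennreal])
        (use wm sets1 collar_measurable in simp_all)
     have 2: "(%y. ennreal (2 * eta) * indicator (collar eps Int cball 0 (2 * B + 2)) y) \<in> borel_measurable lborel"
      by (intro borel_measurable_times_ennreal borel_measurable_const borel_measurable_indicator) (use cm in simp)
     show ?thesis unfolding nn_integral_add[OF 1 2] using cm by (simp add: nn_integral_cmult_indicator)
    qed
    also have "(\<integral>\<^sup>+y. ennreal (w y) * indicator (collar eps) y * indicator \<Omega> y \<partial>lborel) = pint p LO (%x. phi x * indicator (collar eps) x)"
    proof -
     have "pint p LO (%x. phi x * indicator (collar eps) x) = (\<integral>\<^sup>+y. ennreal (w y) * indicator (collar eps) y * indicator \<Omega> y \<partial>lebesgue)"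
      unfolding pint_def
      by (subst nn_integral_restrict_space) (use domain_lebesgue p in "auto simp: w_def norm_mult indicator_def intro!: nn_integral_cong")
     then show ?thesis by (simp add: nn_integral_completion)
    qed
    also have "... = ennreal eps * avg p eps phi"
     using eps(6) by (simp add: avg_def mult.assoc[symmetric] ennreal_mult[symmetric])
    also have "emeasure lborel (collar eps Int cball 0 (2 * B + 2)) <= ennreal (Cv * eps * (2 * B + 2) ^ ?k)"
     using Cv'[rule_format, of eps "2 * B + 2" 0] eps by simp
    also have "Cv * eps * (2 * B + 2) ^ ?k = D * eps" by (simp add: D_def)
    finally show "(\<integral>\<^sup>+y. ennreal (w y + 2 * eta) * indicator (\<Omega> Int collar eps Int cball 0 (2 * B + 2)) y \<partial>lborel) <= ennreal eps * avg p eps phi + ennreal (2 * eta * (D * eps))"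
     using eta D eps(6) by (simp add: ennreal_mult add_left_mono mult_left_mono)
   qed simp
   also have "... = ennreal K * avg p eps phi + ennreal (K * (2 * eta * D))"
   proof -
    have "ennreal (K / eps) * ennreal eps = ennreal K" "ennreal (K / eps) * ennreal (2 * eta * (D * eps)) = ennreal (K * (2 * eta * D))"
     using K eps(6) D eta by (auto simp: ennreal_mult[symmetric])
    then show ?thesis by (simp only: distrib_left mult.assoc[symmetric])
   qed
   also have "... <= ennreal K * M + ennreal (K * (2 * eta * D))"
    by (intro add_right_mono mult_left_mono eps(1)) simp
   finally show ?thesis .
  qed
  show ?thesis
  proof (rule ennreal_le_epsilon)
   fix e :: real assume e: "0 < e"
   define eta where "eta = e / (2 * K * D + 1)"
   have pos: "0 < 2 * K * D + 1" using K D by (simp add: add_nonneg_pos)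
   have eta: "0 < eta" using e pos by (simp add: eta_def)
   have "K * (2 * eta * D) = e * ((2 * K * D) / (2 * K * D + 1))" by (simp add: eta_def)
   also have "... <= e * 1" using e pos by (intro mult_left_mono) auto
   finally have "ennreal (K * (2 * eta * D)) <= ennreal e" by (simp add: ennreal_leI)
   then show "pint p \<sigma> phi <= ennreal K * M + ennreal e"
    using approx[OF eta] by (meson add_left_mono order_trans)
  qed
 qed
 then show ?thesis using K by (intro exI[of _ K] conjI allI impI)
qed

end


section \<open>Atomic sums near the boundary\<close>

lemma finite_cubes_meeting:
 fixes S :: "(real ^ 'n::finite) set"
 assumes "bounded S" shows "finite (cubes_meeting S j)"
proof -
 obtain B where B: "!!x. x \<in> S ==> norm x <= B" using assms bounded_iff by metis
 let ?V = "{v :: int ^ 'n. ALL k. \<bar>of_int (v $ k) - 0\<bar> <= 2 ^ j * \<bar>B\<bar> + 1}"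
 have "cubes_meeting S j \<subseteq> ?V"
 proof
  fix m :: "int ^ 'n" assume "m \<in> cubes_meeting S j"
  then obtain x where x: "x \<in> cube j m" "x \<in> S" by (auto simp: cubes_meeting_def)
  show "m \<in> ?V"
  proof (intro CollectI allI)
   fix k
   have "\<bar>2 ^ j * x $ k - of_int (m $ k)\<bar> <= 1" using x(1) by (simp add: mem_dcube_iff)
   moreover have "\<bar>2 ^ j * x $ k\<bar> <= 2 ^ j * \<bar>B\<bar>"
    using component_le_norm_cart[of x k] B[OF x(2)] by (simp add: abs_mult)
   ultimately show "\<bar>of_int (m $ k) - 0\<bar> <= 2 ^ j * \<bar>B\<bar> + 1" by linarith
  qed
 qed
 moreover have "finite ?V"
  using card_int_vectors_le(1)[of "%_. 2 ^ j * \<bar>B\<bar> + 1" "%_. 0"] by simp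
 ultimately show ?thesis by (rule finite_subset)
qed

definition level :: "(nat => (int, 'n) vec set) => 'n coeffs => 'n atoms => nat => (real, 'n::finite) vec => complex" where
 "level I c a j x = (\<Sum>m\<in>I j. c j m * a j m x)"

lemma atomic_sum_level:
 assumes "!!j. finite (I j)"
 shows "atomic_sum I c a J = (%x. \<Sum>j<J. level I c a j x)"
 unfolding atomic_sum_def level_def using assms by (simp add: fun_eq_iff)

lemma dist_dcubes:
 fixes x y :: "real ^ 'n::finite"
 assumes "x \<in> dcube d j m" "y \<in> dcube e j m"
 shows "dist x y <= real CARD('n) * (d + e) / 2 ^ j"
proof -
 have "\<bar>(x - y) $ i\<bar> <= (d + e) / 2 ^ j" for i
 proof -
  have "\<bar>x $ i - of_int (m $ i) / 2 ^ j\<bar> <= d / 2 ^ j" "\<bar>y $ i - of_int (m $ i) / 2 ^ j\<bar> <= e / 2 ^ j"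
   using assms by (auto simp: dcube_def)
  then show ?thesis by (simp add: add_divide_distrib)
 qed
 then have "(\<Sum>i\<in>UNIV. \<bar>(x - y) $ i\<bar>) <= (\<Sum>i\<in>(UNIV :: 'n set). (d + e) / 2 ^ j)" by (intro sum_mono)
 then show ?thesis using norm_le_l1_cart[of "x - y"] by (simp add: dist_norm)
qed

lemma dcube_borel [measurable]: "dcube d j m \<in> sets borel"
 by (simp add: borel_closed)

text \<open>
  Boundedly many of the dilated cubes of one level contain a given point, and the largest term dominates.
\<close>

lemma sum_atoms_powr_le:
 fixes a :: "(int, 'n::{finite,linorder}) vec => (real, 'n) vec => complex"
 assumes at: "!!m. m \<in> I ==> is_atom d K j m (a m)" and fin: "finite I" and p: "0 < p" and d: "0 <= d"
 shows "cmod (\<Sum>m\<in>I. c m * a m x) powr p <= ((2 * d + 1) ^ CARD('n)) powr p * (\<Sum>m\<in>I. cmod (c m) powr p * indicator (dcube d j m) x)"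
proof -
 define T where "T = {m \<in> I. x \<in> dcube d j m}"
 have finT: "finite T" using fin by (simp add: T_def)
 show ?thesis
 proof (cases "T = {}")
  case True
  then have "c m * a m x = 0" if "m \<in> I" for m using atom_eq_0[OF at[OF that]] that by (auto simp: T_def)
  then have "(\<Sum>m\<in>I. c m * a m x) = 0" by (intro sum.neutral) auto
  then show ?thesis by (simp add: sum_nonneg)
 next
  case False
  define M where "M = Max ((%m. cmod (c m)) ` T)"
  have "M \<in> (%m. cmod (c m)) ` T" unfolding M_def using finT False by (intro Max_in) auto
  then obtain m0 where m0: "m0 \<in> T" "M = cmod (c m0)" by blast
  have "(\<Sum>m\<in>I. c m * a m x) = (\<Sum>m\<in>T. c m * a m x)"
   by (rule sum.mono_neutral_right) (use fin atom_eq_0[OF at] in "auto simp: T_def")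
  also have "cmod ... <= (\<Sum>m\<in>T. M)"
  proof (rule order_trans[OF norm_sum], rule sum_mono)
   fix m assume m: "m \<in> T"
   have "cmod (c m * a m x) <= cmod (c m) * 1"
    unfolding norm_mult using atom_bounded[OF at, of m] m by (intro mult_left_mono) (auto simp: T_def)
   also have "... <= M" unfolding M_def using m finT by simp
   finally show "cmod (c m * a m x) <= M" .
  qed
  also have "... = real (card T) * M" by simp
  also have "... <= (2 * d + 1) ^ CARD('n) * M"
  proof (rule mult_right_mono)
   have "card T <= card {m. x \<in> dcube d j m}" by (intro card_mono card_cubes_at_point d) (auto simp: T_def)
   then show "real (card T) <= (2 * d + 1) ^ CARD('n)" using card_cubes_at_point(2)[OF d, of x j] by linarith
  qed (use m0 in simp)
  finally have "cmod (\<Sum>m\<in>I. c m * a m x) powr p <= ((2 * d + 1) ^ CARD('n) * M) powr p"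
   using p by (intro powr_mono2) auto
  also have "... = ((2 * d + 1) ^ CARD('n)) powr p * M powr p" using d m0 by (simp add: powr_mult)
  also have "... <= ((2 * d + 1) ^ CARD('n)) powr p * (\<Sum>m\<in>I. cmod (c m) powr p * indicator (dcube d j m) x)"
  proof (rule mult_left_mono)
   have "M powr p = cmod (c m0) powr p * indicator (dcube d j m0) x" using m0 by (simp add: T_def)
   also have "... <= (\<Sum>m\<in>I. cmod (c m) powr p * indicator (dcube d j m) x)"
    using m0 fin by (intro member_le_sum) (auto simp: T_def)
   finally show "M powr p <= (\<Sum>m\<in>I. cmod (c m) powr p * indicator (dcube d j m) x)" .
  qed simp
  finally show ?thesis .
 qed
qed

lemma sum_dyadic_le:
 fixes eps :: real
 assumes "0 < eps"
 shows "(\<Sum>j\<in>{j \<in> {J..<J'}. 1 / 2 ^ j < eps}. 1 / 2 ^ j) <= 2 * eps"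
proof (cases "{j \<in> {J..<J'}. 1 / 2 ^ j < eps} = {}")
 case True
 then show ?thesis using assms by (simp only: sum.empty)
next
 case False
 define i where "i = Min {j \<in> {J..<J'}. 1 / 2 ^ j < eps}"
 have i: "i \<in> {j \<in> {J..<J'}. 1 / 2 ^ j < eps}" unfolding i_def using False by (intro Min_in) auto
 have sub: "{j \<in> {J..<J'}. 1 / 2 ^ j < eps} \<subseteq> (%l. i + l) ` {..<J'}"
 proof
  fix j assume j: "j \<in> {j \<in> {J..<J'}. 1 / 2 ^ j < eps}"
  then have "i <= j" unfolding i_def by (intro Min_le) auto
  then show "j \<in> (%l. i + l) ` {..<J'}" using j by (intro image_eqI[of _ _ "j - i"]) auto
 qed
 have "(\<Sum>j\<in>{j \<in> {J..<J'}. 1 / 2 ^ j < eps}. 1 / 2 ^ j) <= (\<Sum>j\<in>(%l. i + l) ` {..<J'}. 1 / 2 ^ j :: real)"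
  using sub by (intro sum_mono2) auto
 also have "... = (\<Sum>l<J'. 1 / 2 ^ (i + l))" by (subst sum.reindex) (auto simp: inj_on_def)
 also have "... = 1 / 2 ^ i * (\<Sum>l<J'. (1 / 2) ^ l)" by (simp add: sum_distrib_left power_add power_divide)
 also have "... <= 1 / 2 ^ i * 2"
 proof (rule mult_left_mono)
  have "(\<Sum>l<J'. (1 / 2) ^ l :: real) <= (\<Sum>l. (1 / 2) ^ l)" by (intro sum_le_suminf summable_geometric) auto
  then show "(\<Sum>l<J'. (1 / 2) ^ l :: real) <= 2" by (simp add: suminf_geometric)
 qed simp
 also have "... <= 2 * eps" using i by simp
 finally show ?thesis .
qed

context lipschitz_domain
begin

abbreviation "IO \<equiv> cubes_meeting \<Omega>"

lemma finite_I: "finite (IO j)"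
 by (rule finite_cubes_meeting[OF bounded_domain])

lemma emeasure_collar_dcube:
 assumes d: "0 < d"
 shows "\<exists>C>0. \<forall>eps>0. ALL j m. emeasure lborel (collar eps Int dcube d j m) <= ennreal (C * eps / 2 ^ (j * (CARD('n) - 1)))"
proof -
 let ?k = "CARD('n) - 1" and ?n = "real CARD('n)"
 from emeasure_collar obtain Cv where Cv: "0 < Cv" and Cv': "ALL z eps R. 0 < eps --> eps <= R -->
   emeasure lborel (collar eps Int cball z R) <= ennreal (Cv * eps * R ^ ?k)" by (elim exE conjE)
 define C where "C = Cv * (?n * d) ^ ?k + (2 * d) ^ CARD('n) / (?n * d)"
 have n: "0 < ?n" by simp
 have C: "0 < C" unfolding C_def using Cv d n by (intro add_pos_pos) auto
 have "emeasure lborel (collar eps Int dcube d j m) <= ennreal (C * eps / 2 ^ (j * ?k))" if eps: "0 < eps" for eps j m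
 proof -
  define R where "R = ?n * d / 2 ^ j"
  have R: "0 < R" using d by (simp add: R_def)
  have sub: "dcube d j m \<subseteq> cball (\<chi> i. of_int (m $ i) / 2 ^ j) R"
  proof
   fix x assume x: "x \<in> dcube d j m"
   have "(\<chi> i. of_int (m $ i) / 2 ^ j) \<in> dcube 0 j m" by (simp add: dcube_def)
   from dist_dcubes[OF this x] show "x \<in> cball (\<chi> i. of_int (m $ i) / 2 ^ j) R" by (simp add: R_def)
  qed
  have pj: "2 ^ (j * CARD('n)) = 2 ^ j * (2 ^ (j * ?k) :: real)"
   by (metis Suc_dimb mult_Suc_right power_add)
  show ?thesis
  proof (cases "eps <= R")
   case True
   have "emeasure lborel (collar eps Int dcube d j m) <= emeasure lborel (collar eps Int cball (\<chi> i. of_int (m $ i) / 2 ^ j) R)"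
    using sub by (intro emeasure_mono) (auto simp: collar_measurable)
   also have "... <= ennreal (Cv * eps * R ^ ?k)" using Cv' eps True by blast
   also have "... <= ennreal (C * eps / 2 ^ (j * ?k))"
   proof (rule ennreal_leI)
    have "Cv * eps * R ^ ?k = Cv * (?n * d) ^ ?k * eps / 2 ^ (j * ?k)"
     by (simp add: R_def power_divide power_mult)
    also have "... <= C * eps / 2 ^ (j * ?k)"
     using eps d by (intro divide_right_mono mult_right_mono) (auto simp: C_def)
    finally show "Cv * eps * R ^ ?k <= C * eps / 2 ^ (j * ?k)" .
   qed
   finally show ?thesis .
  next
   case False
   have "emeasure lborel (collar eps Int dcube d j m) <= emeasure lborel (dcube d j m)"
    by (intro emeasure_mono) auto
   also have "... = ennreal ((2 * d / 2 ^ j) ^ CARD('n))" using d by (intro emeasure_dcube) simp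
   also have "... <= ennreal (C * eps / 2 ^ (j * ?k))"
   proof (rule ennreal_leI)
    have "(2 * d / 2 ^ j) ^ CARD('n) = (2 * d) ^ CARD('n) / (?n * d) * R / 2 ^ (j * ?k)"
     using d n by (simp add: R_def power_divide power_mult[symmetric] pj)
    also have "... <= (2 * d) ^ CARD('n) / (?n * d) * eps / 2 ^ (j * ?k)"
     using False d by (intro divide_right_mono mult_left_mono) auto
    also have "... <= C * eps / 2 ^ (j * ?k)"
     using eps Cv d by (intro divide_right_mono mult_right_mono) (auto simp: C_def)
    finally show "(2 * d / 2 ^ j) ^ CARD('n) <= C * eps / 2 ^ (j * ?k)" .
   qed
   finally show ?thesis .
  qed
 qed
 then show ?thesis using C by (intro exI[of _ C] conjI allI impI)
qed

lemma level_continuous: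
 assumes "\<forall>m\<in>I j. is_atom d K j m (a j m)"
 shows "continuous_on UNIV (level I c a j)"
 unfolding level_def[abs_def] using assms by (intro continuous_on_sum continuous_on_mult continuous_on_const) (auto intro: atom_continuous)

lemma pint_level_le:
 assumes at: "\<forall>m\<in>I j. is_atom d K j m (a j m)" and fin: "finite (I j)" and p: "0 < p" and d: "0 <= d" and S: "S \<in> sets borel"
 shows "pint p LO (%x. level I c a j x * indicator S x) \<le>
   ennreal (((2 * d + 1) ^ CARD('n)) powr p) * (\<Sum>m\<in>I j. ennreal (cmod (c j m) powr p) * emeasure lborel (S Int dcube d j m))"
proof -
 let ?N = "((2 * d + 1) ^ CARD('n)) powr p"
 have "pint p LO (%x. level I c a j x * indicator S x) = (\<integral>\<^sup>+x. ennreal (cmod (level I c a j x * indicator S x) powr p) * indicator \<Omega> x \<partial>lborel)"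
  unfolding pint_def by (subst nn_integral_restrict_space) (use domain_lebesgue in "auto simp: nn_integral_completion")
 also have "... <= (\<integral>\<^sup>+x. ennreal ?N * (\<Sum>m\<in>I j. ennreal (cmod (c j m) powr p) * indicator (S Int dcube d j m) x) \<partial>lborel)"
 proof (rule nn_integral_mono)
  fix x
  show "ennreal (cmod (level I c a j x * indicator S x) powr p) * indicator \<Omega> x <= ennreal ?N * (\<Sum>m\<in>I j. ennreal (cmod (c j m) powr p) * indicator (S Int dcube d j m) x)"
  proof (cases "x \<in> S")
   case True
   have "ennreal (cmod (level I c a j x) powr p) <= ennreal (?N * (\<Sum>m\<in>I j. cmod (c j m) powr p * indicator (dcube d j m) x))"
    unfolding level_def by (rule ennreal_leI, rule sum_atoms_powr_le) (use at fin p d in auto)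
   also have "... = ennreal ?N * (\<Sum>m\<in>I j. ennreal (cmod (c j m) powr p) * indicator (S Int dcube d j m) x)"
   proof -
    have "(\<Sum>m\<in>I j. ennreal (cmod (c j m) powr p) * indicator (S Int dcube d j m) x) = (\<Sum>m\<in>I j. ennreal (cmod (c j m) powr p * indicator (dcube d j m) x))"
     using True by (intro sum.cong) (auto simp: indicator_def)
    also have "... = ennreal (\<Sum>m\<in>I j. cmod (c j m) powr p * indicator (dcube d j m) x)"
     by (rule sum_ennreal) simp
    finally have "(\<Sum>m\<in>I j. ennreal (cmod (c j m) powr p) * indicator (S Int dcube d j m) x) = ennreal (\<Sum>m\<in>I j. cmod (c j m) powr p * indicator (dcube d j m) x)" .
    moreover have "ennreal (?N * (\<Sum>m\<in>I j. cmod (c j m) powr p * indicator (dcube d j m) x)) = ennreal ?N * ennreal (\<Sum>m\<in>I j. cmod (c j m) powr p * indicator (dcube d j m) x)"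
     by (rule ennreal_mult) (simp_all add: sum_nonneg)
    ultimately show ?thesis by (simp only:)
   qed
   finally show ?thesis using True by (auto simp: indicator_def)
  qed (use p in simp)
 qed
 also have "... = ennreal ?N * (\<Sum>m\<in>I j. ennreal (cmod (c j m) powr p) * emeasure lborel (S Int dcube d j m))"
  using S by (subst nn_integral_cmult, measurable, subst nn_integral_sum) (auto simp: nn_integral_cmult_indicator)
 finally show ?thesis .
qed

text \<open>
  Both kinds of estimates are first proved for differences of partial sums; they pass to the limit
  because for a fixed collar the average is dominated by the norm of \<open>L\<^sub>p(\<Omega>)\<close>.
\<close>

lemma avg_limit:
 assumes p: "0 < p" and eps: "0 < eps" and f: "f \<in> borel_measurable LO" and S: "!!J. continuous_on UNIV (S J)"
  and lim: "(%J. pint p LO (%x. f x - S J x)) ----> 0"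
  and M: "!!J'. J <= J' ==> avg p eps (%x. S J' x - S J x) <= M"
 shows "avg p eps (%x. f x - S J x) <= ennreal (2 powr p) * M"
proof -
 let ?u = "%J'. ennreal (1 / eps) * pint p LO (%x. f x - S J' x)"
 have Sm: "S J \<in> borel_measurable LO" for J by (rule continuous_measurable_domain[OF S])
 have "avg p eps (%x. f x - S J x) <= ennreal (2 powr p) * (?u J' + M)" if J': "J <= J'" for J'
 proof -
  have "avg p eps (%x. f x - S J x) <= ennreal (2 powr p) * (avg p eps (%x. f x - S J' x) + avg p eps (%x. S J' x - S J x))"
  proof (rule avg_triangle[OF p])
   show "cmod (f x - S J x) <= cmod (f x - S J' x) + cmod (S J' x - S J x)" for x
    using norm_triangle_ineq[of "f x - S J' x" "S J' x - S J x"] by simp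
  qed (use f Sm in auto)
  also have "... <= ennreal (2 powr p) * (?u J' + M)"
  proof (intro mult_left_mono add_mono M[OF J'])
   show "avg p eps (%x. f x - S J' x) <= ?u J'"
    unfolding avg_def by (intro mult_left_mono pint_mono p) (auto simp: norm_mult indicator_def)
  qed simp
  finally show ?thesis .
 qed
 moreover have "(%J'. ennreal (2 powr p) * (?u J' + M)) ----> ennreal (2 powr p) * (ennreal (1 / eps) * 0 + M)"
  by (intro tendsto_intros ennreal_tendsto_cmult lim tendsto_add) auto
 ultimately show ?thesis
  by (intro LIMSEQ_le_const[of "%J'. ennreal (2 powr p) * (?u J' + M)"]) auto
qed

text \<open>
  The \<open>p\<close>-th power of the level \<open>j\<close> part of the Besov quasi-norm with smoothness
  \<open>1 / p\<close>, where the weight is \<open>2 ^ (j (1 - n))\<close>.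
\<close>

definition bsum :: "real => (nat => (int, 'n) vec set) => 'n coeffs => nat => real" where
 "bsum p I c j = (\<Sum>m\<in>I j. cmod (c j m) powr p) / 2 ^ (j * (CARD('n) - 1))"

lemma bsum_nonneg: "0 <= bsum p I c j"
 by (simp add: bsum_def sum_nonneg)

lemma avg_level_le:
 assumes p: "0 < p" and d: "0 < d"
 shows "\<exists>C>0. ALL I c a j K. (\<forall>m\<in>I j. is_atom d K j m (a j m)) --> finite (I j) -->
   (\<forall>eps>0. pint p LO (%x. level I c a j x * indicator (collar eps) x) <= ennreal (eps * (C * bsum p I c j)))"
proof -
 from emeasure_collar_dcube[OF d] obtain C where C: "0 < C" and C': "\<forall>eps>0. ALL j m. emeasure lborel (collar eps Int dcube d j m) <= ennreal (C * eps / 2 ^ (j * (CARD('n) - 1)))"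
  by (elim exE conjE)
 let ?N = "((2 * d + 1) ^ CARD('n)) powr p"
 have N: "0 < ?N" using d by simp
 have "pint p LO (%x. level I c a j x * indicator (collar eps) x) <= ennreal (eps * (?N * C * bsum p I c j))"
  if at: "\<forall>m\<in>I j. is_atom d K j m (a j m)" and fin: "finite (I j)" and eps: "0 < eps" for I c a j K eps
 proof -
  have "pint p LO (%x. level I c a j x * indicator (collar eps) x) \<le>
   ennreal ?N * (\<Sum>m\<in>I j. ennreal (cmod (c j m) powr p) * emeasure lborel (collar eps Int dcube d j m))"
   by (rule pint_level_le[where K = K and I = I and j = j]) (use at fin p d in "auto simp: collar_measurable")
  also have "... <= ennreal ?N * (\<Sum>m\<in>I j. ennreal (cmod (c j m) powr p) * ennreal (C * eps / 2 ^ (j * (CARD('n) - 1))))"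
   using C' eps by (intro mult_left_mono sum_mono) auto
  also have "... = ennreal (?N * (\<Sum>m\<in>I j. cmod (c j m) powr p * (C * eps / 2 ^ (j * (CARD('n) - 1)))))"
  proof -
   have "(\<Sum>m\<in>I j. ennreal (cmod (c j m) powr p) * ennreal (C * eps / 2 ^ (j * (CARD('n) - 1)))) = (\<Sum>m\<in>I j. ennreal (cmod (c j m) powr p * (C * eps / 2 ^ (j * (CARD('n) - 1)))))"
    using C eps by (intro sum.cong refl ennreal_mult[symmetric]) auto
   also have "... = ennreal (\<Sum>m\<in>I j. cmod (c j m) powr p * (C * eps / 2 ^ (j * (CARD('n) - 1))))"
    using C eps by (intro sum_ennreal) simp
   moreover have "ennreal (?N * (\<Sum>m\<in>I j. cmod (c j m) powr p * (C * eps / 2 ^ (j * (CARD('n) - 1))))) = ennreal ?N * ennreal (\<Sum>m\<in>I j. cmod (c j m) powr p * (C * eps / 2 ^ (j * (CARD('n) - 1))))"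
    by (rule ennreal_mult) (use C eps in "auto intro!: sum_nonneg")
   ultimately show ?thesis by (simp only:)
  qed
  also have "?N * (\<Sum>m\<in>I j. cmod (c j m) powr p * (C * eps / 2 ^ (j * (CARD('n) - 1)))) = eps * (?N * C * bsum p I c j)"
   by (simp only: bsum_def sum_distrib_right[symmetric]) simp
  finally show ?thesis .
 qed
 then show ?thesis using N C by (intro exI[of _ "?N * C"]) auto
qed

lemma avg_from_pint:
 assumes "0 < eps" "pint p LO (%x. h x * indicator (collar eps) x) <= ennreal (eps * M)" "0 <= M"
 shows "avg p eps h <= ennreal M"
proof -
 have "avg p eps h <= ennreal (1 / eps) * ennreal (eps * M)"
  unfolding avg_def by (intro mult_left_mono assms) simp
 also have "... = ennreal M" using assms by (simp add: ennreal_mult[symmetric])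
 finally show ?thesis .
qed

abbreviation psum :: "'n coeffs => 'n atoms => nat => (real, 'n) vec => complex" where
 "psum c a J x \<equiv> \<Sum>j<J. level IO c a j x"

definition atoms_at :: "real => nat => (nat => (int, 'n) vec set) => 'n atoms => bool" where
 "atoms_at d K I a \<longleftrightarrow> (ALL j. \<forall>m\<in>I j. is_atom d K j m (a j m))"

lemma atomic_rep_iff:
 assumes "0 < p"
 shows "atomic_rep d K p \<Omega> f c a \<longleftrightarrow> atoms_at d K IO a \<and>
  (%J. pint p LO (%x. f x - psum c a J x)) ----> 0"
 unfolding atomic_rep_def atoms_at_def atomic_sum_level[OF finite_I] Lp_norm_tendsto_0_iff[OF assms] ..

lemma partial_sum_continuous:
 assumes "atoms_at d K I a" shows "continuous_on UNIV (%x. \<Sum>j<J. level I c a j x)"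
 using assms unfolding atoms_at_def by (intro continuous_on_sum level_continuous[of _ _ d K]) auto

lemma partial_sum_diff:
 "J <= J' ==> (\<Sum>j<J'. level I c a j x) - (\<Sum>j<J. level I c a j x) = (\<Sum>j\<in>{J..<J'}. level I c a j x)"
proof -
 assume "J <= J'"
 then have "{..<J'} - {..<J} = {J..<J'}" "{..<J} \<subseteq> {..<J'}" by auto
 then show ?thesis using sum_diff[of "{..<J'}" "{..<J}" "%j. level I c a j x"] by simp
qed

text \<open>
  The Besov case. Minkowski's inequality for exponents at least 1, and the subadditivity of the
  power below 1, sum the contributions of the levels.
\<close>

lemma collar_bound_B:
 assumes p: "0 < p" and d: "0 < d"
 shows "\<exists>C>0. ALL K f c a J. f \<in> borel_measurable LO --> atomic_rep d K p \<Omega> f c a -->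
   summable (%j. bsum p IO c j powr (min 1 p / p)) -->
   collar_bound p (%x. f x - psum c a J x)
    (ennreal (C * (\<Sum>j. bsum p IO c (j + J) powr (min 1 p / p)) powr (p / min 1 p)))"
proof -
 from avg_level_le[OF p d] obtain C where C: "0 < C" and C': "ALL I c a j K. (\<forall>m\<in>I j. is_atom d K j m (a j m)) --> finite (I j) -->
   (\<forall>eps>0. pint p LO (%x. level I c a j x * indicator (collar eps) x) <= ennreal (eps * (C * bsum p I c j)))"
  by (elim exE conjE)
 define r where "r = min 1 p"
 have r: "0 < r" using p by (simp add: r_def)
 have "collar_bound p (%x. f x - psum c a J x)
    (ennreal (2 powr p * C * (\<Sum>j. bsum p IO c (j + J) powr (r / p)) powr (p / r)))"
  if f: "f \<in> borel_measurable LO" and rep: "atomic_rep d K p \<Omega> f c a"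
   and summ: "summable (%j. bsum p IO c j powr (r / p))" for K f c a J
 proof -
  have at: "atoms_at d K IO a" and lim: "(%J. pint p LO (%x. f x - psum c a J x)) ----> 0"
   using rep unfolding atomic_rep_iff[OF p] by auto
  let ?T = "\<Sum>j. bsum p IO c (j + J) powr (r / p)"
  have "avg p eps (%x. f x - psum c a J x) <= ennreal (2 powr p) * ennreal (C * ?T powr (p / r))" if eps: "0 < eps" for eps
  proof (rule avg_limit[OF p eps f partial_sum_continuous[OF at] lim])
   fix J' assume J': "J <= J'"
   let ?g = "%j x. level IO c a j x * indicator (collar eps) x"
   have gm: "?g j \<in> borel_measurable LO" for j
    using at by (intro borel_measurable_times indicator_collar_measurable continuous_measurable_domain level_continuous[of _ _ d K]) (auto simp: atoms_at_def)
   have gl: "pint p LO (?g j) <= ennreal (eps * (C * bsum p IO c j))" for j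
    using C' at finite_I eps unfolding atoms_at_def by blast
   have Tle: "(\<Sum>j\<in>{J..<J'}. bsum p IO c j powr (r / p)) <= ?T"
   proof -
    have "(\<Sum>j\<in>{J..<J'}. bsum p IO c j powr (r / p)) = (\<Sum>j<J' - J. bsum p IO c (j + J) powr (r / p))"
     using sum.shift_bounds_nat_ivl[of "%j. bsum p IO c j powr (r / p)" 0 J "J' - J"] J' by (simp add: atLeast0LessThan)
    also have "... <= ?T"
     by (intro sum_le_suminf summable_ignore_initial_segment summ) auto
    finally show ?thesis .
   qed
   have "pint p LO (%x. \<Sum>j\<in>{J..<J'}. ?g j x) <= ennreal (eps * (C * ?T powr (p / r)))"
   proof (cases "p <= 1")
    case True
    then have rp: "r = p" by (simp add: r_def)
    have "pint p LO (%x. \<Sum>j\<in>{J..<J'}. ?g j x) <= (\<Sum>j\<in>{J..<J'}. pint p LO (?g j))"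
     by (rule pint_sum_le) (use p True gm in auto)
    also have "... <= (\<Sum>j\<in>{J..<J'}. ennreal (eps * (C * bsum p IO c j)))" by (intro sum_mono gl)
    also have "... = ennreal (eps * (C * (\<Sum>j\<in>{J..<J'}. bsum p IO c j)))"
     using eps C by (subst sum_ennreal) (auto simp: bsum_nonneg sum_distrib_left)
    also have "... <= ennreal (eps * (C * ?T powr (p / r)))"
     using Tle eps C p by (intro ennreal_leI mult_left_mono) (auto simp: rp bsum_nonneg suminf_nonneg order_trans sum_nonneg)
    finally show ?thesis .
   next
    case False
    then have r1: "r = 1" and p1: "1 <= p" by (auto simp: r_def)
    let ?t = "%j. (eps * C) powr (1 / p) * bsum p IO c j powr (r / p)"
    have tp: "?t j powr p = eps * (C * bsum p IO c j)" for j
     using p eps C bsum_nonneg[of p IO c j] by (simp add: powr_mult powr_powr r1)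
    have "pint p LO (%x. \<Sum>j\<in>{J..<J'}. ?g j x) <= ennreal ((\<Sum>j\<in>{J..<J'}. ?t j) powr p)"
    proof (rule pint_sum_Minkowski[OF p1])
     show "pint p LO (?g j) <= ennreal (?t j powr p)" for j unfolding tp by (rule gl)
    qed (use gm in auto)
    also have "... <= ennreal (((eps * C) powr (1 / p) * ?T) powr p)"
     unfolding sum_distrib_left[symmetric] using Tle p
     by (intro ennreal_leI powr_mono2 mult_left_mono mult_nonneg_nonneg sum_nonneg) auto
    also have "((eps * C) powr (1 / p) * ?T) powr p = eps * (C * ?T powr (p / r))"
    proof -
     have "0 <= ?T" by (intro suminf_nonneg summable_ignore_initial_segment summ) auto
     then show ?thesis using p eps C by (simp add: powr_mult powr_powr r1)
    qed
    finally show ?thesis .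
   qed
   then show "avg p eps (%x. psum c a J' x - psum c a J x) <= ennreal (C * ?T powr (p / r))"
    unfolding partial_sum_diff[OF J'] using eps C by (intro avg_from_pint) (auto simp: sum_distrib_right)
  qed
  then have "avg p eps (%x. f x - psum c a J x) <= ennreal (2 powr p * C * ?T powr (p / r))" if "0 < eps" for eps
   using that C by (simp add: ennreal_mult[symmetric] mult.assoc)
  then show ?thesis unfolding collar_bound_def by (simp add: eventually_at_filter)
 qed
 then show ?thesis unfolding r_def using C by (intro exI[of _ "2 powr p * C"]) auto
qed

end


context lipschitz_domain
begin

text \<open>
  The \<open>p\<close>-th power of the integrand of the Triebel--Lizorkin quasi-norm with \<open>q =
  \<infinity>\<close>, the smallest of all these quasi-norms.
\<close>

definition gmax :: "real => 'n coeffs => (real, 'n) vec => ennreal" where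
 "gmax p c x = (SUP (j, m)\<in>(SIGMA j:UNIV. IO j). ennreal (2 ^ j * cmod (c j m) powr p) * indicator (cube j m) x)"

lemma gmax_measurable [measurable]: "gmax p c \<in> borel_measurable borel"
proof -
 have "(%x. SUP i\<in>(SIGMA j:UNIV. IO j). (case i of (j, m) => ennreal (2 ^ j * cmod (c j m) powr p) * indicator (cube j m) x)) \<in> borel_measurable borel"
 proof (rule borel_measurable_SUP)
  show "countable (SIGMA j:UNIV. IO j)" by (intro countable_SIGMA) (auto intro: countable_finite finite_I)
  fix i :: "nat \<times> (int, 'n) vec" assume "i \<in> (SIGMA j:UNIV. IO j)"
  obtain j m where "i = (j, m)" by fastforce
  then show "(%x. case i of (j, m) => ennreal (2 ^ j * cmod (c j m) powr p) * indicator (cube j m) x) \<in> borel_measurable borel"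
   by simp
 qed
 then show ?thesis unfolding gmax_def[abs_def] by simp
qed

lemma gmax_ge: "m \<in> IO j ==> ennreal (2 ^ j * cmod (c j m) powr p) * indicator (cube j m) x <= gmax p c x"
 unfolding gmax_def
 by (rule SUP_upper2[of "(j, m)"]) auto

lemma sum_cubes_le_gmax:
 assumes "T \<subseteq> IO j"
 shows "(\<Sum>m\<in>T. ennreal (2 ^ j * cmod (c j m) powr p) * indicator (cube j m) x) <= ennreal (3 ^ CARD('n)) * gmax p c x"
proof -
 have fin: "finite T" using assms finite_I finite_subset by blast
 let ?T = "{m \<in> T. x \<in> cube j m}"
 have "(\<Sum>m\<in>T. ennreal (2 ^ j * cmod (c j m) powr p) * indicator (cube j m) x) =
   (\<Sum>m\<in>?T. ennreal (2 ^ j * cmod (c j m) powr p) * indicator (cube j m) x)"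
  by (rule sum.mono_neutral_right) (use fin in "auto simp: indicator_def")
 also have "... <= (\<Sum>m\<in>?T. gmax p c x)"
 proof (rule sum_mono)
  fix m assume "m \<in> ?T"
  then have "m \<in> IO j" using assms by blast
  then show "ennreal (2 ^ j * cmod (c j m) powr p) * indicator (cube j m) x <= gmax p c x" by (rule gmax_ge)
 qed
 also have "... = ennreal (real (card ?T)) * gmax p c x" by (simp add: ennreal_of_nat_eq_real_of_nat)
 also have "... <= ennreal (3 ^ CARD('n)) * gmax p c x"
 proof (intro mult_right_mono ennreal_leI)
  have "card ?T <= card {m. x \<in> cube j m}" by (rule card_mono) (use card_cubes_at_point(1)[of 1 x j] in auto)
  then show "real (card ?T) <= 3 ^ CARD('n)" using card_cubes_at_point(2)[of 1 x j] by simp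
 qed simp
 finally show ?thesis .
qed

text \<open>
  A point at a given distance from the boundary belongs to the chosen parts of cubes of boundedly many
  levels only.
\<close>

lemma card_scales_le:
 fixes \<kappa> D t :: real
 assumes \<kappa>: "0 < \<kappa>" and L: "D <= \<kappa> * 2 ^ L"
 shows "finite {j. \<kappa> / 2 ^ j <= t & t <= D / 2 ^ j} & card {j::nat. \<kappa> / 2 ^ j <= t & t <= D / 2 ^ j} <= Suc L"
proof (cases "{j. \<kappa> / 2 ^ j <= t & t <= D / 2 ^ j} = {}")
 case False
 define i where "i = (LEAST j. \<kappa> / 2 ^ j <= t & t <= D / 2 ^ j)"
 have i: "\<kappa> / 2 ^ i <= t" using LeastI_ex[of "%j. \<kappa> / 2 ^ j <= t & t <= D / 2 ^ j"] False by (auto simp: i_def)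
 have "{j. \<kappa> / 2 ^ j <= t & t <= D / 2 ^ j} \<subseteq> {i..i + L}"
 proof
  fix j assume "j \<in> {j. \<kappa> / 2 ^ j <= t & t <= D / 2 ^ j}"
  then have j: "\<kappa> / 2 ^ j <= t" "t <= D / 2 ^ j" by auto
  then have ij: "i <= j" unfolding i_def by (intro Least_le) auto
  have "D / 2 ^ j <= \<kappa> * 2 ^ L / 2 ^ j" using L by (intro divide_right_mono) auto
  then have "\<kappa> / 2 ^ i <= \<kappa> * 2 ^ L / 2 ^ j" using i j(2) by linarith
  then have "\<kappa> * 2 ^ j <= \<kappa> * (2 ^ L * 2 ^ i)" by (simp add: field_simps)
  then have "(2::real) ^ j <= 2 ^ (L + i)" using \<kappa> by (simp add: power_add)
  then have "j <= L + i" by (simp add: power_increasing_iff)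
  then show "j \<in> {i..i + L}" using ij by simp
 qed
 then show ?thesis using card_mono[of "{i..i + L}"] finite_subset[of _ "{i..i + L}"] by auto
next
 case True
 then show ?thesis by (simp only: finite.emptyI card.empty) simp
qed

definition near :: "real => nat => (int, 'n) vec set" where
 "near d j = {m \<in> IO j. dcube d j m Int \<Gamma> ~= {}}"

lemma near_subset: "near d j \<subseteq> IO j" and finite_near: "finite (near d j)"
 unfolding near_def using finite_I finite_subset by auto

text \<open>
  A fixed fraction of a cube near the boundary lies at a distance from the boundary comparable to
  its side length. These parts of cubes of different levels overlap boundedly often, so near the
  boundary the summation index \<open>q\<close> of the Triebel--Lizorkin quasi-norm has no effect.
\<close>

lemma sum_near_le_gmax:
 assumes p: "0 < p" and d: "0 < d"
 shows "\<exists>C>0. ALL c. (\<Sum>j. ennreal (bsum p (near d) c j)) <= ennreal C * (\<integral>\<^sup>+x. gmax p c x \<partial>lborel)"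
proof -
 let ?n = "CARD('n)" and ?k = "CARD('n) - 1"
 from emeasure_collar_dcube[OF zero_less_one] obtain C1 where C1: "0 < C1" and C1': "\<forall>eps>0. ALL j m. emeasure lborel (collar eps Int cube j m) <= ennreal (C1 * eps / 2 ^ (j * ?k))"
  by (elim exE conjE)
 define \<kappa> where "\<kappa> = 1 / C1"
 have \<kappa>: "0 < \<kappa>" using C1 by (simp add: \<kappa>_def)
 define D where "D = real ?n * (1 + d)"
 obtain L where "D / \<kappa> < 2 ^ L" using real_arch_pow[of 2 "D / \<kappa>"] by auto
 then have L: "D <= \<kappa> * 2 ^ L" using \<kappa> by (simp add: pos_divide_less_eq mult.commute)
 define E where "E j m = cube j m - collar (\<kappa> / 2 ^ j)" for j and m :: "(int, 'n) vec"
 have Em[measurable]: "E j m \<in> sets borel" for j m unfolding E_def using collar_measurable by auto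
 have pj: "2 ^ (j * ?n) = 2 ^ j * (2 ^ (j * ?k) :: real)" for j
  by (metis Suc_dimb mult_Suc_right power_add)
 have eE: "ennreal (1 / 2 ^ (j * ?n)) <= emeasure lborel (E j m)" for j m
 proof -
  have cE: "emeasure lborel (collar (\<kappa> / 2 ^ j) Int cube j m) <= ennreal (1 / 2 ^ (j * ?n))"
  proof -
   have "C1 * (\<kappa> / 2 ^ j) / 2 ^ (j * ?k) = 1 / 2 ^ (j * ?n)" using C1 by (simp add: \<kappa>_def pj)
   then show ?thesis using C1'[rule_format, of "\<kappa> / 2 ^ j" j m] \<kappa> by simp
  qed
  have "ennreal (2 / 2 ^ (j * ?n)) <= ennreal ((2 / 2 ^ j) ^ ?n)"
  proof (rule ennreal_leI)
   have "(2::real) ^ 1 <= 2 ^ ?n" using dim by (intro power_increasing) auto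
   then show "2 / 2 ^ (j * ?n) <= ((2 / 2 ^ j) ^ ?n :: real)" by (simp add: power_divide power_mult[symmetric] divide_right_mono)
  qed
  also have "... = emeasure lborel (cube j m)" using emeasure_dcube[of 1 j m] by simp
  also have "... = emeasure lborel (E j m Un (collar (\<kappa> / 2 ^ j) Int cube j m))"
   by (intro arg_cong[of _ _ "emeasure lborel"]) (auto simp: E_def)
  also have "... <= emeasure lborel (E j m) + emeasure lborel (collar (\<kappa> / 2 ^ j) Int cube j m)"
   by (rule emeasure_subadditive) (auto simp: collar_measurable)
  also have "... <= emeasure lborel (E j m) + ennreal (1 / 2 ^ (j * ?n))" by (intro add_left_mono cE)
  finally have "ennreal (1 / 2 ^ (j * ?n)) + ennreal (1 / 2 ^ (j * ?n)) <= emeasure lborel (E j m) + ennreal (1 / 2 ^ (j * ?n))"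
   by (simp add: ennreal_plus[symmetric] del: ennreal_plus)
  then show ?thesis by (simp add: ennreal_add_left_cancel_le add.commute)
 qed
 define C where "C = real (Suc L) * 3 ^ ?n"
 have main: "(\<Sum>j. ennreal (bsum p (near d) c j)) <= ennreal C * (\<integral>\<^sup>+x. gmax p c x \<partial>lborel)" for c
 proof -
  let ?h = "%j x. \<Sum>m\<in>near d j. ennreal (2 ^ j * cmod (c j m) powr p) * indicator (E j m) x"
  have hm: "(%x. ?h j x) \<in> borel_measurable lborel" for j
   by (intro borel_measurable_sum borel_measurable_times_ennreal borel_measurable_const borel_measurable_indicator) simp
  have "ennreal (bsum p (near d) c j) <= (\<integral>\<^sup>+x. ?h j x \<partial>lborel)" for j
  proof -
   have "bsum p (near d) c j = (\<Sum>m\<in>near d j. 2 ^ j * cmod (c j m) powr p * (1 / 2 ^ (j * ?n)))"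
    by (simp add: bsum_def sum_divide_distrib pj)
   then have "ennreal (bsum p (near d) c j) = (\<Sum>m\<in>near d j. ennreal (2 ^ j * cmod (c j m) powr p * (1 / 2 ^ (j * ?n))))"
    by (simp only:) (rule sum_ennreal[symmetric], simp)
   also have "... = (\<Sum>m\<in>near d j. ennreal (2 ^ j * cmod (c j m) powr p) * ennreal (1 / 2 ^ (j * ?n)))"
    by (intro sum.cong refl ennreal_mult) auto
   also have "... <= (\<Sum>m\<in>near d j. ennreal (2 ^ j * cmod (c j m) powr p) * emeasure lborel (E j m))"
    by (intro sum_mono mult_left_mono eE) simp
   also have "... = (\<integral>\<^sup>+x. ?h j x \<partial>lborel)"
    by (subst nn_integral_sum) (auto simp: nn_integral_cmult_indicator)
   finally show ?thesis .
  qed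
  then have "(\<Sum>j. ennreal (bsum p (near d) c j)) <= (\<Sum>j. \<integral>\<^sup>+x. ?h j x \<partial>lborel)"
   by (intro suminf_le summableI)
  also have "... = (\<integral>\<^sup>+x. (\<Sum>j. ?h j x) \<partial>lborel)"
   by (rule nn_integral_suminf[symmetric]) (rule hm)
  also have "... <= (\<integral>\<^sup>+x. ennreal C * gmax p c x \<partial>lborel)"
  proof (rule nn_integral_mono)
   fix x
   let ?J = "{j. \<kappa> / 2 ^ j <= infdist x \<Gamma> & infdist x \<Gamma> <= D / 2 ^ j}"
   have J: "finite ?J" "card ?J <= Suc L" using card_scales_le[OF \<kappa> L, of "infdist x \<Gamma>"] by auto
   have "?h j x = 0" if "j ~: ?J" for j
   proof (rule sum.neutral, rule ballI)
    fix m assume m: "m \<in> near d j"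
    have "x ~: E j m"
    proof
     assume x: "x \<in> E j m"
     then have "\<kappa> / 2 ^ j <= infdist x \<Gamma>" by (simp add: E_def collar_def)
     moreover obtain g where g: "g \<in> dcube d j m" "g \<in> \<Gamma>" using m by (auto simp: near_def)
     have "dist x g <= D / 2 ^ j" using dist_dcubes[of x 1 j m g d] x g by (simp add: E_def D_def)
     then have "infdist x \<Gamma> <= D / 2 ^ j" using infdist_le[OF g(2), of x] by simp
     ultimately show False using that by simp
    qed
    then show "ennreal (2 ^ j * cmod (c j m) powr p) * indicator (E j m) x = 0" by simp
   qed
   then have "(\<Sum>j. ?h j x) = (\<Sum>j\<in>?J. ?h j x)" by (intro suminf_finite J) auto
   also have "... <= (\<Sum>j\<in>?J. ennreal (3 ^ ?n) * gmax p c x)"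
   proof (rule sum_mono)
    fix j
    have "?h j x <= (\<Sum>m\<in>near d j. ennreal (2 ^ j * cmod (c j m) powr p) * indicator (cube j m) x)"
     by (intro sum_mono mult_left_mono) (auto simp: E_def indicator_def)
    also have "... <= ennreal (3 ^ ?n) * gmax p c x" by (rule sum_cubes_le_gmax[OF near_subset])
    finally show "?h j x <= ennreal (3 ^ ?n) * gmax p c x" .
   qed
   also have "... = ennreal (real (card ?J)) * (ennreal (3 ^ ?n) * gmax p c x)" by (simp add: ennreal_of_nat_eq_real_of_nat)
   also have "... <= ennreal (real (Suc L)) * (ennreal (3 ^ ?n) * gmax p c x)"
    using J(2) by (intro mult_right_mono ennreal_leI) auto
   also have "... = ennreal C * gmax p c x"
   proof -
    have "ennreal C = ennreal (real (Suc L)) * ennreal (3 ^ ?n)" unfolding C_def by (rule ennreal_mult) auto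
    then show ?thesis by (simp only: mult.assoc)
   qed
   finally show "(\<Sum>j. ?h j x) <= ennreal C * gmax p c x" .
  qed
  also have "... = ennreal C * (\<integral>\<^sup>+x. gmax p c x \<partial>lborel)"
   by (rule nn_integral_cmult) simp
  finally show ?thesis .
 qed
 have "0 < C" by (simp add: C_def)
 then show ?thesis using main by (intro exI[of _ C] conjI allI)
qed

text \<open>
  Atoms on small cubes that do not reach the boundary contribute to the average over a collar at most
  the part of the quasi-norm that comes from a slightly larger collar, which tends to 0.
\<close>

lemma avg_far_near_le:
 assumes p: "0 < p" "p <= 1" and d: "0 < d"
 shows "\<exists>C>0. \<exists>A>0. ALL K c a eps J J'. atoms_at d K IO a --> 0 < eps -->
   avg p eps (%x. \<Sum>j\<in>{J..<J'}. level IO c a j x) \<le>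
   ennreal C * ((\<Sum>j\<in>{J..<J'}. ennreal (bsum p (near (d + 1)) c j)) + (\<integral>\<^sup>+x. gmax p c x * indicator (collar (A * eps)) x \<partial>lborel))"
proof -
 let ?n = "CARD('n)" and ?k = "CARD('n) - 1"
 from emeasure_collar_dcube[OF d] obtain C1 where C1: "0 < C1" and C1': "\<forall>eps>0. ALL j m. emeasure lborel (collar eps Int dcube d j m) <= ennreal (C1 * eps / 2 ^ (j * ?k))"
  by (elim exE conjE)
 define N where "N = ((2 * d + 1) ^ ?n) powr p"
 have N: "0 < N" using d by (simp add: N_def)
 define A where "A = real ?n * (1 + d) + 1"
 have A: "0 < A" using d by (simp add: A_def add_nonneg_pos)
 define C2 where "C2 = d ^ ?n * 3 ^ ?n * 2"
 have C2: "0 < C2" using d by (simp add: C2_def)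
 define C where "C = N * (C1 + C2)"
 have C: "0 < C" using N C1 C2 by (simp add: C_def)
 have pj: "2 ^ (j * ?n) = 2 ^ j * (2 ^ (j * ?k) :: real)" for j
  by (metis Suc_dimb mult_Suc_right power_add)
 have main: "avg p eps (%x. \<Sum>j\<in>{J..<J'}. level IO c a j x) \<le>
   ennreal C * ((\<Sum>j\<in>{J..<J'}. ennreal (bsum p (near (d + 1)) c j)) + (\<integral>\<^sup>+x. gmax p c x * indicator (collar (A * eps)) x \<partial>lborel))"
  if at: "atoms_at d K IO a" and eps: "0 < eps" for K c a eps J J'
 proof -
  let ?g = "%j x. level IO c a j x * indicator (collar eps) x"
  define G where "G = (\<integral>\<^sup>+x. gmax p c x * indicator (collar (A * eps)) x \<partial>lborel)"
  define S where "S = (\<Sum>j\<in>{J..<J'}. ennreal (bsum p (near (d + 1)) c j))"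
  have gm: "?g j \<in> borel_measurable LO" for j
   using at by (intro borel_measurable_times indicator_collar_measurable continuous_measurable_domain level_continuous[of _ _ d K]) (auto simp: atoms_at_def)
  have scale: "1 / 2 ^ j < eps" if m: "m \<in> IO j - near (d + 1) j" and ne: "collar eps Int dcube d j m ~= {}" for j m
  proof (rule ccontr)
   assume small: "\<not> 1 / 2 ^ j < eps"
   obtain y where y: "infdist y \<Gamma> < eps" "y \<in> dcube d j m" using ne by (auto simp: collar_def)
   obtain g where g: "g \<in> \<Gamma>" "infdist y \<Gamma> = dist y g"
    by (rule infdist_attains_inf[OF compact_imp_closed[OF compact_boundary] boundary_nonempty])
   have "g \<in> dcube (d + 1) j m"
    unfolding dcube_def
   proof (intro CollectI allI)
    fix i
    have "\<bar>(g - y) $ i\<bar> <= 1 / 2 ^ j" using component_le_norm_cart[of "g - y" i] g(2) y(1) small by (simp add: dist_norm norm_minus_commute)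
    moreover have "\<bar>y $ i - of_int (m $ i) / 2 ^ j\<bar> <= d / 2 ^ j" using y(2) by (simp add: dcube_def)
    ultimately show "\<bar>g $ i - of_int (m $ i) / 2 ^ j\<bar> <= (d + 1) / 2 ^ j" by (simp add: add_divide_distrib)
   qed
   then show False using m g(1) by (auto simp: near_def)
  qed
  have lev: "pint p LO (?g j) <= ennreal N * (ennreal (C1 * eps) * ennreal (bsum p (near (d + 1)) c j) +
    ennreal (d ^ ?n * 3 ^ ?n * (if 1 / 2 ^ j < eps then 1 / 2 ^ j else 0)) * G)" for j
  proof -
   let ?t = "%m. ennreal (cmod (c j m) powr p) * emeasure lborel (collar eps Int dcube d j m)"
   have "pint p LO (?g j) <= ennreal N * (\<Sum>m\<in>IO j. ?t m)"
    unfolding N_def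
    by (rule pint_level_le[where K = K]) (use at finite_I p d in "auto simp: atoms_at_def collar_measurable")
   also have "(\<Sum>m\<in>IO j. ?t m) = (\<Sum>m\<in>near (d + 1) j. ?t m) + (\<Sum>m\<in>IO j - near (d + 1) j. ?t m)"
    using sum.subset_diff[OF near_subset finite_I] by (simp add: add.commute)
   also have "... <= ennreal (C1 * eps) * ennreal (bsum p (near (d + 1)) c j) +
    ennreal (d ^ ?n * 3 ^ ?n * (if 1 / 2 ^ j < eps then 1 / 2 ^ j else 0)) * G"
   proof (rule add_mono)
    have "(\<Sum>m\<in>near (d + 1) j. ?t m) <= (\<Sum>m\<in>near (d + 1) j. ennreal (cmod (c j m) powr p) * ennreal (C1 * eps / 2 ^ (j * ?k)))"
     using C1' eps by (intro sum_mono mult_left_mono) auto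
    also have "... = (\<Sum>m\<in>near (d + 1) j. ennreal (cmod (c j m) powr p * (C1 * eps / 2 ^ (j * ?k))))"
     using C1 eps by (intro sum.cong refl ennreal_mult[symmetric]) auto
    also have "... = ennreal (\<Sum>m\<in>near (d + 1) j. cmod (c j m) powr p * (C1 * eps / 2 ^ (j * ?k)))"
     using C1 eps by (intro sum_ennreal) auto
    also have "(\<Sum>m\<in>near (d + 1) j. cmod (c j m) powr p * (C1 * eps / 2 ^ (j * ?k))) = C1 * eps * bsum p (near (d + 1)) c j"
     by (simp only: bsum_def sum_distrib_right[symmetric]) simp
    also have "ennreal ... = ennreal (C1 * eps) * ennreal (bsum p (near (d + 1)) c j)"
     by (rule ennreal_mult) (use C1 eps in "auto simp: bsum_nonneg")
    finally show "(\<Sum>m\<in>near (d + 1) j. ?t m) <= ennreal (C1 * eps) * ennreal (bsum p (near (d + 1)) c j)" .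
   next
    show "(\<Sum>m\<in>IO j - near (d + 1) j. ?t m) <= ennreal (d ^ ?n * 3 ^ ?n * (if 1 / 2 ^ j < eps then 1 / 2 ^ j else 0)) * G"
    proof (cases "1 / 2 ^ j < eps")
     case False
     then have "?t m = 0" if "m \<in> IO j - near (d + 1) j" for m
     proof -
      have "collar eps Int dcube d j m = {}" using scale[OF that] False by blast
      then show ?thesis by simp
     qed
     then have "(\<Sum>m\<in>IO j - near (d + 1) j. ?t m) = 0" by (intro sum.neutral) auto
     then show ?thesis by simp
    next
     case True
     let ?u = "%m x. ennreal (2 ^ j * cmod (c j m) powr p) * indicator (cube j m Int collar (A * eps)) x"
     have "?t m <= ennreal (d ^ ?n / 2 ^ j) * (\<integral>\<^sup>+x. ?u m x \<partial>lborel)" if m: "m \<in> IO j - near (d + 1) j" for m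
     proof (cases "collar eps Int dcube d j m = {}")
      case False
      then obtain y where y: "infdist y \<Gamma> < eps" "y \<in> dcube d j m" by (auto simp: collar_def)
      have sub: "cube j m \<subseteq> collar (A * eps)"
      proof
       fix x assume "x \<in> cube j m"
       then have "dist x y <= real ?n * (1 + d) / 2 ^ j" using dist_dcubes y(2) by blast
       also have "... = real ?n * (1 + d) * (1 / 2 ^ j)" by simp
       also have "... <= real ?n * (1 + d) * eps" using True d by (intro mult_left_mono) auto
       finally have "infdist x \<Gamma> <= infdist y \<Gamma> + real ?n * (1 + d) * eps" using infdist_triangle[of x \<Gamma> y] by simp
       also have "... < A * eps" using y(1) by (simp add: A_def distrib_right)
       finally show "x \<in> collar (A * eps)" by (simp add: collar_def)
      qed
      have "?t m <= ennreal (cmod (c j m) powr p) * emeasure lborel (dcube d j m)"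
       by (intro mult_left_mono emeasure_mono) auto
      also have "... = ennreal (cmod (c j m) powr p * (2 * d / 2 ^ j) ^ ?n)"
       using d by (subst emeasure_dcube) (auto simp: ennreal_mult)
      also have "cmod (c j m) powr p * (2 * d / 2 ^ j) ^ ?n = (d ^ ?n / 2 ^ j) * (2 ^ j * cmod (c j m) powr p * (2 * 1 / 2 ^ j) ^ ?n)"
       by (simp add: power_mult_distrib power_divide)
      also have "ennreal ... = ennreal (d ^ ?n / 2 ^ j) * (ennreal (2 ^ j * cmod (c j m) powr p) * ennreal ((2 * 1 / 2 ^ j) ^ ?n))"
       using d by (subst ennreal_mult, simp, simp, subst ennreal_mult) auto
      also have "ennreal ((2 * 1 / 2 ^ j) ^ ?n) = emeasure lborel (cube j m Int collar (A * eps))"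
       using emeasure_dcube[of 1 j m] sub by (simp add: Int_absorb2)
      also have "ennreal (2 ^ j * cmod (c j m) powr p) * emeasure lborel (cube j m Int collar (A * eps)) = (\<integral>\<^sup>+x. ?u m x \<partial>lborel)"
       by (subst nn_integral_cmult_indicator) (auto simp: collar_measurable)
      finally show ?thesis .
     qed simp
     then have "(\<Sum>m\<in>IO j - near (d + 1) j. ?t m) <= (\<Sum>m\<in>IO j - near (d + 1) j. ennreal (d ^ ?n / 2 ^ j) * (\<integral>\<^sup>+x. ?u m x \<partial>lborel))"
      by (rule sum_mono)
     also have "... = ennreal (d ^ ?n / 2 ^ j) * (\<integral>\<^sup>+x. (\<Sum>m\<in>IO j - near (d + 1) j. ?u m x) \<partial>lborel)"
     proof -
      have um: "?u m \<in> borel_measurable lborel" for m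
       by (intro borel_measurable_times_ennreal borel_measurable_const borel_measurable_indicator) (use collar_measurable in auto)
      show ?thesis unfolding sum_distrib_left[symmetric] nn_integral_sum[OF um] ..
     qed
     also have "... <= ennreal (d ^ ?n / 2 ^ j) * (\<integral>\<^sup>+x. ennreal (3 ^ ?n) * (gmax p c x * indicator (collar (A * eps)) x) \<partial>lborel)"
     proof (intro mult_left_mono nn_integral_mono)
      fix x
      show "(\<Sum>m\<in>IO j - near (d + 1) j. ?u m x) <= ennreal (3 ^ ?n) * (gmax p c x * indicator (collar (A * eps)) x)"
      proof (cases "x \<in> collar (A * eps)")
       case True
       then have "(\<Sum>m\<in>IO j - near (d + 1) j. ?u m x) = (\<Sum>m\<in>IO j - near (d + 1) j. ennreal (2 ^ j * cmod (c j m) powr p) * indicator (cube j m) x)"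
        by (intro sum.cong) (auto simp: indicator_def)
       then show ?thesis using sum_cubes_le_gmax[of "IO j - near (d + 1) j" j c p x] True by simp
      qed simp
     qed simp
     also have "... = ennreal (d ^ ?n / 2 ^ j) * (ennreal (3 ^ ?n) * G)"
     proof -
      have "(%x. gmax p c x * indicator (collar (A * eps)) x) \<in> borel_measurable lborel"
       by (intro borel_measurable_times_ennreal borel_measurable_indicator) (use gmax_measurable collar_measurable in auto)
      then show ?thesis unfolding G_def by (subst nn_integral_cmult) auto
     qed
     also have "... = ennreal (d ^ ?n * 3 ^ ?n * (1 / 2 ^ j)) * G"
     proof -
      have "ennreal (d ^ ?n * 3 ^ ?n * (1 / 2 ^ j)) = ennreal (d ^ ?n / 2 ^ j) * ennreal (3 ^ ?n)"
       using d by (subst ennreal_mult[symmetric]) auto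
      then show ?thesis by (simp only: mult.assoc)
     qed
     finally show ?thesis using True by simp
    qed
   qed
   finally show ?thesis by (simp add: mult_left_mono)
  qed
  have "pint p LO (%x. \<Sum>j\<in>{J..<J'}. ?g j x) <= (\<Sum>j\<in>{J..<J'}. pint p LO (?g j))"
   by (rule pint_sum_le) (use p gm in auto)
  also have "... <= (\<Sum>j\<in>{J..<J'}. ennreal N * (ennreal (C1 * eps) * ennreal (bsum p (near (d + 1)) c j) +
    ennreal (d ^ ?n * 3 ^ ?n * (if 1 / 2 ^ j < eps then 1 / 2 ^ j else 0)) * G))"
   by (rule sum_mono[OF lev])
  also have "... = ennreal N * (ennreal (C1 * eps) * S + (\<Sum>j\<in>{J..<J'}. ennreal (d ^ ?n * 3 ^ ?n * (if 1 / 2 ^ j < eps then 1 / 2 ^ j else 0))) * G)"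
   by (simp only: S_def sum_distrib_left sum_distrib_right sum.distrib distrib_left)
  also have "(\<Sum>j\<in>{J..<J'}. ennreal (d ^ ?n * 3 ^ ?n * (if 1 / 2 ^ j < eps then 1 / 2 ^ j else 0))) =
   ennreal (\<Sum>j\<in>{J..<J'}. d ^ ?n * 3 ^ ?n * (if 1 / 2 ^ j < eps then 1 / 2 ^ j else 0))"
   using d by (intro sum_ennreal) auto
  also have "(\<Sum>j\<in>{J..<J'}. d ^ ?n * 3 ^ ?n * (if 1 / 2 ^ j < eps then 1 / 2 ^ j else 0)) =
   d ^ ?n * 3 ^ ?n * (\<Sum>j\<in>{j \<in> {J..<J'}. 1 / 2 ^ j < eps}. 1 / 2 ^ j)"
   unfolding sum_distrib_left[symmetric] by (subst sum.inter_filter) auto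
  also have "ennreal N * (ennreal (C1 * eps) * S + ennreal (d ^ ?n * 3 ^ ?n * (\<Sum>j\<in>{j \<in> {J..<J'}. 1 / 2 ^ j < eps}. 1 / 2 ^ j)) * G)
    <= ennreal N * (ennreal ((C1 + C2) * eps) * S + ennreal ((C1 + C2) * eps) * G)"
  proof -
   have h1: "C1 * eps <= (C1 + C2) * eps" using C2 eps by simp
   have "d ^ ?n * 3 ^ ?n * (\<Sum>j\<in>{j \<in> {J..<J'}. 1 / 2 ^ j < eps}. 1 / 2 ^ j) <= d ^ ?n * 3 ^ ?n * (2 * eps)"
    using d by (intro mult_left_mono sum_dyadic_le eps) auto
   also have "... = C2 * eps" by (simp add: C2_def)
   also have "... <= (C1 + C2) * eps" using C1 eps by simp
   finally have h2: "d ^ ?n * 3 ^ ?n * (\<Sum>j\<in>{j \<in> {J..<J'}. 1 / 2 ^ j < eps}. 1 / 2 ^ j) <= (C1 + C2) * eps" .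
   show ?thesis
    by (rule mult_left_mono[OF add_mono[OF mult_right_mono[OF ennreal_leI[OF h1]] mult_right_mono[OF ennreal_leI[OF h2]]]]) simp_all
  qed
  also have "... = ennreal eps * (ennreal C * (S + G))"
  proof -
   have "ennreal eps * ennreal C = ennreal N * ennreal ((C1 + C2) * eps)"
    using eps N C1 C2 by (simp add: ennreal_mult[symmetric] C_def mult_ac)
   then show ?thesis by (simp add: mult.assoc[symmetric] distrib_left)
  qed
  finally have fin: "pint p LO (%x. \<Sum>j\<in>{J..<J'}. ?g j x) <= ennreal eps * (ennreal C * (S + G))" .
  have "avg p eps (%x. \<Sum>j\<in>{J..<J'}. level IO c a j x) = ennreal (1 / eps) * pint p LO (%x. \<Sum>j\<in>{J..<J'}. ?g j x)"
   unfolding avg_def by (simp add: sum_distrib_right)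
  also have "... <= ennreal (1 / eps) * (ennreal eps * (ennreal C * (S + G)))" by (intro mult_left_mono fin) simp
  also have "... = ennreal C * (S + G)" using eps by (simp add: mult.assoc[symmetric] ennreal_mult[symmetric])
  finally show ?thesis by (simp only: S_def G_def)
 qed
 show ?thesis using C A main by (intro exI[of _ C] exI[of _ A] conjI allI impI)
qed

lemma boundary_null: "emeasure lborel \<Gamma> = 0"
proof -
 from emeasure_collar obtain Cv where Cv: "0 < Cv" and Cv': "ALL z eps R. 0 < eps --> eps <= R -->
   emeasure lborel (collar eps Int cball z R) <= ennreal (Cv * eps * R ^ (CARD('n) - 1))" by (elim exE conjE)
 obtain B where B: "0 < B" "\<Gamma> \<subseteq> cball 0 B"
  using compact_imp_bounded[OF compact_boundary] by (auto simp: bounded_pos subset_iff)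
 have le: "emeasure lborel \<Gamma> <= ennreal (Cv * eps * B ^ (CARD('n) - 1))" if "0 < eps" "eps <= B" for eps
 proof -
  have "\<Gamma> \<subseteq> collar eps Int cball 0 B" using B that by (auto simp: collar_def)
  then have "emeasure lborel \<Gamma> <= emeasure lborel (collar eps Int cball 0 B)"
   by (intro emeasure_mono) (auto simp: collar_measurable)
  also have "... <= ennreal (Cv * eps * B ^ (CARD('n) - 1))" using Cv' that by blast
  finally show ?thesis .
 qed
 have "((%eps. ennreal (Cv * eps * B ^ (CARD('n) - 1))) \<longlongrightarrow> ennreal (Cv * 0 * B ^ (CARD('n) - 1))) (at_right 0)"
  by (intro tendsto_ennrealI tendsto_intros)
 moreover have "\<forall>\<^sub>F eps in at_right 0. emeasure lborel \<Gamma> <= ennreal (Cv * eps * B ^ (CARD('n) - 1))"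
  using B(1) le by (intro eventually_at_rightI[of 0 B]) auto
 ultimately have "emeasure lborel \<Gamma> <= ennreal (Cv * 0 * B ^ (CARD('n) - 1))"
  by (intro tendsto_lowerbound[OF _ _ trivial_limit_at_right_real])
 then show ?thesis by simp
qed

text \<open>Dominated convergence: the collars shrink to the boundary, which is a Lebesgue null set.\<close>

lemma gmax_collar_small:
 assumes fin: "(\<integral>\<^sup>+x. gmax p c x \<partial>lborel) < \<infinity>" and eta: "0 < eta" and A: "0 < A"
 shows "\<forall>\<^sub>F eps in at_right 0. (\<integral>\<^sup>+x. gmax p c x * indicator (collar (A * eps)) x \<partial>lborel) <= ennreal eta"
proof -
 let ?F = "%eps. \<integral>\<^sup>+x. gmax p c x * indicator (collar eps) x \<partial>lborel"
 have mono: "?F eps <= ?F eps'" if "eps <= eps'" for eps eps'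
  by (intro nn_integral_mono mult_left_mono) (use that in "auto simp: indicator_def collar_def")
 have "(%i. ?F (1 / real (Suc i))) ----> (\<integral>\<^sup>+x. gmax p c x * indicator \<Gamma> x \<partial>lborel)"
 proof (rule nn_integral_dominated_convergence)
  show "(%x. gmax p c x * indicator (collar (1 / real (Suc i))) x) \<in> borel_measurable lborel" for i
   by (intro borel_measurable_times_ennreal borel_measurable_indicator) (use gmax_measurable collar_measurable in auto)
  show "(%x. gmax p c x * indicator \<Gamma> x) \<in> borel_measurable lborel"
   by (intro borel_measurable_times_ennreal borel_measurable_indicator) (use gmax_measurable boundary_borel in auto)
  show "gmax p c \<in> borel_measurable lborel" using gmax_measurable by simp
  show "(\<integral>\<^sup>+x. gmax p c x \<partial>lborel) < \<infinity>" by (rule fin)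
  show "AE x in lborel. gmax p c x * indicator (collar (1 / real (Suc i))) x <= gmax p c x" for i
   by (auto simp: indicator_def)
  show "AE x in lborel. (%i. gmax p c x * indicator (collar (1 / real (Suc i))) x) ----> gmax p c x * indicator \<Gamma> x"
  proof (rule AE_I2)
   fix x
   show "(%i. gmax p c x * indicator (collar (1 / real (Suc i))) x) ----> gmax p c x * indicator \<Gamma> x"
   proof (cases "x \<in> \<Gamma>")
    case True
    then have "x \<in> collar (1 / real (Suc i))" for i by (simp add: collar_def)
    then show ?thesis using True by simp
   next
    case False
    then have pos: "0 < infdist x \<Gamma>"
     using in_closed_iff_infdist_zero[OF compact_imp_closed[OF compact_boundary] boundary_nonempty] infdist_nonneg[of x \<Gamma>] by (auto simp: less_le)
    have "(%i. 1 / real (Suc i)) ----> 0" using LIMSEQ_inverse_real_of_nat by (simp add: inverse_eq_divide)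
    then have "\<forall>\<^sub>F i in sequentially. 1 / real (Suc i) < infdist x \<Gamma>" using pos by (rule order_tendstoD)
    then have "\<forall>\<^sub>F i in sequentially. gmax p c x * indicator (collar (1 / real (Suc i))) x = gmax p c x * indicator \<Gamma> x"
     by eventually_elim (use False in "auto simp: collar_def indicator_def")
    then show ?thesis by (rule tendsto_eventually)
   qed
  qed
 qed
 moreover have "(\<integral>\<^sup>+x. gmax p c x * indicator \<Gamma> x \<partial>lborel) = 0"
 proof -
  have "\<Gamma> \<in> null_sets lborel" using boundary_null boundary_borel by auto
  then have "AE x in lborel. x ~: \<Gamma>" by (rule AE_not_in)
  then have "AE x in lborel. gmax p c x * indicator \<Gamma> x = 0" by eventually_elim simp
  then have "(\<integral>\<^sup>+x. gmax p c x * indicator \<Gamma> x \<partial>lborel) = (\<integral>\<^sup>+x. 0 \<partial>(lborel :: (real, 'n) vec measure))" by (rule nn_integral_cong_AE)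
  then show ?thesis by simp
 qed
 ultimately have "\<forall>\<^sub>F i in sequentially. ?F (1 / real (Suc i)) < ennreal eta"
  using eta by (intro order_tendstoD(2)[of _ 0]) auto
 then obtain i where i: "?F (1 / real (Suc i)) < ennreal eta" using eventually_happens'[OF sequentially_bot] by fastforce
 have "?F (A * eps) <= ennreal eta" if "0 < eps" "eps < 1 / real (Suc i) / A" for eps
 proof -
  have "eps * A < 1 / real (Suc i)" using that(2) A by (simp only: pos_less_divide_eq)
  then have "A * eps <= 1 / real (Suc i)" by (simp only: mult.commute less_imp_le)
  then have "?F (A * eps) <= ?F (1 / real (Suc i))" by (rule mono)
  then show ?thesis using i by simp
 qed
 then show ?thesis using A by (intro eventually_at_rightI[of 0 "1 / real (Suc i) / A"]) auto
qed

text \<open>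
  Both parts are controlled by the integral of \<open>gmax\<close>; the one from the small cubes off the
  boundary is absorbed in \<open>eta\<close>.
\<close>

lemma collar_bound_F:
 assumes p: "0 < p" "p <= 1" and d: "0 < d"
 shows "\<exists>C>0. \<forall>K f c a J eta. f \<in> borel_measurable LO --> atomic_rep d K p \<Omega> f c a -->
   (\<integral>\<^sup>+x. gmax p c x \<partial>lborel) < \<infinity> --> 0 < eta -->
   collar_bound p (%x. f x - psum c a J x)
    (ennreal C * ((\<Sum>j. ennreal (bsum p (near (d + 1)) c (j + J))) + ennreal eta))"
proof -
 from avg_far_near_le[OF p d] obtain C A where C: "0 < C" and A: "0 < A" and CA: "ALL K c a eps J J'. atoms_at d K IO a --> 0 < eps -->
   avg p eps (%x. \<Sum>j\<in>{J..<J'}. level IO c a j x) \<le>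
   ennreal C * ((\<Sum>j\<in>{J..<J'}. ennreal (bsum p (near (d + 1)) c j)) + (\<integral>\<^sup>+x. gmax p c x * indicator (collar (A * eps)) x \<partial>lborel))"
  by (elim exE conjE)
 have "collar_bound p (%x. f x - psum c a J x)
    (ennreal (2 powr p * C) * ((\<Sum>j. ennreal (bsum p (near (d + 1)) c (j + J))) + ennreal eta))"
  if f: "f \<in> borel_measurable LO" and rep: "atomic_rep d K p \<Omega> f c a" and fin: "(\<integral>\<^sup>+x. gmax p c x \<partial>lborel) < \<infinity>" and eta: "0 < eta" for K f c a J eta
 proof -
  have at: "atoms_at d K IO a" and lim: "(%J. pint p LO (%x. f x - psum c a J x)) ----> 0"
   using rep unfolding atomic_rep_iff[OF p(1)] by auto
  have pos: "\<forall>\<^sub>F eps in at_right (0::real). 0 < eps" by (simp add: eventually_at_filter)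
  show ?thesis
   using gmax_collar_small[OF fin eta A] pos unfolding collar_bound_def
  proof eventually_elim
   case (elim eps)
   let ?S = "\<Sum>j. ennreal (bsum p (near (d + 1)) c (j + J))"
   have "avg p eps (%x. f x - psum c a J x) <= ennreal (2 powr p) * (ennreal C * (?S + ennreal eta))"
   proof (rule avg_limit[OF p(1) elim(2) f partial_sum_continuous[OF at] lim])
    fix J' assume J': "J <= J'"
    have "avg p eps (%x. psum c a J' x - psum c a J x) \<le>
     ennreal C * ((\<Sum>j\<in>{J..<J'}. ennreal (bsum p (near (d + 1)) c j)) + (\<integral>\<^sup>+x. gmax p c x * indicator (collar (A * eps)) x \<partial>lborel))"
     unfolding partial_sum_diff[OF J'] using CA at elim(2) by blast
    also have "... <= ennreal C * (?S + ennreal eta)"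
    proof (intro mult_left_mono add_mono elim(1))
     have "(\<Sum>j\<in>{J..<J'}. ennreal (bsum p (near (d + 1)) c j)) = (\<Sum>j<J' - J. ennreal (bsum p (near (d + 1)) c (j + J)))"
      using sum.shift_bounds_nat_ivl[of "%j. ennreal (bsum p (near (d + 1)) c j)" 0 J "J' - J"] J' by (simp add: atLeast0LessThan)
     also have "... <= ?S" by (intro sum_le_suminf summableI) auto
     finally show "(\<Sum>j\<in>{J..<J'}. ennreal (bsum p (near (d + 1)) c j)) <= ?S" .
    qed simp
    finally show "avg p eps (%x. psum c a J' x - psum c a J x) <= ennreal C * (?S + ennreal eta)" .
   qed
   also have "... = ennreal (2 powr p * C) * (?S + ennreal eta)" using C by (simp add: ennreal_mult mult.assoc)
   finally show ?case .
  qed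
 qed
 then show ?thesis using C by (intro exI[of _ "2 powr p * C"] conjI allI impI) auto
qed

end


section \<open>The sequence quasi-norms\<close>

lemma suminf_ennreal_tail:
 fixes u :: "nat => ennreal"
 assumes fin: "suminf u < top"
 shows "(%n. \<Sum>i. u (i + n)) ----> 0"
proof -
 have r: "!!i. u i = ennreal (enn2real (u i))"
  using fin by (metis ennreal_enn2real ennreal_suminf_lessD less_top)
 have s: "summable (%i. enn2real (u i))"
  using fin by (intro summable_suminf_not_top) (auto simp: r[symmetric])
 have "(\<Sum>i. u (i + n)) = ennreal (\<Sum>i. enn2real (u (i + n)))" for n
  using summable_ignore_initial_segment[OF s, of n]
  by (subst suminf_ennreal2[symmetric]) (auto simp: r[symmetric])
 moreover have "(%n. \<Sum>i. enn2real (u (i + n))) ----> 0" by (rule suminf_exist_split2[OF s])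
 ultimately show ?thesis by (simp add: tendsto_ennrealI[of _ 0, simplified])
qed

lemma infsum_nat_ennreal: "infsum u UNIV = suminf (u :: nat => ennreal)"
 by (rule sums_unique, rule has_sum_imp_sums, rule has_sum_infsum, rule nonneg_summable_on_complete) simp

lemma infsum_Sigma_ennreal:
 fixes g :: "nat \<times> 'i => ennreal"
 assumes fin: "!!j. finite (I j)"
 shows "infsum g (SIGMA j:UNIV. I j) = (\<Sum>j. \<Sum>m\<in>I j. g (j, m))"
proof (rule antisym)
 show "infsum g (SIGMA j:UNIV. I j) <= (\<Sum>j. \<Sum>m\<in>I j. g (j, m))"
  unfolding nonneg_infsum_complete[of "SIGMA j:UNIV. I j" g, OF zero_le]
 proof (rule SUP_least)
  fix F assume "F \<in> {F. finite F & F \<subseteq> (SIGMA j:UNIV. I j)}"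
  then have F: "finite F" "F \<subseteq> (SIGMA j:UNIV. I j)" by auto
  obtain J where J: "!!x. x \<in> F ==> fst x < J"
   using finite_nat_set_iff_bounded[of "fst ` F"] F(1) by auto
  have "sum g F <= sum g (SIGMA j:{..<J}. I j)"
   by (rule sum_mono2) (use F J fin in fastforce)+
  also have "... = (\<Sum>j<J. \<Sum>m\<in>I j. g (j, m))"
   using fin by (subst sum.Sigma) auto
  also have "... <= (\<Sum>j. \<Sum>m\<in>I j. g (j, m))" by (intro sum_le_suminf summableI) auto
  finally show "sum g F <= (\<Sum>j. \<Sum>m\<in>I j. g (j, m))" .
 qed
 show "(\<Sum>j. \<Sum>m\<in>I j. g (j, m)) <= infsum g (SIGMA j:UNIV. I j)"
 proof (rule suminf_le_const[OF summableI])
  fix J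
  have "(\<Sum>j<J. \<Sum>m\<in>I j. g (j, m)) = sum g (SIGMA j:{..<J}. I j)"
   using fin by (subst sum.Sigma) auto
  also have "... <= infsum g (SIGMA j:UNIV. I j)"
   unfolding nonneg_infsum_complete[of "SIGMA j:UNIV. I j" g, OF zero_le]
   using fin by (intro SUP_upper) auto
  finally show "(\<Sum>j<J. \<Sum>m\<in>I j. g (j, m)) <= infsum g (SIGMA j:UNIV. I j)" .
 qed
qed

lemma epowr_measurable [measurable]: "(%x. x epowr a) \<in> borel_measurable borel"
 unfolding epowr_def by measurable

text \<open>
  Used with \<open>a\<close> the quotient of \<open>min 1 p\<close> by \<open>q\<close>: this is the
  embedding between sequence spaces that reduces all admissible \<open>q\<close> to the largest one.
\<close>

lemma suminf_powr_le:
 fixes x :: "nat => real"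
 assumes s: "summable x" and nn: "!!j. 0 <= x j" and a: "1 <= a"
 shows "summable (%j. x j powr a)" "(\<Sum>j. x j powr a) <= (\<Sum>j. x j) powr a"
proof -
 have le: "(\<Sum>j<J. x j powr a) <= (\<Sum>j. x j) powr a" for J
 proof -
  have "(\<Sum>j<J. x j powr a) powr (1 / a) <= (\<Sum>j<J. (x j powr a) powr (1 / a))"
   by (rule powr_sum_le) (use a in auto)
  also have "... = (\<Sum>j<J. x j)" using a nn by (simp add: powr_powr)
  also have "... <= (\<Sum>j. x j)" by (intro sum_le_suminf s) (use nn in auto)
  finally have "((\<Sum>j<J. x j powr a) powr (1 / a)) powr a <= (\<Sum>j. x j) powr a"
   using a by (intro powr_mono2) auto
  then show ?thesis using a by (simp add: powr_powr sum_nonneg)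
 qed
 show sa: "summable (%j. x j powr a)"
  by (rule summableI_nonneg_bounded[OF _ le]) simp
 show "(\<Sum>j. x j powr a) <= (\<Sum>j. x j) powr a"
  by (rule suminf_le_const[OF sa le])
qed

context lipschitz_domain
begin

text \<open>
  The factor \<open>(1 / 2) ^ J\<close> on the first levels is the accuracy to which the atoms there are
  smoothed.
\<close>

definition shrink :: "nat => 'n coeffs => 'n coeffs" where
 "shrink J c j m = (if j < J then of_real ((1 / 2) ^ J) else 1) * c j m"

lemma lq_norm_level:
 assumes p: "0 < p"
 shows "ennreal (2 powr (real j * (1 / p - real CARD('n) / p))) * lq_norm (ennreal p) (IO j) (%m. ennreal (cmod (c j m)))
  = ennreal (bsum p IO c j powr (1 / p))"
proof -
 let ?S = "\<Sum>m\<in>IO j. cmod (c j m) powr p"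
 have "lq_norm (ennreal p) (IO j) (%m. ennreal (cmod (c j m))) = (\<Sum>m\<in>IO j. ennreal (cmod (c j m) powr p)) epowr (1 / p)"
  using p finite_I[of j] by (simp add: lq_norm_def epowr_ennreal)
 also have "... = ennreal (?S powr (1 / p))" by (simp add: sum_ennreal epowr_ennreal sum_nonneg)
 finally have l: "lq_norm (ennreal p) (IO j) (%m. ennreal (cmod (c j m))) = ennreal (?S powr (1 / p))" .
 have "1 / p - real CARD('n) / p = - (real (CARD('n) - 1) / p)"
  using dim by (simp add: diff_divide_distrib[symmetric] of_nat_diff minus_divide_left)
 then have "2 powr (real j * (1 / p - real CARD('n) / p)) = (2 powr (- real (j * (CARD('n) - 1)))) powr (1 / p)"
  by (simp add: powr_powr)
 also have "2 powr (- real (j * (CARD('n) - 1))) = 1 / 2 ^ (j * (CARD('n) - 1))"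
  by (simp only: powr_minus powr_realpow[OF zero_less_numeral] inverse_eq_divide)
 finally have e: "2 powr (real j * (1 / p - real CARD('n) / p)) = (1 / 2 ^ (j * (CARD('n) - 1))) powr (1 / p)" .
 have "bsum p IO c j powr (1 / p) = ((1 / 2 ^ (j * (CARD('n) - 1))) * ?S) powr (1 / p)"
  by (simp add: bsum_def)
 also have "... = (1 / 2 ^ (j * (CARD('n) - 1))) powr (1 / p) * ?S powr (1 / p)"
  by (rule powr_mult)
 finally have "bsum p IO c j powr (1 / p) = 2 powr (real j * (1 / p - real CARD('n) / p)) * ?S powr (1 / p)"
  unfolding e .
 then show ?thesis unfolding l by (simp add: ennreal_mult)
qed

lemma b_norm_eq:
 assumes p: "0 < p" and t: "0 < t"
 shows "b_norm (1 / p) p (ennreal t) \<Omega> c = (\<Sum>j. ennreal (bsum p IO c j powr (t / p))) epowr (1 / t)"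
proof -
 have "b_norm (1 / p) p (ennreal t) \<Omega> c = lq_norm (ennreal t) UNIV (%j. ennreal (bsum p IO c j powr (1 / p)))"
  unfolding b_norm_def lq_norm_level[OF p] ..
 also have "... = (\<Sum>j. ennreal (bsum p IO c j powr (1 / p)) epowr t) epowr (1 / t)"
  using t by (simp add: lq_norm_def infsum_nat_ennreal)
 also have "(%j. ennreal (bsum p IO c j powr (1 / p)) epowr t) = (%j. ennreal (bsum p IO c j powr (t / p)))"
  by (simp add: epowr_ennreal powr_powr)
 finally show ?thesis .
qed

text \<open>The common consequences of the two kinds of estimates for traces.\<close>

definition trace_norm :: "real => real => ('n coeffs => ennreal) => bool" where
 "trace_norm p d \<nu> \<longleftrightarrow>
  (ALL K f c a. f \<in> borel_measurable LO --> atomic_rep d K p \<Omega> f c a --> \<nu> c < \<infinity> -->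
    (EX M. M ----> 0 & (ALL J. collar_bound p (%x. f x - psum c a J x) (M J)))) \<and>
  (\<exists>C>0. \<forall>K f c a eta. f \<in> borel_measurable LO --> atomic_rep d K p \<Omega> f c a --> \<nu> c < \<infinity> --> 0 < eta -->
    collar_bound p f (ennreal C * (\<nu> c epowr p + ennreal eta)))"

text \<open>The tails of a convergent series bound the differences to the partial sums.\<close>

lemma trace_norm_B:
 assumes p: "0 < p" and d: "0 < d" and t: "0 < t" "t <= min 1 p"
 shows "trace_norm p d (b_norm (1 / p) p (ennreal t) \<Omega>)"
proof -
 define r where "r = min 1 p"
 have r: "0 < r" "t <= r" using p t by (auto simp: r_def)
 have rt: "1 <= r / t" using t(1) r(2) by simp
 from collar_bound_B[OF p d] obtain C where C: "0 < C" and C': "ALL K f c a J. f \<in> borel_measurable LO --> atomic_rep d K p \<Omega> f c a -->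
   summable (%j. bsum p IO c j powr (r / p)) -->
   collar_bound p (%x. f x - psum c a J x)
    (ennreal (C * (\<Sum>j. bsum p IO c (j + J) powr (r / p)) powr (p / r)))"
  unfolding r_def[symmetric] by (elim exE conjE)
 have fin: "summable (%j. bsum p IO c j powr (r / p))"
  "ennreal ((\<Sum>j. bsum p IO c j powr (r / p)) powr (p / r)) <= b_norm (1 / p) p (ennreal t) \<Omega> c epowr p"
  if "b_norm (1 / p) p (ennreal t) \<Omega> c < \<infinity>" for c
 proof -
  let ?x = "%j. bsum p IO c j powr (t / p)"
  have lt: "(\<Sum>j. ennreal (?x j)) < \<infinity>" using that unfolding b_norm_eq[OF p t(1)] epowr_less_top_iff .
  have s: "summable ?x" by (rule summable_suminf_not_top) (use lt in auto)
  have e: "(\<Sum>j. ennreal (?x j)) = ennreal (\<Sum>j. ?x j)" by (rule suminf_ennreal2) (use s in auto)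
  have xr: "?x j powr (r / t) = bsum p IO c j powr (r / p)" for j using t by (simp add: powr_powr)
  note x = suminf_powr_le[OF s _ rt, unfolded xr]
  show "summable (%j. bsum p IO c j powr (r / p))" by (rule x(1)) simp
  have "(\<Sum>j. bsum p IO c j powr (r / p)) powr (p / r) <= ((\<Sum>j. ?x j) powr (r / t)) powr (p / r)"
   using p r by (intro powr_mono2 x(2) suminf_nonneg x(1)) auto
  also have "... = (\<Sum>j. ?x j) powr (p / t)" using r by (simp add: powr_powr)
  finally have "ennreal ((\<Sum>j. bsum p IO c j powr (r / p)) powr (p / r)) <= ennreal ((\<Sum>j. ?x j) powr (p / t))" by (rule ennreal_leI)
  also have "... = b_norm (1 / p) p (ennreal t) \<Omega> c epowr p"
  proof -
   have "0 <= (\<Sum>j. ?x j)" by (intro suminf_nonneg s) simp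
   then show ?thesis unfolding b_norm_eq[OF p t(1)] e by (simp add: epowr_ennreal powr_powr)
  qed
  finally show "ennreal ((\<Sum>j. bsum p IO c j powr (r / p)) powr (p / r)) <= b_norm (1 / p) p (ennreal t) \<Omega> c epowr p" .
 qed
 show ?thesis
  unfolding trace_norm_def
 proof (rule conjI)
  show "ALL K f c a. f \<in> borel_measurable LO --> atomic_rep d K p \<Omega> f c a --> b_norm (1 / p) p (ennreal t) \<Omega> c < \<infinity> -->
    (EX M. M ----> 0 & (ALL J. collar_bound p (%x. f x - psum c a J x) (M J)))"
  proof (intro allI impI)
   fix K f c a
   assume f: "f \<in> borel_measurable LO" "atomic_rep d K p \<Omega> f c a" and lt: "b_norm (1 / p) p (ennreal t) \<Omega> c < \<infinity>"
   let ?M = "%J. ennreal (C * (\<Sum>j. bsum p IO c (j + J) powr (r / p)) powr (p / r))"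
   have "(%J. \<Sum>j. bsum p IO c (j + J) powr (r / p)) ----> 0" by (rule suminf_exist_split2[OF fin(1)[OF lt]])
   then have "(%J. (\<Sum>j. bsum p IO c (j + J) powr (r / p)) powr (p / r)) ----> 0 powr (p / r)"
    using p r by (intro tendsto_powr2 tendsto_const always_eventually allI suminf_nonneg summable_ignore_initial_segment fin(1)[OF lt]) auto
   then have "(%J. C * (\<Sum>j. bsum p IO c (j + J) powr (r / p)) powr (p / r)) ----> C * 0 powr (p / r)"
    by (intro tendsto_mult tendsto_const)
   then have "?M ----> ennreal (C * 0 powr (p / r))" by (rule tendsto_ennrealI)
   then have "?M ----> 0" by simp
   moreover have "ALL J. collar_bound p (%x. f x - psum c a J x) (?M J)"
    using C' f fin(1)[OF lt] by blast
   ultimately show "EX M. M ----> 0 & (ALL J. collar_bound p (%x. f x - psum c a J x) (M J))"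
    by (intro exI[of _ ?M] conjI)
  qed
  have "collar_bound p f (ennreal C * (b_norm (1 / p) p (ennreal t) \<Omega> c epowr p + ennreal eta))"
   if f: "f \<in> borel_measurable LO" "atomic_rep d K p \<Omega> f c a" and lt: "b_norm (1 / p) p (ennreal t) \<Omega> c < \<infinity>" for K f c a eta
  proof -
   have "collar_bound p (%x. f x - (\<Sum>j<0. level IO c a j x)) (ennreal (C * (\<Sum>j. bsum p IO c (j + 0) powr (r / p)) powr (p / r)))"
    using C' f fin(1)[OF lt] by blast
   then have "collar_bound p f (ennreal (C * (\<Sum>j. bsum p IO c j powr (r / p)) powr (p / r)))" by simp
   moreover have "ennreal (C * (\<Sum>j. bsum p IO c j powr (r / p)) powr (p / r)) <= ennreal C * (b_norm (1 / p) p (ennreal t) \<Omega> c epowr p + ennreal eta)"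
   proof -
    have "ennreal (C * (\<Sum>j. bsum p IO c j powr (r / p)) powr (p / r)) = ennreal C * ennreal ((\<Sum>j. bsum p IO c j powr (r / p)) powr (p / r))"
     using C by (intro ennreal_mult) auto
    also have "... <= ennreal C * (b_norm (1 / p) p (ennreal t) \<Omega> c epowr p + ennreal eta)"
     by (intro mult_left_mono order_trans[OF fin(2)[OF lt]]) auto
    finally show ?thesis .
   qed
   ultimately show ?thesis by (rule collar_bound_mono)
  qed
  then show "\<exists>C>0. \<forall>K f c a eta. f \<in> borel_measurable LO --> atomic_rep d K p \<Omega> f c a --> b_norm (1 / p) p (ennreal t) \<Omega> c < \<infinity> --> 0 < eta -->
    collar_bound p f (ennreal C * (b_norm (1 / p) p (ennreal t) \<Omega> c epowr p + ennreal eta))"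
   using C by (intro exI[of _ C] conjI allI impI)
 qed
qed

text \<open>
  The inner sum of the Triebel--Lizorkin quasi-norm for \<open>q = t\<close>, before the outer powers are
  taken.
\<close>

definition lf :: "real => real => 'n coeffs => (real, 'n) vec => ennreal" where
 "lf p t c x = (\<Sum>j. \<Sum>m\<in>IO j. ennreal ((2 ^ j * cmod (c j m) powr p) powr (t / p)) * indicator (cube j m) x)"

lemma lf_measurable [measurable]: "lf p t c \<in> borel_measurable borel"
 unfolding lf_def[abs_def]
 by (intro borel_measurable_suminf_order borel_measurable_sum borel_measurable_times_ennreal borel_measurable_const borel_measurable_indicator) simp

lemma f_term_powr:
 assumes p: "0 < p" and t: "0 < t"
 shows "(2 powr (real j * (1 / p)) * cmod z) powr t = (2 ^ j * cmod z powr p) powr (t / p)"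
proof -
 have "(2 powr (real j * (1 / p)) * cmod z) powr t = ((2 powr (real j * (1 / p)) * cmod z) powr p) powr (t / p)"
  using p by (simp add: powr_powr)
 also have "(2 powr (real j * (1 / p)) * cmod z) powr p = 2 ^ j * cmod z powr p"
  using p by (simp add: powr_mult powr_powr powr_realpow)
 finally show ?thesis .
qed

lemma f_norm_eq:
 assumes p: "0 < p" and t: "0 < t"
 shows "f_norm (1 / p) p (ennreal t) \<Omega> c = (\<integral>\<^sup>+x. lf p t c x epowr (p / t) \<partial>lborel) epowr (1 / p)"
proof -
 let ?u = "%x. %(j, m). ennreal (2 powr (real j * (1 / p)) * cmod (c j m) * indicator (cube j m) x)"
 have "lq_norm (ennreal t) (SIGMA j:UNIV. IO j) (?u x) epowr p = lf p t c x epowr (p / t)" for x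
 proof -
  have "lq_norm (ennreal t) (SIGMA j:UNIV. IO j) (?u x) = (\<Sum>\<^sub>\<infinity>i\<in>(SIGMA j:UNIV. IO j). ?u x i epowr t) epowr (1 / t)"
   using t by (simp add: lq_norm_def)
  also have "(\<Sum>\<^sub>\<infinity>i\<in>(SIGMA j:UNIV. IO j). ?u x i epowr t) = (\<Sum>j. \<Sum>m\<in>IO j. ?u x (j, m) epowr t)"
   by (rule infsum_Sigma_ennreal[OF finite_I])
  also have "... = lf p t c x"
   unfolding lf_def
  proof (intro arg_cong[of _ _ suminf] ext sum.cong refl)
   fix j m
   show "?u x (j, m) epowr t = ennreal ((2 ^ j * cmod (c j m) powr p) powr (t / p)) * indicator (cube j m) x"
    unfolding f_term_powr[OF p t, symmetric] by (auto simp: indicator_def epowr_ennreal)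
  qed
  finally have e: "lq_norm (ennreal t) (SIGMA j:UNIV. IO j) (?u x) = lf p t c x epowr (1 / t)" .
  show ?thesis unfolding e using p t by (simp add: epowr_epowr)
 qed
 then show ?thesis unfolding f_norm_def by (simp add: nn_integral_completion)
qed

lemma f_norm_infinity_eq:
 assumes p: "0 < p"
 shows "f_norm (1 / p) p \<infinity> \<Omega> c = (\<integral>\<^sup>+x. gmax p c x \<partial>lborel) epowr (1 / p)"
proof -
 let ?u = "%x. %(j, m). ennreal (2 powr (real j * (1 / p)) * cmod (c j m) * indicator (cube j m) x)"
 have u: "?u x (j, m) epowr p = ennreal (2 ^ j * cmod (c j m) powr p) * indicator (cube j m) x" for x j m
  using f_term_powr[OF p p, of j "c j m"] p by (auto simp: indicator_def epowr_ennreal)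
 have "lq_norm \<infinity> (SIGMA j:UNIV. IO j) (?u x) epowr p = gmax p c x" for x
 proof (rule antisym)
  have "lq_norm \<infinity> (SIGMA j:UNIV. IO j) (?u x) <= gmax p c x epowr (1 / p)"
   unfolding lq_norm_def if_P[OF refl]
  proof (rule SUP_least)
   fix i :: "nat \<times> (int, 'n) vec" assume i: "i \<in> (SIGMA j:UNIV. IO j)"
   obtain j m where jm: "i = (j, m)" by fastforce
   then have m: "m \<in> IO j" using i by simp
   have "?u x i = (?u x (j, m) epowr p) epowr (1 / p)" using p jm by simp
   also have "... <= gmax p c x epowr (1 / p)"
    unfolding u using p by (intro epowr_mono gmax_ge[OF m]) simp
   finally show "?u x i <= gmax p c x epowr (1 / p)" .
  qed
  then have "lq_norm \<infinity> (SIGMA j:UNIV. IO j) (?u x) epowr p <= (gmax p c x epowr (1 / p)) epowr p"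
   using p by (intro epowr_mono) auto
  then show "lq_norm \<infinity> (SIGMA j:UNIV. IO j) (?u x) epowr p <= gmax p c x" using p by simp
  show "gmax p c x <= lq_norm \<infinity> (SIGMA j:UNIV. IO j) (?u x) epowr p"
   unfolding gmax_def
  proof (rule SUP_least)
   fix i :: "nat \<times> (int, 'n) vec" assume i: "i \<in> (SIGMA j:UNIV. IO j)"
   obtain j m where jm: "i = (j, m)" by fastforce
   have "?u x i <= lq_norm \<infinity> (SIGMA j:UNIV. IO j) (?u x)"
    unfolding lq_norm_def if_P[OF refl] by (rule SUP_upper[OF i])
   then have "?u x (j, m) epowr p <= lq_norm \<infinity> (SIGMA j:UNIV. IO j) (?u x) epowr p"
    using p jm by (intro epowr_mono) auto
   then show "(case i of (j, m) => ennreal (2 ^ j * cmod (c j m) powr p) * indicator (cube j m) x) <= lq_norm \<infinity> (SIGMA j:UNIV. IO j) (?u x) epowr p"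
    unfolding u jm by simp
  qed
 qed
 then show ?thesis unfolding f_norm_def by (simp add: nn_integral_completion)
qed

lemma gmax_le_lf:
 assumes p: "0 < p" and t: "0 < t"
 shows "gmax p c x <= lf p t c x epowr (p / t)"
 unfolding gmax_def
proof (rule SUP_least)
 fix i :: "nat \<times> (int, 'n) vec" assume "i \<in> (SIGMA j:UNIV. IO j)"
 then obtain j m where jm: "i = (j, m)" "m \<in> IO j" by auto
 let ?w = "ennreal (2 ^ j * cmod (c j m) powr p) * indicator (cube j m) x"
 let ?v = "%m. ennreal ((2 ^ j * cmod (c j m) powr p) powr (t / p)) * indicator (cube j m) x"
 have "?v m <= (\<Sum>m\<in>IO j. ?v m)" using jm(2) finite_I by (intro member_le_sum) auto
 also have "... <= lf p t c x"
  unfolding lf_def using sum_le_suminf[of "%j. \<Sum>m\<in>IO j. ennreal ((2 ^ j * cmod (c j m) powr p) powr (t / p)) * indicator (cube j m) x" "{j}"]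
  by (simp add: summableI)
 finally have "?v m epowr (p / t) <= lf p t c x epowr (p / t)" using p t by (intro epowr_mono) auto
 moreover have "?v m epowr (p / t) = ?w" using p t by (auto simp: indicator_def epowr_ennreal powr_powr)
 ultimately show "(case i of (j, m) => ennreal (2 ^ j * cmod (c j m) powr p) * indicator (cube j m) x) <= lf p t c x epowr (p / t)"
  by (simp add: jm(1))
qed

lemma gmax_le_f_norm:
 assumes p: "0 < p" and q: "0 < q"
 shows "(\<integral>\<^sup>+x. gmax p c x \<partial>lborel) <= f_norm (1 / p) p q \<Omega> c epowr p"
proof (cases q)
 case (real t)
 then have t: "0 < t" using q by simp
 have "(\<integral>\<^sup>+x. gmax p c x \<partial>lborel) <= (\<integral>\<^sup>+x. lf p t c x epowr (p / t) \<partial>lborel)"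
  by (intro nn_integral_mono gmax_le_lf p t)
 then show ?thesis using p unfolding real(2) f_norm_eq[OF p t] by simp
next
 case top
 then have q: "q = \<infinity>" by simp
 show ?thesis unfolding q f_norm_infinity_eq[OF p] using p by simp
qed

lemma trace_norm_F:
 assumes p: "0 < p" "p <= 1" and d: "0 < d" and q: "0 < q"
 shows "trace_norm p d (f_norm (1 / p) p q \<Omega>)"
proof -
 let ?\<nu> = "f_norm (1 / p) p q \<Omega>"
 from collar_bound_F[OF p d] obtain C where C: "0 < C" and C': "\<forall>K f c a J eta. f \<in> borel_measurable LO --> atomic_rep d K p \<Omega> f c a -->
   (\<integral>\<^sup>+x. gmax p c x \<partial>lborel) < \<infinity> --> 0 < eta -->
   collar_bound p (%x. f x - psum c a J x)
    (ennreal C * ((\<Sum>j. ennreal (bsum p (near (d + 1)) c (j + J))) + ennreal eta))" by (elim exE conjE)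
 have "0 < d + 1" using d by simp
 from sum_near_le_gmax[OF p(1) this] obtain D where D: "0 < D" and D': "ALL c. (\<Sum>j. ennreal (bsum p (near (d + 1)) c j)) <= ennreal D * (\<integral>\<^sup>+x. gmax p c x \<partial>lborel)"
  by (elim exE conjE)
 have fin: "(\<integral>\<^sup>+x. gmax p c x \<partial>lborel) < \<infinity>" if "?\<nu> c < \<infinity>" for c
 proof -
  have "?\<nu> c epowr p < \<infinity>" using that by (simp only: epowr_less_top_iff)
  then show ?thesis using gmax_le_f_norm[OF p(1) q, of c] by (rule le_less_trans[rotated])
 qed
 show ?thesis
  unfolding trace_norm_def
 proof (rule conjI)
  show "ALL K f c a. f \<in> borel_measurable LO --> atomic_rep d K p \<Omega> f c a --> ?\<nu> c < \<infinity> -->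
    (EX M. M ----> 0 & (ALL J. collar_bound p (%x. f x - psum c a J x) (M J)))"
  proof (intro allI impI)
   fix K f c a
   assume f: "f \<in> borel_measurable LO" "atomic_rep d K p \<Omega> f c a" and lt: "?\<nu> c < \<infinity>"
   let ?M = "%J. ennreal C * ((\<Sum>j. ennreal (bsum p (near (d + 1)) c (j + J))) + ennreal ((1 / 2) ^ J))"
   have "(\<Sum>j. ennreal (bsum p (near (d + 1)) c j)) < top"
   proof (rule le_less_trans[OF D'[rule_format, of c]])
    show "ennreal D * (\<integral>\<^sup>+x. gmax p c x \<partial>lborel) < top" using fin[OF lt] by (simp add: ennreal_mult_less_top)
   qed
   then have "(%J. \<Sum>j. ennreal (bsum p (near (d + 1)) c (j + J))) ----> 0" by (rule suminf_ennreal_tail)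
   moreover have "(%J. ennreal ((1 / 2) ^ J)) ----> ennreal 0"
    by (intro tendsto_ennrealI LIMSEQ_power_zero) simp
   ultimately have "?M ----> ennreal C * (0 + ennreal 0)" by (intro ennreal_tendsto_cmult tendsto_add) auto
   then have "?M ----> 0" by simp
   moreover have "ALL J. collar_bound p (%x. f x - psum c a J x) (?M J)"
   proof
    fix J
    have "0 < (1 / 2 :: real) ^ J" by simp
    then show "collar_bound p (%x. f x - psum c a J x) (?M J)" using C' f fin[OF lt] by blast
   qed
   ultimately show "EX M. M ----> 0 & (ALL J. collar_bound p (%x. f x - psum c a J x) (M J))"
    by (intro exI[of _ ?M] conjI)
  qed
  have "collar_bound p f (ennreal (C * (D + 1)) * (?\<nu> c epowr p + ennreal eta))"
   if f: "f \<in> borel_measurable LO" "atomic_rep d K p \<Omega> f c a" and lt: "?\<nu> c < \<infinity>" and eta: "0 < eta" for K f c a eta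
  proof -
   have "collar_bound p (%x. f x - (\<Sum>j<0. level IO c a j x)) (ennreal C * ((\<Sum>j. ennreal (bsum p (near (d + 1)) c (j + 0))) + ennreal eta))"
    using C' f fin[OF lt] eta by blast
   then have "collar_bound p f (ennreal C * ((\<Sum>j. ennreal (bsum p (near (d + 1)) c j)) + ennreal eta))" by simp
   moreover have "ennreal C * ((\<Sum>j. ennreal (bsum p (near (d + 1)) c j)) + ennreal eta) <= ennreal (C * (D + 1)) * (?\<nu> c epowr p + ennreal eta)"
   proof -
    have "(\<Sum>j. ennreal (bsum p (near (d + 1)) c j)) + ennreal eta <= ennreal (D + 1) * (?\<nu> c epowr p) + ennreal (D + 1) * ennreal eta"
    proof (rule add_mono)
     have "(\<Sum>j. ennreal (bsum p (near (d + 1)) c j)) <= ennreal D * (?\<nu> c epowr p)"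
      by (rule order_trans[OF D'[rule_format, of c] mult_left_mono[OF gmax_le_f_norm[OF p(1) q]]]) simp
     also have "... <= ennreal (D + 1) * (?\<nu> c epowr p)" by (intro mult_right_mono ennreal_leI) auto
     finally show "(\<Sum>j. ennreal (bsum p (near (d + 1)) c j)) <= ennreal (D + 1) * (?\<nu> c epowr p)" .
     have "ennreal eta <= ennreal ((D + 1) * eta)" using D eta by (intro ennreal_leI) simp
     then show "ennreal eta <= ennreal (D + 1) * ennreal eta" using D eta by (simp add: ennreal_mult del: ennreal_plus)
    qed
    then have "ennreal C * ((\<Sum>j. ennreal (bsum p (near (d + 1)) c j)) + ennreal eta) <= ennreal C * (ennreal (D + 1) * (?\<nu> c epowr p + ennreal eta))"
     unfolding distrib_left[symmetric] by (rule mult_left_mono) simp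
    also have "... = ennreal (C * (D + 1)) * (?\<nu> c epowr p + ennreal eta)"
    proof -
     have "ennreal (C * (D + 1)) = ennreal C * ennreal (D + 1)" using C D by (intro ennreal_mult) auto
     then show ?thesis by (simp only: mult.assoc)
    qed
    finally show ?thesis .
   qed
   ultimately show ?thesis by (rule collar_bound_mono)
  qed
  moreover have "0 < C * (D + 1)" using C D by simp
  ultimately show "\<exists>C>0. \<forall>K f c a eta. f \<in> borel_measurable LO --> atomic_rep d K p \<Omega> f c a --> ?\<nu> c < \<infinity> --> 0 < eta -->
    collar_bound p f (ennreal C * (?\<nu> c epowr p + ennreal eta))"
   by (intro exI[of _ "C * (D + 1)"] conjI allI impI)
 qed
qed

lemma cmod_shrink_powr:
 "cmod (shrink J c j m) powr p = (if j < J then ((1 / 2) ^ J) powr p else 1) * cmod (c j m) powr p"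
 by (simp add: shrink_def norm_mult norm_power powr_mult del: power_one_over)

lemma b_norm_shrink:
 assumes p: "0 < p" and t: "0 < t" and fin: "b_norm (1 / p) p (ennreal t) \<Omega> c < \<infinity>"
 shows "(%J. b_norm (1 / p) p (ennreal t) \<Omega> (shrink J c)) ----> 0"
proof -
 let ?u = "%j. ennreal (bsum p IO c j powr (t / p))"
 have lt: "suminf ?u < top" using fin unfolding b_norm_eq[OF p t] epowr_less_top_iff by simp
 have e: "bsum p IO (shrink J c) j = (if j < J then ((1 / 2) ^ J) powr p else 1) * bsum p IO c j" for J j
  by (simp add: bsum_def cmod_shrink_powr sum_distrib_left[symmetric])
 have eJ: "(((1 / 2) ^ J) powr p) powr (t / p) = ((1 / 2) powr t) ^ J" for J
  using p by (simp add: powr_powr powr_realpow[symmetric] mult.commute)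
 have le: "(\<Sum>j. ennreal (bsum p IO (shrink J c) j powr (t / p))) <= ennreal (((1 / 2) powr t) ^ J) * suminf ?u + (\<Sum>j. ?u (j + J))" for J
 proof -
  have "(\<Sum>j. ennreal (bsum p IO (shrink J c) j powr (t / p))) =
   (\<Sum>j. ennreal (bsum p IO (shrink J c) (j + J) powr (t / p))) + (\<Sum>j<J. ennreal (bsum p IO (shrink J c) j powr (t / p)))"
   by (rule suminf_offset[OF summableI])
  also have "(\<Sum>j. ennreal (bsum p IO (shrink J c) (j + J) powr (t / p))) = (\<Sum>j. ?u (j + J))" by (simp add: e)
  also have "(\<Sum>j<J. ennreal (bsum p IO (shrink J c) j powr (t / p))) = (\<Sum>j<J. ennreal (((1 / 2) powr t) ^ J) * ?u j)"
  proof (rule sum.cong[OF refl])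
   fix j assume "j \<in> {..<J}"
   then have "bsum p IO (shrink J c) j powr (t / p) = ((1 / 2) powr t) ^ J * bsum p IO c j powr (t / p)"
    by (simp add: e powr_mult bsum_nonneg eJ)
   then show "ennreal (bsum p IO (shrink J c) j powr (t / p)) = ennreal (((1 / 2) powr t) ^ J) * ?u j"
    by (simp add: ennreal_mult)
  qed
  also have "(\<Sum>j. ?u (j + J)) + (\<Sum>j<J. ennreal (((1 / 2) powr t) ^ J) * ?u j) <= (\<Sum>j. ?u (j + J)) + ennreal (((1 / 2) powr t) ^ J) * suminf ?u"
   unfolding sum_distrib_left[symmetric] by (rule add_left_mono[OF mult_left_mono[OF sum_le_suminf[OF summableI]]]) auto
  finally have "(\<Sum>j. ennreal (bsum p IO (shrink J c) j powr (t / p))) <= (\<Sum>j. ?u (j + J)) + ennreal (((1 / 2) powr t) ^ J) * suminf ?u"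
   .
  then show ?thesis by (subst add.commute)
 qed
 have "norm ((1 / 2 :: real) powr t) < 1" using powr_less_mono2[of t "1 / 2" 1] t by simp
 from tendsto_ennrealI[OF LIMSEQ_power_zero[OF this]]
 have "(%J. ennreal (((1 / 2) powr t) ^ J)) ----> ennreal 0" .
 from tendsto_add[OF ennreal_tendsto_cmult[OF lt this] suminf_ennreal_tail[OF lt]]
 have "(%J. ennreal (((1 / 2) powr t) ^ J) * suminf ?u + (\<Sum>j. ?u (j + J))) ----> 0" by (simp add: mult.commute)
 then have "(%J. \<Sum>j. ennreal (bsum p IO (shrink J c) j powr (t / p))) ----> 0"
  by (rule tendsto_sandwich[OF always_eventually always_eventually tendsto_const, rotated 2, OF _ allI allI]) (rule zero_le, rule le)
 then show ?thesis unfolding b_norm_eq[OF p t] using t by (subst epowr_tendsto_0_iff) auto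
qed

text \<open>
  Pointwise, the shrunk sum is at most a small multiple of the full sum plus a tail of it; dominated
  convergence does the rest.
\<close>

lemma f_norm_shrink:
 assumes p: "0 < p" and t: "0 < t" and fin: "f_norm (1 / p) p (ennreal t) \<Omega> c < \<infinity>"
 shows "(%J. f_norm (1 / p) p (ennreal t) \<Omega> (shrink J c)) ----> 0"
proof -
 let ?e = "%x j. \<Sum>m\<in>IO j. ennreal ((2 ^ j * cmod (c j m) powr p) powr (t / p)) * indicator (cube j m) x"
 have eJ: "(((1 / 2) ^ J) powr p) powr (t / p) = ((1 / 2) powr t) ^ J" for J
  using p by (simp add: powr_powr powr_realpow[symmetric] mult.commute)
 have q1: "(1 / 2 :: real) powr t < 1" using powr_less_mono2[of t "1 / 2" 1] t by simp
 have scaled: "(2 ^ j * cmod (shrink J c j m) powr p) powr (t / p) = (if j < J then ((1 / 2) powr t) ^ J else 1) * (2 ^ j * cmod (c j m) powr p) powr (t / p)" for J j m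
 proof -
  have "2 ^ j * cmod (shrink J c j m) powr p = (if j < J then ((1 / 2) ^ J) powr p else 1) * (2 ^ j * cmod (c j m) powr p)"
   by (simp add: cmod_shrink_powr)
  then show ?thesis by (simp add: powr_mult eJ)
 qed
 have lf_shrink: "lf p t (shrink J c) x = (\<Sum>j. ennreal (if j < J then ((1 / 2) powr t) ^ J else 1) * ?e x j)" for J x
  unfolding lf_def scaled by (simp add: ennreal_mult sum_distrib_left mult.assoc)
 have le1: "lf p t (shrink J c) x <= lf p t c x" for J x
  unfolding lf_shrink unfolding lf_def
 proof (intro suminf_le summableI)
  fix j
  have "(if j < J then ((1 / 2) powr t) ^ J else 1) <= (1 :: real)" using q1 by (simp add: power_le_one)
  from ennreal_leI[OF this] have "ennreal (if j < J then ((1 / 2) powr t) ^ J else 1) <= 1" by (simp only: ennreal_1)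
  then have "ennreal (if j < J then ((1 / 2) powr t) ^ J else 1) * ?e x j <= 1 * ?e x j" by (intro mult_right_mono) auto
  then show "ennreal (if j < J then ((1 / 2) powr t) ^ J else 1) * ?e x j <= ?e x j" by simp
 qed
 have le2: "lf p t (shrink J c) x <= ennreal (((1 / 2) powr t) ^ J) * lf p t c x + (\<Sum>j. ?e x (j + J))" for J x
 proof -
  have "lf p t (shrink J c) x = (\<Sum>j. ennreal (if j + J < J then ((1 / 2) powr t) ^ J else 1) * ?e x (j + J)) + (\<Sum>j<J. ennreal (if j < J then ((1 / 2) powr t) ^ J else 1) * ?e x j)"
   unfolding lf_shrink by (rule suminf_offset[OF summableI])
  also have "(\<Sum>j. ennreal (if j + J < J then ((1 / 2) powr t) ^ J else 1) * ?e x (j + J)) = (\<Sum>j. ?e x (j + J))" by simp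
  also have "(\<Sum>j<J. ennreal (if j < J then ((1 / 2) powr t) ^ J else 1) * ?e x j) = ennreal (((1 / 2) powr t) ^ J) * (\<Sum>j<J. ?e x j)"
   by (simp add: sum_distrib_left)
  also have "(\<Sum>j. ?e x (j + J)) + ennreal (((1 / 2) powr t) ^ J) * (\<Sum>j<J. ?e x j) <= (\<Sum>j. ?e x (j + J)) + ennreal (((1 / 2) powr t) ^ J) * lf p t c x"
   unfolding lf_def by (rule add_left_mono[OF mult_left_mono[OF sum_le_suminf[OF summableI]]]) auto
  finally have "lf p t (shrink J c) x <= (\<Sum>j. ?e x (j + J)) + ennreal (((1 / 2) powr t) ^ J) * lf p t c x"
   .
  then show ?thesis by (subst add.commute)
 qed
 have finI: "(\<integral>\<^sup>+x. lf p t c x epowr (p / t) \<partial>lborel) < \<infinity>"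
  using fin unfolding f_norm_eq[OF p t] epowr_less_top_iff .
 have "(%J. \<integral>\<^sup>+x. lf p t (shrink J c) x epowr (p / t) \<partial>lborel) ----> (\<integral>\<^sup>+x. 0 \<partial>(lborel :: (real, 'n) vec measure))"
 proof (rule nn_integral_dominated_convergence[where w = "%x. lf p t c x epowr (p / t)"])
  show "(%x. lf p t (shrink J c) x epowr (p / t)) \<in> borel_measurable lborel" for J
   using measurable_compose[OF lf_measurable epowr_measurable] by simp
  show "(%x. lf p t c x epowr (p / t)) \<in> borel_measurable lborel"
   using measurable_compose[OF lf_measurable epowr_measurable] by simp
  show "AE x in lborel. lf p t (shrink J c) x epowr (p / t) <= lf p t c x epowr (p / t)" for J
   using p t by (intro AE_I2 epowr_mono le1) auto
  have "AE x in lborel. lf p t c x epowr (p / t) ~= \<infinity>"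
   by (rule nn_integral_PInf_AE) (use finI measurable_compose[OF lf_measurable epowr_measurable] in auto)
  then show "AE x in lborel. (%J. lf p t (shrink J c) x epowr (p / t)) ----> 0"
  proof eventually_elim
   case (elim x)
   then have "lf p t c x epowr (p / t) < \<infinity>" by (simp only: less_top infinity_ennreal_def)
   then have lt: "lf p t c x < top" unfolding epowr_less_top_iff by simp
   then have lt': "suminf (?e x) < top" by (simp add: lf_def)
   have "norm ((1 / 2 :: real) powr t) < 1" using q1 by simp
   from tendsto_ennrealI[OF LIMSEQ_power_zero[OF this]]
   have "(%J. ennreal (((1 / 2) powr t) ^ J)) ----> ennreal 0" .
   from tendsto_add[OF ennreal_tendsto_cmult[OF lt this] suminf_ennreal_tail[OF lt']]
   have "(%J. ennreal (((1 / 2) powr t) ^ J) * lf p t c x + (\<Sum>j. ?e x (j + J))) ----> 0" by (simp add: mult.commute)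
   then have "(%J. lf p t (shrink J c) x) ----> 0"
    by (rule tendsto_sandwich[OF always_eventually always_eventually tendsto_const, rotated 2, OF _ allI allI]) (rule zero_le, rule le2)
   then show ?case using p t by (subst epowr_tendsto_0_iff) auto
  qed
 qed (rule borel_measurable_const, rule finI)
 then show ?thesis unfolding f_norm_eq[OF p t] using p by (subst epowr_tendsto_0_iff) auto
qed

end


section \<open>Traces\<close>

context lipschitz_domain
begin

text \<open>
  The difference of two continuous approximations does not involve \<open>f\<close>, so its integral over
  the boundary is defined and bounded by its averages.
\<close>

lemma pint_surface_diff_le:
 assumes p: "0 < p"
 shows "\<exists>C>0. \<forall>f phi psi M N. f \<in> borel_measurable LO --> continuous_on UNIV phi --> continuous_on UNIV psi -->
   collar_bound p (%x. f x - phi x) M --> collar_bound p (%x. f x - psi x) N -->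
   pint p \<sigma> (%x. phi x - psi x) <= ennreal C * (M + N)"
proof -
 from pint_surface_le_collar obtain C where C: "0 < C" and C': "\<forall>p phi M. 0 < p --> continuous_on UNIV phi --> collar_bound p phi M --> pint p \<sigma> phi <= ennreal C * M"
  by (elim exE conjE)
 have "pint p \<sigma> (%x. phi x - psi x) <= ennreal (C * 2 powr p) * (M + N)"
  if f: "f \<in> borel_measurable LO" and c: "continuous_on UNIV phi" "continuous_on UNIV psi"
   and b: "collar_bound p (%x. f x - phi x) M" "collar_bound p (%x. f x - psi x) N" for f phi psi M N
 proof -
  have "collar_bound p (%x. phi x - psi x) (ennreal (2 powr p) * (M + N))"
  proof (rule collar_bound_triangle[OF p _ _ _ b])
   show "(%x. f x - phi x) \<in> borel_measurable LO" "(%x. f x - psi x) \<in> borel_measurable LO"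
    using f continuous_measurable_domain c by auto
   show "cmod (phi x - psi x) <= cmod (f x - phi x) + cmod (f x - psi x)" for x
    using norm_triangle_ineq4[of "f x - psi x" "f x - phi x"] by simp
  qed
  moreover have "continuous_on UNIV (%x. phi x - psi x)" using c by (intro continuous_intros)
  ultimately have "pint p \<sigma> (%x. phi x - psi x) <= ennreal C * (ennreal (2 powr p) * (M + N))" using C' p by blast
  then show ?thesis using C by (simp add: ennreal_mult mult.assoc)
 qed
 then show ?thesis using C by (intro exI[of _ "C * 2 powr p"] conjI allI impI) auto
qed

lemma trace_exists:
 assumes p: "0 < p" and f: "f \<in> borel_measurable LO" and psi: "!!k. continuous_on UNIV (psi k)"
  and M: "!!k. collar_bound p (%x. f x - psi k x) (M k)" "M ----> 0"
 shows "\<exists>g\<in>Lp p \<sigma>. (%k. pint p \<sigma> (%x. g x - psi k x)) ----> 0"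
proof (rule Lp_complete[OF p continuous_measurable_surface[OF psi] pint_surface_continuous_finite[OF p psi]])
 from pint_surface_diff_le[OF p] obtain C where C: "0 < C" and C': "\<forall>f phi psi M N. f \<in> borel_measurable LO --> continuous_on UNIV phi --> continuous_on UNIV psi -->
   collar_bound p (%x. f x - phi x) M --> collar_bound p (%x. f x - psi x) N -->
   pint p \<sigma> (%x. phi x - psi x) <= ennreal C * (M + N)" by (elim exE conjE)
 fix e :: real assume e: "0 < e"
 have "0 < e / (2 * C)" using e C by simp
 then have "\<forall>\<^sub>F k in sequentially. M k < ennreal (e / (2 * C))" using M(2) unfolding tendsto_0_ennreal_iff by blast
 then obtain N where N: "!!k. N <= k ==> M k < ennreal (e / (2 * C))" unfolding eventually_sequentially by blast
 show "EX N. \<forall>k\<ge>N. \<forall>l\<ge>N. pint p \<sigma> (%x. psi k x - psi l x) <= ennreal e"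
 proof (intro exI[of _ N] allI impI)
  fix k l assume kl: "N <= k" "N <= l"
  have "pint p \<sigma> (%x. psi k x - psi l x) <= ennreal C * (M k + M l)" using C' f psi M(1) by blast
  also have "... <= ennreal C * (ennreal (e / (2 * C)) + ennreal (e / (2 * C)))"
   using N[OF kl(1)] N[OF kl(2)] by (intro mult_left_mono add_mono) auto
  also have "... = ennreal (C * (e / (2 * C) + e / (2 * C)))"
   using e C by (simp only: ennreal_mult' ennreal_plus less_imp_le divide_nonneg_pos mult_pos_pos zero_less_numeral)
  also have "C * (e / (2 * C) + e / (2 * C)) = e" using C by simp
  finally show "pint p \<sigma> (%x. psi k x - psi l x) <= ennreal e" .
 qed
qed

lemma trace_independent:
 assumes p: "0 < p" and f: "f \<in> borel_measurable LO" and g: "g \<in> borel_measurable \<sigma>"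
  and psi: "!!k. continuous_on UNIV (psi k)" and M: "!!k. collar_bound p (%x. f x - psi k x) (M k)" "M ----> 0"
  and phi: "!!k. continuous_on UNIV (phi k)" and N: "!!k. collar_bound p (%x. f x - phi k x) (N k)" "N ----> 0"
  and lim: "(%k. pint p \<sigma> (%x. g x - psi k x)) ----> 0"
 shows "(%k. pint p \<sigma> (%x. g x - phi k x)) ----> 0"
proof -
 from pint_surface_diff_le[OF p] obtain C where C: "0 < C" and C': "\<forall>f phi psi M N. f \<in> borel_measurable LO --> continuous_on UNIV phi --> continuous_on UNIV psi -->
   collar_bound p (%x. f x - phi x) M --> collar_bound p (%x. f x - psi x) N -->
   pint p \<sigma> (%x. phi x - psi x) <= ennreal C * (M + N)" by (elim exE conjE)
 let ?u = "%k. ennreal (2 powr p) * (pint p \<sigma> (%x. g x - psi k x) + ennreal C * (M k + N k))"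
 have "pint p \<sigma> (%x. g x - phi k x) <= ?u k" for k
 proof -
  have "pint p \<sigma> (%x. g x - phi k x) <= ennreal (2 powr p) * (pint p \<sigma> (%x. g x - psi k x) + pint p \<sigma> (%x. psi k x - phi k x))"
  proof (rule pint_triangle[OF p])
   show "cmod (g x - phi k x) <= cmod (g x - psi k x) + cmod (psi k x - phi k x)" for x
    using norm_triangle_ineq[of "g x - psi k x" "psi k x - phi k x"] by simp
  qed (intro borel_measurable_diff g continuous_measurable_surface psi phi)+
  also have "... <= ?u k" using C' f psi phi M(1) N(1) by (intro mult_left_mono add_left_mono) auto
  finally show ?thesis .
 qed
 moreover have "?u ----> ennreal (2 powr p) * (0 + ennreal C * (0 + 0))"
  by (intro ennreal_tendsto_cmult tendsto_add lim M N ennreal_less_top)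
 then have "?u ----> 0" by (simp only: add_0 mult_zero_right)
 ultimately show ?thesis
  by - (rule tendsto_sandwich[where f = "%_. 0" and h = ?u], auto)
qed

lemma schwartz_continuous: "schwartz phi ==> continuous_on UNIV phi"
 unfolding schwartz_def using Ck_continuous by blast

lemma zero_atom: "is_atom d K j m (%x. 0)"
 unfolding is_atom_iff support_subset_dcube_iff by (simp add: Ck_bounded_zero)

text \<open>
  Replacing the atoms of the first levels by smooth functions, with an error of size
  \<open>(1 / 2) ^ J\<close>, approximates a function by Schwartz functions. The difference has the
  coefficients that are shrunk on these levels and unchanged on the others.
\<close>

lemma schwartz_approximation:
 assumes p: "0 < p" and d: "0 < d" and rep: "atomic_rep d K p \<Omega> f c a"
 shows "\<exists>phi. ALL J. schwartz (phi J) & (EX a'. atomic_rep d K p \<Omega> (%x. f x - phi J x) (shrink J c) a')"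
proof (rule choice, rule allI)
 fix J :: nat
 have at: "atoms_at d K IO a" and lim: "(%J. pint p LO (%x. f x - psum c a J x)) ----> 0"
  using rep unfolding atomic_rep_iff[OF p] by auto
 have "\<exists>phi. (ALL k. Ck k phi) & (ALL x. x ~: dcube d j m --> phi x = 0) & Ck_bounded K (2 ^ j) ((1 / 2) ^ J) (%x. a j m x - phi x)"
  if m: "m \<in> IO j" for j m
 proof -
  have "is_atom d K j m (a j m)" using at m by (simp add: atoms_at_def)
  then obtain phi where "!!k. Ck k phi" "!!x. x ~: dcube d j m ==> phi x = 0" "Ck_bounded K (2 ^ j) ((1 / 2) ^ J) (%x. a j m x - phi x)"
   by (rule atom_smooth_approximation[OF _ d, of _ _ _ _ "(1 / 2) ^ J"]) auto
  then show ?thesis by blast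
 qed
 note ex = this
 define phi where "phi j m = (SOME phi. (ALL k. Ck k phi) & (ALL x. x ~: dcube d j m --> phi x = 0) \<and>
   Ck_bounded K (2 ^ j) ((1 / 2) ^ J) (%x. a j m x - phi x))" for j m
 have phi': "(ALL k. Ck k (phi j m)) & (ALL x. x ~: dcube d j m --> phi j m x = 0) \<and>
   Ck_bounded K (2 ^ j) ((1 / 2) ^ J) (%x. a j m x - phi j m x)" if "m \<in> IO j" for j m
  unfolding phi_def by (rule someI_ex[OF ex[OF that]])
 have phi: "!!j m k. m \<in> IO j ==> Ck k (phi j m)" "!!j m x. m \<in> IO j ==> x ~: dcube d j m ==> phi j m x = 0"
  "!!j m. m \<in> IO j ==> Ck_bounded K (2 ^ j) ((1 / 2) ^ J) (%x. a j m x - phi j m x)"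
  using phi' by blast+
 define \<Phi> where "\<Phi> x = (\<Sum>j<J. level IO c phi j x)" for x
 define a' where "a' j m x = (if j < J then of_real (2 ^ J) * (a j m x - phi j m x) else a j m x)" for j m x
 have "schwartz \<Phi>"
 proof (rule schwartz_compact_support)
  show "Ck k \<Phi>" for k
   unfolding \<Phi>_def[abs_def] level_def by (intro Ck_sum Ck_cmult phi(1))
  show "compact (\<Union>j\<in>{..<J}. \<Union>m\<in>IO j. dcube d j m)"
   by (intro compact_UN finite_I compact_dcube) auto
  show "\<Phi> x = 0" if x: "x ~: (\<Union>j\<in>{..<J}. \<Union>m\<in>IO j. dcube d j m)" for x
   unfolding \<Phi>_def level_def using x phi(2) by (intro sum.neutral ballI) auto
 qed
 moreover have "atoms_at d K IO a'"
  unfolding atoms_at_def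
 proof (intro allI ballI)
  fix j m assume m: "m \<in> IO j"
  have a: "is_atom d K j m (a j m)" using at m by (simp add: atoms_at_def)
  show "is_atom d K j m (a' j m)"
  proof (cases "j < J")
   case True
   have "Ck_bounded K (2 ^ j) (cmod (of_real (2 ^ J)) * (1 / 2) ^ J) (%x. of_real (2 ^ J) * (a j m x - phi j m x))"
    by (rule Ck_bounded_cmult[OF phi(3)[OF m]])
   moreover have "cmod (of_real (2 ^ J)) * (1 / 2) ^ J = 1" by (simp add: norm_power power_mult_distrib[symmetric] del: of_real_power)
   moreover have "(a' j m) = (%x. of_real (2 ^ J) * (a j m x - phi j m x))" using True by (simp add: a'_def fun_eq_iff)
   ultimately show ?thesis
    using atom_eq_0[OF a] phi(2)[OF m] unfolding is_atom_iff support_subset_dcube_iff by simp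
  next
   case False
   then have "a' j m = a j m" by (simp add: a'_def fun_eq_iff)
   then show ?thesis using a by simp
  qed
 qed
 moreover have "(%J'. pint p LO (%x. f x - \<Phi> x - (\<Sum>j<J'. level IO (shrink J c) a' j x))) ----> 0"
 proof (rule Lim_transform_eventually[OF lim])
  have lev: "level IO (shrink J c) a' j x = level IO c a j x - (if j < J then level IO c phi j x else 0)" for j x
  proof (cases "j < J")
   case True
   have "shrink J c j m * a' j m x = c j m * a j m x - c j m * phi j m x" for m
   proof -
    have reassoc: "(u * z) * (v * w) = (u * v) * (z * w)" for u v w z :: complex by (simp add: ac_simps)
    have "complex_of_real ((1 / 2) ^ J) * of_real (2 ^ J) = 1"
     by (simp only: of_real_mult[symmetric] power_mult_distrib[symmetric]) simp
    then have "shrink J c j m * a' j m x = 1 * (c j m * (a j m x - phi j m x))"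
     unfolding shrink_def a'_def using True
     by (simp only: if_True reassoc[of "of_real ((1 / 2) ^ J)" "c j m" "of_real (2 ^ J)"])
    then show ?thesis by (simp add: right_diff_distrib)
   qed
   then show ?thesis using True by (simp add: level_def sum_subtractf)
  qed (simp add: level_def shrink_def a'_def)
  show "\<forall>\<^sub>F J' in sequentially. pint p LO (%x. f x - psum c a J' x) = pint p LO (%x. f x - \<Phi> x - (\<Sum>j<J'. level IO (shrink J c) a' j x))"
   using eventually_ge_at_top[of J]
  proof eventually_elim
   case (elim J')
   have "(\<Sum>j<J'. if j < J then level IO c phi j x else 0) = \<Phi> x" for x
   proof -
    have "(\<Sum>j<J'. if j < J then level IO c phi j x else 0) = (\<Sum>j\<in>{j \<in> {..<J'}. j < J}. level IO c phi j x)"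
     by (rule sum.inter_filter[symmetric]) simp
    also have "{j \<in> {..<J'}. j < J} = {..<J}" using elim by auto
    finally show ?thesis by (simp add: \<Phi>_def)
   qed
   then have "f x - \<Phi> x - (\<Sum>j<J'. level IO (shrink J c) a' j x) = f x - psum c a J' x" for x
    by (simp add: lev sum_subtractf)
   then show ?case by (simp only:)
  qed
 qed
 ultimately show "\<exists>phi. schwartz phi & (EX a'. atomic_rep d K p \<Omega> (%x. f x - phi x) (shrink J c) a')"
  unfolding atomic_rep_iff[OF p] by (intro exI[of _ \<Phi>] conjI exI[of _ a'])
qed

lemma atomic_norm_le: "atomic_rep d K p \<Omega> f c a ==> atomic_norm d K p \<Omega> \<nu> f <= \<nu> c"
 unfolding atomic_norm_def by (rule Inf_lower) blast

text \<open>
  The summand \<open>eta\<close> inside the power pays for choosing a representation that nearly attains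
  the infimum.
\<close>

lemma collar_bound_atomic_norm:
 assumes p: "0 < p" and tr: "trace_norm p d \<nu>"
 shows "\<exists>C>0. \<forall>K f eta. f \<in> borel_measurable LO --> 0 < eta -->
   collar_bound p f (ennreal C * ((atomic_norm d K p \<Omega> \<nu> f + ennreal eta) epowr p + ennreal eta))"
proof -
 from tr[unfolded trace_norm_def, THEN conjunct2] obtain C where C: "0 < C" and C': "\<forall>K f c a eta. f \<in> borel_measurable LO --> atomic_rep d K p \<Omega> f c a --> \<nu> c < \<infinity> --> 0 < eta -->
    collar_bound p f (ennreal C * (\<nu> c epowr p + ennreal eta))" by (elim exE conjE)
 have "collar_bound p f (ennreal C * ((atomic_norm d K p \<Omega> \<nu> f + ennreal eta) epowr p + ennreal eta))"
  if f: "f \<in> borel_measurable LO" and eta: "0 < eta" for K f eta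
 proof (cases "atomic_norm d K p \<Omega> \<nu> f = \<infinity>")
  case True
  then show ?thesis using C by (simp add: collar_bound_def epowr_def ennreal_mult_top)
 next
  case False
  then have "atomic_norm d K p \<Omega> \<nu> f < atomic_norm d K p \<Omega> \<nu> f + ennreal eta"
   using eta by (cases "atomic_norm d K p \<Omega> \<nu> f") (auto simp: ennreal_plus[symmetric] ennreal_less_iff simp del: ennreal_plus)
  then obtain c a where c: "atomic_rep d K p \<Omega> f c a" "\<nu> c < atomic_norm d K p \<Omega> \<nu> f + ennreal eta"
   unfolding atomic_norm_def Inf_less_iff by auto
  have "\<nu> c < \<infinity>" using c(2) less_top_ennreal by (metis infinity_ennreal_def less_le_trans top_greatest)
  then have "collar_bound p f (ennreal C * (\<nu> c epowr p + ennreal eta))" using C' f c(1) eta by blast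
  moreover have "ennreal C * (\<nu> c epowr p + ennreal eta) <= ennreal C * ((atomic_norm d K p \<Omega> \<nu> f + ennreal eta) epowr p + ennreal eta)"
   using c(2) p by (intro mult_left_mono add_right_mono epowr_mono) auto
  ultimately show ?thesis by (rule collar_bound_mono)
 qed
 then show ?thesis using C by (intro exI[of _ C] conjI allI impI)
qed

lemma collar_bound_approximation:
 assumes p: "0 < p" and tr: "trace_norm p d \<nu>" and f: "f \<in> borel_measurable LO"
  and phi: "!!k. schwartz (phi k)" and lim: "(%k. atomic_norm d K p \<Omega> \<nu> (%x. f x - phi k x)) ----> 0"
 shows "EX M. M ----> 0 & (ALL k. collar_bound p (%x. f x - phi k x) (M k))"
proof -
 from collar_bound_atomic_norm[OF p tr] obtain C where C: "0 < C" and C': "\<forall>K f eta. f \<in> borel_measurable LO --> 0 < eta -->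
   collar_bound p f (ennreal C * ((atomic_norm d K p \<Omega> \<nu> f + ennreal eta) epowr p + ennreal eta))" by (elim exE conjE)
 let ?eta = "%k::nat. ennreal ((1 / 2) ^ k)"
 let ?M = "%k. ennreal C * ((atomic_norm d K p \<Omega> \<nu> (%x. f x - phi k x) + ?eta k) epowr p + ?eta k)"
 have eta: "?eta ----> 0"
  using tendsto_ennrealI[OF LIMSEQ_power_zero[of "1 / 2 :: real"]] by simp
 have "(%k. atomic_norm d K p \<Omega> \<nu> (%x. f x - phi k x) + ?eta k) ----> 0"
  using tendsto_add[OF lim eta] by simp
 then have "(%k. (atomic_norm d K p \<Omega> \<nu> (%x. f x - phi k x) + ?eta k) epowr p) ----> 0"
  using p by (subst epowr_tendsto_0_iff) auto
 from ennreal_tendsto_cmult[OF _ tendsto_add[OF this eta], of "ennreal C"]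
 have "?M ----> 0" by simp
 moreover have "ALL k. collar_bound p (%x. f x - phi k x) (?M k)"
 proof
  fix k
  have "(%x. f x - phi k x) \<in> borel_measurable LO"
   using f continuous_measurable_domain[OF schwartz_continuous[OF phi]] by auto
  then show "collar_bound p (%x. f x - phi k x) (?M k)" by (intro C'[rule_format]) auto
 qed
 ultimately show ?thesis by (intro exI[of _ ?M] conjI)
qed

text \<open>
  The image of the completion trace, for a sequence quasi-norm for which the shrunk coefficients
  tend to 0 and for which every function on the boundary has an extension.
\<close>

definition extension :: "real => real => nat => ('n coeffs => ennreal) => ((real, 'n) vec => complex) =>
  ((real, 'n) vec => complex) => 'n coeffs => 'n atoms => bool" where
 "extension p d K \<nu> g f c a \<longleftrightarrow> f \<in> Lp p LO & atomic_rep d K p \<Omega> f c a & \<nu> c < \<infinity> \<and>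
   (ALL J. schwartz (%x. \<Sum>j<J. level IO c a j x)) \<and>
   (%J. pint p \<sigma> (%x. g x - psum c a J x)) ----> 0 \<and>
   (ALL j. \<forall>m\<in>IO j - cubes_meeting \<Gamma> j. \<forall>x\<in>\<Gamma>. a j m x = 0)"

lemma completion_image:
 assumes p: "0 < p" and d: "0 < d" and tr: "trace_norm p d \<nu>"
  and sh: "!!c. \<nu> c < \<infinity> ==> (%J. \<nu> (shrink J c)) ----> 0"
  and ext: "!!g. g \<in> Lp p \<sigma> ==> EX f c a. extension p d K \<nu> g f c a"
 shows "image_under_trace \<sigma> (completion_trace p \<Omega> (atomic_norm d K p \<Omega> \<nu>)) (atomic_space d K p \<Omega> \<nu>) (Lp p \<sigma>)"
proof -
 let ?N = "atomic_norm d K p \<Omega> \<nu>" and ?X = "atomic_space d K p \<Omega> \<nu>"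
 let ?T = "completion_trace p \<Omega> ?N"
 have T: "?T f g \<longleftrightarrow> g \<in> Lp p \<sigma> & (\<exists>phi. (ALL k. schwartz (phi k)) & (%k::nat. ?N (%x. f x - phi k x)) ----> 0) \<and>
   (\<forall>phi. (ALL k. schwartz (phi k)) & (%k::nat. ?N (%x. f x - phi k x)) ----> 0 --> (%k. pint p \<sigma> (%x. g x - phi k x)) ----> 0)" for f g
  unfolding completion_trace_def Let_def Lp_norm_tendsto_0_iff[OF p] ..
 have Xm: "f \<in> borel_measurable LO" if "f \<in> ?X" for f using that by (simp add: atomic_space_def mem_Lp_iff)
 have I: "?T f g" if f: "f \<in> borel_measurable LO" and g: "g \<in> Lp p \<sigma>" and phi: "!!k. schwartz (phi k)" "(%k::nat. ?N (%x. f x - phi k x)) ----> 0"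
  and lim: "(%k. pint p \<sigma> (%x. g x - phi k x)) ----> 0" for f g phi
  unfolding T
 proof (intro conjI allI impI)
  show "\<exists>phi. (ALL k. schwartz (phi k)) & (%k::nat. ?N (%x. f x - phi k x)) ----> 0" using phi by blast
  fix psi assume psi: "(ALL k. schwartz (psi k)) & (%k::nat. ?N (%x. f x - psi k x)) ----> 0"
  from collar_bound_approximation[OF p tr f phi] obtain M where M: "M ----> 0" "ALL k. collar_bound p (%x. f x - phi k x) (M k)" by blast
  from collar_bound_approximation[OF p tr f, of psi K] psi obtain N where N: "N ----> 0" "ALL k. collar_bound p (%x. f x - psi k x) (N k)" by blast
  show "(%k. pint p \<sigma> (%x. g x - psi k x)) ----> 0"
   by (rule trace_independent[OF p f _ schwartz_continuous M(2)[rule_format] M(1) schwartz_continuous N(2)[rule_format] N(1) lim])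
     (use g phi psi in "auto simp: mem_Lp_iff")
 qed (rule g)
 show ?thesis
  unfolding image_under_trace_def
 proof (intro conjI ballI allI impI)
  fix f assume f: "f \<in> ?X"
  then obtain c a where c: "atomic_rep d K p \<Omega> f c a" "\<nu> c < \<infinity>" by (auto simp: atomic_space_def)
  from schwartz_approximation[OF p d c(1)] obtain phi where phi: "ALL J. schwartz (phi J) & (EX a'. atomic_rep d K p \<Omega> (%x. f x - phi J x) (shrink J c) a')" by blast
  have "?N (%x. f x - phi J x) <= \<nu> (shrink J c)" for J using phi atomic_norm_le by blast
  then have lim: "(%k. ?N (%x. f x - phi k x)) ----> 0"
   by (intro tendsto_sandwich[OF _ _ tendsto_const sh[OF c(2)]]) auto
  have sm: "!!k. schwartz (phi k)" using phi by blast
  from collar_bound_approximation[OF p tr Xm[OF f] sm lim] obtain M where M: "M ----> 0" "ALL k. collar_bound p (%x. f x - phi k x) (M k)" by blast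
  from trace_exists[OF p Xm[OF f] schwartz_continuous[OF sm] M(2)[rule_format] M(1)]
  obtain g where g: "g \<in> Lp p \<sigma>" "(%k. pint p \<sigma> (%x. g x - phi k x)) ----> 0" by blast
  show "EX g. ?T f g" using I[OF Xm[OF f] g(1) sm lim g(2)] by blast
 next
  fix f g h assume f: "f \<in> ?X" and Tg: "?T f g" and Th: "?T f h"
  obtain phi where phi: "!!k. schwartz (phi k)" "(%k::nat. ?N (%x. f x - phi k x)) ----> 0"
   using Tg unfolding T by blast
  show "AE x in \<sigma>. g x = h x"
  proof (rule pint_AE_eq[OF p])
   show "phi k \<in> borel_measurable \<sigma>" for k by (rule continuous_measurable_surface[OF schwartz_continuous[OF phi(1)]])
   show "g \<in> borel_measurable \<sigma>" "h \<in> borel_measurable \<sigma>" using Tg Th unfolding T by (auto simp: mem_Lp_iff)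
   show "(%k. pint p \<sigma> (%x. g x - phi k x)) ----> 0" "(%k. pint p \<sigma> (%x. h x - phi k x)) ----> 0"
    using Tg Th phi unfolding T by blast+
  qed
 next
  have "\<exists>f\<in>?X. ?T f g" if g: "g \<in> Lp p \<sigma>" for g
  proof -
   from ext[OF g] obtain f c a where e: "extension p d K \<nu> g f c a" by blast
   then have f: "f \<in> Lp p LO" and rep: "atomic_rep d K p \<Omega> f c a" and fin: "\<nu> c < \<infinity>"
    and sm: "!!J. schwartz (%x. \<Sum>j<J. level IO c a j x)"
    and lim: "(%J. pint p \<sigma> (%x. g x - psum c a J x)) ----> 0"
    unfolding extension_def by auto
   have at: "atoms_at d K IO a" and liml: "(%J. pint p LO (%x. f x - psum c a J x)) ----> 0"
    using rep unfolding atomic_rep_iff[OF p] by auto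
   have "?N (%x. f x - psum c a J x) <= \<nu> (shrink J c)" for J
   proof (rule atomic_norm_le)
    let ?a = "%j m x. if j < J then 0 else a j m x"
    have lev: "level IO (shrink J c) ?a j x = (if j < J then 0 else level IO c a j x)" for j x
     by (simp add: level_def shrink_def)
    have a: "atoms_at d K IO ?a"
     unfolding atoms_at_def
    proof (intro allI ballI)
     fix j m assume "m \<in> IO j"
     then show "is_atom d K j m (?a j m)" using at zero_atom by (cases "j < J") (auto simp: atoms_at_def)
    qed
    have "(%J'. pint p LO (%x. f x - psum c a J x - (\<Sum>j<J'. level IO (shrink J c) ?a j x))) ----> 0"
    proof (rule Lim_transform_eventually[OF liml])
     show "\<forall>\<^sub>F J' in sequentially. pint p LO (%x. f x - psum c a J' x) =
       pint p LO (%x. f x - psum c a J x - (\<Sum>j<J'. level IO (shrink J c) ?a j x))"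
      using eventually_ge_at_top[of J]
     proof eventually_elim
      case (elim J')
      have "(\<Sum>j<J'. level IO (shrink J c) ?a j x) = (\<Sum>j\<in>{J..<J'}. level IO c a j x)" for x
      proof -
       have "(\<Sum>j<J'. level IO (shrink J c) ?a j x) = (\<Sum>j<J'. if J <= j then level IO c a j x else 0)"
        by (rule sum.cong) (auto simp: lev)
       also have "... = (\<Sum>j\<in>{j \<in> {..<J'}. J <= j}. level IO c a j x)" by (rule sum.inter_filter[symmetric]) simp
       also have "{j \<in> {..<J'}. J <= j} = {J..<J'}" by auto
       finally show ?thesis .
      qed
      then have "f x - psum c a J x - (\<Sum>j<J'. level IO (shrink J c) ?a j x) = f x - psum c a J' x" for x
       using partial_sum_diff[OF elim, of IO c a x] by (simp add: algebra_simps)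
      then show ?case by (simp only:)
     qed
    qed
    with a show "atomic_rep d K p \<Omega> (%x. f x - psum c a J x) (shrink J c) ?a"
     unfolding atomic_rep_iff[OF p] by blast
   qed
   then have "(%J. ?N (%x. f x - psum c a J x)) ----> 0"
    by (intro tendsto_sandwich[OF _ _ tendsto_const sh[OF fin]]) auto
   then have "?T f g" using I[OF _ g sm _ lim] f by (simp add: mem_Lp_iff)
   moreover have "f \<in> ?X" using f rep fin by (auto simp: atomic_space_def)
   ultimately show ?thesis by blast
  qed
  then show "{g. \<exists>f\<in>?X. ?T f g} = Lp p \<sigma>" unfolding T by blast
 qed
qed

text \<open>The image of the termwise trace, once representations can be moved to cubes that meet the boundary.\<close>

lemma series_image:
 assumes p: "0 < p" and d: "0 < d" and tr: "trace_norm p d \<nu>"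
  and rel: "!!f c a. atomic_rep d K p \<Omega> f c a ==> \<nu> c < \<infinity> ==>
   EX c' a'. atomic_rep d K p \<Omega> f c' a' & \<nu> c' < \<infinity> & (ALL j. \<forall>m\<in>IO j - cubes_meeting \<Gamma> j. \<forall>x\<in>\<Gamma>. a' j m x = 0)"
  and ext: "!!g. g \<in> Lp p \<sigma> ==> EX f c a. extension p d K \<nu> g f c a"
 shows "image_under_trace \<sigma> (series_trace d K p \<Omega> \<nu>) (atomic_space d K p \<Omega> \<nu>) (Lp p \<sigma>)"
proof -
 let ?X = "atomic_space d K p \<Omega> \<nu>" and ?T = "series_trace d K p \<Omega> \<nu>"
 let ?van = "%a. ALL j. \<forall>m\<in>IO j - cubes_meeting \<Gamma> j. \<forall>x\<in>\<Gamma>. a j m x = (0::complex)"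
 let ?ok = "%f c a. atomic_rep d K p \<Omega> f c a & \<nu> c < \<infinity> & ?van a"
 let ?S = "%c a J x. \<Sum>j<J. level IO c a j x"
 have fin: "finite (IO j Int cubes_meeting \<Gamma> j)" for j using finite_I by blast
 have eq: "pint p \<sigma> (%x. g x - atomic_sum (%j. IO j Int cubes_meeting \<Gamma> j) c a J x) = pint p \<sigma> (%x. g x - ?S c a J x)"
  if v: "ALL j. \<forall>m\<in>IO j - cubes_meeting \<Gamma> j. \<forall>x\<in>\<Gamma>. a j m x = 0" for g c a J
  unfolding pint_def
 proof (rule nn_integral_cong)
  fix x assume "x \<in> space \<sigma>"
  then have x: "x \<in> \<Gamma>" by simp
  have "level (%j. IO j Int cubes_meeting \<Gamma> j) c a j x = level IO c a j x" for j
   unfolding level_def by (rule sum.mono_neutral_left) (use finite_I v x in auto)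
  then show "ennreal (cmod (g x - atomic_sum (%j. IO j Int cubes_meeting \<Gamma> j) c a J x) powr p) = ennreal (cmod (g x - ?S c a J x) powr p)"
   using atomic_sum_level[of "%j. IO j Int cubes_meeting \<Gamma> j" c a J, OF fin] by simp
 qed
 have T: "?T f g \<longleftrightarrow> g \<in> Lp p \<sigma> & (EX c a. ?ok f c a & (%J. pint p \<sigma> (%x. g x - ?S c a J x)) ----> 0)" for f g
 proof -
  have "(atomic_rep d K p \<Omega> f c a & \<nu> c < \<infinity> & ?van a & (%J. pint p \<sigma> (%x. g x - atomic_sum (%j. IO j Int cubes_meeting \<Gamma> j) c a J x)) ----> 0)
    \<longleftrightarrow> ?ok f c a & (%J. pint p \<sigma> (%x. g x - ?S c a J x)) ----> 0" for c a
  proof (cases "?van a")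
   case True
   then show ?thesis by (simp only: eq[OF True] conj_assoc)
  next
   case False
   then show ?thesis by (simp only: simp_thms)
  qed
  then show ?thesis
   unfolding series_trace_def Let_def Lp_norm_tendsto_0_iff[OF p] by (simp only:)
 qed
 have Xm: "f \<in> borel_measurable LO" if "f \<in> ?X" for f using that by (simp add: atomic_space_def mem_Lp_iff)
 have bound: "EX M. M ----> 0 & (ALL J. collar_bound p (%x. f x - ?S c a J x) (M J))"
  if "f \<in> ?X" "?ok f c a" for f c a
  using tr[unfolded trace_norm_def, THEN conjunct1] Xm[OF that(1)] that(2) by blast
 have cont: "continuous_on UNIV (?S c a J)" if "?ok f c a" for f c a J
  using partial_sum_continuous[of d K IO a] that unfolding atomic_rep_iff[OF p] by simp
 show ?thesis
  unfolding image_under_trace_def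
 proof (intro conjI ballI allI impI)
  fix f assume f: "f \<in> ?X"
  then obtain c0 a0 where "atomic_rep d K p \<Omega> f c0 a0" "\<nu> c0 < \<infinity>" by (auto simp: atomic_space_def)
  from rel[OF this] obtain c a where c: "?ok f c a" by blast
  from bound[OF f c] obtain M where M: "M ----> 0" "ALL J. collar_bound p (%x. f x - ?S c a J x) (M J)" by blast
  from trace_exists[OF p Xm[OF f] cont[OF c] M(2)[rule_format] M(1)]
  obtain g where "g \<in> Lp p \<sigma>" "(%k. pint p \<sigma> (%x. g x - ?S c a k x)) ----> 0" by blast
  then show "EX g. ?T f g" using c unfolding T by blast
 next
  fix f g h assume f: "f \<in> ?X" and Tg: "?T f g" and Th: "?T f h"
  obtain c a where c: "?ok f c a" "(%J. pint p \<sigma> (%x. g x - ?S c a J x)) ----> 0" using Tg unfolding T by blast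
  obtain c' a' where c': "?ok f c' a'" "(%J. pint p \<sigma> (%x. h x - ?S c' a' J x)) ----> 0" using Th unfolding T by blast
  from bound[OF f c(1)] obtain M where M: "M ----> 0" "ALL J. collar_bound p (%x. f x - ?S c a J x) (M J)" by blast
  from bound[OF f c'(1)] obtain N where N: "N ----> 0" "ALL J. collar_bound p (%x. f x - ?S c' a' J x) (N J)" by blast
  have gm: "g \<in> borel_measurable \<sigma>" "h \<in> borel_measurable \<sigma>" using Tg Th unfolding T by (auto simp: mem_Lp_iff)
  have lim: "(%J. pint p \<sigma> (%x. g x - ?S c' a' J x)) ----> 0"
   by (rule trace_independent[OF p Xm[OF f] gm(1) cont[OF c(1)] M(2)[rule_format] M(1) cont[OF c'(1)] N(2)[rule_format] N(1) c(2)])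
  show "AE x in \<sigma>. g x = h x"
   by (rule pint_AE_eq[OF p continuous_measurable_surface[OF cont[OF c'(1)]] gm lim c'(2)])
 next
  have "\<exists>f\<in>?X. ?T f g" if g: "g \<in> Lp p \<sigma>" for g
  proof -
   from ext[OF g] obtain f c a where e: "extension p d K \<nu> g f c a" by blast
   then have "?T f g" using g unfolding T extension_def by blast
   moreover have "f \<in> ?X" using e by (auto simp: atomic_space_def extension_def)
   ultimately show ?thesis by blast
  qed
  then show "{g. \<exists>f\<in>?X. ?T f g} = Lp p \<sigma>" unfolding T by blast
 qed
qed

end


section \<open>Approximation of boundary functions\<close>

context lipschitz_domain
begin

text \<open>
  Approximation by continuous functions is stable under limits and linear combinations, which reduces it to
  indicators of compact sets.
\<close>

definition approximable :: "real => ((real, 'n) vec => complex) => bool" where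
 "approximable p g \<longleftrightarrow> g \<in> borel_measurable \<sigma> \<and>
   (\<forall>e>0. \<exists>phi. continuous_on UNIV phi & pint p \<sigma> (%x. g x - phi x) <= ennreal e)"

lemma pint_diff_le:
 assumes p: "0 < p" and m: "f \<in> borel_measurable \<sigma>" "g \<in> borel_measurable \<sigma>" "h \<in> borel_measurable \<sigma>"
  and e: "0 <= e" and le: "pint p \<sigma> (%x. f x - g x) <= ennreal (e / (2 * 2 powr p))" "pint p \<sigma> (%x. g x - h x) <= ennreal (e / (2 * 2 powr p))"
 shows "pint p \<sigma> (%x. f x - h x) <= ennreal e"
proof -
 have "pint p \<sigma> (%x. f x - h x) <= ennreal (2 powr p) * (pint p \<sigma> (%x. f x - g x) + pint p \<sigma> (%x. g x - h x))"
 proof (rule pint_triangle[OF p])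
  show "cmod (f x - h x) <= cmod (f x - g x) + cmod (g x - h x)" for x
   using norm_triangle_ineq[of "f x - g x" "g x - h x"] by simp
 qed (intro borel_measurable_diff m)+
 also have "... <= ennreal (2 powr p) * (ennreal (e / (2 * 2 powr p)) + ennreal (e / (2 * 2 powr p)))"
  by (intro mult_left_mono add_mono le) simp
 also have "... = ennreal (2 powr p * (e / (2 * 2 powr p) + e / (2 * 2 powr p)))"
  using e by (simp add: ennreal_mult[symmetric] ennreal_plus[symmetric] del: ennreal_plus)
 also have "2 powr p * (e / (2 * 2 powr p) + e / (2 * 2 powr p)) = e" by simp
 finally show ?thesis .
qed

lemma approximable_closed:
 assumes p: "0 < p" and g: "g \<in> borel_measurable \<sigma>"
  and ap: "!!e. 0 < e ==> EX f. approximable p f & pint p \<sigma> (%x. g x - f x) <= ennreal e"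
 shows "approximable p g"
 unfolding approximable_def
proof (intro conjI allI impI g)
 fix e :: real assume e: "0 < e"
 then have e': "0 < e / (2 * 2 powr p)" by simp
 obtain f where f: "approximable p f" "pint p \<sigma> (%x. g x - f x) <= ennreal (e / (2 * 2 powr p))" using ap[OF e'] by blast
 obtain phi where phi: "continuous_on UNIV phi" "pint p \<sigma> (%x. f x - phi x) <= ennreal (e / (2 * 2 powr p))"
  using f(1) e' unfolding approximable_def by blast
 have "pint p \<sigma> (%x. g x - phi x) <= ennreal e"
  by (rule pint_diff_le[OF p g _ continuous_measurable_surface[OF phi(1)] less_imp_le[OF e] f(2) phi(2)])
    (use f(1) in "simp add: approximable_def")
 with phi(1) show "\<exists>phi. continuous_on UNIV phi & pint p \<sigma> (%x. g x - phi x) <= ennreal e" by blast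
qed

lemma approximable_continuous: "0 < p ==> continuous_on UNIV phi ==> approximable p phi"
 unfolding approximable_def by (auto intro!: continuous_measurable_surface exI[of _ phi])

lemma approximable_add:
 assumes p: "0 < p" and f: "approximable p f" and g: "approximable p g"
 shows "approximable p (%x. f x + g x)"
 unfolding approximable_def
proof (intro conjI allI impI)
 have m: "f \<in> borel_measurable \<sigma>" "g \<in> borel_measurable \<sigma>" using f g by (auto simp: approximable_def)
 then show "(%x. f x + g x) \<in> borel_measurable \<sigma>" by simp
 fix e :: real assume e: "0 < e"
 then have e': "0 < e / (2 * 2 powr p)" by simp
 obtain phi where phi: "continuous_on UNIV phi" "pint p \<sigma> (%x. f x - phi x) <= ennreal (e / (2 * 2 powr p))"
  using f e' unfolding approximable_def by blast
 obtain psi where psi: "continuous_on UNIV psi" "pint p \<sigma> (%x. g x - psi x) <= ennreal (e / (2 * 2 powr p))"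
  using g e' unfolding approximable_def by blast
 have "pint p \<sigma> (%x. f x + g x - (phi x + psi x)) <= ennreal e"
  by (rule pint_diff_le[OF p _ _ _ less_imp_le[OF e], of _ "%x. phi x + g x"])
    (use m phi psi continuous_measurable_surface[OF phi(1)] continuous_measurable_surface[OF psi(1)] in "auto simp: algebra_simps")
 moreover have "continuous_on UNIV (%x. phi x + psi x)" using phi(1) psi(1) by (intro continuous_intros)
 ultimately show "\<exists>phi. continuous_on UNIV phi & pint p \<sigma> (%x. f x + g x - phi x) <= ennreal e"
  by (intro exI[of _ "%x. phi x + psi x"]) simp
qed

lemma approximable_cmult:
 assumes p: "0 < p" and f: "approximable p f"
 shows "approximable p (%x. c * f x)"
proof (cases "c = 0")
 case True
 then show ?thesis using approximable_continuous[OF p, of "%x. 0"] by simp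
next
 case False
 show ?thesis unfolding approximable_def
 proof (intro conjI allI impI)
  have m: "f \<in> borel_measurable \<sigma>" using f by (simp add: approximable_def)
  then show "(%x. c * f x) \<in> borel_measurable \<sigma>" by simp
  fix e :: real assume e: "0 < e"
  then have "0 < e / cmod c powr p" using False by simp
  then obtain phi where phi: "continuous_on UNIV phi" "pint p \<sigma> (%x. f x - phi x) <= ennreal (e / cmod c powr p)"
   using f unfolding approximable_def by blast
  have "pint p \<sigma> (%x. c * f x - c * phi x) = ennreal (cmod c powr p) * pint p \<sigma> (%x. f x - phi x)"
   unfolding pint_def right_diff_distrib[symmetric] norm_mult
   by (subst nn_integral_cmult[symmetric])
     (use m continuous_measurable_surface[OF phi(1)] in "auto simp: powr_mult ennreal_mult")
  also have "... <= ennreal (cmod c powr p) * ennreal (e / cmod c powr p)" using phi(2) by (rule mult_left_mono) simp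
  also have "... = ennreal e" using False e by (simp add: ennreal_mult[symmetric])
  finally show "\<exists>phi. continuous_on UNIV phi & pint p \<sigma> (%x. c * f x - phi x) <= ennreal e"
   using phi(1) by (intro exI[of _ "%x. c * phi x"] conjI continuous_intros)
 qed
qed

lemma approximable_sum:
 assumes p: "0 < p" and "finite Y" "!!y. y \<in> Y ==> approximable p (f y)"
 shows "approximable p (%x. \<Sum>y\<in>Y. f y x)"
 using assms(2,3)
proof (induction Y rule: finite_induct)
 case empty
 show ?case using approximable_continuous[OF p, of "%x. 0"] by simp
next
 case (insert y Y)
 then show ?case using approximable_add[OF p, of "f y" "%x. \<Sum>y\<in>Y. f y x"] by simp
qed

lemma pint_dominated:
 assumes p: "0 < p" and f[measurable]: "!!i. f i \<in> borel_measurable \<sigma>" and g[measurable]: "g \<in> borel_measurable \<sigma>"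
  and w[measurable]: "w \<in> borel_measurable \<sigma>" and fin: "(\<integral>\<^sup>+x. w x \<partial>\<sigma>) < \<infinity>"
  and le: "!!i x. x \<in> \<Gamma> ==> ennreal (cmod (g x - f i x) powr p) <= w x"
  and lim: "!!x. x \<in> \<Gamma> ==> (%i. f i x) ----> g x"
 shows "(%i::nat. pint p \<sigma> (%x. g x - f i x)) ----> 0"
proof -
 have "(%i. \<integral>\<^sup>+x. ennreal (cmod (g x - f i x) powr p) \<partial>\<sigma>) ----> (\<integral>\<^sup>+x. 0 \<partial>\<sigma>)"
 proof (rule nn_integral_dominated_convergence[OF _ _ w _ fin])
  show "AE x in \<sigma>. ennreal (cmod (g x - f j x) powr p) <= w x" for j using le by auto
  have "(%i. ennreal (cmod (g x - f i x) powr p)) ----> 0" if x: "x \<in> \<Gamma>" for x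
  proof -
   have "(%i. cmod (g x - f i x)) ----> 0"
    using tendsto_norm[OF tendsto_diff[OF tendsto_const lim[OF x], of "g x"]] by simp
   then have "(%i. cmod (g x - f i x) powr p) ----> 0 powr p"
    by (rule tendsto_powr') (use p in auto)
   then show ?thesis using tendsto_ennrealI by fastforce
  qed
  then show "AE x in \<sigma>. (%i. ennreal (cmod (g x - f i x) powr p)) ----> 0" by auto
 qed auto
 then show ?thesis by (simp add: pint_def)
qed

lemma tendsto_0_le:
 fixes u :: "nat => ennreal"
 shows "u ----> 0 ==> 0 < e ==> EX i. u i <= ennreal e"
 unfolding tendsto_0_ennreal_iff eventually_sequentially by (meson less_imp_le order_refl)

text \<open>Urysohn functions \<open>max 0 (1 - i dist(x, K))\<close> decrease to the indicator.\<close>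

lemma approximable_compact:
 assumes p: "0 < p" and K: "compact K"
 shows "approximable p (indicator K)"
proof (cases "K = {}")
 case True
 then show ?thesis using approximable_continuous[OF p, of "%x. 0"] by (simp add: indicator_def[abs_def])
next
 case False
 have cl: "closed K" using K by (rule compact_imp_closed)
 let ?phi = "%(i::nat) x. complex_of_real (max 0 (1 - real i * infdist x K))"
 have c: "continuous_on UNIV (?phi i)" for i by (intro continuous_intros)
 have ind: "(indicator K :: (real, 'n) vec => complex) \<in> borel_measurable \<sigma>"
  by (intro borel_measurable_surface borel_measurable_indicator borel_closed cl)
 have fin: "(\<integral>\<^sup>+x. 1 \<partial>\<sigma>) < \<infinity>" using finite_surface by simp
 have "(%i. pint p \<sigma> (%x. indicator K x - ?phi i x)) ----> 0"
 proof (rule pint_dominated[OF p continuous_measurable_surface[OF c] ind borel_measurable_const fin])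
  fix i x
  have "cmod (indicator K x - ?phi i x) <= 1"
   unfolding indicator_def
   by (cases "x \<in> K") (auto simp: max_def infdist_nonneg norm_mult simp del: of_real_diff)
  then have "cmod (indicator K x - ?phi i x) powr p <= 1 powr p" using p by (intro powr_mono2) auto
  then show "ennreal (cmod (indicator K x - ?phi i x) powr p) <= 1" using ennreal_leI[of _ 1] by simp
 next
  fix x
  show "(%i. ?phi i x) ----> indicator K x"
  proof (cases "x \<in> K")
   case True
   then show ?thesis by simp
  next
   case x: False
   then have "0 < infdist x K" using cl False by (simp add: infdist_pos_not_in_closed)
   then obtain N :: nat where N: "1 < real N * infdist x K" using reals_Archimedean3 by blast
   have "?phi i x = 0" if "N <= i" for i
   proof -
    have "real N * infdist x K <= real i * infdist x K" using that infdist_nonneg by (intro mult_right_mono) auto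
    then have "max 0 (1 - real i * infdist x K) = 0" using N by simp
    then show ?thesis by (simp only: of_real_0)
   qed
   then have "\<forall>\<^sub>F i in sequentially. ?phi i x = 0" unfolding eventually_sequentially by blast
   then have "(%i. ?phi i x) ----> 0" by (rule tendsto_eventually)
   then show ?thesis using x by simp
  qed
 qed
 note lim = this
 show ?thesis unfolding approximable_def
 proof (intro conjI allI impI ind)
  fix e :: real assume "0 < e"
  from tendsto_0_le[OF lim this] c show "\<exists>phi. continuous_on UNIV phi & pint p \<sigma> (%x. indicator K x - phi x) <= ennreal e" by blast
 qed
qed

text \<open>The surface measure, as a finite Borel measure on the whole space, is inner regular.\<close>

lemma approximable_borel:
 assumes p: "0 < p" and B: "B \<in> sets borel"
 shows "approximable p (indicator B)"
proof (rule approximable_closed[OF p])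
 show "(indicator B :: (real, 'n) vec => complex) \<in> borel_measurable \<sigma>"
  by (intro borel_measurable_surface borel_measurable_indicator B)
 fix e :: real assume e: "0 < e"
 let ?M = "distr \<sigma> borel (%x. x)"
 have id: "(%x. x) \<in> measurable \<sigma> borel" by (intro continuous_measurable_surface continuous_on_id)
 have em: "emeasure ?M A = emeasure \<sigma> (A Int \<Gamma>)" if "A \<in> sets borel" for A
  using emeasure_distr[OF id that] by simp
 have lt: "emeasure ?M A < \<infinity>" if "A \<in> sets borel" for A
 proof -
  have "emeasure ?M A <= emeasure \<sigma> \<Gamma>" unfolding em[OF that] by (intro emeasure_mono) (use sets.top[of \<sigma>] in auto)
  then show ?thesis using finite_surface by (rule le_less_trans)
 qed
 have reg: "emeasure ?M B = (SUP K\<in>{K. K \<subseteq> B & compact K}. emeasure ?M K)"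
  by (rule inner_regular) (use B lt[of UNIV] in auto)
 have ne: "{K. K \<subseteq> B & compact K} ~= {}" by auto
 have "\<exists>K\<in>{K. K \<subseteq> B & compact K}. emeasure ?M B < emeasure ?M K + ennreal e"
  by (rule SUP_approx_ennreal[OF e ne reg less_imp_neq[OF lt[OF B]]])
 then obtain K where K: "K \<subseteq> B" "compact K" "emeasure ?M B < emeasure ?M K + ennreal e" by auto
 have Kb: "K \<in> sets borel" using K(2) by (simp add: borel_closed compact_imp_closed)
 have ms: "A Int \<Gamma> \<in> sets \<sigma>" if "A \<in> sets borel" for A
  using measurable_sets[OF id that] by simp
 have "pint p \<sigma> (%x. indicator B x - indicator K x) = (\<integral>\<^sup>+x. indicator ((B - K) Int \<Gamma>) x \<partial>\<sigma>)"
  unfolding pint_def by (rule nn_integral_cong) (use K(1) p in "auto simp: indicator_def")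
 also have "... = emeasure ?M (B - K)" using B Kb ms by (subst em) auto
 also have "... = emeasure ?M B - emeasure ?M K"
  by (rule emeasure_Diff) (use B Kb K(1) lt[OF Kb] in auto)
 also have "... <= ennreal e" using K(3) less_imp_neq[OF lt[OF B]] by (simp add: ennreal_minus_le_iff less_imp_le)
 finally show "EX f. approximable p f & pint p \<sigma> (%x. indicator B x - f x) <= ennreal e"
  using approximable_compact[OF p K(2)] by blast
qed

text \<open>A set measurable for the completed surface measure is a Borel set up to a null set.\<close>

lemma approximable_indicator:
 assumes p: "0 < p" and A: "A \<in> sets \<sigma>"
 shows "approximable p (indicator A)"
proof (rule approximable_closed[OF p])
 let ?M = "restrict_space (hausdorff_measure (CARD('n) - 1)) \<Gamma> :: (real, 'n) vec measure"
 show "(indicator A :: (real, 'n) vec => complex) \<in> borel_measurable \<sigma>" by (intro borel_measurable_indicator A)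
 fix e :: real assume e: "0 < e"
 obtain S N N' where A': "A = S Un N" "N \<subseteq> N'" "N' \<in> null_sets ?M" "S \<in> sets ?M"
  using A unfolding surface_measure_def by (rule sets_completionE)
 have "S \<in> sets borel" using A'(4) boundary_borel
  unfolding sets_restrict_space sets_hausdorff_measure[OF dimb_pos] by auto
 then have S: "approximable p (indicator S)" by (rule approximable_borel[OF p])
 have "AE x in \<sigma>. x ~: N'" unfolding surface_measure_def by (intro AE_not_in null_sets_completionI A'(3))
 then have "AE x in \<sigma>. ennreal (cmod (indicator A x - indicator S x) powr p) = 0"
  by eventually_elim (use A'(1,2) in "auto simp: indicator_def")
 then have "pint p \<sigma> (%x. indicator A x - indicator S x) = 0"
  unfolding pint_def by (subst nn_integral_cong_AE[of _ "%x. 0"]) auto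
 then show "EX f. approximable p f & pint p \<sigma> (%x. indicator A x - f x) <= ennreal e" using S by auto
qed

text \<open>
  Simple functions approximate with a bound by twice the function, which gives the dominating function.
\<close>

lemma approximable_Lp:
 assumes p: "0 < p" and g: "g \<in> Lp p \<sigma>"
 shows "approximable p g"
proof (rule approximable_closed[OF p])
 show gm[measurable]: "g \<in> borel_measurable \<sigma>" using g by (simp add: mem_Lp_iff)
 fix e :: real assume e: "0 < e"
 obtain F where F: "!!i. simple_function \<sigma> (F i)" "!!x. x \<in> \<Gamma> ==> (%i. F i x) ----> g x"
  "!!i x. x \<in> \<Gamma> ==> dist (F i x) 0 <= 2 * dist (g x) 0"
  using borel_measurable_implies_sequence_metric[OF gm, of 0] unfolding space_surface by blast
 have Fm: "F i \<in> borel_measurable \<sigma>" for i by (rule borel_measurable_simple_function[OF F(1)])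
 have "(%i. pint p \<sigma> (%x. g x - F i x)) ----> 0"
 proof (rule pint_dominated[OF p Fm gm _ _ _ F(2)])
  let ?w = "%x. ennreal (3 powr p) * ennreal (cmod (g x) powr p)"
  show "?w \<in> borel_measurable \<sigma>" by measurable
  have "(\<integral>\<^sup>+x. ?w x \<partial>\<sigma>) = ennreal (3 powr p) * pint p \<sigma> g" unfolding pint_def by (rule nn_integral_cmult) measurable
  then show "(\<integral>\<^sup>+x. ?w x \<partial>\<sigma>) < \<infinity>" using g by (simp add: mem_Lp_iff ennreal_mult_less_top)
  fix i x assume "x \<in> \<Gamma>"
  then have "cmod (g x - F i x) <= 3 * cmod (g x)" using F(3)[of x i] norm_triangle_ineq4[of "g x" "F i x"] by simp
  then have "cmod (g x - F i x) powr p <= (3 * cmod (g x)) powr p" using p by (intro powr_mono2) auto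
  then show "ennreal (cmod (g x - F i x) powr p) <= ?w x"
   by (simp add: powr_mult ennreal_mult[symmetric] ennreal_leI)
 qed
 from tendsto_0_le[OF this e] obtain i where i: "pint p \<sigma> (%x. g x - F i x) <= ennreal e" by blast
 let ?s = "%x. \<Sum>y\<in>F i ` \<Gamma>. y * indicator (F i -` {y} Int \<Gamma>) x"
 have "approximable p ?s"
 proof (intro approximable_sum approximable_cmult approximable_indicator p)
  show "finite (F i ` \<Gamma>)" using F(1)[of i] by (simp add: simple_function_def)
  show "F i -` {y} Int \<Gamma> \<in> sets \<sigma>" for y
   using measurable_sets[OF Fm[of i], of "{y}"] by simp
 qed
 moreover have "pint p \<sigma> (%x. g x - ?s x) = pint p \<sigma> (%x. g x - F i x)"
  unfolding pint_def
 proof (rule nn_integral_cong)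
  fix x assume "x \<in> space \<sigma>"
  from simple_function_indicator_representation_banach[OF F(1)[of i] this]
  have "F i x = (\<Sum>y\<in>F i ` \<Gamma>. indicator (F i -` {y} Int \<Gamma>) x *\<^sub>R y)" unfolding space_surface .
  also have "... = ?s x" by (rule sum.cong[OF refl]) (simp split: split_indicator)
  finally have eq: "F i x = ?s x" .
  show "ennreal (cmod (g x - ?s x) powr p) = ennreal (cmod (g x - F i x) powr p)" unfolding eq[symmetric] ..
 qed
 ultimately show "EX f. approximable p f & pint p \<sigma> (%x. g x - f x) <= ennreal e" using i by auto
qed

text \<open>
  A continuous function is approximated on the boundary by a sum of one level with the coefficients
  taken from values of the function. The ball around the point where the value is taken has
  surface measure at least a multiple of \<open>2 ^ (- j (n - 1))\<close>, which bounds the coefficients.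
\<close>

lemma discretize:
 assumes p: "0 < p"
 shows "\<exists>C>0. \<forall>phi e. continuous_on UNIV phi --> 0 < e --> (\<forall>\<^sub>F j in sequentially. EX c.
   pint p \<sigma> (%x. phi x - (\<Sum>m\<in>IO j. c m * theta j m x)) <= ennreal e \<and>
   ennreal ((\<Sum>m\<in>IO j. cmod (c m) powr p) / 2 ^ (j * (CARD('n) - 1))) <= ennreal C * (pint p \<sigma> phi + ennreal e))"
proof -
 let ?k = "CARD('n) - 1" and ?n = "CARD('n)"
 from hausdorff_boundary_lower obtain c0 R0 where c0: "0 < c0" and R0: "0 < R0"
  and low: "\<forall>x\<in>\<Gamma>. \<forall>r>0. r <= R0 --> ennreal (c0 * r ^ ?k) <= hausdorff_outer ?k (\<Gamma> Int ball x r)" by (elim exE conjE)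
 obtain M where M: "0 < M" "!!j m. Ck_bounded 0 (2 ^ j) M (theta j m :: (real, 'n) vec => complex)" by (rule theta_Ck_bounded[where K = 0]) (rule that)
 have th: "cmod (theta j m x) <= M" for j and m :: "(int, 'n) vec" and x using Ck_bounded_norm[OF M(2)] by blast
 define S where "S = enn2real (emeasure \<sigma> \<Gamma>)"
 have S: "emeasure \<sigma> \<Gamma> = ennreal S" "0 <= S" using finite_surface by (auto simp: S_def)
 \<comment> \<open>A point lies in at most \<open>5 ^ n\<close> of the balls of radius \<open>1 / 2 ^ j\<close> used below.\<close>
 define C where "C = 5 ^ ?n * 2 powr p / c0"
 have C: "0 < C" using c0 by (simp add: C_def)
 \<comment> \<open>At most \<open>3 ^ n\<close> members of the partition of unity, each bounded by \<open>M\<close>, are nonzero at a point.\<close>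
 define N :: real where "N = 3 ^ ?n * M + 1"
 have N: "1 <= N" "3 ^ ?n * M <= N" using M(1) by (auto simp: N_def)
 have main: "\<forall>\<^sub>F j in sequentially. EX c.
   pint p \<sigma> (%x. phi x - (\<Sum>m\<in>IO j. c m * theta j m x)) <= ennreal e \<and>
   ennreal ((\<Sum>m\<in>IO j. cmod (c m) powr p) / 2 ^ (j * ?k)) <= ennreal C * (pint p \<sigma> phi + ennreal e)"
  if phi: "continuous_on UNIV phi" and e: "0 < e" for phi e
 proof -
  define w where "w = (e / (S + 1)) powr (1 / p)"
  have w: "0 < w" using e S by (simp add: w_def)
  have wp: "w powr p * S <= e"
  proof -
   have "w powr p = e / (S + 1)" using e S p by (simp add: w_def powr_powr)
   then have "w powr p * (S + 1) = e" using S by simp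
   moreover have "w powr p * S <= w powr p * (S + 1)" by (intro mult_left_mono) auto
   ultimately show ?thesis by (simp only:)
  qed
  have pw: "(\<integral>\<^sup>+x. ennreal (w powr p) \<partial>\<sigma>) <= ennreal e"
   using wp S w by (simp add: ennreal_mult[symmetric] ennreal_leI)
  define u where "u = w / N"
  have u: "0 < u" "u <= w" "N * u = w" using w N by (auto simp: u_def field_simps)
  have "uniformly_continuous_on \<Gamma> phi"
   by (intro compact_uniformly_continuous continuous_on_subset[OF phi] compact_boundary) auto
  then obtain dlt where dlt: "0 < dlt" "!!x y. x \<in> \<Gamma> ==> y \<in> \<Gamma> ==> dist x y < dlt ==> dist (phi x) (phi y) < u"
   using u(1) unfolding uniformly_continuous_on_def by blast
  have "(%j. 2 * real ?n * (1 / 2) ^ j) ----> 0" using tendsto_mult_right_zero[OF LIMSEQ_power_zero[of "1/2::real"], of "2 * real ?n"] by simp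
  moreover have "0 < min dlt R0" using dlt R0 by simp
  ultimately have "\<forall>\<^sub>F j in sequentially. 2 * real ?n * (1 / 2) ^ j < min dlt R0" by (rule order_tendstoD)
  then show ?thesis
  proof eventually_elim
   case (elim j)
   have n1: "1 <= real ?n" using dim by simp
   have "1 / 2 ^ j <= 2 * real ?n * (1 / 2) ^ j" using mult_right_mono[of 1 "2 * real ?n" "(1 / 2) ^ j"] n1 by (simp add: power_one_over)
   then have small: "1 / 2 ^ j < dlt" "1 / 2 ^ j <= R0" "2 * real ?n / 2 ^ j < dlt" using elim by (auto simp: power_one_over)
   define H where "H = {m. dcube (3 / 4) j m Int \<Gamma> ~= {}}"
   define y where "y m = (SOME x. x \<in> dcube (3 / 4) j m Int \<Gamma>)" for m
   have y: "y m \<in> dcube (3 / 4) j m" "y m \<in> \<Gamma>" if "m \<in> H" for m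
   proof -
    have "EX x. x \<in> dcube (3 / 4) j m Int \<Gamma>" using that by (auto simp: H_def)
    from someI_ex[OF this] show "y m \<in> dcube (3 / 4) j m" "y m \<in> \<Gamma>" by (auto simp: y_def)
   qed
   have enlarge: "x' \<in> dcube (b + s) j m" if "x \<in> dcube b j m" "dist x x' <= s / 2 ^ j" for x x' b s m
    unfolding dcube_def
   proof (intro CollectI allI)
    fix i
    have "\<bar>x' $ i - x $ i\<bar> <= s / 2 ^ j" using that(2) component_le_norm_cart[of "x' - x" i] by (simp add: dist_norm norm_minus_commute)
    moreover have "\<bar>x $ i - of_int (m $ i) / 2 ^ j\<bar> <= b / 2 ^ j" using that(1) by (simp add: dcube_def)
    ultimately show "\<bar>x' $ i - of_int (m $ i) / 2 ^ j\<bar> <= (b + s) / 2 ^ j" by (simp add: add_divide_distrib)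
   qed
   have HI: "H \<subseteq> IO j"
   proof
    fix m assume m: "m \<in> H"
    have "y m \<in> closure \<Omega>" using y(2)[OF m] by (simp add: frontier_def)
    moreover have "0 < (1 / 4) / (2::real) ^ j" by simp
    ultimately obtain x where x: "x \<in> \<Omega>" "dist x (y m) < (1 / 4) / 2 ^ j" unfolding closure_approachable by blast
    then have "x \<in> dcube (3 / 4 + 1 / 4) j m" by (intro enlarge[OF y(1)[OF m]]) (simp add: dist_commute)
    then show "m \<in> IO j" using x(1) by (auto simp: cubes_meeting_def)
   qed
   then have finH: "finite H" using finite_I finite_subset by blast
   define c where "c m = (if m \<in> H then phi (y m) else 0)" for m
   have sumI: "(\<Sum>m\<in>IO j. f m) = (\<Sum>m\<in>H. f m)" if "!!m. m ~: H ==> f m = 0" for f :: "_ => 'b::comm_monoid_add"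
    by (rule sum.mono_neutral_right) (use HI finite_I that in auto)
   have near: "dist (y m) x < dlt" if "m \<in> H" "x \<in> dcube (3 / 4) j m" for m x
   proof -
    have "dist (y m) x <= real ?n * (3 / 4 + 3 / 4) / 2 ^ j" by (rule dist_dcubes[OF y(1)[OF that(1)] that(2)])
    also have "... <= real ?n * 2 / 2 ^ j" by (intro divide_right_mono mult_left_mono) auto
    also have "... < dlt" using small(3) by (simp add: mult.commute)
    finally show ?thesis .
   qed
   have "pint p \<sigma> (%x. phi x - (\<Sum>m\<in>IO j. c m * theta j m x)) <= (\<integral>\<^sup>+x. ennreal (w powr p) \<partial>\<sigma>)"
    unfolding pint_def
   proof (intro nn_integral_mono ennreal_leI powr_mono2 less_imp_le[OF p] norm_ge_zero)
    fix x assume "x \<in> space \<sigma>"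
    then have x: "x \<in> \<Gamma>" by simp
    let ?T = "{m \<in> H. x \<in> dcube (3 / 4) j m}"
    have "(\<Sum>m\<in>H. theta j m x) = 1"
    proof (rule sum_theta[OF finH])
     fix m assume "theta j m x ~= 0"
     then have "x \<in> dcube (3 / 4) j m" using theta_outside_cube by blast
     then show "m \<in> H" using x by (auto simp: H_def)
    qed
    then have "phi x = (\<Sum>m\<in>H. phi x * theta j m x)" by (simp add: sum_distrib_left[symmetric])
    moreover have "(\<Sum>m\<in>IO j. c m * theta j m x) = (\<Sum>m\<in>H. phi (y m) * theta j m x)"
     by (subst sumI) (auto simp: c_def)
    ultimately have "phi x - (\<Sum>m\<in>IO j. c m * theta j m x) = (\<Sum>m\<in>H. (phi x - phi (y m)) * theta j m x)"
     by (simp add: sum_subtractf left_diff_distrib)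
    also have "... = (\<Sum>m\<in>?T. (phi x - phi (y m)) * theta j m x)"
     by (rule sum.mono_neutral_right) (use finH theta_outside_cube in auto)
    finally have "cmod (phi x - (\<Sum>m\<in>IO j. c m * theta j m x)) <= (\<Sum>m\<in>?T. cmod ((phi x - phi (y m)) * theta j m x))"
     by (simp only: norm_sum)
    also have "... <= (\<Sum>m\<in>?T. u * M)"
    proof (rule sum_mono)
     fix m assume m: "m \<in> ?T"
     have "dist (phi (y m)) (phi x) < u" using m near x y(2) dlt(2) by blast
     then show "cmod ((phi x - phi (y m)) * theta j m x) <= u * M"
      unfolding norm_mult using th u M by (intro mult_mono) (auto simp: dist_norm norm_minus_commute)
    qed
    also have "... = real (card ?T) * (u * M)" by simp
    also have "... <= 3 ^ ?n * (u * M)"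
    proof (rule mult_right_mono)
     have "card ?T <= card {m. x \<in> dcube 1 j m}"
     proof (rule card_mono)
      show "finite {m. x \<in> dcube 1 j m}" by (rule card_cubes_at_point) simp
      show "?T \<subseteq> {m. x \<in> dcube 1 j m}" using dcube_mono[of "3/4" 1] by fastforce
     qed
     then show "real (card ?T) <= 3 ^ ?n" using card_cubes_at_point(2)[of 1 x j] by simp
    qed (use u M in simp)
    also have "... <= N * u" using N(2) u(1) mult_right_mono[of "3 ^ ?n * M" N u] by (simp add: mult.commute mult.left_commute)
    finally show "cmod (phi x - (\<Sum>m\<in>IO j. c m * theta j m x)) <= w" using u(3) by simp
   qed
   also note pw
   finally have first: "pint p \<sigma> (%x. phi x - (\<Sum>m\<in>IO j. c m * theta j m x)) <= ennreal e" .
   let ?B = "%m. ball (y m) (1 / 2 ^ j)"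
   let ?G = "%x. ennreal (2 powr p) * (ennreal (cmod (phi x) powr p) + ennreal (w powr p))"
   have phim[measurable]: "phi \<in> borel_measurable \<sigma>" by (rule continuous_measurable_surface[OF phi])
   have Bm: "(indicator (?B m) :: _ => ennreal) \<in> borel_measurable \<sigma>" for m
    by (intro borel_measurable_surface borel_measurable_indicator) simp
   have each: "ennreal (cmod (c m) powr p) * ennreal (c0 / 2 ^ (j * ?k)) <= (\<integral>\<^sup>+x. ?G x * indicator (?B m) x \<partial>\<sigma>)" if m: "m \<in> H" for m
   proof -
    have ms: "\<Gamma> Int ?B m \<in> sets \<sigma>"
     using measurable_sets[OF continuous_measurable_surface[OF continuous_on_id], of "?B m"] by (simp add: Int_commute)
    have "ennreal (c0 / 2 ^ (j * ?k)) <= emeasure \<sigma> (\<Gamma> Int ?B m)"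
     using low[rule_format, OF y(2)[OF m], of "1 / 2 ^ j"] small(2)
     by (subst emeasure_surface) (auto simp: power_divide power_mult[symmetric])
    then have "ennreal (cmod (c m) powr p) * ennreal (c0 / 2 ^ (j * ?k)) <= ennreal (cmod (c m) powr p) * emeasure \<sigma> (\<Gamma> Int ?B m)"
     by (rule mult_left_mono) simp
    also have "... = (\<integral>\<^sup>+x. ennreal (cmod (c m) powr p) * indicator (\<Gamma> Int ?B m) x \<partial>\<sigma>)"
     using ms by (simp add: nn_integral_cmult_indicator)
    also have "... <= (\<integral>\<^sup>+x. ?G x * indicator (?B m) x \<partial>\<sigma>)"
    proof (rule nn_integral_mono)
     fix x assume "x \<in> space \<sigma>"
     then have x: "x \<in> \<Gamma>" by simp
     show "ennreal (cmod (c m) powr p) * indicator (\<Gamma> Int ?B m) x <= ?G x * indicator (?B m) x"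
     proof (cases "x \<in> ?B m")
      case True
      then have "dist (y m) x < dlt" using small(1) by simp
      then have "dist (phi (y m)) (phi x) < u" using x y(2)[OF m] dlt(2) by blast
      then have "cmod (c m) <= cmod (phi x) + w"
       using m u(2) norm_triangle_ineq2[of "phi (y m)" "phi x"] by (simp add: c_def dist_norm)
      then have "cmod (c m) powr p <= (cmod (phi x) + w) powr p" using p by (intro powr_mono2) auto
      also have "... <= 2 powr p * (cmod (phi x) powr p + w powr p)" by (rule powr_add_le) (use p w in auto)
      finally have "ennreal (cmod (c m) powr p) <= ?G x"
       by (simp add: ennreal_mult[symmetric] ennreal_plus[symmetric] ennreal_leI del: ennreal_plus)
      then show ?thesis using x True by simp
     qed simp
    qed
    finally show ?thesis .
   qed
   have "ennreal (\<Sum>m\<in>IO j. cmod (c m) powr p) * ennreal (c0 / 2 ^ (j * ?k)) = (\<Sum>m\<in>H. ennreal (cmod (c m) powr p) * ennreal (c0 / 2 ^ (j * ?k)))"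
    by (subst sumI) (use p in "auto simp: c_def sum_ennreal sum_distrib_right[symmetric]")
   also have "... <= (\<Sum>m\<in>H. \<integral>\<^sup>+x. ?G x * indicator (?B m) x \<partial>\<sigma>)" by (intro sum_mono each)
   also have "... = (\<integral>\<^sup>+x. (\<Sum>m\<in>H. ?G x * indicator (?B m) x) \<partial>\<sigma>)"
    by (rule nn_integral_sum[symmetric]) (intro borel_measurable_times_ennreal Bm, measurable)
   also have "... <= (\<integral>\<^sup>+x. ennreal (5 ^ ?n) * ?G x \<partial>\<sigma>)"
   proof (rule nn_integral_mono)
    fix x
    let ?T = "{m \<in> H. x \<in> ?B m}"
    have "(\<Sum>m\<in>H. ?G x * indicator (?B m) x) = (\<Sum>m\<in>?T. ?G x)"
     by (rule sum.mono_neutral_cong_right) (use finH in auto)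
    also have "... = ennreal (real (card ?T)) * ?G x" by (simp add: ennreal_of_nat_eq_real_of_nat)
    also have "... <= ennreal (5 ^ ?n) * ?G x"
    proof (intro mult_right_mono ennreal_leI)
     have "card ?T <= card {m. x \<in> dcube 2 j m}"
     proof (rule card_mono)
      show "finite {m. x \<in> dcube 2 j m}" by (rule card_cubes_at_point) simp
      have "x \<in> dcube 2 j m" if "m \<in> ?T" for m
      proof -
       have "x \<in> dcube (3 / 4 + 1) j m" using that y(1) by (intro enlarge[of "y m" "3 / 4"]) auto
       then show ?thesis using dcube_mono[of "3 / 4 + 1" 2 j m] by auto
      qed
      then show "?T \<subseteq> {m. x \<in> dcube 2 j m}" by blast
     qed
     then show "real (card ?T) <= 5 ^ ?n" using card_cubes_at_point(2)[of 2 x j] by simp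
    qed simp
    finally show "(\<Sum>m\<in>H. ?G x * indicator (?B m) x) <= ennreal (5 ^ ?n) * ?G x" .
   qed
   also have "... = ennreal (5 ^ ?n) * (ennreal (2 powr p) * (pint p \<sigma> phi + (\<integral>\<^sup>+x. ennreal (w powr p) \<partial>\<sigma>)))"
    unfolding pint_def by (subst nn_integral_cmult, measurable, subst nn_integral_cmult, measurable, subst nn_integral_add) auto
   also have "... <= ennreal (5 ^ ?n) * (ennreal (2 powr p) * (pint p \<sigma> phi + ennreal e))"
    by (intro mult_left_mono add_left_mono pw) auto
   also have "... = ennreal c0 * (ennreal C * (pint p \<sigma> phi + ennreal e))"
    using c0 by (simp add: C_def mult.assoc[symmetric] ennreal_mult[symmetric])
   finally have "ennreal (\<Sum>m\<in>IO j. cmod (c m) powr p) * ennreal (c0 / 2 ^ (j * ?k)) <= ennreal c0 * (ennreal C * (pint p \<sigma> phi + ennreal e))" .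
   moreover have "ennreal (\<Sum>m\<in>IO j. cmod (c m) powr p) * ennreal (c0 / 2 ^ (j * ?k)) = ennreal c0 * ennreal ((\<Sum>m\<in>IO j. cmod (c m) powr p) / 2 ^ (j * ?k))"
    using c0 by (simp add: ennreal_mult[symmetric] sum_nonneg mult.commute)
   ultimately have "ennreal c0 * ennreal ((\<Sum>m\<in>IO j. cmod (c m) powr p) / 2 ^ (j * ?k)) <= ennreal c0 * (ennreal C * (pint p \<sigma> phi + ennreal e))"
    by (simp only:)
   then have "ennreal ((\<Sum>m\<in>IO j. cmod (c m) powr p) / 2 ^ (j * ?k)) <= ennreal C * (pint p \<sigma> phi + ennreal e)"
    using c0 by (subst (asm) ennreal_mult_le_mult_iff) auto
   with first show ?case by blast
  qed
 qed
 show ?thesis using C main by blast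
qed

end


section \<open>Coefficients decaying along sparse levels\<close>

lemma geometric_suminf_finite:
 fixes D rho :: real
 assumes "0 <= D" "0 <= rho" "rho < 1"
 shows "(\<Sum>k. ennreal (D * rho ^ k)) = ennreal (D / (1 - rho))"
proof -
 have s: "summable (%k. D * rho ^ k)" using assms by (intro summable_mult summable_geometric) auto
 have "(\<Sum>k. ennreal (D * rho ^ k)) = ennreal (\<Sum>k. D * rho ^ k)"
  by (rule suminf_ennreal2[OF _ s]) (use assms in auto)
 also have "(\<Sum>k. D * rho ^ k) = D / (1 - rho)" using assms by (simp add: suminf_mult suminf_geometric summable_geometric)
 finally show ?thesis .
qed

context lipschitz_domain
begin

text \<open>
  Outside the levels \<open>l k\<close> there are no coefficients, and the level sums decay geometrically
  in \<open>k\<close>, not in the level itself.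
\<close>

definition sparse :: "real => 'n coeffs => (nat => nat) => real => bool" where
 "sparse p c l D \<longleftrightarrow> strict_mono l & 0 <= D & (ALL j m. j ~: range l --> c j m = 0) \<and>
   (ALL k. bsum p IO c (l k) <= D * (1 / 4) ^ k)"

lemma b_norm_sparse:
 assumes p: "0 < p" and t: "0 < t" and sp: "sparse p c l D"
 shows "b_norm (1 / p) p (ennreal t) \<Omega> c < \<infinity>"
proof -
 have l: "strict_mono l" and D: "0 <= D" and z: "!!j m. j ~: range l ==> c j m = 0" and b: "!!k. bsum p IO c (l k) <= D * (1 / 4) ^ k"
  using sp by (auto simp: sparse_def)
 let ?s = "t / p" and ?u = "%j. ennreal (bsum p IO c j powr (t / p))"
 have s: "0 < ?s" using p t by simp
 have "?u j = 0" if "j ~: range l" for j using z[OF that] p by (simp add: bsum_def)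
 then have "suminf ?u = (\<Sum>k. ?u (l k))" by (rule suminf_mono_reindex[OF l, symmetric])
 also have "... <= (\<Sum>k. ennreal (D powr ?s * ((1 / 4) powr ?s) ^ k))"
 proof (intro suminf_le ennreal_leI)
  fix k
  have "bsum p IO c (l k) powr ?s <= (D * (1 / 4) ^ k) powr ?s" using b bsum_nonneg s by (intro powr_mono2) auto
  also have "... = D powr ?s * ((1 / 4) powr ?s) ^ k"
   using D by (simp add: powr_mult powr_realpow[symmetric] powr_powr mult.commute)
  finally show "bsum p IO c (l k) powr ?s <= D powr ?s * ((1 / 4) powr ?s) ^ k" .
 qed auto
 also have "... = ennreal (D powr ?s / (1 - (1 / 4) powr ?s))"
  by (rule geometric_suminf_finite) (use s powr_less_mono2[OF s, of "1/4" 1] in auto)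
 also have "... < \<infinity>" by simp
 finally show ?thesis unfolding b_norm_eq[OF p t] epowr_less_top_iff .
qed

text \<open>
  \<open>T\<close> is the sum of all terms, the \<open>k\<close>-th level weighted by \<open>2 ^ k\<close>;
  the decay \<open>4 ^ (- k)\<close> keeps its integral finite.
\<close>

lemma sparse_dominated:
 assumes p: "0 < p" and sp: "sparse p c l D"
 shows "EX T. (\<integral>\<^sup>+x. T x \<partial>lborel) < \<infinity> & T \<in> borel_measurable borel \<and>
   (ALL x k. \<forall>m\<in>IO (l k). ennreal (2 ^ k * (2 ^ l k * cmod (c (l k) m) powr p)) * indicator (cube (l k) m) x <= T x)"
proof -
 have D: "0 <= D" and b: "!!k. bsum p IO c (l k) <= D * (1 / 4) ^ k"
  using sp by (auto simp: sparse_def)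
 let ?t = "%k m x. ennreal (2 ^ k * (2 ^ l k * cmod (c (l k) m) powr p)) * indicator (cube (l k) m) x"
 let ?T = "%x. \<Sum>k. \<Sum>m\<in>IO (l k). ?t k m x"
 have tm: "(%x. ?t k m x) \<in> borel_measurable borel" for k m
  by (intro borel_measurable_times_ennreal borel_measurable_const borel_measurable_indicator) simp
 have sm: "(%x. \<Sum>m\<in>IO (l k). ?t k m x) \<in> borel_measurable borel" for k by (intro borel_measurable_sum tm)
 have one: "(\<integral>\<^sup>+x. ?t k m x \<partial>lborel) = ennreal (2 ^ k * 2 ^ CARD('n) * (cmod (c (l k) m) powr p / 2 ^ (l k * (CARD('n) - 1))))" for k m
 proof -
  have "(\<integral>\<^sup>+x. ?t k m x \<partial>lborel) = ennreal (2 ^ k * (2 ^ l k * cmod (c (l k) m) powr p)) * ennreal ((2 * 1 / 2 ^ l k) ^ CARD('n))"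
   by (subst nn_integral_cmult_indicator) (simp_all add: emeasure_dcube)
  also have "... = ennreal (2 ^ k * (2 ^ l k * cmod (c (l k) m) powr p) * (2 * 1 / 2 ^ l k) ^ CARD('n))" by (simp add: ennreal_mult)
  also have "(2 * 1 / 2 ^ l k) ^ CARD('n) = (2::real) ^ CARD('n) / (2 ^ l k * 2 ^ (l k * (CARD('n) - 1)))"
  proof -
   have "(2 ^ l k) ^ CARD('n) = (2::real) ^ l k * (2 ^ l k) ^ (CARD('n) - 1)"
    using power_Suc[of "(2::real) ^ l k" "CARD('n) - 1"] unfolding Suc_dimb[symmetric] .
   then show ?thesis by (simp only: power_divide mult_1_right power_mult)
  qed
  also have "2 ^ k * (2 ^ l k * cmod (c (l k) m) powr p) * ((2::real) ^ CARD('n) / (2 ^ l k * 2 ^ (l k * (CARD('n) - 1)))) =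
    2 ^ k * 2 ^ CARD('n) * (cmod (c (l k) m) powr p / 2 ^ (l k * (CARD('n) - 1)))" by (simp add: field_simps)
  finally show ?thesis .
 qed
 have "(\<integral>\<^sup>+x. ?T x \<partial>lborel) = (\<Sum>k. \<integral>\<^sup>+x. (\<Sum>m\<in>IO (l k). ?t k m x) \<partial>lborel)"
  by (rule nn_integral_suminf) (use sm in simp)
 also have "... = (\<Sum>k. ennreal (2 ^ k * 2 ^ CARD('n) * bsum p IO c (l k)))"
 proof (intro arg_cong[of _ _ suminf] ext)
  fix k
  have "(\<integral>\<^sup>+x. (\<Sum>m\<in>IO (l k). ?t k m x) \<partial>lborel) = (\<Sum>m\<in>IO (l k). \<integral>\<^sup>+x. ?t k m x \<partial>lborel)"
   by (rule nn_integral_sum) (use tm in simp)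
  also have "... = ennreal (\<Sum>m\<in>IO (l k). 2 ^ k * 2 ^ CARD('n) * (cmod (c (l k) m) powr p / 2 ^ (l k * (CARD('n) - 1))))"
   unfolding one by (rule sum_ennreal) simp
  finally show "(\<integral>\<^sup>+x. (\<Sum>m\<in>IO (l k). ?t k m x) \<partial>lborel) = ennreal (2 ^ k * 2 ^ CARD('n) * bsum p IO c (l k))"
   unfolding bsum_def by (simp only: sum_distrib_left[symmetric] sum_divide_distrib[symmetric])
 qed
 also have "... <= (\<Sum>k. ennreal (2 ^ CARD('n) * D * (1 / 2) ^ k))"
 proof (intro suminf_le ennreal_leI)
  fix k
  have "2 ^ k * 2 ^ CARD('n) * bsum p IO c (l k) <= 2 ^ k * 2 ^ CARD('n) * (D * (1 / 4) ^ k)" using b by (intro mult_left_mono) auto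
  also have "... = 2 ^ CARD('n) * D * (2 ^ k * (1 / 4) ^ k)" by (simp only: ac_simps)
  also have "2 ^ k * (1 / 4) ^ k = (1 / 2 :: real) ^ k" by (simp add: power_mult_distrib[symmetric])
  finally show "2 ^ k * 2 ^ CARD('n) * bsum p IO c (l k) <= 2 ^ CARD('n) * D * (1 / 2) ^ k" .
 qed auto
 also have "... = ennreal (2 ^ CARD('n) * D / (1 - 1 / 2))" by (rule geometric_suminf_finite) (use D in auto)
 also have "... < \<infinity>" by simp
 finally have fin: "(\<integral>\<^sup>+x. ?T x \<partial>lborel) < \<infinity>" .
 have le: "?t k m x <= ?T x" if m: "m \<in> IO (l k)" for k m x
 proof -
  have "?t k m x <= (\<Sum>m\<in>IO (l k). ?t k m x)" by (rule member_le_sum[OF m _ finite_I]) simp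
  also have "... <= ?T x" using sum_le_suminf[of "%k. \<Sum>m\<in>IO (l k). ?t k m x" "{k}"] by (simp add: summableI)
  finally show ?thesis .
 qed
 have Tm: "?T \<in> borel_measurable borel" by (intro borel_measurable_suminf_order sm)
 show ?thesis by (intro exI[of _ ?T] conjI fin Tm allI ballI le)
qed

text \<open>
  The weights \<open>2 ^ k\<close> in the dominating function turn each level into a geometrically small
  part of it, so that any power of the terms can be summed.
\<close>

lemma f_norm_sparse:
 assumes p: "0 < p" and q: "0 < q" and sp: "sparse p c l D"
 shows "f_norm (1 / p) p q \<Omega> c < \<infinity>"
proof -
 have l: "strict_mono l" and z: "!!j m. j ~: range l ==> c j m = 0" using sp by (auto simp: sparse_def)
 obtain T where T: "(\<integral>\<^sup>+x. T x \<partial>lborel) < \<infinity>" "T \<in> borel_measurable borel"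
  "!!x k m. m \<in> IO (l k) ==> ennreal (2 ^ k * (2 ^ l k * cmod (c (l k) m) powr p)) * indicator (cube (l k) m) x <= T x"
  using sparse_dominated[OF p sp] by blast
 show ?thesis
 proof (cases "q = \<infinity>")
  case True
  have "gmax p c x <= T x" for x
   unfolding gmax_def
  proof (rule SUP_least)
   fix i :: "nat \<times> (int, 'n) vec" assume "i \<in> (SIGMA j:UNIV. IO j)"
   then obtain j m where jm: "i = (j, m)" "m \<in> IO j" by auto
   have "ennreal (2 ^ j * cmod (c j m) powr p) * indicator (cube j m) x <= T x"
   proof (cases "j \<in> range l")
    case True
    then obtain k where k: "j = l k" by blast
    have "ennreal (1 * (2 ^ l k * cmod (c (l k) m) powr p)) * indicator (cube (l k) m) x \<le>
      ennreal (2 ^ k * (2 ^ l k * cmod (c (l k) m) powr p)) * indicator (cube (l k) m) x"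
     by (intro mult_right_mono ennreal_leI) auto
    also have "... <= T x" using T(3) jm k by blast
    finally show ?thesis using k by simp
   next
    case False
    then show ?thesis using z p by simp
   qed
   then show "(case i of (j, m) => ennreal (2 ^ j * cmod (c j m) powr p) * indicator (cube j m) x) <= T x" using jm by simp
  qed
  then have "(\<integral>\<^sup>+x. gmax p c x \<partial>lborel) <= (\<integral>\<^sup>+x. T x \<partial>lborel)" by (intro nn_integral_mono)
  then show ?thesis unfolding True f_norm_infinity_eq[OF p] epowr_less_top_iff using T(1) by (rule le_less_trans)
 next
  case False
  then obtain t where qt: "q = ennreal t" and t: "0 < t" using q by (cases q) auto
  define s where "s = t / p"
  have s: "0 < s" using p t by (simp add: s_def)
  define r where "r = (1 / 2) powr s"
  have r: "0 <= r" "r < 1" using powr_less_mono2[OF s, of "1/2" 1] by (auto simp: r_def)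
  define E where "E = 3 ^ CARD('n) / (1 - r)"
  have E: "0 < E" using r by (simp add: E_def)
  have "lf p t c x epowr (p / t) <= ennreal (E powr (1 / s)) * T x" for x
  proof (cases "T x = \<infinity>")
   case True
   then show ?thesis using E by (simp add: ennreal_mult_top)
  next
   case False
   then obtain \<tau> where \<tau>: "T x = ennreal \<tau>" "0 <= \<tau>" by (cases "T x") auto
   let ?v = "%j. \<Sum>m\<in>IO j. ennreal ((2 ^ j * cmod (c j m) powr p) powr s) * indicator (cube j m) x"
   have vz: "?v j = 0" if "j ~: range l" for j using z[OF that] p by simp
   have "lf p t c x = suminf ?v" by (simp add: lf_def s_def)
   also have "... = (\<Sum>k. ?v (l k))" using vz by (rule suminf_mono_reindex[OF l, symmetric])
   also have "... <= (\<Sum>k. ennreal (3 ^ CARD('n) * \<tau> powr s * r ^ k))"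
   proof (intro suminf_le)
    fix k
    let ?S = "{m \<in> IO (l k). x \<in> cube (l k) m}"
    have "?v (l k) = (\<Sum>m\<in>?S. ennreal ((2 ^ l k * cmod (c (l k) m) powr p) powr s))"
     by (rule sum.mono_neutral_cong_right) (use finite_I in auto)
    also have "... <= (\<Sum>m\<in>?S. ennreal (\<tau> powr s * r ^ k))"
    proof (intro sum_mono ennreal_leI)
     fix m assume m: "m \<in> ?S"
     then have "ennreal (2 ^ k * (2 ^ l k * cmod (c (l k) m) powr p)) <= ennreal \<tau>" using T(3)[of m k x] \<tau> by simp
     then have "2 ^ k * (2 ^ l k * cmod (c (l k) m) powr p) <= \<tau>" using \<tau>(2) by (simp add: ennreal_le_iff)
     then have "2 ^ l k * cmod (c (l k) m) powr p <= \<tau> * (1 / 2) ^ k" by (simp add: power_one_over field_simps)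
     then have "(2 ^ l k * cmod (c (l k) m) powr p) powr s <= (\<tau> * (1 / 2) ^ k) powr s" using s by (intro powr_mono2) auto
     also have "... = \<tau> powr s * r ^ k"
      using \<tau>(2) by (simp add: r_def powr_mult powr_realpow[symmetric] powr_powr mult.commute)
     finally show "(2 ^ l k * cmod (c (l k) m) powr p) powr s <= \<tau> powr s * r ^ k" .
    qed
    also have "... = ennreal (real (card ?S) * (\<tau> powr s * r ^ k))"
     using r by (simp add: ennreal_mult ennreal_of_nat_eq_real_of_nat)
    also have "... <= ennreal (3 ^ CARD('n) * (\<tau> powr s * r ^ k))"
    proof (intro ennreal_leI mult_right_mono)
     have "card ?S <= card {m. x \<in> cube (l k) m}" by (rule card_mono) (auto intro: card_cubes_at_point)
     then show "real (card ?S) <= 3 ^ CARD('n)" using card_cubes_at_point(2)[of 1 x "l k"] by simp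
    qed (use r in simp)
    finally show "?v (l k) <= ennreal (3 ^ CARD('n) * \<tau> powr s * r ^ k)" by (simp only: mult.assoc)
   qed auto
   also have "... = ennreal (3 ^ CARD('n) * \<tau> powr s / (1 - r))" by (rule geometric_suminf_finite) (use r in auto)
   finally have "lf p t c x epowr (1 / s) <= ennreal (3 ^ CARD('n) * \<tau> powr s / (1 - r)) epowr (1 / s)"
    using s by (intro epowr_mono) auto
   also have "... = ennreal ((E * \<tau> powr s) powr (1 / s))" using r by (subst epowr_ennreal) (auto simp: E_def)
   also have "(E * \<tau> powr s) powr (1 / s) = E powr (1 / s) * \<tau>" using E \<tau>(2) s by (simp add: powr_mult powr_powr)
   finally show ?thesis using \<tau> by (simp add: s_def ennreal_mult)
  qed
  then have "(\<integral>\<^sup>+x. lf p t c x epowr (p / t) \<partial>lborel) <= (\<integral>\<^sup>+x. ennreal (E powr (1 / s)) * T x \<partial>lborel)" by (intro nn_integral_mono)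
  also have "... = ennreal (E powr (1 / s)) * (\<integral>\<^sup>+x. T x \<partial>lborel)" by (rule nn_integral_cmult) (use T(2) in simp)
  also have "... < \<infinity>" using T(1) by (simp add: ennreal_mult_less_top)
  finally show ?thesis unfolding qt f_norm_eq[OF p t] epowr_less_top_iff .
 qed
qed

text \<open>Boundedness of the level sums already gives convergence in \<open>L\<^sub>p(\<Omega>)\<close>: the level \<open>j\<close> has a factor \<open>2 ^ (- j)\<close>.\<close>

lemma partial_sums_converge:
 assumes p: "0 < p" and d: "0 < d" and at: "atoms_at d K IO a" and B: "!!j. bsum p IO c j <= B"
 shows "\<exists>f\<in>Lp p LO. atomic_rep d K p \<Omega> f c a"
proof -
 let ?k = "CARD('n) - 1"
 have B0: "0 <= B" using B[of 0] bsum_nonneg order_trans by blast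
 let ?N = "((2 * d + 1) ^ CARD('n)) powr p * (2 * d) ^ CARD('n)"
 define A where "A = ?N * B"
 have A: "0 <= A" using B0 d by (simp add: A_def)
 have cont: "continuous_on UNIV (%x. \<Sum>j<J. level IO c a j x)" for J by (rule partial_sum_continuous[OF at])
 have lm: "level IO c a j \<in> borel_measurable LO" for j
  using at by (intro continuous_measurable_domain level_continuous[of _ _ d K]) (simp add: atoms_at_def)
 have lev: "pint p LO (level IO c a j) <= ennreal (A * (1 / 2) ^ j)" for j
 proof -
  have "pint p LO (%x. level IO c a j x * indicator UNIV x) <= ennreal (((2 * d + 1) ^ CARD('n)) powr p) *
    (\<Sum>m\<in>IO j. ennreal (cmod (c j m) powr p) * emeasure lborel (UNIV Int dcube d j m))"
   by (rule pint_level_le[OF _ finite_I p]) (use at d in "auto simp: atoms_at_def")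
  also have "(\<Sum>m\<in>IO j. ennreal (cmod (c j m) powr p) * emeasure lborel (UNIV Int dcube d j m)) =
    (\<Sum>m\<in>IO j. ennreal (cmod (c j m) powr p * (2 * d / 2 ^ j) ^ CARD('n)))"
   using d by (intro sum.cong refl) (simp add: emeasure_dcube ennreal_mult[symmetric])
  also have "... = ennreal ((\<Sum>m\<in>IO j. cmod (c j m) powr p) * (2 * d / 2 ^ j) ^ CARD('n))"
   using d by (subst sum_ennreal) (auto simp: sum_distrib_right)
  also have "(\<Sum>m\<in>IO j. cmod (c j m) powr p) * (2 * d / 2 ^ j) ^ CARD('n) = (2 * d) ^ CARD('n) * bsum p IO c j * (1 / 2) ^ j"
  proof -
   have "(2 ^ j) ^ CARD('n) = (2::real) ^ (j * ?k) * 2 ^ j"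
    using power_Suc[of "(2::real) ^ j" ?k] unfolding Suc_dimb[symmetric] power_mult by (simp only: mult.commute)
   then have "(2 * d / 2 ^ j) ^ CARD('n) = (2 * d) ^ CARD('n) / (2 ^ (j * ?k) * 2 ^ j)" by (simp only: power_divide)
   then show ?thesis by (simp only: bsum_def power_one_over) (simp add: field_simps)
  qed
  also have "ennreal (((2 * d + 1) ^ CARD('n)) powr p) * ennreal ((2 * d) ^ CARD('n) * bsum p IO c j * (1 / 2) ^ j) =
    ennreal (?N * bsum p IO c j * (1 / 2) ^ j)"
   using d bsum_nonneg by (subst ennreal_mult'[symmetric]) (auto simp: ac_simps)
  also have "... <= ennreal (A * (1 / 2) ^ j)"
   unfolding A_def using B d by (intro ennreal_leI mult_right_mono mult_left_mono) auto
  finally show ?thesis by simp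
 qed
 have "EX s. s ----> (0::real) & (ALL J J'. J <= J' --> pint p LO (%x. \<Sum>j\<in>{J..<J'}. level IO c a j x) <= ennreal (s J))"
 proof -
  have geo: "(\<Sum>j\<in>{J..<J'}. rho ^ j) <= rho ^ J / (1 - rho)" if "0 <= rho" "rho < 1" "J <= J'" for rho :: real and J J' :: nat
  proof -
   have "(\<Sum>j\<in>{J..<J'}. rho ^ j) = (\<Sum>i<J' - J. rho ^ (i + J))"
    using sum.shift_bounds_nat_ivl[of "%j. rho ^ j" 0 J "J' - J"] that by (simp add: atLeast0LessThan)
   also have "... = rho ^ J * (\<Sum>i<J' - J. rho ^ i)" by (simp add: power_add sum_distrib_left mult.commute)
   also have "... <= rho ^ J * (1 / (1 - rho))"
   proof (rule mult_left_mono)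
    have "(\<Sum>i<J' - J. rho ^ i) = (1 - rho ^ (J' - J)) / (1 - rho)" using that by (simp add: sum_gp_strict)
    also have "... <= 1 / (1 - rho)" using that by (intro divide_right_mono) auto
    finally show "(\<Sum>i<J' - J. rho ^ i) <= 1 / (1 - rho)" .
   qed (use that in simp)
   finally show ?thesis by simp
  qed
  show ?thesis
  proof (cases "p <= 1")
   case True
   have "pint p LO (%x. \<Sum>j\<in>{J..<J'}. level IO c a j x) <= ennreal (A * ((1 / 2) ^ J / (1 - 1 / 2)))" if J: "J <= J'" for J J'
   proof -
    have "pint p LO (%x. \<Sum>j\<in>{J..<J'}. level IO c a j x) <= (\<Sum>j\<in>{J..<J'}. pint p LO (level IO c a j))"
     by (rule pint_sum_le[OF p True]) (use lm in auto)
    also have "... <= (\<Sum>j\<in>{J..<J'}. ennreal (A * (1 / 2) ^ j))" by (intro sum_mono lev)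
    also have "... = ennreal (A * (\<Sum>j\<in>{J..<J'}. (1 / 2) ^ j))" using A by (subst sum_ennreal) (auto simp: sum_distrib_left)
    also have "... <= ennreal (A * ((1 / 2) ^ J / (1 - 1 / 2)))" using A J by (intro ennreal_leI mult_left_mono geo) auto
    finally show ?thesis .
   qed
   moreover have "(%J. A * ((1 / 2) ^ J / (1 - 1 / 2))) ----> A * (0 / (1 - 1 / 2))"
    by (intro tendsto_intros LIMSEQ_power_zero) auto
   ultimately show ?thesis by (intro exI[of _ "%J. A * ((1 / 2) ^ J / (1 - 1 / 2))"]) auto
  next
   case False
   define rho where "rho = (1 / 2) powr (1 / p)"
   define A' where "A' = A powr (1 / p)"
   have rho: "0 < rho" "rho < 1" using powr_less_mono2[of "1 / p" "1/2" 1] p by (auto simp: rho_def)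
   have "(A' * rho ^ j) powr p = A * (1 / 2) ^ j" for j
   proof -
    have "(rho ^ j) powr p = (rho powr p) ^ j" using rho(1) by (simp add: powr_realpow[symmetric] powr_powr mult.commute)
    moreover have "rho powr p = 1 / 2" "A' powr p = A" using p A by (auto simp: rho_def A'_def powr_powr)
    ultimately show ?thesis using rho by (simp add: powr_mult A'_def)
   qed
   then have lev': "pint p LO (level IO c a j) <= ennreal ((A' * rho ^ j) powr p)" for j using lev by simp
   have A': "0 <= A'" by (simp add: A'_def)
   have "pint p LO (%x. \<Sum>j\<in>{J..<J'}. level IO c a j x) <= ennreal ((A' * (rho ^ J / (1 - rho))) powr p)" if J: "J <= J'" for J J'
   proof -
    have "pint p LO (%x. \<Sum>j\<in>{J..<J'}. level IO c a j x) <= ennreal ((\<Sum>j\<in>{J..<J'}. A' * rho ^ j) powr p)"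
     by (rule pint_sum_Minkowski) (use False lm lev' A' rho in auto)
    also have "... <= ennreal ((A' * (rho ^ J / (1 - rho))) powr p)"
     unfolding sum_distrib_left[symmetric] using A' J p rho
     by (intro ennreal_leI powr_mono2 mult_left_mono geo mult_nonneg_nonneg sum_nonneg) auto
    finally show ?thesis .
   qed
   moreover have "(%J. (A' * (rho ^ J / (1 - rho))) powr p) ----> 0 powr p"
   proof (rule tendsto_powr')
    have "(%J. A' * (rho ^ J / (1 - rho))) ----> A' * (0 / (1 - rho))"
     using rho by (intro tendsto_intros LIMSEQ_power_zero) auto
    then show "(%J. A' * (rho ^ J / (1 - rho))) ----> 0" by simp
   qed (use p A' rho in auto)
   ultimately show ?thesis by (intro exI[of _ "%J. (A' * (rho ^ J / (1 - rho))) powr p"]) auto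
  qed
 qed
 then obtain s where s: "s ----> (0::real)" "!!J J'. J <= J' ==> pint p LO (%x. \<Sum>j\<in>{J..<J'}. level IO c a j x) <= ennreal (s J)" by blast
 have diff: "pint p LO (%x. psum c a J' x - psum c a J x) <= ennreal (s J)"
  "pint p LO (%x. psum c a J x - psum c a J' x) <= ennreal (s J)" if "J <= J'" for J J'
 proof -
  show "pint p LO (%x. psum c a J' x - psum c a J x) <= ennreal (s J)"
   unfolding partial_sum_diff[OF that] by (rule s(2)[OF that])
  then show "pint p LO (%x. psum c a J x - psum c a J' x) <= ennreal (s J)"
   by (simp only: pint_def norm_minus_commute)
 qed
 have "\<exists>f\<in>Lp p LO. (%J. pint p LO (%x. f x - psum c a J x)) ----> 0"
 proof (rule Lp_complete[OF p continuous_measurable_domain[OF cont]])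
  show "pint p LO (%x. \<Sum>j<J. level IO c a j x) < \<infinity>" for J
   using le_less_trans[OF diff(1)[of 0 J]] by simp
  fix e :: real assume "0 < e"
  then have "\<forall>\<^sub>F J in sequentially. s J < e" by (rule order_tendstoD(2)[OF s(1)])
  then obtain N where N: "!!J. N <= J ==> s J < e" unfolding eventually_sequentially by blast
  have le: "ennreal (s J) <= ennreal e" if "N <= J" for J using N[OF that] by (intro ennreal_leI) simp
  show "EX N. \<forall>k\<ge>N. \<forall>l\<ge>N. pint p LO (%x. (\<Sum>j<k. level IO c a j x) - (\<Sum>j<l. level IO c a j x)) <= ennreal e"
  proof (intro exI[of _ N] allI impI)
   fix k l assume kl: "N <= k" "N <= l"
   show "pint p LO (%x. (\<Sum>j<k. level IO c a j x) - (\<Sum>j<l. level IO c a j x)) <= ennreal e"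
   proof (cases "k <= l")
    case True
    show ?thesis by (rule order_trans[OF diff(2)[OF True] le[OF kl(1)]])
   next
    case False
    then have "l <= k" by simp
    then show ?thesis by (rule order_trans[OF diff(1) le[OF kl(2)]])
   qed
  qed
 qed
 then show ?thesis unfolding atomic_rep_iff[OF p] using at by blast
qed

end


section \<open>Extension of boundary functions\<close>

context lipschitz_domain
begin

text \<open>A continuous function lies between the given function and the level.\<close>

lemma one_level:
 assumes p: "0 < p"
 shows "\<exists>C>0. ALL g e L. g \<in> Lp p \<sigma> --> 0 < e --> (EX j c. L < j \<and>
   pint p \<sigma> (%x. g x - (\<Sum>m\<in>IO j. c m * theta j m x)) <= ennreal e \<and>
   ennreal ((\<Sum>m\<in>IO j. cmod (c m) powr p) / 2 ^ (j * (CARD('n) - 1))) <= ennreal C * (pint p \<sigma> g + ennreal e))"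
proof -
 from discretize[OF p] obtain C where C: "0 < C" and C': "\<forall>phi e. continuous_on UNIV phi --> 0 < e --> (\<forall>\<^sub>F j in sequentially. EX c.
   pint p \<sigma> (%x. phi x - (\<Sum>m\<in>IO j. c m * theta j m x)) <= ennreal e \<and>
   ennreal ((\<Sum>m\<in>IO j. cmod (c m) powr p) / 2 ^ (j * (CARD('n) - 1))) <= ennreal C * (pint p \<sigma> phi + ennreal e))"
  by (elim exE conjE)
 have "EX j c. L < j \<and>
   pint p \<sigma> (%x. g x - (\<Sum>m\<in>IO j. c m * theta j m x)) <= ennreal e \<and>
   ennreal ((\<Sum>m\<in>IO j. cmod (c m) powr p) / 2 ^ (j * (CARD('n) - 1))) <= ennreal (C * 2 powr p) * (pint p \<sigma> g + ennreal e)"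
  if g: "g \<in> Lp p \<sigma>" and e: "0 < e" for g e and L :: nat
 proof -
  define eta where "eta = e / (2 * 2 powr p)"
  have eta: "0 < eta" using e by (simp add: eta_def)
  have gm: "g \<in> borel_measurable \<sigma>" using g by (simp add: mem_Lp_iff)
  obtain phi where phi: "continuous_on UNIV phi" "pint p \<sigma> (%x. g x - phi x) <= ennreal eta"
   using approximable_Lp[OF p g] eta unfolding approximable_def by blast
  have phim: "phi \<in> borel_measurable \<sigma>" by (rule continuous_measurable_surface[OF phi(1)])
  from eventually_happens'[OF sequentially_bot eventually_conj[OF C'[rule_format, OF phi(1) eta] eventually_gt_at_top[of L]]]
  obtain j c where j: "L < j" and c: "pint p \<sigma> (%x. phi x - (\<Sum>m\<in>IO j. c m * theta j m x)) <= ennreal eta"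
   "ennreal ((\<Sum>m\<in>IO j. cmod (c m) powr p) / 2 ^ (j * (CARD('n) - 1))) <= ennreal C * (pint p \<sigma> phi + ennreal eta)" by blast
  have "continuous_on UNIV (theta j m :: (real, 'n) vec => complex)" for m by (rule Ck_continuous[OF Ck_theta])
  then have hm: "(%x. \<Sum>m\<in>IO j. c m * theta j m x) \<in> borel_measurable \<sigma>"
   by (intro continuous_measurable_surface continuous_on_sum continuous_on_mult continuous_on_const)
  have one: "pint p \<sigma> (%x. g x - (\<Sum>m\<in>IO j. c m * theta j m x)) <= ennreal e"
   by (rule pint_diff_le[OF p gm phim hm less_imp_le[OF e] phi(2)[unfolded eta_def] c(1)[unfolded eta_def]])
  have "pint p \<sigma> phi <= ennreal (2 powr p) * (pint p \<sigma> g + pint p \<sigma> (%x. g x - phi x))"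
  proof (rule pint_triangle[OF p gm])
   show "cmod (phi x) <= cmod (g x) + cmod (g x - phi x)" for x
    using norm_triangle_ineq4[of "g x" "g x - phi x"] by simp
  qed (intro borel_measurable_diff gm phim)
  also have "ennreal (2 powr p) * (pint p \<sigma> g + pint p \<sigma> (%x. g x - phi x)) <= ennreal (2 powr p) * (pint p \<sigma> g + ennreal eta)"
   by (intro mult_left_mono add_left_mono phi(2)) simp
  finally have phile: "pint p \<sigma> phi <= ennreal (2 powr p) * (pint p \<sigma> g + ennreal eta)" .
  have "1 <= 2 powr p" using p by (simp add: ge_one_powr_ge_zero)
  then have "ennreal eta <= ennreal (2 powr p) * ennreal eta" using eta by (simp add: ennreal_mult[symmetric] ennreal_leI)
  then have "pint p \<sigma> phi + ennreal eta <= ennreal (2 powr p) * (pint p \<sigma> g + ennreal eta) + ennreal (2 powr p) * ennreal eta"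
   by (rule add_mono[OF phile])
  also have "... = ennreal (2 powr p) * (pint p \<sigma> g + ennreal (eta + eta))" using eta by (simp only: distrib_left add.assoc ennreal_plus less_imp_le)
  also have "... <= ennreal (2 powr p) * (pint p \<sigma> g + ennreal e)"
  proof (intro mult_left_mono add_left_mono ennreal_leI)
   have "eta + eta = e / 2 powr p" by (simp add: eta_def)
   also have "... <= e / 1" using \<open>1 <= 2 powr p\<close> e by (intro divide_left_mono) auto
   finally show "eta + eta <= e" by simp
  qed simp
  finally have "ennreal C * (pint p \<sigma> phi + ennreal eta) <= ennreal C * (ennreal (2 powr p) * (pint p \<sigma> g + ennreal e))"
   by (rule mult_left_mono) simp
  then have "ennreal C * (pint p \<sigma> phi + ennreal eta) <= ennreal (C * 2 powr p) * (pint p \<sigma> g + ennreal e)"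
   using C by (simp add: ennreal_mult mult.assoc)
  with c(2) have "ennreal ((\<Sum>m\<in>IO j. cmod (c m) powr p) / 2 ^ (j * (CARD('n) - 1))) <= ennreal (C * 2 powr p) * (pint p \<sigma> g + ennreal e)"
   by (rule order_trans)
  with j one show ?thesis by blast
 qed
 then show ?thesis using C by (intro exI[of _ "C * 2 powr p"] conjI allI impI) auto
qed

text \<open>
  A level of size comparable to the residual reduces the residual by a factor of 4. Level 0 with no
  coefficients starts the recursion.
\<close>

lemma geometric_levels:
 assumes p: "0 < p" and g: "g \<in> Lp p \<sigma>"
 shows "EX l c r D E. strict_mono l & c 0 = (%_. 0) & r 0 = g \<and>
   (ALL k. r (Suc k) = (%x. r k x - (\<Sum>m\<in>IO (l (Suc k)). c (Suc k) m * theta (l (Suc k)) m x))) \<and>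
   (ALL k. pint p \<sigma> (r k) <= ennreal (E * (1 / 4) ^ k)) & 0 <= D \<and>
   (ALL k. (\<Sum>m\<in>IO (l k). cmod (c k m) powr p) / 2 ^ (l k * (CARD('n) - 1)) <= D * (1 / 4) ^ k)"
proof -
 let ?bs = "%j c. (\<Sum>m\<in>IO j. cmod (c m) powr p) / 2 ^ (j * (CARD('n) - 1))"
 from one_level[OF p] obtain C where C: "0 < C" and C': "ALL g e L. g \<in> Lp p \<sigma> --> 0 < e --> (EX j c. L < j \<and>
   pint p \<sigma> (%x. g x - (\<Sum>m\<in>IO j. c m * theta j m x)) <= ennreal e & ennreal (?bs j c) <= ennreal C * (pint p \<sigma> g + ennreal e))"
  by (elim exE conjE)
 define E where "E = enn2real (pint p \<sigma> g) + 1"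
 have E: "0 < E" "pint p \<sigma> g <= ennreal E"
  using g by (cases "pint p \<sigma> g"; simp add: E_def mem_Lp_iff add_nonneg_pos ennreal_leI)+
 \<comment> \<open>The next level is bounded by \<open>C\<close> times two consecutive bounds of residuals, together at most \<open>2 E / 4 ^ k\<close>.\<close>
 define D where "D = 8 * C * E"
 have D: "0 <= D" using C E by (simp add: D_def)
 define P where "P k s \<longleftrightarrow> snd (snd s) \<in> Lp p \<sigma> & pint p \<sigma> (snd (snd s)) <= ennreal (E * (1 / 4) ^ k) \<and>
   ?bs (fst s) (fst (snd s)) <= D * (1 / 4) ^ k & (k = 0 --> s = (0, (%_. 0), g))" for k s
 define Q where "Q s s' \<longleftrightarrow> fst s < fst s' \<and>
   snd (snd s') = (%x. snd (snd s) x - (\<Sum>m\<in>IO (fst s'). fst (snd s') m * theta (fst s') m x))"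
  for s s' :: "nat \<times> ((int, 'n) vec => complex) \<times> ((real, 'n) vec => complex)"
 have "EX s. ALL k. P k (s k) & Q (s k) (s (Suc k))"
 proof (rule dependent_nat_choice)
  show "EX s. P 0 s"
   unfolding P_def by (intro exI[of _ "(0, (%_. 0), g)"]) (use p g E D in "simp add: sum_nonneg")
 next
  fix s k assume s: "P k s"
  then have r: "snd (snd s) \<in> Lp p \<sigma>" "pint p \<sigma> (snd (snd s)) <= ennreal (E * (1 / 4) ^ k)" by (auto simp: P_def)
  have e: "0 < E * (1 / 4) ^ Suc k" using E by simp
  from C'[rule_format, OF r(1) e, of "fst s"] obtain j c where jc: "fst s < j"
   "pint p \<sigma> (%x. snd (snd s) x - (\<Sum>m\<in>IO j. c m * theta j m x)) <= ennreal (E * (1 / 4) ^ Suc k)"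
   "ennreal (?bs j c) <= ennreal C * (pint p \<sigma> (snd (snd s)) + ennreal (E * (1 / 4) ^ Suc k))" by blast
  let ?r = "%x. snd (snd s) x - (\<Sum>m\<in>IO j. c m * theta j m x)"
  have "continuous_on UNIV (theta j m :: (real, 'n) vec => complex)" for m by (rule Ck_continuous[OF Ck_theta])
  then have "(%x. \<Sum>m\<in>IO j. c m * theta j m x) \<in> borel_measurable \<sigma>"
   by (intro continuous_measurable_surface continuous_on_sum continuous_on_mult continuous_on_const)
  then have "?r \<in> borel_measurable \<sigma>" using r(1) by (intro borel_measurable_diff) (simp_all add: mem_Lp_iff)
  then have rL: "?r \<in> Lp p \<sigma>" using le_less_trans[OF jc(2)] by (simp add: mem_Lp_iff)
  note jc(3)
  also have "ennreal C * (pint p \<sigma> (snd (snd s)) + ennreal (E * (1 / 4) ^ Suc k)) <= ennreal C * (ennreal (E * (1 / 4) ^ k) + ennreal (E * (1 / 4) ^ Suc k))"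
   by (intro mult_left_mono add_right_mono r(2)) simp
  also have "... = ennreal (C * (E * (1 / 4) ^ k + E * (1 / 4) ^ Suc k))"
   using C E by (simp add: ennreal_mult[symmetric] ennreal_plus[symmetric] del: ennreal_plus)
  finally have "?bs j c <= C * (E * (1 / 4) ^ k + E * (1 / 4) ^ Suc k)" using C E by (subst (asm) ennreal_le_iff) auto
  also have "... <= D * (1 / 4) ^ Suc k" using C E by (simp add: D_def field_simps)
  finally have "?bs j c <= D * (1 / 4) ^ Suc k" .
  then show "EX s'. P (Suc k) s' & Q s s'"
   unfolding P_def Q_def by (intro exI[of _ "(j, c, ?r)"]) (use jc rL in simp)
 qed
 then obtain s where s: "!!k. P k (s k)" "!!k. Q (s k) (s (Suc k))" by blast
 show ?thesis
 proof (rule exI[of _ "%k. fst (s k)"], rule exI[of _ "%k. fst (snd (s k))"], rule exI[of _ "%k. snd (snd (s k))"],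
   rule exI[of _ D], rule exI[of _ E], intro conjI allI)
  show "strict_mono (%k. fst (s k))" using s(2) by (intro strict_monoI_Suc) (simp add: Q_def)
  show "fst (snd (s 0)) = (%_. 0)" "snd (snd (s 0)) = g" using s(1)[of 0] by (auto simp: P_def)
 qed (use s D in "simp_all add: P_def Q_def")
qed

text \<open>
  Every boundary function is the sum of a series of levels that are sparse and decay geometrically;
  the residuals are the boundary function minus the partial sums.
\<close>

lemma sparse_extension:
 assumes p: "0 < p" and d: "1 < d" and g: "g \<in> Lp p \<sigma>"
 shows "EX f c a l D. sparse p c l D & (\<forall>\<nu>. \<nu> c < \<infinity> --> extension p d K \<nu> g f c a)"
proof -
 obtain l u r D E where l: "strict_mono l" and u0: "u 0 = (%_. 0)" and r0: "r 0 = g"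
  and rS: "!!k. r (Suc k) = (%x. r k x - (\<Sum>m\<in>IO (l (Suc k)). u (Suc k) m * theta (l (Suc k)) m x))"
  and rE: "!!k. pint p \<sigma> (r k) <= ennreal (E * (1 / 4) ^ k)" and D: "0 <= D"
  and uD: "!!k. (\<Sum>m\<in>IO (l k). cmod (u k m) powr p) / 2 ^ (l k * (CARD('n) - 1)) <= D * (1 / 4) ^ k"
  using geometric_levels[OF p g] by (elim exE conjE) blast
 obtain M where M: "0 < M" "!!j m. Ck_bounded K (2 ^ j) M (theta j m :: (real, 'n) vec => complex)" by (rule theta_Ck_bounded[where K = K]) (rule that)
 \<comment> \<open>Division by \<open>M\<close> turns the members of the partition of unity into atoms.\<close>
 define c where "c j m = (if j \<in> range l then of_real M * u (inv l j) m else 0)" for j and m :: "(int, 'n) vec"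
 define a where "a j m = (%x. of_real (1 / M) * theta j m x :: complex)" for j and m :: "(int, 'n) vec"
 have inj: "inj l" using l by (rule strict_mono_imp_inj_on)
 have cl: "c (l k) m = of_real M * u k m" for k m using inj by (simp add: c_def)
 have cz: "c j m = 0" if "j ~: range l" for j m using that by (simp add: c_def)
 have sub: "dcube (3 / 4) j m \<subseteq> dcube d j m" for j m using d by (intro dcube_mono) simp
 have az: "a j m x = 0" if "x ~: dcube d j m" for j m x
  using that sub theta_outside_cube[of x j m] unfolding a_def by auto
 have at: "atoms_at d K IO a"
  unfolding atoms_at_def is_atom_iff support_subset_dcube_iff
 proof (intro allI ballI conjI impI az)
  fix j m
  have "Ck_bounded K (2 ^ j) (cmod (of_real (1 / M)) * M) (a j m)" unfolding a_def by (rule Ck_bounded_cmult[OF M(2)])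
  moreover have "cmod (of_real (1 / M)) * M = 1" using M(1) by (simp add: norm_divide)
  ultimately show "Ck_bounded K (2 ^ j) 1 (a j m)" by (simp only:)
 qed
 have lev: "level IO c a (l k) x = (\<Sum>m\<in>IO (l k). u k m * theta (l k) m x)" for k x
  unfolding level_def cl a_def using M(1) by simp
 have levz: "level IO c a j x = 0" if "j ~: range l" for j x unfolding level_def cz[OF that] by simp
 have bl: "bsum p IO c (l k) <= M powr p * D * (1 / 4) ^ k" for k
 proof -
  have "bsum p IO c (l k) = M powr p * ((\<Sum>m\<in>IO (l k). cmod (u k m) powr p) / 2 ^ (l k * (CARD('n) - 1)))"
   unfolding bsum_def cl using M(1) by (simp add: norm_mult powr_mult sum_distrib_left)
  also have "... <= M powr p * (D * (1 / 4) ^ k)" by (intro mult_left_mono uD) simp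
  finally show ?thesis by (simp only: mult.assoc)
 qed
 have sp: "sparse p c l (M powr p * D)"
  unfolding sparse_def using l D cz bl by auto
 have "bsum p IO c j <= M powr p * D" for j
 proof (cases "j \<in> range l")
  case True
  then obtain k where "j = l k" by blast
  moreover have "M powr p * D * (1 / 4) ^ k <= M powr p * D * 1" for k using D by (intro mult_left_mono power_le_one) auto
  ultimately show ?thesis using bl[of k] by (metis mult.right_neutral order_trans)
 next
  case False
  then show ?thesis using D p cz[OF False] by (simp add: bsum_def)
 qed
 from partial_sums_converge[OF p _ at this] d obtain f where f: "f \<in> Lp p LO" "atomic_rep d K p \<Omega> f c a" by auto
 have sm: "schwartz (%x. \<Sum>j<J. level IO c a j x)" for J
 proof (rule schwartz_compact_support)
  show "Ck k (%x. \<Sum>j<J. level IO c a j x)" for k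
   unfolding level_def a_def by (intro Ck_sum Ck_cmult Ck_theta)
  show "compact (\<Union>j\<in>{..<J}. \<Union>m\<in>IO j. dcube d j m)"
   by (intro compact_UN finite_I compact_dcube) auto
  show "psum c a J x = 0" if x: "x ~: (\<Union>j\<in>{..<J}. \<Union>m\<in>IO j. dcube d j m)" for x
   unfolding level_def using x az by (intro sum.neutral ballI) auto
 qed
 have res: "EX k. (ALL i. i <= k \<longleftrightarrow> l i < J \<or> i = 0) & (ALL x. g x - psum c a J x = r k x)" for J
 proof (induction J)
  case 0
  show ?case using r0 by (intro exI[of _ 0]) auto
 next
  case (Suc J)
  then obtain k where k: "!!i. i <= k \<longleftrightarrow> l i < J \<or> i = 0" "!!x. g x - psum c a J x = r k x" by blast
  show ?case
  proof (cases "J \<in> range l")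
   case False
   have "i <= k \<longleftrightarrow> l i < Suc J \<or> i = 0" for i using k(1)[of i] False by (auto simp: less_Suc_eq)
   then show ?thesis using k(2) levz[OF False] by (intro exI[of _ k]) auto
  next
   case True
   then obtain i where i: "J = l i" by blast
   have lt: "l i' < l i \<longleftrightarrow> i' < i" for i' using strict_mono_less[OF l] .
   show ?thesis
   proof (cases i)
    case 0
    have k0: "k = 0" using k(1)[of k] lt[of k] i 0 by auto
    have "i' <= k \<longleftrightarrow> l i' < Suc J \<or> i' = 0" for i' using k0 lt[of i'] i 0 inj by (auto simp: less_Suc_eq inj_eq)
    moreover have "level IO c a J x = 0" for x unfolding i lev 0 u0 by simp
    ultimately show ?thesis using k(2) by (intro exI[of _ k]) auto
   next
    case (Suc i0)
    have ki: "k = i0" using k(1)[of i0] k(1)[of i] lt[of i0] i Suc by auto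
    have "i' <= i \<longleftrightarrow> l i' < Suc J \<or> i' = 0" for i' using lt[of i'] i Suc inj by (auto simp: less_Suc_eq inj_eq)
    moreover have "g x - (\<Sum>j<Suc J. level IO c a j x) = r i x" for x
     using k(2)[of x] unfolding i lev Suc ki rS by (simp add: lev[of "Suc i0", symmetric] algebra_simps)
    ultimately show ?thesis by blast
   qed
  qed
 qed
 have lim: "(%J. pint p \<sigma> (%x. g x - psum c a J x)) ----> 0"
  unfolding tendsto_0_ennreal_iff
 proof (intro allI impI)
  fix e :: real assume e: "0 < e"
  have E: "E * (1 / 4) ^ k <= \<bar>E\<bar> * (1 / 4) ^ k" for k by (intro mult_right_mono) auto
  have "(%k. \<bar>E\<bar> * (1 / 4) ^ k) ----> \<bar>E\<bar> * 0" by (intro tendsto_intros LIMSEQ_power_zero) simp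
  then have "\<forall>\<^sub>F k in sequentially. \<bar>E\<bar> * (1 / 4) ^ k < e" by (rule order_tendstoD) (use e in simp)
  then obtain N where N: "!!k. N <= k ==> \<bar>E\<bar> * (1 / 4) ^ k < e" unfolding eventually_sequentially by blast
  show "\<forall>\<^sub>F J in sequentially. pint p \<sigma> (%x. g x - psum c a J x) < ennreal e"
   using eventually_gt_at_top[of "l N"]
  proof eventually_elim
   case (elim J)
   obtain k where k: "!!i. i <= k \<longleftrightarrow> l i < J \<or> i = 0" "!!x. g x - psum c a J x = r k x" using res[of J] by blast
   have "N <= k" using k(1)[of N] elim by simp
   then have "E * (1 / 4) ^ k < e" using N[of k] E[of k] by linarith
   then have "ennreal (E * (1 / 4) ^ k) < ennreal e" using e by (rule ennreal_lessI[rotated])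
   then show ?case unfolding k(2) using rE[of k] by (rule le_less_trans[rotated])
  qed
 qed
 have van: "a j m x = 0" if "m \<in> IO j - cubes_meeting \<Gamma> j" "x \<in> \<Gamma>" for j m x
 proof -
  have "x ~: cube j m" using that by (auto simp: cubes_meeting_def)
  then have "x ~: dcube (3 / 4) j m" using dcube_mono[of "3/4" 1 j m] by auto
  then show ?thesis by (simp add: a_def theta_outside_cube)
 qed
 have "extension p d K \<nu> g f c a" if "\<nu> c < \<infinity>" for \<nu>
  unfolding extension_def using f that sm lim van by blast
 with sp show ?thesis by blast
qed

end


section \<open>Moving atoms away from the boundary\<close>

context lipschitz_domain
begin

text \<open>
  The cubes that miss the boundary but whose dilations meet it, and whose atoms can be nonzero on the cube
  \<open>l\<close>.
\<close>

definition touching :: "real => nat => (int, 'n) vec => (int, 'n) vec set" where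
 "touching d j l = {m \<in> near d j. cube j m Int \<Gamma> = {} & dcube d j m Int cube j l ~= {}}"

lemma finite_touching: "finite (touching d j l)" and touching_near: "touching d j l \<subseteq> near d j"
 using finite_near[of d j] finite_subset by (auto simp: touching_def)

lemma card_touching:
 assumes d: "0 <= d"
 shows "real (card {l \<in> IO j. m \<in> touching d j l}) <= (2 * (d + 1) + 1) ^ CARD('n)"
proof -
 let ?V = "{v :: (int, 'n) vec. ALL k. \<bar>of_int (v $ k) - real_of_int (m $ k)\<bar> <= d + 1}"
 have "{l \<in> IO j. m \<in> touching d j l} \<subseteq> ?V"
 proof (intro subsetI CollectI allI)
  fix l k assume "l \<in> {l \<in> IO j. m \<in> touching d j l}"
  then obtain x where x: "x \<in> dcube d j m" "x \<in> cube j l" by (auto simp: touching_def)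
  then have "\<bar>2 ^ j * x $ k - of_int (m $ k)\<bar> <= d" "\<bar>2 ^ j * x $ k - of_int (l $ k)\<bar> <= 1" unfolding mem_dcube_iff by blast+
  then show "\<bar>of_int (l $ k) - real_of_int (m $ k)\<bar> <= d + 1" by linarith
 qed
 moreover have V: "finite ?V" "real (card ?V) <= (\<Prod>k\<in>(UNIV :: 'n set). 2 * (d + 1) + 1)"
  using card_int_vectors_le[of "%k. d + 1" "%k. real_of_int (m $ k)"] d by auto
 ultimately have "card {l \<in> IO j. m \<in> touching d j l} <= card ?V" by (intro card_mono)
 then show ?thesis using V(2) by simp
qed

text \<open>
  Only cubes near the boundary contribute to the added coefficients, and for these the sum over all levels
  is finite, not merely the supremum.
\<close>

lemma relocated_gmax_finite:
 assumes p: "0 < p" "p <= 1" and d: "0 < d" and C: "0 <= C" and fin: "(\<integral>\<^sup>+x. gmax p c x \<partial>lborel) < \<infinity>"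
 shows "(\<integral>\<^sup>+x. gmax p (%j l. of_real (cmod (c j l) + C * (\<Sum>m\<in>touching d j l. cmod (c j m)))) x \<partial>lborel) < \<infinity>"
proof -
 let ?s = "%j l. \<Sum>m\<in>touching d j l. cmod (c j m) powr p"
 let ?\<mu> = "%j l. complex_of_real (cmod (c j l) + C * (\<Sum>m\<in>touching d j l. cmod (c j m)))"
 let ?t = "%j l x. ennreal (2 ^ j * ?s j l) * indicator (cube j l) x"
 let ?Z = "%x. \<Sum>j. \<Sum>l\<in>IO j. ?t j l x"
 let ?N = "(2 * (d + 1) + 1) ^ CARD('n)"
 have tm: "(%x. ?t j l x) \<in> borel_measurable borel" for j l
  by (intro borel_measurable_times_ennreal borel_measurable_const borel_measurable_indicator) simp
 have sm: "(%x. \<Sum>l\<in>IO j. ?t j l x) \<in> borel_measurable borel" for j by (intro borel_measurable_sum tm)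
 have Zm: "?Z \<in> borel_measurable borel" by (intro borel_measurable_suminf_order sm)
 have s0: "0 <= ?s j l" for j l by (intro sum_nonneg) simp
 have one: "(\<integral>\<^sup>+x. ?t j l x \<partial>lborel) = ennreal (2 ^ CARD('n) * (?s j l / 2 ^ (j * (CARD('n) - 1))))" for j l
 proof -
  have "(\<integral>\<^sup>+x. ?t j l x \<partial>lborel) = ennreal (2 ^ j * ?s j l) * ennreal ((2 * 1 / 2 ^ j) ^ CARD('n))"
   by (subst nn_integral_cmult_indicator) (simp_all add: emeasure_dcube)
  also have "... = ennreal (2 ^ j * ?s j l * (2 * 1 / 2 ^ j) ^ CARD('n))" using s0 by (simp add: ennreal_mult)
  also have "(2 * 1 / 2 ^ j) ^ CARD('n) = (2::real) ^ CARD('n) / (2 ^ j * 2 ^ (j * (CARD('n) - 1)))"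
  proof -
   have "(2 ^ j) ^ CARD('n) = (2::real) ^ j * (2 ^ j) ^ (CARD('n) - 1)"
    using power_Suc[of "(2::real) ^ j" "CARD('n) - 1"] unfolding Suc_dimb[symmetric] .
   then show ?thesis by (simp only: power_divide mult_1_right power_mult)
  qed
  also have "2 ^ j * ?s j l * ((2::real) ^ CARD('n) / (2 ^ j * 2 ^ (j * (CARD('n) - 1)))) = 2 ^ CARD('n) * (?s j l / 2 ^ (j * (CARD('n) - 1)))"
   by (simp add: field_simps)
  finally show ?thesis .
 qed
 have "(\<integral>\<^sup>+x. ?Z x \<partial>lborel) = (\<Sum>j. \<integral>\<^sup>+x. (\<Sum>l\<in>IO j. ?t j l x) \<partial>lborel)"
  by (rule nn_integral_suminf) (use sm in simp)
 also have "... <= (\<Sum>j. ennreal (2 ^ CARD('n) * ?N) * ennreal (bsum p (near d) c j))"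
 proof (intro suminf_le)
  fix j
  have "(\<integral>\<^sup>+x. (\<Sum>l\<in>IO j. ?t j l x) \<partial>lborel) = (\<Sum>l\<in>IO j. \<integral>\<^sup>+x. ?t j l x \<partial>lborel)"
   by (rule nn_integral_sum) (use tm in simp)
  also have "... = ennreal (\<Sum>l\<in>IO j. 2 ^ CARD('n) * (?s j l / 2 ^ (j * (CARD('n) - 1))))"
   unfolding one by (rule sum_ennreal) (use s0 in simp)
  also have "(\<Sum>l\<in>IO j. 2 ^ CARD('n) * (?s j l / 2 ^ (j * (CARD('n) - 1)))) = 2 ^ CARD('n) * ((\<Sum>l\<in>IO j. ?s j l) / 2 ^ (j * (CARD('n) - 1)))"
   by (simp only: sum_distrib_left[symmetric] sum_divide_distrib[symmetric])
  also have "(\<Sum>l\<in>IO j. ?s j l) = (\<Sum>l\<in>IO j. \<Sum>m\<in>near d j. if m \<in> touching d j l then cmod (c j m) powr p else 0)"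
  proof (rule sum.cong[OF refl])
   fix l
   have "?s j l = (\<Sum>m\<in>{m \<in> near d j. m \<in> touching d j l}. cmod (c j m) powr p)" using touching_near by (intro sum.cong) auto
   also have "... = (\<Sum>m\<in>near d j. if m \<in> touching d j l then cmod (c j m) powr p else 0)" by (rule sum.inter_filter[OF finite_near])
   finally show "?s j l = (\<Sum>m\<in>near d j. if m \<in> touching d j l then cmod (c j m) powr p else 0)" .
  qed
  also have "... = (\<Sum>m\<in>near d j. \<Sum>l\<in>IO j. if m \<in> touching d j l then cmod (c j m) powr p else 0)" by (rule sum.swap)
  also have "... = (\<Sum>m\<in>near d j. real (card {l \<in> IO j. m \<in> touching d j l}) * cmod (c j m) powr p)"
   by (simp add: sum.inter_filter[OF finite_I, symmetric])
  also have "2 ^ CARD('n) * ((\<Sum>m\<in>near d j. real (card {l \<in> IO j. m \<in> touching d j l}) * cmod (c j m) powr p) / 2 ^ (j * (CARD('n) - 1)))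
    <= 2 ^ CARD('n) * ((\<Sum>m\<in>near d j. ?N * cmod (c j m) powr p) / 2 ^ (j * (CARD('n) - 1)))"
   using d by (intro mult_left_mono divide_right_mono sum_mono mult_right_mono card_touching) auto
  also have "... = 2 ^ CARD('n) * ?N * bsum p (near d) c j" by (simp add: bsum_def sum_distrib_left[symmetric])
  finally have "(\<integral>\<^sup>+x. (\<Sum>l\<in>IO j. ?t j l x) \<partial>lborel) <= ennreal (2 ^ CARD('n) * ?N * bsum p (near d) c j)"
   by (simp add: ennreal_leI)
  then show "(\<integral>\<^sup>+x. (\<Sum>l\<in>IO j. ?t j l x) \<partial>lborel) <= ennreal (2 ^ CARD('n) * ?N) * ennreal (bsum p (near d) c j)"
   using d bsum_nonneg by (simp add: ennreal_mult)
 qed auto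
 also have "... = ennreal (2 ^ CARD('n) * ?N) * (\<Sum>j. ennreal (bsum p (near d) c j))" by (rule ennreal_suminf_cmult)
 also have "... < \<infinity>"
 proof -
  from sum_near_le_gmax[OF p(1) d] obtain A where "ALL c. (\<Sum>j. ennreal (bsum p (near d) c j)) <= ennreal A * (\<integral>\<^sup>+x. gmax p c x \<partial>lborel)"
   by (elim exE conjE)
  then have "(\<Sum>j. ennreal (bsum p (near d) c j)) <= ennreal A * (\<integral>\<^sup>+x. gmax p c x \<partial>lborel)" by blast
  also have "... < \<infinity>" using fin by (simp add: ennreal_mult_less_top)
  finally show ?thesis by (simp add: ennreal_mult_less_top)
 qed
 finally have Zf: "(\<integral>\<^sup>+x. ?Z x \<partial>lborel) < \<infinity>" .
 have "gmax p ?\<mu> x <= ennreal (2 powr p) * (gmax p c x + ennreal (C powr p) * ?Z x)" for x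
  unfolding gmax_def[of p ?\<mu>]
 proof (rule SUP_least)
  fix i :: "nat \<times> (int, 'n) vec" assume "i \<in> (SIGMA j:UNIV. IO j)"
  then obtain j l where jl: "i = (j, l)" "l \<in> IO j" by auto
  have "(\<Sum>m\<in>touching d j l. cmod (c j m)) powr p <= ?s j l"
   by (rule powr_sum_le[OF finite_touching _ p]) simp
  then have S: "(C * (\<Sum>m\<in>touching d j l. cmod (c j m))) powr p <= C powr p * ?s j l"
   using C by (simp add: powr_mult sum_nonneg mult_left_mono)
  have "cmod (?\<mu> j l) = cmod (c j l) + C * (\<Sum>m\<in>touching d j l. cmod (c j m))"
   unfolding norm_of_real using C by (intro abs_of_nonneg add_nonneg_nonneg mult_nonneg_nonneg sum_nonneg) auto
  then have "cmod (?\<mu> j l) powr p <= 2 powr p * (cmod (c j l) powr p + (C * (\<Sum>m\<in>touching d j l. cmod (c j m))) powr p)"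
   using powr_add_le[of "cmod (c j l)" "C * (\<Sum>m\<in>touching d j l. cmod (c j m))" p] C p by (simp add: sum_nonneg)
  also have "... <= 2 powr p * (cmod (c j l) powr p + C powr p * ?s j l)" using S by (intro mult_left_mono add_left_mono) auto
  finally have "2 ^ j * cmod (?\<mu> j l) powr p <= 2 ^ j * (2 powr p * (cmod (c j l) powr p + C powr p * ?s j l))" by (rule mult_left_mono) simp
  also have "... = 2 powr p * (2 ^ j * cmod (c j l) powr p + C powr p * (2 ^ j * ?s j l))" by (simp add: distrib_left ac_simps)
  finally have "ennreal (2 ^ j * cmod (?\<mu> j l) powr p) <= ennreal (2 powr p * (2 ^ j * cmod (c j l) powr p + C powr p * (2 ^ j * ?s j l)))" by (rule ennreal_leI)
  also have "... = ennreal (2 powr p) * (ennreal (2 ^ j * cmod (c j l) powr p) + ennreal (C powr p) * ennreal (2 ^ j * ?s j l))"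
   using s0[of j l] by (simp add: ennreal_mult[symmetric] ennreal_plus[symmetric] del: ennreal_plus)
  finally have "ennreal (2 ^ j * cmod (?\<mu> j l) powr p) * indicator (cube j l) x \<le>
    ennreal (2 powr p) * (ennreal (2 ^ j * cmod (c j l) powr p) + ennreal (C powr p) * ennreal (2 ^ j * ?s j l)) * indicator (cube j l) x"
   by (rule mult_right_mono) simp
  also have "... = ennreal (2 powr p) * (ennreal (2 ^ j * cmod (c j l) powr p) * indicator (cube j l) x + ennreal (C powr p) * ?t j l x)"
   by (auto simp: indicator_def)
  also have "... <= ennreal (2 powr p) * (gmax p c x + ennreal (C powr p) * ?Z x)"
  proof (intro mult_left_mono add_mono gmax_ge[OF jl(2)])
   have "?t j l x <= (\<Sum>l\<in>IO j. ?t j l x)" by (rule member_le_sum[OF jl(2) _ finite_I]) simp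
   also have "... <= ?Z x" using sum_le_suminf[of "%j. \<Sum>l\<in>IO j. ?t j l x" "{j}"] by (simp add: summableI)
   finally show "?t j l x <= ?Z x" .
  qed auto
  finally show "(case i of (j, m) => ennreal (2 ^ j * cmod (?\<mu> j m) powr p) * indicator (cube j m) x) <= ennreal (2 powr p) * (gmax p c x + ennreal (C powr p) * ?Z x)"
   unfolding jl by (simp only: prod.case)
 qed
 then have "(\<integral>\<^sup>+x. gmax p ?\<mu> x \<partial>lborel) <= (\<integral>\<^sup>+x. ennreal (2 powr p) * (gmax p c x + ennreal (C powr p) * ?Z x) \<partial>lborel)"
  by (intro nn_integral_mono)
 also have "... = ennreal (2 powr p) * ((\<integral>\<^sup>+x. gmax p c x \<partial>lborel) + ennreal (C powr p) * (\<integral>\<^sup>+x. ?Z x \<partial>lborel))"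
 proof -
  have Zm': "?Z \<in> borel_measurable lborel" using Zm by simp
  have G: "gmax p c \<in> borel_measurable lborel" using gmax_measurable by simp
  have CZ: "(%x. ennreal (C powr p) * ?Z x) \<in> borel_measurable lborel" by (intro borel_measurable_times_ennreal borel_measurable_const Zm')
  have s: "(%x. gmax p c x + ennreal (C powr p) * ?Z x) \<in> borel_measurable lborel" by (intro borel_measurable_add G CZ)
  show ?thesis unfolding nn_integral_cmult[OF s] nn_integral_add[OF G CZ] nn_integral_cmult[OF Zm'] ..
 qed
 also have "... < \<infinity>" using fin Zf by (simp add: ennreal_mult_less_top)
 finally show ?thesis .
qed

text \<open>
  An atom of a cube that misses the boundary, though its dilation does not, is distributed by the
  partition of unity over the cubes that its support meets. The pieces are supported in their cubes,
  so that those located at cubes that miss the boundary vanish on the boundary.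
\<close>

lemma relocation:
 assumes p: "0 < p" "p <= 1" and d: "1 < d" and rep: "atomic_rep d K p \<Omega> f c a" and fin: "f_norm (1 / p) p \<infinity> \<Omega> c < \<infinity>"
 shows "EX c' a'. atomic_rep d K p \<Omega> f c' a' & f_norm (1 / p) p \<infinity> \<Omega> c' < \<infinity> \<and>
   (ALL j. \<forall>m\<in>IO j - cubes_meeting \<Gamma> j. \<forall>x\<in>\<Gamma>. a' j m x = 0)"
proof -
 have at: "!!j m. m \<in> IO j ==> is_atom d K j m (a j m)" and lim: "(%J. pint p LO (%x. f x - psum c a J x)) ----> 0"
  using rep unfolding atomic_rep_iff[OF p(1)] atoms_at_def by auto
 obtain M where M: "0 < M" "!!j m. Ck_bounded K (2 ^ j) M (theta j m :: (real, 'n) vec => complex)" by (rule theta_Ck_bounded[where K = K]) (rule that)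
 define C where "C = 2 ^ K * M"
 have C: "0 < C" using M(1) by (simp add: C_def)
 define P where "P j = {m \<in> near d j. cube j m Int \<Gamma> = {}}" for j
 have Pfin: "finite (P j)" for j using finite_near[of d j] by (simp add: P_def)
 have PI: "P j \<subseteq> IO j" for j using near_subset by (auto simp: P_def)
 have tP: "touching d j l \<subseteq> P j" for j l by (auto simp: touching_def P_def)
 define w where "w j l x = (\<Sum>m\<in>touching d j l. c j m * a j m x)" for j l x
 define b where "b j l x = (if l \<in> P j then 0 else c j l * a j l x) + theta j l x * w j l x" for j l x
 \<comment> \<open>The derivative bound of \<open>b j l\<close>, so that the quotient is an atom.\<close>
 define \<mu> where "\<mu> j l = cmod (c j l) + C * (\<Sum>m\<in>touching d j l. cmod (c j m))" for j l
 define a' where "a' j l x = of_real (1 / \<mu> j l) * b j l x" for j l x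
 have \<mu>0: "0 <= \<mu> j l" for j l unfolding \<mu>_def using C by (intro add_nonneg_nonneg mult_nonneg_nonneg sum_nonneg) auto
 have bC: "Ck_bounded K (2 ^ j) (\<mu> j l) (b j l)" if l: "l \<in> IO j" for j l
 proof -
  have one: "Ck_bounded K (2 ^ j) (cmod (c j m) * 1) (%x. c j m * a j m x)" if "m \<in> IO j" for m
   using at[OF that] by (intro Ck_bounded_cmult) (simp add: is_atom_iff)
  have z: "Ck_bounded K (2 ^ j) (cmod (c j l)) (%x. 0)" by (intro Ck_bounded_zero) auto
  have 1: "Ck_bounded K (2 ^ j) (cmod (c j l)) (%x. if l \<in> P j then 0 else c j l * a j l x)"
   using one[OF l] z by (cases "l \<in> P j") simp_all
  have 2: "Ck_bounded K (2 ^ j) (\<Sum>m\<in>touching d j l. cmod (c j m) * 1) (w j l)"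
   unfolding w_def[abs_def]
   by (intro Ck_bounded_sum finite_touching one subsetD[OF order_trans[OF tP PI]]) auto
  have 3: "Ck_bounded K (2 ^ j) (2 ^ K * M * (\<Sum>m\<in>touching d j l. cmod (c j m) * 1)) (%x. theta j l x * w j l x)"
   by (rule Ck_bounded_mult[OF M(2) 2]) (use M(1) in "auto intro: sum_nonneg")
  show ?thesis using Ck_bounded_add[OF 1 3] unfolding b_def[abs_def] \<mu>_def C_def by simp
 qed
 have bz: "b j l x = 0" if "\<mu> j l = 0" "l \<in> IO j" for j l x
  using Ck_bounded_norm[OF bC[OF that(2)], of x] that(1) by simp
 have ab: "of_real (\<mu> j l) * a' j l x = b j l x" if "l \<in> IO j" for j l x
  using bz[OF _ that] by (cases "\<mu> j l = 0") (auto simp: a'_def)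
 have th: "theta j l x = 0" if "x ~: cube j l" for j l x
  using that theta_outside_cube[of x j l] dcube_mono[of "3/4" 1 j l] by auto
 have atoms: "atoms_at d K IO a'"
  unfolding atoms_at_def is_atom_iff support_subset_dcube_iff
 proof (intro allI ballI conjI impI)
  fix j l assume l: "l \<in> IO j"
  have "Ck_bounded K (2 ^ j) (cmod (of_real (1 / \<mu> j l)) * \<mu> j l) (a' j l)"
   unfolding a'_def[abs_def] by (rule Ck_bounded_cmult[OF bC[OF l]])
  moreover have "cmod (of_real (1 / \<mu> j l)) * \<mu> j l <= 1" using \<mu>0[of j l] by (simp add: norm_divide)
  ultimately show "Ck_bounded K (2 ^ j) 1 (a' j l)" by (rule Ck_bounded_mono) simp
  fix x assume x: "x ~: dcube d j l"
  then have "x ~: cube j l" using dcube_mono[of 1 d j l] d by auto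
  then have "theta j l x = 0" by (rule th)
  then show "a' j l x = 0" using atom_eq_0[OF at[OF l] x] by (simp add: a'_def b_def)
 qed
 have lev: "level IO (%j l. of_real (\<mu> j l)) a' j x = level IO c a j x" if x: "x \<in> \<Omega>" for j x
 proof -
  let ?W = "\<Sum>m\<in>P j. c j m * a j m x"
  have tw: "theta j l x * w j l x = theta j l x * ?W" for l
  proof (cases "x \<in> cube j l")
   case True
   have "w j l x = ?W"
    unfolding w_def
   proof (rule sum.mono_neutral_left[OF Pfin tP], intro ballI)
    fix m assume m: "m \<in> P j - touching d j l"
    then have "x ~: dcube d j m" using True by (auto simp: touching_def P_def)
    moreover have "m \<in> IO j" using m PI by blast
    ultimately show "c j m * a j m x = 0" using atom_eq_0[OF at] by simp
   qed
   then show ?thesis by simp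
  qed (simp add: th)
  have th1: "(\<Sum>l\<in>IO j. theta j l x) = 1"
  proof (rule sum_theta[OF finite_I])
   fix l assume "theta j l x ~= 0"
   then have "x \<in> cube j l" using th by blast
   then show "l \<in> IO j" using x by (auto simp: cubes_meeting_def)
  qed
  have "level IO (%j l. of_real (\<mu> j l)) a' j x = (\<Sum>l\<in>IO j. b j l x)"
   unfolding level_def by (intro sum.cong refl ab)
  also have "... = (\<Sum>l\<in>IO j. if l \<in> P j then 0 else c j l * a j l x) + (\<Sum>l\<in>IO j. theta j l x * ?W)"
   unfolding b_def tw by (rule sum.distrib)
  also have "(\<Sum>l\<in>IO j. theta j l x * ?W) = ?W" unfolding sum_distrib_right[symmetric] th1 by simp
  also have "(\<Sum>l\<in>IO j. if l \<in> P j then 0 else c j l * a j l x) = (\<Sum>l\<in>IO j - P j. c j l * a j l x)"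
   by (rule sum.mono_neutral_cong_right) (use finite_I in auto)
  also have "(\<Sum>l\<in>IO j - P j. c j l * a j l x) + ?W = level IO c a j x"
   unfolding level_def by (rule sum.subset_diff[OF PI finite_I, symmetric])
  finally show ?thesis .
 qed
 have "pint p LO (%x. f x - (\<Sum>j<J. level IO (%j l. of_real (\<mu> j l)) a' j x)) = pint p LO (%x. f x - psum c a J x)" for J
  unfolding pint_def by (rule nn_integral_cong) (simp add: lev space_restrict_space)
 then have "atomic_rep d K p \<Omega> f (%j l. of_real (\<mu> j l)) a'"
  unfolding atomic_rep_iff[OF p(1)] using atoms lim by simp
 moreover have "f_norm (1 / p) p \<infinity> \<Omega> (%j l. of_real (\<mu> j l)) < \<infinity>"
 proof -
  have "(\<integral>\<^sup>+x. gmax p c x \<partial>lborel) < \<infinity>" using fin unfolding f_norm_infinity_eq[OF p(1)] epowr_less_top_iff .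
  moreover have "0 < d" "0 <= C" using d C by auto
  ultimately show ?thesis
   unfolding f_norm_infinity_eq[OF p(1)] epowr_less_top_iff \<mu>_def by (intro relocated_gmax_finite p)
 qed
 moreover have "a' j l x = 0" if l: "l \<in> IO j - cubes_meeting \<Gamma> j" and x: "x \<in> \<Gamma>" for j l x
 proof -
  have nx: "cube j l Int \<Gamma> = {}" using l by (auto simp: cubes_meeting_def)
  have "(if l \<in> P j then 0 else c j l * a j l x) = 0"
  proof (cases "x \<in> dcube d j l")
   case True
   then have "l \<in> P j" using l nx x by (auto simp: P_def near_def)
   then show ?thesis by simp
  next
   case False
   then show ?thesis using atom_eq_0[OF at] l by simp
  qed
  moreover have "theta j l x = 0" using nx x th by blast
  ultimately show ?thesis by (simp add: a'_def b_def)
 qed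
 ultimately show ?thesis by (intro exI[of _ "%j l. of_real (\<mu> j l)"] exI[of _ a']) blast
qed

end

section \<open>The trace theorem\<close>

theorem corollary4p13:
  fixes \<Omega> :: "(real ^ 'n::{finite,linorder}) set"
    and p d :: real and q :: ennreal and K :: nat
  assumes "CARD('n) \<ge> 2"
    and "bounded_lipschitz_domain \<Omega>"
    and "0 < p" and "0 < q"
    and "d > 1" and "int K \<ge> 1 + \<lfloor>1 / p\<rfloor>"
  shows "(q \<le> ennreal (min 1 p) \<longrightarrow>
           image_under_trace (surface_measure (frontier \<Omega>))
             (B_trace d K (1 / p) p q \<Omega>)
             (B_space d K (1 / p) p q \<Omega>)
             (Lp p (surface_measure (frontier \<Omega>))))
       \<and> (p \<le> 1 \<longrightarrow>
           image_under_trace (surface_measure (frontier \<Omega>))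
             (F_trace d K (1 / p) p q \<Omega>)
             (F_space d K (1 / p) p q \<Omega>)
             (Lp p (surface_measure (frontier \<Omega>))))"
proof (intro conjI impI)
  interpret lipschitz_domain \<Omega> by unfold_locales (use assms in auto)
  note p = \<open>0 < p\<close> and q = \<open>0 < q\<close>
  have d: "0 < d" "1 < d" using \<open>d > 1\<close> by auto
  {
    assume le: "q \<le> ennreal (min 1 p)"
    then have "q < \<infinity>" by (rule le_less_trans) simp
    then obtain t where qt: "q = ennreal t" and t: "0 < t" using q by (cases q) auto
    have t1: "t \<le> min 1 p" using le p unfolding qt by (subst (asm) ennreal_le_iff) auto
    have "\<exists>f c a. extension p d K (b_norm (1 / p) p (ennreal t) \<Omega>) g f c a" if "g \<in> Lp p \<sigma>" for g
      using sparse_extension[OF p d(2) that, of K] b_norm_sparse[OF p t] by blast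
    then show "image_under_trace \<sigma> (B_trace d K (1 / p) p q \<Omega>) (B_space d K (1 / p) p q \<Omega>) (Lp p \<sigma>)"
      unfolding B_trace_def B_space_def qt
      by (intro completion_image[OF p d(1) trace_norm_B[OF p d(1) t t1]] b_norm_shrink p t)
  next
    assume p1: "p \<le> 1"
    note tr = trace_norm_F[OF p p1 d(1) q]
    have ext: "\<exists>f c a. extension p d K (f_norm (1 / p) p q \<Omega>) g f c a" if "g \<in> Lp p \<sigma>" for g
      using sparse_extension[OF p d(2) that, of K] f_norm_sparse[OF p q] by blast
    show "image_under_trace \<sigma> (F_trace d K (1 / p) p q \<Omega>) (F_space d K (1 / p) p q \<Omega>) (Lp p \<sigma>)"
    proof (cases "q = \<infinity>")
      case True
      show ?thesis
        unfolding F_trace_def F_space_def True if_P[OF refl]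
        by (rule series_image[OF p d(1) tr[unfolded True] relocation[OF p p1 d(2)] ext[unfolded True]])
    next
      case False
      then obtain t where qt: "q = ennreal t" and t: "0 < t" using q by (cases q) auto
      have "image_under_trace \<sigma> (completion_trace p \<Omega> (atomic_norm d K p \<Omega> (f_norm (1 / p) p q \<Omega>))) (F_space d K (1 / p) p q \<Omega>) (Lp p \<sigma>)"
        unfolding F_space_def
        by (rule completion_image[OF p d(1) tr _ ext]) (rule f_norm_shrink[OF p t, folded qt])
      then show ?thesis unfolding F_trace_def if_not_P[OF False] .
    qed
  }
qed

end
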